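(* Let $p>r\ge1$ and consider, for $\mathbf f\in L^2(\Omega;\mathbb R^2)$ and Dirichlet data $\mathbf u_D\in H^{1/2}(\Gamma;\mathbb R^2)$, the discretized weak form with strong symmetry: find $\boldsymbol\sigma_h\in\mathcal V_{h,2}^s$, $\mathbf u_h\in\mathbf V_{h,3}^s$ such that $$\langle\mathbf A\boldsymbol\sigma_h,\boldsymbol\tau_h\rangle+\langle\mathbf u_h,\nabla\cdot\boldsymbol\tau_h\rangle=\langle\boldsymbol\tau_h\cdot\mathbf n;\mathbf u_D\rangle_\Gamma\quad\forall\boldsymbol\tau_h\in\mathcal V_{h,2}^s,\qquad \langle\nabla\cdot\boldsymbol\sigma_h,\mathbf v_h\rangle=\langle\mathbf f,\mathbf v_h\rangle\quad\forall\mathbf v_h\in\mathbf V_{h,3}^s.$$ This discrete problem is inf-sup stable. More precisely, there are constants $\gamma_1,\gamma_2>0$ independent of $h$ such that $$\inf_{\mathbf v_h\in\mathbf V_{h,3}^s\setminus\{0\}}\ \sup_{\boldsymbol\tau_h\in\mathcal V_{h,2}^s\setminus\{0\}}\frac{\langle\nabla\cdot\boldsymbol\tau_h,\mathbf v_h\rangle}{\|\boldsymbol\tau_h\|_{\mathcal H(\mathrm{div})}\|\mathbf v_h\|_{L^2}}\ge\gamma_1$$ and $$\langle\mathbf A\boldsymbol\tau_h,\boldsymbol\tau_h\rangle\ge\gamma_2\|\boldsymbol\tau_h\|_{\mathcal H(\mathrm{div})}^2\quad\forall\boldsymbol\tau_h\in B_h:=\{\boldsymbol\tau_h\in\mathcal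 V_{h,2}^s\ |\ \langle\nabla\cdot\boldsymbol\tau_h,\mathbf v_h\rangle=0\ \forall\mathbf v_h\in\mathbf V_{h,3}^s\}.$$
   Context: Setting: $\widehat\Omega=(0,1)^2$ with coordinates $(\zeta_1,\zeta_2)$; $\mathbf F=(F_1,F_2)^T:\widehat\Omega\to\mathbb R^2$, $\Omega=\mathbf F(\widehat\Omega)$ a bounded Lipschitz domain, $\Gamma=\partial\Omega$, $\mathbf n$ outer unit normal; $\mathbf F$ is a diffeomorphism with $\mathbf F\in C^3(\overline{\widehat\Omega})$, $\mathbf F^{-1}\in C^3(\overline\Omega)$. $\mathbf J=D\mathbf F$ and $\tilde{\mathbf J}=\mathrm{adj}(\mathbf J)=\begin{pmatrix}J_{22}&-J_{12}\\-J_{21}&J_{11}\end{pmatrix}$ on $\widehat\Omega$; $\tilde{\mathbf J}^{-1}$ denotes the matrix field $\mathbf x\mapsto\tilde{\mathbf J}(\mathbf F^{-1}(\mathbf x))^{-1}$ on $\Omega$. Repeated indices are summed over $1,2$; $\hat\partial_i$, $\partial_i$ are derivatives w.r.t. the $i$-th parametric and physical coordinate; divergence of matrix fields is row-wise; $\sigma(n)=3-n$; $\int_0^{\zeta_1}g\,d1:=\int_0^{\zeta_1}g(\tau,\zeta_2)d\tau$, $\int_0^{\zeta_2}g\,d2:=\int_0^{\zeta_2}g(\zeta_1,\tau)d\tau$; $g(0,\cdot)$ means the first parametric coordinate is set to $0$. $\widehat{\mathrm{Airy}}(\hat\phi)=\begin{pmatrix}\hat\partial_{22}\hat\phi&-\hat\partial_{12}\hat\phi\\-\hat\partial_{21}\hat\phi&\hat\partial_{11}\hat\phi\end{pmatrix}$.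 $\mathbb S$: symmetric $2\times2$ matrices; $\mathcal H(\Omega,\mathrm{div},\mathbb S)$: symmetric $L^2$ matrix fields with $L^2$ divergence, norm $\|\boldsymbol\tau\|_{\mathcal H(\mathrm{div})}^2=\|\boldsymbol\tau\|_{L^2}^2+\|\nabla\cdot\boldsymbol\tau\|_{L^2}^2$. Transformations: $\mathcal Y_{2,\Gamma_1}^s:L^2(\Omega,\mathbb S)\to L^2(\widehat\Omega,\mathbb S)$, $\mathcal Y_{2,\Gamma_1}^s(\mathbf S)=\tilde{\mathbf J}(\mathbf S\circ\mathbf F)\tilde{\mathbf J}^T+\widehat{\mathrm{Airy}}(F_n)\int_0^{\zeta_1}(-1)^{n+1}\tilde J_{2l}(S_{\sigma(n)l}\circ\mathbf F)\,d1$; $\mathcal Y_3^s:L^2(\Omega;\mathbb R^2)\to L^2(\widehat\Omega;\mathbb R^2)$, $\mathcal Y_3^s(\mathbf v)=\det(\mathbf J)\tilde{\mathbf J}(\mathbf v\circ\mathbf F)+\hat\partial_1\tilde{\mathbf J}\int_0^{\zeta_1}\det(\mathbf J)(\mathbf v\circ\mathbf F)\,d1$. Both are invertible. For $\tilde{\mathbf S}$ symmetric and regular enough ($C^1$, extended by boundedness to $H^1$ fields, values $(0,\cdot)$ being traces) let $T(\tilde{\mathbf S})$ be the vector field on $\Omega$ with components $[T(\tilde{\mathbf S})]_m=\partial_k\tilde J^{-1}_{mi}\,\tilde J^{-1}_{k1}\,(\tilde S_{i1}(0,\cdot)\circ\mathbf F^{-1})$ and $$\tilde{\mathcal Y}_2^s(\tilde{\mathbf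 S})=(\mathcal Y_{2,\Gamma_1}^s)^{-1}(\tilde{\mathbf S})-(\mathcal Y_{2,\Gamma_1}^s)^{-1}\begin{pmatrix}\int_0^{\zeta_1}[\mathcal Y_3^s(T(\tilde{\mathbf S}))]_1\,d1&0\\0&\int_0^{\zeta_2}[\mathcal Y_3^s(T(\tilde{\mathbf S}))]_2\,d2\end{pmatrix}.$$ Splines: for integers $p>r\ge-1$ and breakpoints $0=\psi_1<\dots<\psi_m=1$, $S_p^r$ is the span of the B-splines of degree $p$ with $0,1$ repeated $p+1$ times and each interior breakpoint repeated $p-r$ times (piecewise polynomials of degree $\le p$, globally $C^r$); $S_{p_1,p_2}^{r_1,r_2}=S_{p_1}^{r_1}\otimes S_{p_2}^{r_2}$, with the same breakpoints in each direction for all degrees. The image under $\mathbf F$ of the resulting rectangular mesh is the mesh $\mathcal M$ of $\Omega$ with $h=\max_{\mathcal K}h_{\mathcal K}$, $h_{\mathcal K}=\mathrm{diam}(\mathcal K)$; there is $c_u$ independent of mesh size with $h_{\mathcal K}\le h\le c_uh_{\mathcal K}$, and $\mathbf F$ (fixed under refinement) is smooth on the closure of each mesh element. $\mathrm{SYM}(s_1,s_2,s_3)=\begin{pmatrix}s_1&s_2\\ s_2&s_3\end{pmatrix}$, also applied to spaces. Discrete spaces: $\widehat{\mathcal V}_{h,2}^s=\mathrm{SYM}(S_{p+1,p-1}^{r+1,r-1},S_{p,p}^{r,r},S_{p-1,p+1}^{r-1,r+1})$, $\widehat{\mathbf V}_{h,3}^s=S_{p,p-1}^{r,r-1}\times S_{p-1,p}^{r-1,r}$,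 $\mathcal V_{h,2}^s=\tilde{\mathcal Y}_2^s(\widehat{\mathcal V}_{h,2}^s)$, $\mathbf V_{h,3}^s=(\mathcal Y_3^s)^{-1}(\widehat{\mathbf V}_{h,3}^s)$. $\mathbf A=\mathbf A(\mathbf x):\mathbb S\to\mathbb S$ is symmetric, (uniformly) positive definite and bounded w.r.t. the $L^2$ norm. $\langle\cdot,\cdot\rangle$ is the $L^2$ inner product, $\langle\boldsymbol\tau\cdot\mathbf n;\cdot\rangle_\Gamma$ the normal-trace duality pairing. *)

theory Defs
  imports "HOL-Analysis.Analysis"
begin

definition partial :: "2 \<Rightarrow> (real^2 \<Rightarrow> real) \<Rightarrow> real^2 \<Rightarrow> real" where
  "partial i f x = frechet_derivative f (at x) (axis i 1)"

definition extends_continuously :: "(real^2) set \<Rightarrow> (real^2 \<Rightarrow> real) \<Rightarrow> bool" where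
  "extends_continuously U f \<longleftrightarrow> (\<exists>g. continuous_on (closure U) g \<and> (\<forall>x\<in>U. g x = f x))"

text \<open>\<open>Ck_closure k U f\<close>: for open \<open>U\<close>, the partial derivatives of \<open>f\<close> of order at most \<open>k\<close> exist
  on \<open>U\<close> and extend continuously to the closure of \<open>U\<close>; \<open>f\<close> need not be meaningful off \<open>U\<close>.\<close>

primrec Ck_closure :: "nat \<Rightarrow> (real^2) set \<Rightarrow> (real^2 \<Rightarrow> real) \<Rightarrow> bool" where
  "Ck_closure 0 U f \<longleftrightarrow> extends_continuously U f"
| "Ck_closure (Suc k) U f \<longleftrightarrow> extends_continuously U f \<and>
     (\<forall>x\<in>U. f differentiable (at x)) \<and> (\<forall>i. Ck_closure k U (partial i f))"

definition test_functions :: "(real^2) set \<Rightarrow> (real^2 \<Rightarrow> real) set" where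
  "test_functions U = {\<phi>. (\<forall>k. Ck_closure k UNIV \<phi>) \<and>
     compact (closure {x. \<phi> x \<noteq> 0}) \<and> closure {x. \<phi> x \<noteq> 0} \<subseteq> U}"

text \<open>Elements of the Lebesgue spaces are represented by Borel functions, of which only the values
  on \<open>U\<close> matter; two representatives denote the same element iff they satisfy \<open>ae_eq U\<close>.\<close>

definition ae_eq :: "(real^2) set \<Rightarrow> (real^2 \<Rightarrow> 'b) \<Rightarrow> (real^2 \<Rightarrow> 'b) \<Rightarrow> bool" where
  "ae_eq U f g \<longleftrightarrow> (AE x in lborel. x \<in> U \<longrightarrow> f x = g x)"

definition L2 :: "(real^2) set \<Rightarrow> (real^2 \<Rightarrow> 'b::euclidean_space) set" where
  "L2 U = {f. set_borel_measurable lborel U f \<and> set_integrable lborel U (\<lambda>x. (norm (f x))\<^sup>2)}"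

text \<open>On \<open>real^2^2\<close> the library inner product is the Frobenius product.\<close>

definition L2_inner :: "(real^2) set \<Rightarrow> (real^2 \<Rightarrow> 'b::euclidean_space) \<Rightarrow> (real^2 \<Rightarrow> 'b) \<Rightarrow> real" where
  "L2_inner U f g = (LINT x:U|lborel. f x \<bullet> g x)"

definition L2_norm :: "(real^2) set \<Rightarrow> (real^2 \<Rightarrow> 'b::euclidean_space) \<Rightarrow> real" where
  "L2_norm U f = sqrt (L2_inner U f f)"

definition sym_matrices :: "(real^2^2) set" where
  "sym_matrices = {M. transpose M = M}"

definition L2_sym :: "(real^2) set \<Rightarrow> (real^2 \<Rightarrow> real^2^2) set" where
  "L2_sym U = {\<tau> \<in> L2 U. \<forall>x\<in>U. \<tau> x \<in> sym_matrices}"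

definition has_weak_div :: "(real^2) set \<Rightarrow> (real^2 \<Rightarrow> real^2^2) \<Rightarrow> (real^2 \<Rightarrow> real^2) \<Rightarrow> bool" where
  "has_weak_div U \<tau> d \<longleftrightarrow> d \<in> L2 U \<and>
     (\<forall>\<phi>\<in>test_functions U. \<forall>i.
        (LINT x:U|lborel. \<Sum>j\<in>UNIV. \<tau> x $ i $ j * partial j \<phi> x) = - (LINT x:U|lborel. d x $ i * \<phi> x))"

definition Hdiv_sym :: "(real^2) set \<Rightarrow> (real^2 \<Rightarrow> real^2^2) set" where
  "Hdiv_sym U = {\<tau> \<in> L2_sym U. \<exists>d. has_weak_div U \<tau> d}"

text \<open>Weak derivatives are unique almost everywhere; \<open>SOME\<close> picks a representative.\<close>

definition weak_div :: "(real^2) set \<Rightarrow> (real^2 \<Rightarrow> real^2^2) \<Rightarrow> real^2 \<Rightarrow> real^2" where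
  "weak_div U \<tau> = (SOME d. has_weak_div U \<tau> d)"

definition Hdiv_norm :: "(real^2) set \<Rightarrow> (real^2 \<Rightarrow> real^2^2) \<Rightarrow> real" where
  "Hdiv_norm U \<tau> = sqrt ((L2_norm U \<tau>)\<^sup>2 + (L2_norm U (weak_div U \<tau>))\<^sup>2)"

definition has_weak_grad :: "(real^2) set \<Rightarrow> (real^2 \<Rightarrow> real^2) \<Rightarrow> (real^2 \<Rightarrow> real^2^2) \<Rightarrow> bool" where
  "has_weak_grad U w G \<longleftrightarrow> G \<in> L2 U \<and>
     (\<forall>\<phi>\<in>test_functions U. \<forall>i j.
        (LINT x:U|lborel. w x $ i * partial j \<phi> x) = - (LINT x:U|lborel. G x $ i $ j * \<phi> x))"

definition H1 :: "(real^2) set \<Rightarrow> (real^2 \<Rightarrow> real^2) set" where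
  "H1 U = {w \<in> L2 U. \<exists>G. has_weak_grad U w G}"

definition weak_grad :: "(real^2) set \<Rightarrow> (real^2 \<Rightarrow> real^2) \<Rightarrow> real^2 \<Rightarrow> real^2^2" where
  "weak_grad U w = (SOME G. has_weak_grad U w G)"

text \<open>\<open>H\<^sup>1\<^sup>/\<^sup>2\<close> of the boundary is the space of traces of \<open>H\<^sup>1\<close> functions, so a boundary datum is given by
  any \<open>H\<^sup>1\<close> lifting \<open>w\<close>. By Green's formula the pairing of its trace with the normal trace of
  \<open>\<tau>\<close> is the following; it does not depend on the choice of the lifting.\<close>

definition normal_trace_pairing :: "(real^2) set \<Rightarrow> (real^2 \<Rightarrow> real^2^2) \<Rightarrow> (real^2 \<Rightarrow> real^2) \<Rightarrow> real" where
  "normal_trace_pairing U \<tau> w = L2_inner U \<tau> (weak_grad U w) + L2_inner U (weak_div U \<tau>) w"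

text \<open>Around each boundary point there is a rectangle, in rotated coordinates \<open>z\<close> centred at the
  point, in which the domain is the strict subgraph of a Lipschitz function.\<close>

definition lipschitz_domain :: "(real^2) set \<Rightarrow> bool" where
  "lipschitz_domain U \<longleftrightarrow> open U \<and> connected U \<and> U \<noteq> {} \<and>
     (\<forall>x0\<in>frontier U. \<exists>(Q::real^2 \<Rightarrow> real^2) a b L (g::real \<Rightarrow> real).
        orthogonal_transformation Q \<and> a > 0 \<and> b > 0 \<and>
        L-lipschitz_on {-a<..<a} g \<and> (\<forall>t\<in>{-a<..<a}. \<bar>g t\<bar> \<le> b / 2) \<and>
        (\<forall>z. \<bar>z $ 1\<bar> < a \<and> \<bar>z $ 2\<bar> < b \<longrightarrow>
           (x0 + Q z \<in> U \<longleftrightarrow> z $ 2 < g (z $ 1)) \<and>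
           (x0 + Q z \<in> frontier U \<longleftrightarrow> z $ 2 = g (z $ 1))))"

abbreviation unit_square :: "(real^2) set" where
  "unit_square \<equiv> box 0 1"

abbreviation Finv :: "(real^2 \<Rightarrow> real^2) \<Rightarrow> real^2 \<Rightarrow> real^2" where
  "Finv F \<equiv> inv_into unit_square F"

definition admissible_geometry :: "(real^2 \<Rightarrow> real^2) \<Rightarrow> bool" where
  "admissible_geometry F \<longleftrightarrow> inj_on F unit_square \<and>
     bounded (F ` unit_square) \<and> lipschitz_domain (F ` unit_square) \<and>
     (\<forall>i. Ck_closure 3 unit_square (\<lambda>z. F z $ i)) \<and>
     (\<forall>i. Ck_closure 3 (F ` unit_square) (\<lambda>x. Finv F x $ i))"

definition jac :: "(real^2 \<Rightarrow> real^2) \<Rightarrow> real^2 \<Rightarrow> real^2^2" where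
  "jac F z = (\<chi> i j. partial j (\<lambda>y. F y $ i) z)"

definition mat22 :: "real \<Rightarrow> real \<Rightarrow> real \<Rightarrow> real \<Rightarrow> real^2^2" where
  "mat22 a b c d = vector [vector [a, b], vector [c, d]]"

definition adj_jac :: "(real^2 \<Rightarrow> real^2) \<Rightarrow> real^2 \<Rightarrow> real^2^2" where
  "adj_jac F z = mat22 (jac F z $ 2 $ 2) (- (jac F z $ 1 $ 2)) (- (jac F z $ 2 $ 1)) (jac F z $ 1 $ 1)"

definition adj_jac_inv :: "(real^2 \<Rightarrow> real^2) \<Rightarrow> real^2 \<Rightarrow> real^2^2" where
  "adj_jac_inv F x = matrix_inv (adj_jac F (Finv F x))"

definition airy :: "(real^2 \<Rightarrow> real) \<Rightarrow> real^2 \<Rightarrow> real^2^2" where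
  "airy \<phi> z = mat22 (partial 2 (partial 2 \<phi>) z) (- partial 1 (partial 2 \<phi>) z)
                     (- partial 2 (partial 1 \<phi>) z) (partial 1 (partial 1 \<phi>) z)"

definition int1 :: "(real^2 \<Rightarrow> 'b::euclidean_space) \<Rightarrow> real^2 \<Rightarrow> 'b" where
  "int1 g z = (LINT t:{0<..<z $ 1}|lborel. g (vector [t, z $ 2]))"

definition int2 :: "(real^2 \<Rightarrow> 'b::euclidean_space) \<Rightarrow> real^2 \<Rightarrow> 'b" where
  "int2 g z = (LINT t:{0<..<z $ 2}|lborel. g (vector [z $ 1, t]))"

text \<open>\<open>other_index n\<close> is \<open>3 - n\<close> and \<open>alt_sign n\<close> is \<open>(-1)\<close> to the power \<open>n + 1\<close>, for indices \<open>1, 2\<close>.\<close>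

definition other_index :: "2 \<Rightarrow> 2" where
  "other_index n = (if n = 1 then 2 else 1)"

definition alt_sign :: "2 \<Rightarrow> real" where
  "alt_sign n = (if n = 1 then 1 else - 1)"

definition Y2 :: "(real^2 \<Rightarrow> real^2) \<Rightarrow> (real^2 \<Rightarrow> real^2^2) \<Rightarrow> real^2 \<Rightarrow> real^2^2" where
  "Y2 F S z = adj_jac F z ** S (F z) ** transpose (adj_jac F z)
     + (\<Sum>n\<in>UNIV.
          int1 (\<lambda>y. alt_sign n * (\<Sum>l\<in>UNIV. adj_jac F y $ 2 $ l * S (F y) $ other_index n $ l)) z
            *\<^sub>R airy (\<lambda>y. F y $ n) z)"

definition Y3 :: "(real^2 \<Rightarrow> real^2) \<Rightarrow> (real^2 \<Rightarrow> real^2) \<Rightarrow> real^2 \<Rightarrow> real^2" where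
  "Y3 F v z = det (jac F z) *\<^sub>R (adj_jac F z *v v (F z))
     + (\<chi> i j. partial 1 (\<lambda>y. adj_jac F y $ i $ j) z) *v int1 (\<lambda>y. det (jac F y) *\<^sub>R v (F y)) z"

text \<open>\<open>Y2\<close> and \<open>Y3\<close> are invertible as maps between spaces of classes modulo \<open>ae_eq\<close>;
  the inverses return a representative.\<close>

definition Y2_inv :: "(real^2 \<Rightarrow> real^2) \<Rightarrow> (real^2 \<Rightarrow> real^2^2) \<Rightarrow> real^2 \<Rightarrow> real^2^2" where
  "Y2_inv F S' = (SOME S. S \<in> L2_sym (F ` unit_square) \<and> ae_eq unit_square (Y2 F S) S')"

definition Y3_inv :: "(real^2 \<Rightarrow> real^2) \<Rightarrow> (real^2 \<Rightarrow> real^2) \<Rightarrow> real^2 \<Rightarrow> real^2" where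
  "Y3_inv F w = (SOME v. v \<in> L2 (F ` unit_square) \<and> ae_eq unit_square (Y3 F v) w)"

text \<open>Only applied to fields that are continuous on the closed unit square, for which the trace on
  the edge with vanishing first coordinate is given by point values.\<close>

definition T_corr :: "(real^2 \<Rightarrow> real^2) \<Rightarrow> (real^2 \<Rightarrow> real^2^2) \<Rightarrow> real^2 \<Rightarrow> real^2" where
  "T_corr F S' x = (\<chi> m. \<Sum>k\<in>UNIV. \<Sum>i\<in>UNIV.
      partial k (\<lambda>y. adj_jac_inv F y $ m $ i) x * adj_jac_inv F x $ k $ 1
        * S' (vector [0, Finv F x $ 2]) $ i $ 1)"

definition Y2_tilde :: "(real^2 \<Rightarrow> real^2) \<Rightarrow> (real^2 \<Rightarrow> real^2^2) \<Rightarrow> real^2 \<Rightarrow> real^2^2" where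
  "Y2_tilde F S' x = Y2_inv F S' x
     - Y2_inv F (\<lambda>z. mat22 (int1 (\<lambda>y. Y3 F (T_corr F S') y $ 1) z) 0
                            0 (int2 (\<lambda>y. Y3 F (T_corr F S') y $ 2) z)) x"

definition breakpoints :: "real list \<Rightarrow> bool" where
  "breakpoints \<psi> \<longleftrightarrow> 2 \<le> length \<psi> \<and> sorted_wrt (<) \<psi> \<and> hd \<psi> = 0 \<and> last \<psi> = 1"

definition knots :: "real list \<Rightarrow> nat \<Rightarrow> int \<Rightarrow> real list" where
  "knots \<psi> q s = replicate (q + 1) 0
     @ concat (map (replicate (nat (int q - s))) (butlast (tl \<psi>))) @ replicate (q + 1) 1"

text \<open>Cox-de Boor recursion with \<open>x / 0 = 0\<close>, indices starting from 0. The last nonempty knot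
  interval is taken to be closed, so that the functions are continuous from the left at the end.\<close>

primrec bspline :: "real list \<Rightarrow> nat \<Rightarrow> nat \<Rightarrow> real \<Rightarrow> real" where
  "bspline \<xi> 0 i x =
     (if \<xi> ! i \<le> x \<and> x < \<xi> ! (i + 1) \<or> \<xi> ! i < x \<and> x = \<xi> ! (i + 1) \<and> x = last \<xi> then 1 else 0)"
| "bspline \<xi> (Suc q) i x =
     (x - \<xi> ! i) / (\<xi> ! (i + q + 1) - \<xi> ! i) * bspline \<xi> q i x
     + (\<xi> ! (i + q + 2) - x) / (\<xi> ! (i + q + 2) - \<xi> ! (i + 1)) * bspline \<xi> q (i + 1) x"

definition spline_space :: "real list \<Rightarrow> nat \<Rightarrow> int \<Rightarrow> (real \<Rightarrow> real) set" where
  "spline_space \<psi> q s =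
     {\<lambda>x. \<Sum>i<length (knots \<psi> q s) - q - 1. c i * bspline (knots \<psi> q s) q i x | c. True}"

definition tensor_space :: "(real \<Rightarrow> real) set \<Rightarrow> (real \<Rightarrow> real) set \<Rightarrow> (real^2 \<Rightarrow> real) set" where
  "tensor_space X Y = {\<lambda>z. \<Sum>k<(n::nat). f k (z $ 1) * g k (z $ 2) | n f g.
     (\<forall>k<n. f k \<in> X) \<and> (\<forall>k<n. g k \<in> Y)}"

definition spline_space2 ::
  "real list \<Rightarrow> real list \<Rightarrow> nat \<Rightarrow> nat \<Rightarrow> int \<Rightarrow> int \<Rightarrow> (real^2 \<Rightarrow> real) set" where
  "spline_space2 \<psi>1 \<psi>2 q1 q2 s1 s2 = tensor_space (spline_space \<psi>1 q1 s1) (spline_space \<psi>2 q2 s2)"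

definition param_mesh :: "real list \<Rightarrow> real list \<Rightarrow> (real^2) set set" where
  "param_mesh \<psi>1 \<psi>2 =
     {box (vector [\<psi>1 ! i, \<psi>2 ! j]) (vector [\<psi>1 ! (i + 1), \<psi>2 ! (j + 1)]) | i j.
        i + 1 < length \<psi>1 \<and> j + 1 < length \<psi>2}"

definition mesh :: "(real^2 \<Rightarrow> real^2) \<Rightarrow> real list \<Rightarrow> real list \<Rightarrow> (real^2) set set" where
  "mesh F \<psi>1 \<psi>2 = (\<lambda>K. F ` K) ` param_mesh \<psi>1 \<psi>2"

definition mesh_size :: "(real^2) set set \<Rightarrow> real" where
  "mesh_size M = Max (diameter ` M)"

definition admissible_mesh :: "real \<Rightarrow> (real^2 \<Rightarrow> real^2) \<Rightarrow> real list \<Rightarrow> real list \<Rightarrow> bool" where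
  "admissible_mesh cu F \<psi>1 \<psi>2 \<longleftrightarrow> breakpoints \<psi>1 \<and> breakpoints \<psi>2 \<and>
     (\<forall>K\<in>mesh F \<psi>1 \<psi>2. diameter K \<le> mesh_size (mesh F \<psi>1 \<psi>2) \<and>
                       mesh_size (mesh F \<psi>1 \<psi>2) \<le> cu * diameter K) \<and>
     (\<forall>K\<in>param_mesh \<psi>1 \<psi>2. \<forall>i k. Ck_closure k K (\<lambda>z. F z $ i))"

definition V2_hat :: "real list \<Rightarrow> real list \<Rightarrow> nat \<Rightarrow> int \<Rightarrow> (real^2 \<Rightarrow> real^2^2) set" where
  "V2_hat \<psi>1 \<psi>2 p r = {\<lambda>z. mat22 (s1 z) (s2 z) (s2 z) (s3 z) | s1 s2 s3.
     s1 \<in> spline_space2 \<psi>1 \<psi>2 (p + 1) (p - 1) (r + 1) (r - 1) \<and>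
     s2 \<in> spline_space2 \<psi>1 \<psi>2 p p r r \<and>
     s3 \<in> spline_space2 \<psi>1 \<psi>2 (p - 1) (p + 1) (r - 1) (r + 1)}"

definition V3_hat :: "real list \<Rightarrow> real list \<Rightarrow> nat \<Rightarrow> int \<Rightarrow> (real^2 \<Rightarrow> real^2) set" where
  "V3_hat \<psi>1 \<psi>2 p r = {\<lambda>z. vector [w1 z, w2 z] | w1 w2.
     w1 \<in> spline_space2 \<psi>1 \<psi>2 p (p - 1) r (r - 1) \<and>
     w2 \<in> spline_space2 \<psi>1 \<psi>2 (p - 1) p (r - 1) r}"

definition V2_h ::
  "(real^2 \<Rightarrow> real^2) \<Rightarrow> real list \<Rightarrow> real list \<Rightarrow> nat \<Rightarrow> int \<Rightarrow> (real^2 \<Rightarrow> real^2^2) set" where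
  "V2_h F \<psi>1 \<psi>2 p r = {\<tau> \<in> L2_sym (F ` unit_square).
     \<exists>S'\<in>V2_hat \<psi>1 \<psi>2 p r. ae_eq (F ` unit_square) \<tau> (Y2_tilde F S')}"

definition V3_h ::
  "(real^2 \<Rightarrow> real^2) \<Rightarrow> real list \<Rightarrow> real list \<Rightarrow> nat \<Rightarrow> int \<Rightarrow> (real^2 \<Rightarrow> real^2) set" where
  "V3_h F \<psi>1 \<psi>2 p r = {v \<in> L2 (F ` unit_square).
     \<exists>w\<in>V3_hat \<psi>1 \<psi>2 p r. ae_eq (F ` unit_square) v (Y3_inv F w)}"

text \<open>\<open>A\<close> acts pointwise on symmetric matrices; symmetry, uniform positive definiteness and
  boundedness are those of the induced operator on square-integrable symmetric fields.\<close>

definition admissible_tensor :: "(real^2) set \<Rightarrow> (real^2 \<Rightarrow> real^2^2 \<Rightarrow> real^2^2) \<Rightarrow> bool" where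
  "admissible_tensor U A \<longleftrightarrow>
     (\<forall>x\<in>U. \<forall>S\<in>sym_matrices. A x S \<in> sym_matrices) \<and>
     (\<forall>x\<in>U. \<forall>S\<in>sym_matrices. \<forall>T\<in>sym_matrices. \<forall>a b.
        A x (a *\<^sub>R S + b *\<^sub>R T) = a *\<^sub>R A x S + b *\<^sub>R A x T) \<and>
     (\<forall>\<tau>\<in>L2_sym U. (\<lambda>x. A x (\<tau> x)) \<in> L2_sym U) \<and>
     (\<forall>\<sigma>\<in>L2_sym U. \<forall>\<tau>\<in>L2_sym U.
        L2_inner U (\<lambda>x. A x (\<sigma> x)) \<tau> = L2_inner U \<sigma> (\<lambda>x. A x (\<tau> x))) \<and>
     (\<exists>\<alpha>>0. \<forall>\<tau>\<in>L2_sym U. L2_inner U (\<lambda>x. A x (\<tau> x)) \<tau> \<ge> \<alpha> * (L2_norm U \<tau>)\<^sup>2) \<and>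
     (\<exists>\<beta>. \<forall>\<tau>\<in>L2_sym U. L2_norm U (\<lambda>x. A x (\<tau> x)) \<le> \<beta> * L2_norm U \<tau>)"

record ('v, 'q) mixed_problem =
  space_V :: "'v set"
  space_Q :: "'q set"
  norm_V :: "'v \<Rightarrow> real"
  norm_Q :: "'q \<Rightarrow> real"
  form_a :: "'v \<Rightarrow> 'v \<Rightarrow> real"
  form_b :: "'v \<Rightarrow> 'q \<Rightarrow> real"
  load_V :: "'v \<Rightarrow> real"
  load_Q :: "'q \<Rightarrow> real"

definition solves :: "('v, 'q) mixed_problem \<Rightarrow> 'v \<Rightarrow> 'q \<Rightarrow> bool" where
  "solves P \<sigma> u \<longleftrightarrow> \<sigma> \<in> space_V P \<and> u \<in> space_Q P \<and>
     (\<forall>\<tau>\<in>space_V P. form_a P \<sigma> \<tau> + form_b P \<tau> u = load_V P \<tau>) \<and>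
     (\<forall>v\<in>space_Q P. form_b P \<sigma> v = load_Q P v)"

definition kernel_b :: "('v, 'q) mixed_problem \<Rightarrow> 'v set" where
  "kernel_b P = {\<tau> \<in> space_V P. \<forall>v\<in>space_Q P. form_b P \<tau> v = 0}"

text \<open>Since elements are representatives of classes, being a nonzero element is expressed by a
  nonzero norm. The infimum and supremum are taken in the extended reals.\<close>

definition inf_sup_stable :: "real \<Rightarrow> real \<Rightarrow> ('v, 'q) mixed_problem \<Rightarrow> bool" where
  "inf_sup_stable \<gamma>1 \<gamma>2 P \<longleftrightarrow>
     (INF v\<in>{v \<in> space_Q P. norm_Q P v \<noteq> 0}. SUP \<tau>\<in>{\<tau> \<in> space_V P. norm_V P \<tau> \<noteq> 0}.
        ereal (form_b P \<tau> v / (norm_V P \<tau> * norm_Q P v))) \<ge> ereal \<gamma>1 \<and>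
     (\<forall>\<tau>\<in>kernel_b P. form_a P \<tau> \<tau> \<ge> \<gamma>2 * (norm_V P \<tau>)\<^sup>2)"

definition strong_symmetry_problem ::
  "(real^2 \<Rightarrow> real^2) \<Rightarrow> (real^2 \<Rightarrow> real^2^2 \<Rightarrow> real^2^2) \<Rightarrow> (real^2 \<Rightarrow> real^2) \<Rightarrow> (real^2 \<Rightarrow> real^2) \<Rightarrow>
   real list \<Rightarrow> real list \<Rightarrow> nat \<Rightarrow> int \<Rightarrow> (real^2 \<Rightarrow> real^2^2, real^2 \<Rightarrow> real^2) mixed_problem" where
  "strong_symmetry_problem F A f uD \<psi>1 \<psi>2 p r = (let U = F ` unit_square in
     \<lparr> space_V = V2_h F \<psi>1 \<psi>2 p r,
       space_Q = V3_h F \<psi>1 \<psi>2 p r,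
       norm_V = Hdiv_norm U,
       norm_Q = L2_norm U,
       form_a = (\<lambda>\<sigma> \<tau>. L2_inner U (\<lambda>x. A x (\<sigma> x)) \<tau>),
       form_b = (\<lambda>\<tau> v. L2_inner U (weak_div U \<tau>) v),
       load_V = (\<lambda>\<tau>. normal_trace_pairing U \<tau> uD),
       load_Q = (\<lambda>v. L2_inner U f v) \<rparr>)"

end

theory Submission
  imports Defs
begin

text \<open>The inf-sup condition holds because the divergence has a right inverse on the discrete spaces,
  bounded independently of the mesh, and coercivity holds because the divergence of a discrete stress
  is a discrete displacement, so that the discrete kernel is exactly divergence free. Both facts rest on
  explicit formulas on the unit square.

  \<^bold>\<open>Inverting the transformations.\<close> For a matrix field \<open>j\<close> on the square, \<open>Pi_op j\<close> maps a vector field \<open>\<mu>\<close>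
  to the derivative in the first direction of \<open>j\<close> times the antiderivative of \<open>\<mu>\<close>. If \<open>b\<close> is the
  pointwise inverse of \<open>j\<close>, then \<open>Pi_op b\<close> undoes \<open>Pi_op j\<close>: the antiderivative of \<open>Pi_op j \<mu>\<close> is
  \<open>j\<close> times that of \<open>\<mu>\<close>, so multiplying by \<open>b\<close> and differentiating returns \<open>\<mu>\<close>. Thus no Volterra equation
  has to be solved. The transformation \<open>Y3\<close> is \<open>Pi_op\<close> of the adjugate Jacobian, applied to the Piola
  pull-back of the vector field. The entries of the Airy matrices of the components of \<open>F\<close> are, up to sign,
  derivatives of the entries of the adjugate Jacobian; hence in the second column \<open>Y2\<close> is again
  \<open>Pi_op\<close> of it, and once this column is inverted, the first column is an algebraic equation.
  The inverses return an arbitrary square integrable preimage, so the formulas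
  \<open>Y3_inv_spec\<close> and \<open>Y2_inv_spec\<close> are shown almost everywhere, for every such preimage.

  \<^bold>\<open>Commuting with the divergence.\<close> If \<open>S\<close> is a symmetric field on the square with row-wise divergence
  \<open>f\<close>, then the divergence of \<open>Y2_tilde F S\<close> is \<open>Y3_inv F f\<close> (\<open>has_weak_div_Y2_tilde\<close>). After a change
  of variables this is an identity between integrals over the square against a test function, and it is
  the sum of four integrations by parts (\<open>weak_divergence_square\<close>). The values of \<open>S\<close> on the edge where
  the first coordinate vanishes contribute an extra term to the divergence, which the trace correction
  in \<open>Y2_tilde\<close> cancels.

  \<^bold>\<open>Splines.\<close> Raising degree and smoothness of a spline space by one gives the antiderivatives of its elements:
  a function of the larger space is its value at \<open>0\<close> plus the integral of a function of the smaller one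
  (\<open>spline_derivative\<close>), and conversely (\<open>spline_antiderivative\<close>). So the divergence maps \<open>V2_hat\<close> into
  \<open>V3_hat\<close>, and \<open>w\<close> in \<open>V3_hat\<close> is the divergence of the diagonal field of the antiderivatives of its
  components, each taken in its own direction. The first column of this field vanishes on the edge
  just mentioned, so that its trace correction is zero.

  \<^bold>\<open>Conclusion.\<close> Let \<open>v\<close> be the discrete displacement belonging to \<open>w\<close>, and \<open>\<tau>\<close> the image under \<open>Y2_tilde\<close> of
  that diagonal field. Then \<open>div \<tau> = v\<close>. Passing from \<open>v\<close> to \<open>w\<close> and on to \<open>\<tau>\<close> only involves antiderivatives and
  products with bounded functions given by \<open>F\<close>, so the square of the \<open>L2\<close> norm of \<open>\<tau>\<close> is at most \<open>C\<close> times that of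
  \<open>v\<close>, where \<open>C\<close> depends on \<open>F\<close> alone (\<open>energy_bound\<close>), and \<open>\<gamma>1 = 1 / sqrt (C + 1)\<close> is admissible. On
  the discrete kernel the norm is the \<open>L2\<close> norm, and \<open>\<gamma>2\<close> is the lower bound of \<open>A\<close>.\<close>

section \<open>Splines\<close>

text \<open>The recursion of the B-splines with the values in degree \<open>0\<close> frozen at the coefficients \<open>b\<close>. The
  result is a polynomial in \<open>x\<close>, so near a given point every B-spline can be replaced by a polynomial:
  on each knot interval it is \<open>cox\<close> with \<open>b\<close> the indicator of that interval.\<close>

primrec cox :: "real list \<Rightarrow> real \<Rightarrow> (nat \<Rightarrow> real) \<Rightarrow> nat \<Rightarrow> nat \<Rightarrow> real" where
  "cox \<xi> x b 0 i = b i"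
| "cox \<xi> x b (Suc q) i =
     (x - \<xi> ! i) / (\<xi> ! (i + q + 1) - \<xi> ! i) * cox \<xi> x b q i
     + (\<xi> ! (i + q + 2) - x) / (\<xi> ! (i + q + 2) - \<xi> ! (i + 1)) * cox \<xi> x b q (i + 1)"

lemma bspline_eq_cox: "bspline \<xi> q i x = cox \<xi> x (\<lambda>i. bspline \<xi> 0 i x) q i"
  by (induction q arbitrary: i) simp_all

lemma cox_cong:
  "(\<And>j. i \<le> j \<Longrightarrow> j \<le> i + q \<Longrightarrow> b j = b' j) \<Longrightarrow> cox \<xi> x b q i = cox \<xi> x b' q i"
proof (induction q arbitrary: i)
  case (Suc q)
  have "cox \<xi> x b q i = cox \<xi> x b' q i" "cox \<xi> x b q (i+1) = cox \<xi> x b' q (i+1)"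
    by (rule Suc.IH; rule Suc.prems; simp)+
  then show ?case by simp
qed simp

text \<open>The usual derivative formula of B-splines is a consequence of the recursion and the order of the knots, so it holds for
  all coefficients \<open>b\<close>. Knots may coincide: a quotient with a vanishing denominator is zero on both sides
  of each identity in the proof.\<close>

lemma cox_has_derivative:
  assumes "\<And>m n. m \<le> n \<Longrightarrow> n \<le> i + q + 2 \<Longrightarrow> \<xi> ! m \<le> \<xi> ! n"
  shows "((\<lambda>x. cox \<xi> x b (Suc q) i) has_real_derivative
     real (q + 1) * (cox \<xi> x b q i / (\<xi> ! (i + q + 1) - \<xi> ! i)
        - cox \<xi> x b q (i + 1) / (\<xi> ! (i + q + 2) - \<xi> ! (i + 1)))) (at x)"
  using assms
proof (induction q arbitrary: i)
  case 0
  show ?case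
  proof -
    have "((\<lambda>x. (x - a) * u + (c - x) * v) has_real_derivative u - v) (at x)" for a u c v
      by (auto intro!: derivative_eq_intros)
    from this[of "\<xi> ! i" "b i / (\<xi> ! (i + 1) - \<xi> ! i)" "\<xi> ! (i + 2)" "b (i + 1) / (\<xi> ! (i + 2) - \<xi> ! (i + 1))"]
    show ?thesis by simp
  qed
next
  case (Suc q)
  note IH1 = Suc.IH[of i, OF Suc.prems] and IH2 = Suc.IH[of "i+1", OF Suc.prems]
  define d1 where "d1 = \<xi> ! (i + q + 1) - \<xi> ! i"
  define d2 where "d2 = \<xi> ! (i + q + 2) - \<xi> ! (i + 1)"
  define d3 where "d3 = \<xi> ! (i + q + 3) - \<xi> ! (i + 2)"
  define e1 where "e1 = \<xi> ! (i + q + 2) - \<xi> ! i"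
  define e2 where "e2 = \<xi> ! (i + q + 3) - \<xi> ! (i + 1)"
  define c1 where "c1 = cox \<xi> x b q i"
  define c2 where "c2 = cox \<xi> x b q (i + 1)"
  define c3 where "c3 = cox \<xi> x b q (i + 2)"
  have D1: "((\<lambda>x. cox \<xi> x b (Suc q) i) has_real_derivative real (q + 1) * (c1 / d1 - c2 / d2)) (at x)"
    unfolding c1_def c2_def d1_def d2_def by (rule IH1) auto
  have D2: "((\<lambda>x. cox \<xi> x b (Suc q) (i + 1)) has_real_derivative real (q + 1) * (c2 / d2 - c3 / d3)) (at x)"
    using IH2 unfolding c2_def c3_def d2_def d3_def by (simp add: numeral_eq_Suc)
  have e: "cox \<xi> x b (Suc (Suc q)) i = (x - \<xi> ! i) / e1 * cox \<xi> x b (Suc q) i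
      + (\<xi> ! (i + q + 3) - x) / e2 * cox \<xi> x b (Suc q) (i + 1)" for x
    unfolding e1_def e2_def by (simp add: numeral_eq_Suc)
  have B1: "cox \<xi> x b (Suc q) i = (x - \<xi> ! i) / d1 * c1 + (\<xi> ! (i + q + 2) - x) / d2 * c2"
    unfolding c1_def c2_def d1_def d2_def by simp
  have B2: "cox \<xi> x b (Suc q) (i + 1) = (x - \<xi> ! (i + 1)) / d2 * c2 + (\<xi> ! (i + q + 3) - x) / d3 * c3"
    unfolding c3_def c2_def d3_def d2_def by (simp add: numeral_eq_Suc)
  \<comment> \<open>The product rule differentiates both the linear factors and the lower degree functions;
    the latter contribute q + 1 copies of what the former contribute once.\<close>
  have key: "(x - \<xi> ! i) / e1 * (c1 / d1 - c2 / d2) + (\<xi> ! (i + q + 3) - x) / e2 * (c2 / d2 - c3 / d3)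
     = cox \<xi> x b (Suc q) i / e1 - cox \<xi> x b (Suc q) (i + 1) / e2"
  proof -
    have "c2 / d2 * (- (x - \<xi> ! i) / e1 + (\<xi> ! (i + q + 3) - x) / e2)
        = c2 / d2 * ((\<xi> ! (i + q + 2) - x) / e1 - (x - \<xi> ! (i + 1)) / e2)"
    proof (cases "d2 = 0")
      case False
      have "\<xi> ! i \<le> \<xi> ! (i+1)" "\<xi> ! (i+1) \<le> \<xi> ! (i+q+2)" "\<xi> ! (i+q+2) \<le> \<xi> ! (i+q+3)"
        by (rule Suc.prems; simp)+
      then have "e1 > 0" "e2 > 0" using False unfolding d2_def e1_def e2_def by auto
      have "- (x - \<xi> ! i) / e1 = (\<xi> ! (i + q + 2) - x) / e1 - 1"
      proof -
        have "- (x - \<xi> ! i) = (\<xi> ! (i + q + 2) - x) - e1" by (simp add: e1_def)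
        then show ?thesis using \<open>e1 > 0\<close> by (simp only: diff_divide_distrib) simp
      qed
      moreover have "(\<xi> ! (i + q + 3) - x) / e2 = 1 - (x - \<xi> ! (i + 1)) / e2"
      proof -
        have "\<xi> ! (i + q + 3) - x = e2 - (x - \<xi> ! (i + 1))" by (simp add: e2_def)
        then show ?thesis using \<open>e2 > 0\<close> by (simp only: diff_divide_distrib) simp
      qed
      ultimately show ?thesis by simp
    qed simp
    then show ?thesis unfolding B1 B2 by (simp add: algebra_simps add_divide_distrib diff_divide_distrib)
  qed
  have "((\<lambda>x. cox \<xi> x b (Suc (Suc q)) i) has_real_derivative
      (1 / e1 * cox \<xi> x b (Suc q) i - 1 / e2 * cox \<xi> x b (Suc q) (i + 1)
      + real (q + 1) * ((x - \<xi> ! i) / e1 * (c1 / d1 - c2 / d2)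
         + (\<xi> ! (i + q + 3) - x) / e2 * (c2 / d2 - c3 / d3)))) (at x)"
  proof -
    have lin: "((\<lambda>x. (x - a) * u x + (c - x) * v x) has_real_derivative (u x - v x + ((x - a) * u' + (c - x) * v'))) (at x)"
      if "(u has_real_derivative u') (at x)" "(v has_real_derivative v') (at x)" for a c u v u' v'
      by (rule derivative_eq_intros that refl)+ simp
    show ?thesis
      using lin[OF DERIV_cdivide[OF D1, of e1] DERIV_cdivide[OF D2, of e2], of "\<xi> ! i" "\<xi> ! (i + q + 3)"]
      unfolding e by (simp add: algebra_simps add_divide_distrib diff_divide_distrib del: cox.simps)
  qed
  moreover have "1 / e1 * cox \<xi> x b (Suc q) i - 1 / e2 * cox \<xi> x b (Suc q) (i + 1)
      + real (q + 1) * (cox \<xi> x b (Suc q) i / e1 - cox \<xi> x b (Suc q) (i + 1) / e2)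
     = real (Suc q + 1) * (cox \<xi> x b (Suc q) i / e1 - cox \<xi> x b (Suc q) (i + 1) / e2)"
    by (simp add: algebra_simps add_divide_distrib del: cox.simps)
  ultimately have "((\<lambda>x. cox \<xi> x b (Suc (Suc q)) i) has_real_derivative
      real (Suc q + 1) * (cox \<xi> x b (Suc q) i / e1 - cox \<xi> x b (Suc q) (i + 1) / e2)) (at x)"
    by (simp only: key)
  moreover have "i + Suc q + 1 = i + q + 2" "i + Suc q + 2 = i + q + 3" by simp_all
  ultimately show ?case unfolding e1_def e2_def by (simp only:)
qed

text \<open>At a point \<open>y\<close> that is a \<open>j\<close>-fold knot ending with the knot number \<open>c\<close>, each step of the recursion
  multiplies the only nonzero value by \<open>1\<close> and shifts its index down. So the polynomials of the knot
  interval to the right of \<open>y\<close> take the values \<open>0\<close> and \<open>1\<close> there. The next lemma treats the interval to the left,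
  where the index does not move.\<close>

lemma cox_delta_right:
  assumes "y < \<xi> ! (c + 1)" "\<And>m. c < m + j \<Longrightarrow> m \<le> c \<Longrightarrow> \<xi> ! m = y" "j \<le> c"
  shows "cox \<xi> y (\<lambda>i. if i = c then 1 else 0) j i = (if i + j = c then 1 else 0)"
  using assms
proof (induction j arbitrary: i)
  case (Suc j)
  have IH: "cox \<xi> y (\<lambda>i. if i = c then 1 else 0) j i = (if i + j = c then 1 else 0)" for i
    by (rule Suc.IH) (use Suc.prems in auto)
  have "\<xi> ! i = y" if "i + j = c" using Suc.prems(2)[of i] that by simp
  moreover have "\<xi> ! (i + 1) = y" "i + j + 2 = c + 1" if "i + Suc j = c" using Suc.prems(2)[of "i+1"] that by simp_all
  ultimately show ?case
    unfolding cox.simps IH using Suc.prems(1) by (auto simp: numeral_eq_Suc)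
qed simp

lemma cox_delta_left:
  assumes "\<xi> ! e < y" "\<And>m. e < m \<Longrightarrow> m \<le> e + j \<Longrightarrow> \<xi> ! m = y"
  shows "cox \<xi> y (\<lambda>i. if i = e then 1 else 0) j i = (if i = e then 1 else 0)"
  using assms
proof (induction j arbitrary: i)
  case (Suc j)
  have IH: "cox \<xi> y (\<lambda>i. if i = e then 1 else 0) j i = (if i = e then 1 else 0)" for i
    by (rule Suc.IH) (use Suc.prems in auto)
  have "\<xi> ! (i + j + 1) = y" if "i = e" using Suc.prems(2)[of "i + j + 1"] that by simp
  moreover have "\<xi> ! (i + j + 2) = y" if "i + 1 = e" using Suc.prems(2)[of "i+j+2"] that by simp
  ultimately show ?case
    unfolding cox.simps IH using Suc.prems(1) by (auto simp del: One_nat_def)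
qed simp

text \<open>Two polynomial pieces that agree at a point in one degree agree there in all higher degrees. Together
  with the two lemmas before it, this shows that the pieces on both sides of a knot match from the degree on
  that equals its multiplicity.\<close>

lemma cox_eq_mono:
  assumes "\<And>i. cox \<xi> y b m i = cox \<xi> y b' m i" "m \<le> k"
  shows "cox \<xi> y b k i = cox \<xi> y b' k i"
  using assms(2)
proof (induction arbitrary: i rule: dec_induct)
  case base then show ?case by (rule assms(1))
qed simp

text \<open>What the arguments on single B-splines use of the knot vectors of the spline spaces; the bound on
  the multiplicities is added where it matters.\<close>

definition knot_vector :: "real list \<Rightarrow> bool" where
  "knot_vector \<xi> \<longleftrightarrow> sorted \<xi> \<and> 2 \<le> length \<xi> \<and> \<xi> ! 0 = 0 \<and> last \<xi> = 1"

lemma knot_vector_mono: "knot_vector \<xi> \<Longrightarrow> m \<le> n \<Longrightarrow> n < length \<xi> \<Longrightarrow> \<xi> ! m \<le> \<xi> ! n"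
  by (simp add: knot_vector_def sorted_iff_nth_mono)

lemma knot_vector_last: "knot_vector \<xi> \<Longrightarrow> \<xi> ! (length \<xi> - 1) = 1"
  by (metis knot_vector_def last_conv_nth list.size(3) not_numeral_le_zero)

lemma knot_right:
  assumes "knot_vector \<xi>" "0 \<le> y" "y < 1"
  obtains c where "c + 1 < length \<xi>" "\<xi> ! c \<le> y" "y < \<xi> ! (c + 1)"
proof -
  define P where "P c \<longleftrightarrow> c < length \<xi> \<and> \<xi> ! c \<le> y" for c
  have P0: "P 0" using assms by (auto simp: P_def knot_vector_def)
  have bd: "\<forall>c. P c \<longrightarrow> c \<le> length \<xi>" by (auto simp: P_def)
  obtain c where c: "P c" "\<And>d. P d \<Longrightarrow> d \<le> c"
    using GreatestI_nat[of P, OF P0] Greatest_le_nat[of P] bd by blast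
  have "c \<noteq> length \<xi> - 1" using c(1) knot_vector_last[OF assms(1)] assms(3) by (auto simp: P_def)
  then have "c + 1 < length \<xi>" using c(1) by (auto simp: P_def)
  moreover have "y < \<xi> ! (c + 1)"
    using c(2)[of "c+1"] calculation by (fastforce simp: P_def)
  ultimately show ?thesis using that c(1) by (auto simp: P_def)
qed

lemma knot_left:
  assumes "knot_vector \<xi>" "0 < y" "y \<le> 1"
  obtains e where "e + 1 < length \<xi>" "\<xi> ! e < y" "y \<le> \<xi> ! (e + 1)"
proof -
  define P where "P c \<longleftrightarrow> c < length \<xi> \<and> \<xi> ! c < y" for c
  have P0: "P 0" using assms by (auto simp: P_def knot_vector_def)
  have bd: "\<forall>c. P c \<longrightarrow> c \<le> length \<xi>" by (auto simp: P_def)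
  obtain c where c: "P c" "\<And>d. P d \<Longrightarrow> d \<le> c"
    using GreatestI_nat[of P, OF P0] Greatest_le_nat[of P] bd by blast
  have "c \<noteq> length \<xi> - 1" using c(1) knot_vector_last[OF assms(1)] assms(3) by (auto simp: P_def)
  then have "c + 1 < length \<xi>" using c(1) by (auto simp: P_def)
  moreover have "y \<le> \<xi> ! (c + 1)"
    using c(2)[of "c+1"] calculation by (fastforce simp: P_def)
  ultimately show ?thesis using that c(1) by (auto simp: P_def)
qed

lemma bspline_0_right:
  assumes "knot_vector \<xi>" "c + 1 < length \<xi>" "\<xi> ! c \<le> x" "x < \<xi> ! (c + 1)" "i + 1 < length \<xi>"
  shows "bspline \<xi> 0 i x = (if i = c then 1 else 0)"
proof -
  have "x < 1" using assms knot_vector_mono[of \<xi> "c+1" "length \<xi> - 1"] knot_vector_last by fastforce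
  moreover have "\<xi> ! (i + 1) \<le> \<xi> ! c" if "i < c" using that assms knot_vector_mono[of \<xi> "i+1" c] by simp
  moreover have "\<xi> ! (c + 1) \<le> \<xi> ! i" if "c < i" using that assms knot_vector_mono[of \<xi> "c+1" i] by simp
  ultimately show ?thesis using assms by (cases i c rule: linorder_cases) (auto simp: knot_vector_def)
qed

lemma bspline_0_one:
  assumes "knot_vector \<xi>" "e + 1 < length \<xi>" "\<xi> ! e < 1" "1 \<le> \<xi> ! (e + 1)" "i + 1 < length \<xi>"
  shows "bspline \<xi> 0 i 1 = (if i = e then 1 else 0)"
proof -
  have "\<xi> ! m \<le> 1" if "m < length \<xi>" for m
    using assms knot_vector_mono[of \<xi> m "length \<xi> - 1"] knot_vector_last that by fastforce
  note this[of "e+1"] this[of "i+1"]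
  moreover have "\<xi> ! (i + 1) \<le> \<xi> ! e" if "i < e" using that assms knot_vector_mono[of \<xi> "i+1" e] by simp
  moreover have "\<xi> ! (e + 1) \<le> \<xi> ! i" if "e < i" using that assms knot_vector_mono[of \<xi> "e+1" i] by simp
  ultimately show ?thesis using assms by (cases i e rule: linorder_cases) (auto simp: knot_vector_def)
qed

text \<open>On a half-open knot interval exactly one B-spline of degree \<open>0\<close> is nonzero. At the end point \<open>1\<close> of the
  domain this role is played by the last nonempty interval, whose germ from the left is treated next.\<close>

lemma bspline_right_germ:
  assumes "knot_vector \<xi>" "c + 1 < length \<xi>" "\<xi> ! c \<le> x" "x < \<xi> ! (c + 1)" "i + k + 1 < length \<xi>"
  shows "bspline \<xi> k i x = cox \<xi> x (\<lambda>i. if i = c then 1 else 0) k i"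
  unfolding bspline_eq_cox[of \<xi> k] by (rule cox_cong, rule bspline_0_right) (use assms in auto)

lemma bspline_germ_one:
  assumes "knot_vector \<xi>" "e + 1 < length \<xi>" "\<xi> ! e < 1" "1 \<le> \<xi> ! (e + 1)" "i + k + 1 < length \<xi>"
  shows "bspline \<xi> k i 1 = cox \<xi> 1 (\<lambda>i. if i = e then 1 else 0) k i"
  unfolding bspline_eq_cox[of \<xi> k] by (rule cox_cong, rule bspline_0_one) (use assms in auto)

lemma cox_continuous: "isCont (\<lambda>x. cox \<xi> x b k i) y"
  by (induction k arbitrary: i) (auto simp: divide_inverse intro!: continuous_intros)

text \<open>Continuity only depends on the knot multiplicities, which the last assumption bounds by the
  degree. At the point \<open>y\<close> let \<open>e\<close> be the knot interval to the left and \<open>c\<close> the one to the right.\<close>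

lemma bspline_continuous:
  assumes kv: "knot_vector \<xi>" and ik: "i + k + 1 < length \<xi>"
    and mult: "\<And>j. j + k < length \<xi> \<Longrightarrow> 0 < \<xi> ! j \<Longrightarrow> \<xi> ! j < 1 \<Longrightarrow> \<xi> ! j < \<xi> ! (j + k)"
  shows "continuous_on {0..1} (bspline \<xi> k i)"
  unfolding continuous_on_def
proof
  fix y :: real assume y: "y \<in> {0..1}"
  have right: "(bspline \<xi> k i \<longlongrightarrow> bspline \<xi> k i y) (at_right y)" if "y < 1"
  proof -
    from knot_right[OF kv _ that] y obtain c
      where c: "c + 1 < length \<xi>" "\<xi> ! c \<le> y" "y < \<xi> ! (c + 1)" by auto
    have "((\<lambda>x. cox \<xi> x (\<lambda>i. if i = c then 1 else 0) k i) \<longlongrightarrow> cox \<xi> y (\<lambda>i. if i = c then 1 else 0) k i) (at_right y)"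
      using cox_continuous[where \<xi>=\<xi> and y=y and k=k and i=i] by (simp add: isCont_def filterlim_at_split)
    moreover have "\<forall>\<^sub>F x in at_right y. cox \<xi> x (\<lambda>i. if i = c then 1 else 0) k i = bspline \<xi> k i x"
      using eventually_at_right_less[of y] eventually_at_right_real[OF c(3)]
      by eventually_elim (use bspline_right_germ[OF kv c(1) _ _ ik] c in auto)
    ultimately show ?thesis
      using bspline_right_germ[OF kv c ik] by (auto elim: Lim_transform_eventually)
  qed
  have left: "(bspline \<xi> k i \<longlongrightarrow> bspline \<xi> k i y) (at_left y)" if "y > 0"
  proof -
    from knot_left[OF kv that] y obtain e
      where e: "e + 1 < length \<xi>" "\<xi> ! e < y" "y \<le> \<xi> ! (e + 1)" by auto
    have "((\<lambda>x. cox \<xi> x (\<lambda>i. if i = e then 1 else 0) k i) \<longlongrightarrow> cox \<xi> y (\<lambda>i. if i = e then 1 else 0) k i) (at_left y)"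
      using cox_continuous[where \<xi>=\<xi> and y=y and k=k and i=i] by (simp add: isCont_def filterlim_at_split)
    moreover have "\<forall>\<^sub>F x in at_left y. cox \<xi> x (\<lambda>i. if i = e then 1 else 0) k i = bspline \<xi> k i x"
      using eventually_at_left_real[OF e(2)]
      by eventually_elim (use bspline_right_germ[OF kv e(1) _ _ ik] e in auto)
    moreover have "bspline \<xi> k i y = cox \<xi> y (\<lambda>i. if i = e then 1 else 0) k i"
    proof (cases "y = 1")
      case True then show ?thesis using bspline_germ_one[OF kv e(1) _ _ ik] e by auto
    next
      case False
      then have "y < 1" using y by auto
      from knot_right[OF kv _ this] y obtain c
        where c: "c + 1 < length \<xi>" "\<xi> ! c \<le> y" "y < \<xi> ! (c + 1)" by auto
      have ec: "e \<le> c"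
      proof (rule ccontr)
        assume "\<not> e \<le> c" then have "\<xi> ! (c+1) \<le> \<xi> ! e" using knot_vector_mono[OF kv, of "c+1" e] e by simp
        then show False using c e by simp
      qed
      have eq: "\<xi> ! m = y" if "e < m" "m \<le> c" for m
        using knot_vector_mono[OF kv, of "e+1" m] knot_vector_mono[OF kv, of m c] that e c by simp
      \<comment> \<open>The knots number e + 1 to c are all equal to y, so c - e is its multiplicity.\<close>
      have "c - e \<le> k"
      proof (rule ccontr)
        assume "\<not> c - e \<le> k"
        then have "e + 1 + k \<le> c" by simp
        then have "\<xi> ! (e + 1) = y" "\<xi> ! (e + 1 + k) = y" using eq by auto
        then show False using mult[of "e+1"] \<open>e + 1 + k \<le> c\<close> c(1) that \<open>y < 1\<close> by simp
      qed
      have "cox \<xi> y (\<lambda>i. if i = c then 1 else 0) k i = cox \<xi> y (\<lambda>i. if i = e then 1 else 0) k i"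
      proof (rule cox_eq_mono[OF _ \<open>c - e \<le> k\<close>])
        fix i
        have "cox \<xi> y (\<lambda>i. if i = c then 1 else 0) (c - e) i = (if i + (c - e) = c then 1 else 0)"
          by (rule cox_delta_right) (use c(3) eq ec in auto)
        moreover have "cox \<xi> y (\<lambda>i. if i = e then 1 else 0) (c - e) i = (if i = e then 1 else 0)"
          by (rule cox_delta_left) (use e(2) eq ec in auto)
        ultimately show "cox \<xi> y (\<lambda>i. if i = c then 1 else 0) (c - e) i = cox \<xi> y (\<lambda>i. if i = e then 1 else 0) (c - e) i"
          using ec by auto
      qed
      then show ?thesis using bspline_right_germ[OF kv c ik] by simp
    qed
    ultimately show ?thesis by (auto elim: Lim_transform_eventually)
  qed
  consider "y = 0" | "y = 1" | "0 < y" "y < 1" using y by fastforce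
  then show "(bspline \<xi> k i \<longlongrightarrow> bspline \<xi> k i y) (at y within {0..1})"
  proof cases
    case 1
    then show ?thesis using right by (simp add: at_within_Icc_at_right)
  next
    case 2
    then show ?thesis using left by (simp add: at_within_Icc_at_left)
  next
    case 3
    then show ?thesis using left right by (simp add: at_within_Icc_at filterlim_at_split)
  qed
qed

text \<open>Between two knots a B-spline is a polynomial piece \<open>cox\<close>, and so are the lower degree B-splines
  in the formula, with the same coefficients.\<close>

lemma bspline_has_derivative:
  assumes kv: "knot_vector \<xi>" and ik: "i + k + 2 < length \<xi>" and x: "0 < x" "x < 1" "x \<notin> set \<xi>"
  shows "(bspline \<xi> (Suc k) i has_real_derivative
     real (k + 1) * (bspline \<xi> k i x / (\<xi> ! (i + k + 1) - \<xi> ! i)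
        - bspline \<xi> k (i + 1) x / (\<xi> ! (i + k + 2) - \<xi> ! (i + 1)))) (at x)"
proof -
  from knot_right[OF kv _ x(2)] x obtain c
    where c: "c + 1 < length \<xi>" "\<xi> ! c \<le> x" "x < \<xi> ! (c + 1)" by auto
  then have cx: "\<xi> ! c < x" using x(3) nth_mem[of c \<xi>] by (metis add_lessD1 less_eq_real_def)
  define b :: "nat \<Rightarrow> real" where "b = (\<lambda>i. if i = c then 1 else 0)"
  have "((\<lambda>x. cox \<xi> x b (Suc k) i) has_real_derivative
     real (k + 1) * (cox \<xi> x b k i / (\<xi> ! (i + k + 1) - \<xi> ! i)
        - cox \<xi> x b k (i + 1) / (\<xi> ! (i + k + 2) - \<xi> ! (i + 1)))) (at x)"
    by (rule cox_has_derivative) (use ik knot_vector_mono[OF kv] in auto)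
  moreover have "cox \<xi> x b k i = bspline \<xi> k i x" "cox \<xi> x b k (i+1) = bspline \<xi> k (i+1) x"
    unfolding b_def using bspline_right_germ[OF kv c] ik by auto
  moreover have "cox \<xi> u b (Suc k) i = bspline \<xi> (Suc k) i u" if "u \<in> {\<xi> ! c <..< \<xi> ! (c+1)}" for u
    unfolding b_def using bspline_right_germ[OF kv c(1), of u i "Suc k"] that ik by auto
  ultimately show ?thesis
    using has_field_derivative_transform_within_open[of "\<lambda>x. cox \<xi> x b (Suc k) i" _ x "{\<xi> ! c <..< \<xi> ! (c+1)}" "bspline \<xi> (Suc k) i"]
      cx c(3) by (auto simp del: bspline.simps cox.simps)
qed

lemma bspline_borel [measurable]: "bspline \<xi> k i \<in> borel_measurable borel"
proof (induction k arbitrary: i)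
  case 0
  have "bspline \<xi> 0 i = (\<lambda>x. if \<xi> ! i \<le> x \<and> x < \<xi> ! (i + 1) \<or> \<xi> ! i < x \<and> x = \<xi> ! (i + 1) \<and> x = last \<xi> then 1 else 0)"
    by (rule ext) simp
  then show ?case by simp
next
  case (Suc k)
  have "bspline \<xi> (Suc k) i = (\<lambda>x. (x - \<xi> ! i) / (\<xi> ! (i + k + 1) - \<xi> ! i) * bspline \<xi> k i x
     + (\<xi> ! (i + k + 2) - x) / (\<xi> ! (i + k + 2) - \<xi> ! (i + 1)) * bspline \<xi> k (i + 1) x)"
    by (rule ext) simp
  then show ?case using Suc[of i] Suc[of "i+1"] by simp
qed

lemma bspline_bounded: "\<exists>C. \<forall>x\<in>{0..1}. \<bar>bspline \<xi> k i x\<bar> \<le> C"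
proof (induction k arbitrary: i)
  case 0
  show ?case by (rule exI[of _ 1]) simp
next
  case (Suc k)
  from Suc[of i] Suc[of "i+1"] obtain C D where CD: "\<forall>x\<in>{0..1}. \<bar>bspline \<xi> k i x\<bar> \<le> C" "\<forall>x\<in>{0..1}. \<bar>bspline \<xi> k (i+1) x\<bar> \<le> D"
    by blast
  define d where "d = \<xi> ! (i + k + 1) - \<xi> ! i"
  define e where "e = \<xi> ! (i + k + 2) - \<xi> ! (i + 1)"
  show ?case
  proof (rule exI[of _ "(1 + \<bar>\<xi> ! i\<bar>) / \<bar>d\<bar> * C + (1 + \<bar>\<xi> ! (i + k + 2)\<bar>) / \<bar>e\<bar> * D"], rule ballI)
    fix x :: real assume x: "x \<in> {0..1}"
    have "\<bar>(x - \<xi> ! i) / d * bspline \<xi> k i x\<bar> \<le> (1 + \<bar>\<xi> ! i\<bar>) / \<bar>d\<bar> * C"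
      unfolding abs_mult abs_divide using x CD by (intro mult_mono divide_right_mono) auto
    moreover have "\<bar>(\<xi> ! (i + k + 2) - x) / e * bspline \<xi> k (i+1) x\<bar> \<le> (1 + \<bar>\<xi> ! (i + k + 2)\<bar>) / \<bar>e\<bar> * D"
      unfolding abs_mult abs_divide using x CD by (intro mult_mono divide_right_mono) auto
    ultimately show "\<bar>bspline \<xi> (Suc k) i x\<bar> \<le> (1 + \<bar>\<xi> ! i\<bar>) / \<bar>d\<bar> * C + (1 + \<bar>\<xi> ! (i + k + 2)\<bar>) / \<bar>e\<bar> * D"
      unfolding bspline.simps d_def[symmetric] e_def[symmetric] by linarith
  qed
qed

text \<open>Interior knots have multiplicity \<open>q - s\<close>, which does not change if both numbers grow by one. Only the two end
  knots get one more copy, which gives the relation between the two knot vectors.\<close>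

lemma knot_vector_knots:
  assumes "breakpoints \<psi>"
  shows "knot_vector (knots \<psi> q s)"
    and "\<And>j. j \<le> q \<Longrightarrow> knots \<psi> q s ! j = 0"
    and "\<And>j. length (knots \<psi> q s) - q - 1 \<le> j \<Longrightarrow> j < length (knots \<psi> q s) \<Longrightarrow> knots \<psi> q s ! j = 1"
    and "2 * q + 2 \<le> length (knots \<psi> q s)"
    and "knots \<psi> (Suc q) (s + 1) = 0 # knots \<psi> q s @ [1]"
    and "0 < knots \<psi> q s ! (q + 1)"
proof -
  define m where "m = nat (int q - s)"
  define I where "I = butlast (tl \<psi>)"
  have \<psi>: "\<psi> = 0 # I @ [1]"
  proof -
    from assms have "length \<psi> \<noteq> 0" "length (tl \<psi>) \<noteq> 0" "hd \<psi> = 0" "last \<psi> = 1"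
      by (auto simp: breakpoints_def simp del: length_0_conv)
    then have "\<psi> \<noteq> []" "tl \<psi> \<noteq> []" "hd \<psi> = 0" "last \<psi> = 1" by (auto simp del: length_tl)
    then show ?thesis unfolding I_def by (metis append_butlast_last_id hd_Cons_tl last_tl)
  qed
  have kn: "knots \<psi> q s = replicate (q + 1) 0 @ concat (map (replicate m) I) @ replicate (q + 1) 1"
    by (simp add: knots_def m_def I_def)
  have sI: "sorted_wrt (<) I" "\<forall>x\<in>set I. 0 < x \<and> x < 1"
    using assms unfolding breakpoints_def \<psi> by (auto simp: sorted_wrt_append)
  have "sorted I" using sI strict_sorted_imp_sorted by blast
  then have so: "sorted (concat (map (replicate m) I))"
    by (induction I) (auto simp: sorted_append)
  have "sorted (knots \<psi> q s)"
    unfolding kn using so sI(2) by (auto simp: sorted_append less_imp_le simp del: replicate_Suc)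
  then show "knot_vector (knots \<psi> q s)"
    unfolding knot_vector_def by (simp add: kn nth_append)
  show "knots \<psi> q s ! j = 0" if "j \<le> q" for j
    using that unfolding kn by (simp add: nth_append del: replicate_Suc)
  show "knots \<psi> q s ! j = 1" if "length (knots \<psi> q s) - q - 1 \<le> j" "j < length (knots \<psi> q s)" for j
    using that unfolding kn by (auto simp: nth_append simp del: replicate_Suc)
  show "2 * q + 2 \<le> length (knots \<psi> q s)" by (simp add: kn)
  define L where "L = concat (map (replicate m) I) @ replicate (q + 1) 1"
  have "knots \<psi> q s ! (q + 1) = L ! 0"
    unfolding kn L_def[symmetric] by (simp add: nth_append del: replicate_Suc)
  moreover have "L \<noteq> []" by (simp add: L_def)
  ultimately have "knots \<psi> q s ! (q + 1) \<in> set L" by simp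
  moreover have "set L \<subseteq> set I \<union> {1}" unfolding L_def by (auto simp del: replicate_Suc)
  ultimately show "0 < knots \<psi> q s ! (q + 1)" using sI(2) by force
  have "nat (int (Suc q) - (s + 1)) = m" by (simp add: m_def)
  then show "knots \<psi> (Suc q) (s + 1) = 0 # knots \<psi> q s @ [1]"
    unfolding knots_def kn by (simp add: I_def replicate_append_same)
qed

text \<open>By monotonicity, if the inequality failed then \<open>k + 1\<close> consecutive knots would be equal to an interior
  breakpoint, which is repeated only \<open>q - s\<close> times.\<close>

lemma knots_mult:
  assumes bp: "breakpoints \<psi>" and "int q - s \<le> int k"
    and j: "j + k < length (knots \<psi> q s)" "0 < knots \<psi> q s ! j" "knots \<psi> q s ! j < 1"
  shows "knots \<psi> q s ! j < knots \<psi> q s ! (j + k)"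
proof (rule ccontr)
  define \<xi> where "\<xi> = knots \<psi> q s"
  define m where "m = nat (int q - s)"
  define I where "I = butlast (tl \<psi>)"
  define y where "y = \<xi> ! j"
  have kv: "knot_vector \<xi>" unfolding \<xi>_def by (rule knot_vector_knots[OF bp])
  assume "\<not> knots \<psi> q s ! j < knots \<psi> q s ! (j + k)"
  then have "\<xi> ! (j + k) \<le> y" by (simp add: y_def \<xi>_def)
  then have "\<xi> ! i = y" if "j \<le> i" "i \<le> j + k" for i
    using knot_vector_mono[OF kv, of j i] knot_vector_mono[OF kv, of i "j+k"] that j
    by (simp add: y_def \<xi>_def)
  then have "{j..j+k} \<subseteq> {i. i < length \<xi> \<and> \<xi> ! i = y}" using j by (auto simp: \<xi>_def)
  then have "k + 1 \<le> card {i. i < length \<xi> \<and> \<xi> ! i = y}"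
    using card_mono[of "{i. i < length \<xi> \<and> \<xi> ! i = y}" "{j..j+k}"] by simp
  also have "\<dots> = count_list \<xi> y"
    by (simp add: count_list_eq_length_filter length_filter_conv_card eq_commute)
  also have "\<dots> = count_list (concat (map (replicate m) I)) y"
  proof -
    have "0 < y" "y < 1" using j by (auto simp: y_def \<xi>_def)
    then have "count_list (replicate n (0::real)) y = 0" "count_list (replicate n (1::real)) y = 0" for n
      by (auto intro!: count_notin)
    then show ?thesis unfolding \<xi>_def knots_def m_def I_def by (simp del: replicate_Suc)
  qed
  also have "\<dots> \<le> m"
  proof -
    have "sorted_wrt (<) I"
      using bp unfolding breakpoints_def I_def
      by (cases \<psi>) (auto simp: butlast_conv_take intro: sorted_wrt_take)
    then have "distinct I" using strict_sorted_iff by blast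
    then show ?thesis
    proof (induction I)
      case (Cons a I)
      have "count_list (replicate m a) y \<le> m" using count_le_length[of "replicate m a" y] by simp
      moreover have "count_list (concat (map (replicate m) I)) y = 0" if "a = y"
        using Cons.prems that by (intro count_notin) auto
      moreover have "count_list (replicate m a) y = 0" if "a \<noteq> y" using that by (intro count_notin) auto
      ultimately show ?case using Cons by (cases "a = y") auto
    qed simp
  qed
  finally show False using assms(2) by (simp add: m_def)
qed

lemma bspline_extend:
  assumes "i + k + 1 < length \<xi>" "\<xi> \<noteq> []" "last \<xi> = 1"
  shows "bspline (0 # \<xi> @ [1]) k (Suc i) x = bspline \<xi> k i x"
  using assms by (induction k arbitrary: i) (simp_all add: nth_append)

text \<open>Summation by parts of the coefficients: differentiating the spline of degree \<open>q + 1\<close> with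
  coefficients \<open>c\<close> term by term gives the spline of degree \<open>q\<close> whose coefficients are the divided
  differences of \<open>c\<close>. Where the knots coincide the coefficient \<open>a j\<close> is arbitrary, because the B-spline
  vanishes. The derivative formula holds off the finitely many knots, which suffices by continuity.\<close>

lemma has_integral_spline:
  fixes a c :: "nat \<Rightarrow> real" and q :: nat and s :: int and \<psi> :: "real list"
  assumes bp: "breakpoints \<psi>" and s: "-1 \<le> s" and x: "0 \<le> x" "x \<le> 1"
  defines "\<xi> \<equiv> knots \<psi> q s" and "\<xi>' \<equiv> knots \<psi> (Suc q) (s + 1)"
  defines "N \<equiv> length \<xi> - q - 1"
  assumes a: "\<And>j. j < N \<Longrightarrow> \<xi> ! (j + q + 1) \<noteq> \<xi> ! j \<Longrightarrow> a j = real (q + 1) * (c (j + 1) - c j) / (\<xi> ! (j + q + 1) - \<xi> ! j)"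
  shows "((\<lambda>x. \<Sum>j<N. a j * bspline \<xi> q j x) has_integral
    (\<Sum>i<N + 1. c i * bspline \<xi>' (Suc q) i x) - (\<Sum>i<N + 1. c i * bspline \<xi>' (Suc q) i 0)) {0..x}"
proof (rule fundamental_theorem_of_calculus_interior_strong[where S = "set \<xi>'"])
  note kn = knot_vector_knots[OF bp]
  have len: "length \<xi>' = length \<xi> + 2" and \<xi>': "\<xi>' = 0 # \<xi> @ [1]" unfolding \<xi>'_def \<xi>_def kn(5) by auto
  have kv: "knot_vector \<xi>" "knot_vector \<xi>'" unfolding \<xi>_def \<xi>'_def by (rule kn)+
  have N: "N + q + 1 = length \<xi>" using kn(4)[of q s] by (simp add: N_def \<xi>_def)
  show "finite (set \<xi>')" "0 \<le> x" using x by auto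
  have mult: "\<xi>' ! j < \<xi>' ! (j + Suc q)" if "j + Suc q < length \<xi>'" "0 < \<xi>' ! j" "\<xi>' ! j < 1" for j
    using that unfolding \<xi>'_def by (intro knots_mult[OF bp]) (use s in auto)
  show "continuous_on {0..x} (\<lambda>x. \<Sum>i<N + 1. c i * bspline \<xi>' (Suc q) i x)"
    by (intro continuous_intros continuous_on_subset[OF bspline_continuous[OF kv(2) _ mult]])
       (use x N len in \<open>auto simp del: bspline.simps\<close>)
  fix t assume t: "t \<in> {0<..<x} - set \<xi>'"
  define D where "D i = bspline \<xi>' q i t / (\<xi>' ! (i + q + 1) - \<xi>' ! i)" for i
  have "((\<lambda>x. \<Sum>i<N + 1. c i * bspline \<xi>' (Suc q) i x) has_real_derivative
      (\<Sum>i<N + 1. c i * (real (q + 1) * (D i - D (i + 1))))) (at t)"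
  proof (intro DERIV_sum DERIV_cmult)
    fix i assume "i \<in> {..<N + 1}"
    then show "(bspline \<xi>' (Suc q) i has_real_derivative real (q + 1) * (D i - D (i + 1))) (at t)"
      using bspline_has_derivative[OF kv(2), of i q t] t x N len by (simp add: D_def numeral_eq_Suc del: bspline.simps)
  qed
  moreover have "(\<Sum>i<N + 1. c i * (real (q + 1) * (D i - D (i + 1)))) = (\<Sum>j<N. a j * bspline \<xi> q j t)"
  proof -
    have "\<xi>' ! (q + 1) = 0" unfolding \<xi>'_def by (rule kn) simp
    moreover have "\<xi>' ! 0 = 0" unfolding \<xi>'_def by (rule kn) simp
    \<comment> \<open>The extreme terms drop out, as the first and the last B-spline of degree q on the larger
      knot vector have an empty support.\<close>
    ultimately have D0: "D 0 = 0" by (simp add: D_def)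
    have "\<xi>' ! (N + 1) = 1" "\<xi>' ! (N + 1 + q + 1) = 1"
      unfolding \<xi>'_def by (rule kn(3); use N len in \<open>simp add: \<xi>'_def\<close>)+
    then have DN: "D (N + 1) = 0" by (simp add: D_def)
    have "(\<Sum>i<N + 1. c i * D i) = (\<Sum>i<N. c (i + 1) * D (i + 1))"
      using D0 by (simp add: sum.lessThan_Suc_shift del: sum.lessThan_Suc)
    moreover have "(\<Sum>i<N + 1. c i * D (i + 1)) = (\<Sum>i<N. c i * D (i + 1))"
      using DN by simp
    moreover have "(\<Sum>i<N + 1. c i * (real (q + 1) * (D i - D (i + 1))))
        = real (q + 1) * ((\<Sum>i<N + 1. c i * D i) - (\<Sum>i<N + 1. c i * D (i + 1)))"
      unfolding sum_subtractf[symmetric] sum_distrib_left by (intro sum.cong refl) (simp add: algebra_simps)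
    moreover have "(\<Sum>i<N. real (q + 1) * (c (i + 1) - c i) * D (i + 1))
        = real (q + 1) * ((\<Sum>i<N. c (i + 1) * D (i + 1)) - (\<Sum>i<N. c i * D (i + 1)))"
      unfolding sum_subtractf[symmetric] sum_distrib_left by (intro sum.cong refl) (simp add: algebra_simps)
    ultimately have "(\<Sum>i<N + 1. c i * (real (q + 1) * (D i - D (i + 1))))
        = (\<Sum>i<N. real (q + 1) * (c (i + 1) - c i) * D (i + 1))"
      by (simp only:)
    also have "\<dots> = (\<Sum>j<N. a j * bspline \<xi> q j t)"
    proof (intro sum.cong refl)
      fix j assume j: "j \<in> {..<N}"
      have B: "bspline \<xi>' q (j + 1) t = bspline \<xi> q j t"
        unfolding \<xi>' using bspline_extend[of j q \<xi> t] j N kv(1) by (cases \<xi>) (auto simp: knot_vector_def)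
      have d: "\<xi>' ! (j + 1 + q + 1) - \<xi>' ! (j + 1) = \<xi> ! (j + q + 1) - \<xi> ! j"
        unfolding \<xi>' using j N by (simp add: nth_append)
      show "real (q + 1) * (c (j + 1) - c j) * D (j + 1) = a j * bspline \<xi> q j t"
      proof (cases "\<xi> ! (j + q + 1) = \<xi> ! j")
        case False
        then show ?thesis unfolding D_def B d using a[of j] j by simp
      next
        case True
        have "bspline \<xi> q j t = 0"
        proof -
          have eq: "\<xi> ! m = \<xi> ! j" if "j \<le> m" "m \<le> j + q + 1" for m
            using knot_vector_mono[OF kv(1), of j m] knot_vector_mono[OF kv(1), of m "j+q+1"] that j N True by simp
          have "bspline \<xi> k i t = 0" if "j \<le> i" "i + k \<le> j + q" for i k
            using that
          proof (induction k arbitrary: i)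
            case 0
            then show ?case using eq[of i] eq[of "i+1"] by simp
          next
            case (Suc k)
            then show ?case using Suc.IH[of i] Suc.IH[of "i+1"] by simp
          qed
          then show ?thesis by simp
        qed
        then show ?thesis unfolding D_def B by simp
      qed
    qed
    finally show ?thesis .
  qed
  ultimately show "((\<lambda>x. \<Sum>i<N + 1. c i * bspline \<xi>' (Suc q) i x) has_vector_derivative
      (\<Sum>j<N. a j * bspline \<xi> q j t)) (at t)"
    by (simp add: has_real_derivative_iff_has_vector_derivative)
qed

definition bounded_borel_interval :: "(real \<Rightarrow> real) \<Rightarrow> bool" where
  "bounded_borel_interval f \<longleftrightarrow> f \<in> borel_measurable borel \<and> (\<exists>C. \<forall>x\<in>{0..1}. \<bar>f x\<bar> \<le> C)"

lemma spline_bounded_borel_interval: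
  assumes "f \<in> spline_space \<psi> q s" shows "bounded_borel_interval f"
proof -
  obtain c where f: "f = (\<lambda>x. \<Sum>i<length (knots \<psi> q s) - q - 1. c i * bspline (knots \<psi> q s) q i x)"
    using assms by (auto simp: spline_space_def)
  obtain C where C: "\<And>i x. x \<in> {0..1} \<Longrightarrow> \<bar>bspline (knots \<psi> q s) q i x\<bar> \<le> C i"
    using bspline_bounded[of "knots \<psi> q s" q] by metis
  have "\<forall>x\<in>{0..1}. \<bar>f x\<bar> \<le> (\<Sum>i<length (knots \<psi> q s) - q - 1. \<bar>c i\<bar> * C i)"
    unfolding f by (auto intro!: order_trans[OF sum_abs] sum_mono mult_left_mono C simp: abs_mult)
  then show ?thesis unfolding bounded_borel_interval_def f by auto
qed

lemma integral_bounded_borel_interval: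
  assumes "bounded_borel_interval f" "0 \<le> x" "x \<le> 1" "(f has_integral I) {0..x}"
  shows "(LINT t:{0<..<x}|lborel. f t) = I"
proof -
  obtain C where C: "\<forall>x\<in>{0..1}. \<bar>f x\<bar> \<le> C" and [measurable]: "f \<in> borel_measurable borel"
    using assms(1) by (auto simp: bounded_borel_interval_def)
  have "set_integrable lborel {0<..<x} f"
    unfolding set_integrable_def
    by (rule integrableI_bounded_set[where A="{0<..<x}" and B=C])
       (use C assms in \<open>auto simp: indicator_def\<close>)
  then have "(LINT t:{0<..<x}|lborel. f t) = integral {0<..<x} f"
    by (rule set_borel_integral_eq_integral(2))
  also have "\<dots> = integral {0..x} f"
    by (simp add: integral_open_interval_real)
  finally show ?thesis using assms(4) by auto
qed

text \<open>The derivative appears as an integrand only, so nothing has to be said about its values at the knots.\<close>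

lemma spline_derivative:
  assumes bp: "breakpoints \<psi>" and s: "-1 \<le> s" and f: "f \<in> spline_space \<psi> (Suc q) (s + 1)"
  shows "\<exists>g\<in>spline_space \<psi> q s. \<forall>x. 0 \<le> x \<longrightarrow> x \<le> 1 \<longrightarrow> f x = f 0 + (LINT t:{0<..<x}|lborel. g t)"
proof -
  define \<xi> where "\<xi> = knots \<psi> q s"
  define N where "N = length \<xi> - q - 1"
  have len: "length (knots \<psi> (Suc q) (s + 1)) - Suc q - 1 = N + 1"
    using knot_vector_knots(4,5)[OF bp, of q s] by (simp add: N_def \<xi>_def)
  obtain c where f: "f = (\<lambda>x. \<Sum>i<N + 1. c i * bspline (knots \<psi> (Suc q) (s + 1)) (Suc q) i x)"
    using f unfolding spline_space_def len by blast
  define a where "a j = real (q + 1) * (c (j + 1) - c j) / (\<xi> ! (j + q + 1) - \<xi> ! j)" for j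
  define g where "g x = (\<Sum>j<N. a j * bspline \<xi> q j x)" for x
  have g: "g \<in> spline_space \<psi> q s" unfolding g_def[abs_def] spline_space_def N_def \<xi>_def by blast
  have "(LINT t:{0<..<x}|lborel. g t) = f x - f 0" if "0 \<le> x" "x \<le> 1" for x
    by (rule integral_bounded_borel_interval[OF spline_bounded_borel_interval[OF g] that])
       (use has_integral_spline[OF bp s that, of q a c] in \<open>simp add: f g_def[abs_def] a_def N_def \<xi>_def del: sum.lessThan_Suc bspline.simps\<close>)
  then show ?thesis using g by force
qed

lemma spline_antiderivative:
  assumes bp: "breakpoints \<psi>" and s: "-1 \<le> s" and g: "g \<in> spline_space \<psi> q s"
  shows "\<exists>f\<in>spline_space \<psi> (Suc q) (s + 1). f 0 = 0 \<and> (\<forall>x. 0 \<le> x \<longrightarrow> x \<le> 1 \<longrightarrow> f x = (LINT t:{0<..<x}|lborel. g t))"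
proof -
  note kn = knot_vector_knots[OF bp]
  define \<xi> where "\<xi> = knots \<psi> q s"
  define \<xi>' where "\<xi>' = knots \<psi> (Suc q) (s + 1)"
  define N where "N = length \<xi> - q - 1"
  have len: "length (knots \<psi> (Suc q) (s + 1)) - Suc q - 1 = N + 1"
    using knot_vector_knots(4,5)[OF bp, of q s] by (simp add: N_def \<xi>_def)
  obtain a where ga: "g = (\<lambda>x. \<Sum>i<N. a i * bspline \<xi> q i x)"
    using g unfolding spline_space_def \<xi>_def N_def by blast
  define c where "c j = (\<Sum>i<j. a i * (\<xi> ! (i + q + 1) - \<xi> ! i) / real (q + 1))" for j
  define f where "f x = (\<Sum>i<N + 1. c i * bspline \<xi>' (Suc q) i x)" for x
  have f: "f \<in> spline_space \<psi> (Suc q) (s + 1)" unfolding f_def[abs_def] spline_space_def len \<xi>'_def by blast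
  have kv: "knot_vector \<xi>'" unfolding \<xi>'_def by (rule kn)
  \<comment> \<open>At 0 only the first B-spline is nonzero, and its coefficient c 0 is an empty sum.\<close>
  have f0: "f 0 = 0"
  proof -
    from knot_right[OF kv, of 0] obtain d
      where d: "d + 1 < length \<xi>'" "\<xi>' ! d \<le> 0" "0 < \<xi>' ! (d + 1)" by auto
    have "q + 1 \<le> d"
    proof (rule ccontr)
      assume "\<not> q + 1 \<le> d"
      then have "\<xi>' ! (d + 1) = 0" unfolding \<xi>'_def by (intro kn) auto
      then show False using d by simp
    qed
    have z: "\<xi>' ! m = 0" if "m \<le> d" for m
      using knot_vector_mono[OF kv, of 0 m] knot_vector_mono[OF kv, of m d] that d kv by (auto simp: knot_vector_def)
    have "\<xi>' ! (q + 2) \<noteq> 0" using kn(6)[of "Suc q" "s + 1"] by (simp add: \<xi>'_def)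
    then have "d = q + 1" using z[of "q + 2"] \<open>q + 1 \<le> d\<close> by linarith
    have "c i * bspline \<xi>' (Suc q) i 0 = 0" if "i < N + 1" for i
    proof -
      have "i + Suc q + 1 < length \<xi>'" using that len kn(4)[of "Suc q" "s+1"] unfolding \<xi>'_def by linarith
      then have "bspline \<xi>' (Suc q) i 0 = cox \<xi>' 0 (\<lambda>i. if i = d then 1 else 0) (Suc q) i"
        by (intro bspline_right_germ[OF kv d])
      also have "\<dots> = (if i + Suc q = d then 1 else 0)"
        by (rule cox_delta_right[OF d(3)]) (use z \<open>d = q + 1\<close> in auto)
      finally show ?thesis using \<open>d = q + 1\<close> by (auto simp: c_def)
    qed
    then show ?thesis unfolding f_def by (intro sum.neutral) auto
  qed
  have "(LINT t:{0<..<x}|lborel. g t) = f x" if "0 \<le> x" "x \<le> 1" for x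
  proof (rule integral_bounded_borel_interval[OF spline_bounded_borel_interval[OF g] that])
    have "((\<lambda>x. \<Sum>j<N. a j * bspline \<xi> q j x) has_integral f x - f 0) {0..x}"
      unfolding f_def[abs_def] N_def \<xi>_def \<xi>'_def
      by (rule has_integral_spline[OF bp s that]) (simp add: c_def \<xi>_def)
    then show "(g has_integral f x) {0..x}" using f0 ga by simp
  qed
  then show ?thesis using f f0 by auto
qed

section \<open>Iterated integrals over the unit square\<close>

abbreviation pt :: "real \<Rightarrow> real \<Rightarrow> real^2" where
  "pt x y \<equiv> vector [x, y]"

lemma pt_conv: "pt x y = x *\<^sub>R axis 1 1 + y *\<^sub>R axis 2 1"
  by (simp add: vec_eq_iff forall_2 axis_def)

lemma pt_eta [simp]: "pt (z $ 1) (z $ 2) = z"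
  by (simp add: vec_eq_iff forall_2)

lemma pt_mem_square: "pt x y \<in> unit_square \<longleftrightarrow> 0 < x \<and> x < 1 \<and> 0 < y \<and> y < 1"
  by (auto simp: mem_box_cart forall_2)

lemma mem_square: "z \<in> unit_square \<longleftrightarrow> 0 < z $ 1 \<and> z $ 1 < 1 \<and> 0 < z $ 2 \<and> z $ 2 < 1"
  by (auto simp: mem_box_cart forall_2)

lemma pt_measurable [measurable (raw)]:
  fixes f g :: "'a \<Rightarrow> real"
  assumes [measurable]: "f \<in> borel_measurable M" "g \<in> borel_measurable M"
  shows "(\<lambda>w. pt (f w) (g w)) \<in> borel_measurable M"
  unfolding pt_conv by measurable

lemma vec_nth_measurable [measurable (raw)]:
  fixes f :: "'a \<Rightarrow> real^'n"
  assumes [measurable]: "f \<in> borel_measurable M"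
  shows "(\<lambda>w. f w $ i) \<in> borel_measurable M"
  unfolding cart_eq_inner_axis by measurable

lemma Basis_real2: "(Basis :: (real^2) set) = {axis 1 1, axis 2 1}"
  by (auto simp: Basis_vec_def UNIV_2)

text \<open>Lebesgue measure on the plane of vectors is the image of the product measure on pairs, as both have the
  same value on boxes. This transfers Fubini's theorem to integrals over the square.\<close>

lemma lborel_real2:
  "(lborel :: (real^2) measure) = distr (lborel \<Otimes>\<^sub>M lborel) borel (\<lambda>w. pt (fst w) (snd w))"
proof (rule lborel_eqI)
  fix l u :: "real^2" assume le: "\<And>b. b \<in> Basis \<Longrightarrow> l \<bullet> b \<le> u \<bullet> b"
  have le': "l $ 1 \<le> u $ 1" "l $ 2 \<le> u $ 2"
    using le[of "axis 1 1"] le[of "axis 2 1"] by (simp_all add: Basis_real2 inner_axis)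
  have "(\<lambda>w. pt (fst w) (snd w)) -` box l u \<inter> space (lborel \<Otimes>\<^sub>M lborel) = {l $ 1 <..< u $ 1} \<times> {l $ 2 <..< u $ 2}"
    by (auto simp: mem_box_cart forall_2 space_pair_measure)
  then have "emeasure (distr (lborel \<Otimes>\<^sub>M lborel) borel (\<lambda>w. pt (fst w) (snd w))) (box l u)
      = emeasure (lborel \<Otimes>\<^sub>M lborel) ({l $ 1 <..< u $ 1} \<times> {l $ 2 <..< u $ 2})"
    by (subst emeasure_distr) auto
  also have "\<dots> = ennreal (u $ 1 - l $ 1) * ennreal (u $ 2 - l $ 2)"
    using le' by (subst lborel.emeasure_pair_measure_Times) auto
  also have "\<dots> = ennreal (\<Prod>b\<in>Basis. (u - l) \<bullet> b)"
    using le' by (simp add: Basis_real2 axis_eq_axis inner_axis ennreal_mult)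
  finally show "emeasure (distr (lborel \<Otimes>\<^sub>M lborel) borel (\<lambda>w. pt (fst w) (snd w))) (box l u)
    = ennreal (\<Prod>b\<in>Basis. (u - l) \<bullet> b)" .
qed simp

lemma lborel_real2_swap:
  "(lborel :: (real^2) measure) = distr (lborel \<Otimes>\<^sub>M lborel) borel (\<lambda>w. pt (snd w) (fst w))"
proof -
  let ?P = "lborel \<Otimes>\<^sub>M lborel :: (real \<times> real) measure"
  have A: "distr (distr ?P ?P (\<lambda>(x, y). (y, x))) borel (\<lambda>w. pt (fst w) (snd w))
      = distr ?P borel ((\<lambda>w. pt (fst w) (snd w)) \<circ> (\<lambda>(x, y). (y, x)))"
    by (rule distr_distr) measurable
  have B: "distr ?P ?P (\<lambda>(x, y). (y, x)) = ?P"
    by (rule lborel_pair.distr_pair_swap[symmetric])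
  have C: "(\<lambda>w. pt (fst w) (snd w)) \<circ> (\<lambda>(x, y). (y, x)) = (\<lambda>w. pt (snd w) (fst w))"
    by (simp add: fun_eq_iff)
  show ?thesis using A unfolding B C by (rule trans[OF lborel_real2])
qed

lemma integrable_real2:
  fixes g :: "real^2 \<Rightarrow> real"
  assumes "integrable lborel g"
  shows "integrable (lborel \<Otimes>\<^sub>M lborel) (\<lambda>(x, y). g (pt x y))"
    and "integral\<^sup>L lborel g = integral\<^sup>L (lborel \<Otimes>\<^sub>M lborel) (\<lambda>(x, y). g (pt x y))"
proof -
  have [measurable]: "g \<in> borel_measurable borel" using assms by auto
  have "integrable (distr (lborel \<Otimes>\<^sub>M lborel) borel (\<lambda>w. pt (fst w) (snd w))) g"
    using assms unfolding lborel_real2[symmetric] .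
  then show "integrable (lborel \<Otimes>\<^sub>M lborel) (\<lambda>(x, y). g (pt x y))"
    by (subst (asm) integrable_distr_eq) (auto simp: split_beta')
  show "integral\<^sup>L lborel g = integral\<^sup>L (lborel \<Otimes>\<^sub>M lborel) (\<lambda>(x, y). g (pt x y))"
    by (subst lborel_real2, subst integral_distr) (auto simp: split_beta')
qed

lemma fubini_real2:
  fixes g :: "real^2 \<Rightarrow> real"
  assumes "integrable lborel g"
  shows "integral\<^sup>L lborel g = (\<integral>y. (\<integral>x. g (pt x y) \<partial>lborel) \<partial>lborel)"
    and "integral\<^sup>L lborel g = (\<integral>x. (\<integral>y. g (pt x y) \<partial>lborel) \<partial>lborel)"
    and "AE y in lborel. integrable lborel (\<lambda>x. g (pt x y))"
    and "integrable lborel (\<lambda>y. \<integral>x. g (pt x y) \<partial>lborel)"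
    and "integrable lborel (\<lambda>x. \<integral>y. g (pt x y) \<partial>lborel)"
proof -
  define h where "h x y = g (pt x y)" for x y
  have I: "integrable (lborel \<Otimes>\<^sub>M lborel) (\<lambda>(x, y). h x y)"
    and E: "integral\<^sup>L lborel g = integral\<^sup>L (lborel \<Otimes>\<^sub>M lborel) (\<lambda>(x, y). h x y)"
    using integrable_real2[OF assms] by (simp_all add: h_def)
  show "integral\<^sup>L lborel g = (\<integral>y. (\<integral>x. g (pt x y) \<partial>lborel) \<partial>lborel)"
    using E lborel_pair.integral_snd[OF I] by (simp add: h_def)
  show "integral\<^sup>L lborel g = (\<integral>x. (\<integral>y. g (pt x y) \<partial>lborel) \<partial>lborel)"
    using E lborel_pair.integral_fst[OF I] by (simp add: h_def)
  show "AE y in lborel. integrable lborel (\<lambda>x. g (pt x y))"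
    using lborel_pair.AE_integrable_snd[OF I] by (simp add: h_def)
  show "integrable lborel (\<lambda>y. \<integral>x. g (pt x y) \<partial>lborel)"
    using lborel_pair.integrable_snd[OF I] by (simp add: h_def)
  show "integrable lborel (\<lambda>x. \<integral>y. g (pt x y) \<partial>lborel)"
    using lborel_pair.integrable_fst[OF I] by (simp add: h_def)
qed

text \<open>Together with \<open>AE_second_coordinate\<close>, this replaces a property that holds at almost every point of the
  square by the property on almost every horizontal line, and returns to almost every point.
  It is how a statement on \<open>int1\<close>, an integral along lines, can be made for functions that are only known almost
  everywhere.\<close>

lemma AE_lines:
  assumes "AE z in lborel. z \<in> unit_square \<longrightarrow> P z"
  shows "AE y in lborel. y \<in> {0<..<1} \<longrightarrow> (AE x in lborel. x \<in> {0<..<1} \<longrightarrow> P (pt x y))"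
proof -
  have "AE z in distr (lborel \<Otimes>\<^sub>M lborel) borel (\<lambda>w. pt (snd w) (fst w)). z \<in> unit_square \<longrightarrow> P z"
    using assms unfolding lborel_real2_swap[symmetric] .
  then have "AE w in lborel \<Otimes>\<^sub>M lborel. pt (snd w) (fst w) \<in> unit_square \<longrightarrow> P (pt (snd w) (fst w))"
    by (rule AE_distrD[rotated]) measurable
  then have "AE y in lborel. AE x in lborel. pt x y \<in> unit_square \<longrightarrow> P (pt x y)"
    by (auto dest: lborel_pair.AE_pair)
  then show ?thesis
    by eventually_elim (auto simp: pt_mem_square)
qed

lemma AE_second_coordinate:
  assumes "AE y in lborel. y \<in> {0<..<1} \<longrightarrow> Q y"
  shows "AE z in lborel. z \<in> unit_square \<longrightarrow> Q (z $ 2)"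
proof -
  obtain N where N: "{y \<in> space lborel. \<not> (y \<in> {0<..<1} \<longrightarrow> Q y)} \<subseteq> N" "emeasure lborel N = 0" "N \<in> sets lborel"
    using assms by (auto elim!: AE_E)
  then have [measurable]: "N \<in> sets borel" by simp
  define M where "M = (\<lambda>z::real^2. z $ 2) -` N"
  have "M = (\<lambda>z::real^2. z $ 2) -` N \<inter> space borel" by (simp add: M_def)
  also have "\<dots> \<in> sets borel" by (rule measurable_sets[of _ _ borel]) auto
  finally have [measurable]: "M \<in> sets borel" .
  have "emeasure lborel M = emeasure (lborel \<Otimes>\<^sub>M lborel) ((UNIV :: real set) \<times> N)"
  proof -
    have "(\<lambda>w. pt (fst w) (snd w)) -` M \<inter> space (lborel \<Otimes>\<^sub>M lborel) = UNIV \<times> N"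
      by (auto simp: M_def space_pair_measure)
    then show ?thesis by (subst lborel_real2, subst emeasure_distr) auto
  qed
  also have "\<dots> = 0"
    by (subst lborel.emeasure_pair_measure_Times) (use N in auto)
  finally have "M \<in> null_sets lborel" by (auto simp: null_sets_def)
  then show ?thesis
    by (rule AE_I') (use N in \<open>auto simp: M_def mem_square\<close>)
qed

section \<open>Antiderivatives in a coordinate direction\<close>

text \<open>The class of fields on the square in which all explicit formulas stay: it is closed under sums,
  products and antiderivatives, contains the splines and the coefficients given by the geometry, and all its elements
  are integrable over the square and along each line.\<close>

definition bounded_borel :: "(real^2 \<Rightarrow> real) \<Rightarrow> bool" where
  "bounded_borel f \<longleftrightarrow> set_borel_measurable lborel unit_square f \<and> (\<exists>C. \<forall>z\<in>unit_square. \<bar>f z\<bar> \<le> C)"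

lemma bounded_borel_cong: "(\<And>z. z \<in> unit_square \<Longrightarrow> f z = g z) \<Longrightarrow> bounded_borel f \<longleftrightarrow> bounded_borel g"
proof -
  assume "\<And>z. z \<in> unit_square \<Longrightarrow> f z = g z"
  moreover from this have "(\<lambda>x. indicator unit_square x *\<^sub>R f x) = (\<lambda>x. indicator unit_square x *\<^sub>R g x)"
    by (auto simp: indicator_def)
  ultimately show ?thesis unfolding bounded_borel_def set_borel_measurable_def by auto
qed

lemma bounded_borel_const [intro]: "bounded_borel (\<lambda>z. c)"
  by (auto simp: bounded_borel_def set_borel_measurable_def)

lemma bounded_borel_add [intro]: assumes "bounded_borel f" "bounded_borel g" shows "bounded_borel (\<lambda>z. f z + g z)"
proof -
  obtain C D where "\<forall>z\<in>unit_square. \<bar>f z\<bar> \<le> C" "\<forall>z\<in>unit_square. \<bar>g z\<bar> \<le> D"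
    using assms by (auto simp: bounded_borel_def)
  then have "\<forall>z\<in>unit_square. \<bar>f z + g z\<bar> \<le> C + D" by (metis abs_triangle_ineq add_mono order_trans)
  moreover have [measurable]: "(\<lambda>x. indicator unit_square x *\<^sub>R f x) \<in> borel_measurable lborel"
    "(\<lambda>x. indicator unit_square x *\<^sub>R g x) \<in> borel_measurable lborel"
    using assms by (auto simp: bounded_borel_def set_borel_measurable_def)
  then have "(\<lambda>x. indicator unit_square x *\<^sub>R f x + indicator unit_square x *\<^sub>R g x) \<in> borel_measurable lborel"
    by measurable
  ultimately show ?thesis by (auto simp: bounded_borel_def set_borel_measurable_def algebra_simps)
qed

lemma bounded_borel_mult [intro]: assumes "bounded_borel f" "bounded_borel g" shows "bounded_borel (\<lambda>z. f z * g z)"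
proof -
  obtain C D where CD: "\<forall>z\<in>unit_square. \<bar>f z\<bar> \<le> C" "\<forall>z\<in>unit_square. \<bar>g z\<bar> \<le> D"
    using assms by (auto simp: bounded_borel_def)
  have "\<forall>z\<in>unit_square. \<bar>f z * g z\<bar> \<le> C * D"
  proof
    fix z :: "real^2" assume z: "z \<in> unit_square"
    then have "0 \<le> C" using CD by (metis abs_ge_zero order_trans)
    then show "\<bar>f z * g z\<bar> \<le> C * D" using CD z by (auto simp: abs_mult intro!: mult_mono)
  qed
  moreover have [measurable]: "(\<lambda>x. indicator unit_square x *\<^sub>R f x) \<in> borel_measurable lborel"
    "(\<lambda>x. indicator unit_square x *\<^sub>R g x) \<in> borel_measurable lborel"
    using assms by (auto simp: bounded_borel_def set_borel_measurable_def)
  then have "(\<lambda>x. (indicator unit_square x *\<^sub>R f x) * (indicator unit_square x *\<^sub>R g x)) \<in> borel_measurable lborel"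
    by measurable
  moreover have "(\<lambda>x. (indicator unit_square x *\<^sub>R f x) * (indicator unit_square x *\<^sub>R g x))
     = (\<lambda>x. indicator unit_square x *\<^sub>R (f x * g x))" by (auto simp: indicator_def)
  ultimately show ?thesis by (auto simp: bounded_borel_def set_borel_measurable_def)
qed

lemma bounded_borel_uminus [intro]: assumes "bounded_borel f" shows "bounded_borel (\<lambda>z. - f z)"
  using bounded_borel_mult[OF bounded_borel_const[of "-1"] assms] by simp

lemma bounded_borel_diff [intro]: assumes "bounded_borel f" "bounded_borel g" shows "bounded_borel (\<lambda>z. f z - g z)"
  using bounded_borel_add[OF assms(1) bounded_borel_uminus[OF assms(2)]] by simp

lemma bounded_borel_sum [intro]: "(\<And>i. i \<in> I \<Longrightarrow> bounded_borel (f i)) \<Longrightarrow> bounded_borel (\<lambda>z. \<Sum>i\<in>I. f i z)"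
  by (induction I rule: infinite_finite_induct) (auto intro!: bounded_borel_add)

lemma bounded_borel_extend:
  assumes "bounded_borel f"
  obtains g where "g \<in> borel_measurable borel" "\<And>z. z \<in> unit_square \<Longrightarrow> g z = f z" "\<And>z. z \<notin> unit_square \<Longrightarrow> g z = 0"
  by (rule that[of "\<lambda>z. indicator unit_square z *\<^sub>R f z"])
     (use assms in \<open>auto simp: bounded_borel_def set_borel_measurable_def\<close>)

lemma bounded_borel_integrable:
  assumes "bounded_borel f" shows "set_integrable lborel unit_square f"
proof -
  obtain C where C: "\<forall>z\<in>unit_square. \<bar>f z\<bar> \<le> C"
    using assms by (auto simp: bounded_borel_def)
  show ?thesis unfolding set_integrable_def
    by (rule integrableI_bounded_set[where A=unit_square and B=C])
      (use assms C in \<open>auto simp: bounded_borel_def set_borel_measurable_def indicator_def emeasure_lborel_box_eq\<close>)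
qed

lemma bounded_borel_line_integrable:
  assumes "bounded_borel f" "y \<in> {0<..<1}"
  shows "set_integrable lborel {0<..<1} (\<lambda>t. f (pt t y))" "set_integrable lborel {0<..<1} (\<lambda>t. f (pt y t))"
proof -
  obtain C where C: "\<forall>z\<in>unit_square. \<bar>f z\<bar> \<le> C"
    using assms by (auto simp: bounded_borel_def)
  from bounded_borel_extend[OF assms(1)] obtain g where [measurable]: "g \<in> borel_measurable borel"
    and g: "\<And>z. z \<in> unit_square \<Longrightarrow> g z = f z" "\<And>z. z \<notin> unit_square \<Longrightarrow> g z = 0" by blast
  have e: "(\<lambda>t. indicator {0<..<1} t *\<^sub>R f (pt t y)) = (\<lambda>t. g (pt t y))"
    "(\<lambda>t. indicator {0<..<1} t *\<^sub>R f (pt y t)) = (\<lambda>t. g (pt y t))"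
    using g assms(2) by (auto simp: indicator_def pt_mem_square fun_eq_iff)
  have "integrable lborel (\<lambda>t. g (pt t y))" "integrable lborel (\<lambda>t. g (pt y t))"
    by (rule integrableI_bounded_set[where A="{0<..<1}" and B=C];
        use C g assms(2) in \<open>auto simp: pt_mem_square\<close>)+
  then show "set_integrable lborel {0<..<1} (\<lambda>t. f (pt t y))" "set_integrable lborel {0<..<1} (\<lambda>t. f (pt y t))"
    unfolding set_integrable_def e by auto
qed

lemma set_lint_bound:
  fixes f :: "real \<Rightarrow> real"
  assumes "set_integrable lborel {a<..<b} f" "\<And>t. t \<in> {a<..<b} \<Longrightarrow> \<bar>f t\<bar> \<le> C" "a \<le> b"
  shows "\<bar>LINT t:{a<..<b}|lborel. f t\<bar> \<le> C * (b - a)"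
proof -
  have "\<bar>LINT t:{a<..<b}|lborel. f t\<bar> \<le> (LINT t:{a<..<b}|lborel. \<bar>f t\<bar>)"
    using set_integral_norm_bound[OF assms(1)] by simp
  also have "\<dots> \<le> (LINT t:{a<..<b}|lborel. C)"
    by (rule set_integral_mono)
      (use assms set_integrable_abs[OF assms(1)] in \<open>auto simp: set_integrable_def intro!: integrable_mult_left integrable_real_indicator\<close>)
  also have "\<dots> = C * (b - a)" using assms(3) by (simp add: set_integral_const)
  finally show ?thesis .
qed

lemma bounded_borel_int:
  assumes "bounded_borel f" shows "bounded_borel (int1 f)" "bounded_borel (int2 f)"
proof -
  obtain C where C: "\<forall>z\<in>unit_square. \<bar>f z\<bar> \<le> C"
    using assms by (auto simp: bounded_borel_def)
  have "pt (1/2) (1/2) \<in> unit_square" by (simp add: pt_mem_square)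
  then have "\<bar>f (pt (1/2) (1/2))\<bar> \<le> C" using C by blast
  then have "0 \<le> C" by linarith
  from bounded_borel_extend[OF assms(1)] obtain g where [measurable]: "g \<in> borel_measurable borel"
    and g: "\<And>z. z \<in> unit_square \<Longrightarrow> g z = f z" "\<And>z. z \<notin> unit_square \<Longrightarrow> g z = 0" by blast
  have b: "\<bar>int1 f z\<bar> \<le> C" "\<bar>int2 f z\<bar> \<le> C" if z: "z \<in> unit_square" for z
  proof -
    have "\<bar>int1 f z\<bar> \<le> C * (z $ 1 - 0)" unfolding int1_def
      by (rule set_lint_bound[OF set_integrable_subset[OF bounded_borel_line_integrable(1)[OF assms]]])
         (use z C in \<open>auto simp: mem_square pt_mem_square\<close>)
    also have "\<dots> \<le> C" using z \<open>0 \<le> C\<close> by (auto simp: mem_square intro!: mult_left_le)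
    finally show "\<bar>int1 f z\<bar> \<le> C" .
    have "\<bar>int2 f z\<bar> \<le> C * (z $ 2 - 0)" unfolding int2_def
      by (rule set_lint_bound[OF set_integrable_subset[OF bounded_borel_line_integrable(2)[OF assms]]])
         (use z C in \<open>auto simp: mem_square pt_mem_square\<close>)
    also have "\<dots> \<le> C" using z \<open>0 \<le> C\<close> by (auto simp: mem_square intro!: mult_left_le)
    finally show "\<bar>int2 f z\<bar> \<le> C" .
  qed
  have e1: "indicator unit_square z *\<^sub>R int1 f z = indicator unit_square z *\<^sub>R (\<integral>t. (if 0 < t \<and> t < z $ 1 then g (pt t (z $ 2)) else 0) \<partial>lborel)" for z
  proof (cases "z \<in> unit_square")
    case True
    then have "int1 f z = (\<integral>t. (if 0 < t \<and> t < z $ 1 then g (pt t (z $ 2)) else 0) \<partial>lborel)"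
      unfolding int1_def set_lebesgue_integral_def
      by (intro Bochner_Integration.integral_cong) (auto simp: indicator_def g pt_mem_square mem_square)
    then show ?thesis by simp
  qed simp
  have e2: "indicator unit_square z *\<^sub>R int2 f z = indicator unit_square z *\<^sub>R (\<integral>t. (if 0 < t \<and> t < z $ 2 then g (pt (z $ 1) t) else 0) \<partial>lborel)" for z
  proof (cases "z \<in> unit_square")
    case True
    then have "int2 f z = (\<integral>t. (if 0 < t \<and> t < z $ 2 then g (pt (z $ 1) t) else 0) \<partial>lborel)"
      unfolding int2_def set_lebesgue_integral_def
      by (intro Bochner_Integration.integral_cong) (auto simp: indicator_def g pt_mem_square mem_square)
    then show ?thesis by simp
  qed simp
  have "set_borel_measurable lborel unit_square (int1 f)" "set_borel_measurable lborel unit_square (int2 f)"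
    unfolding set_borel_measurable_def e1 e2 by measurable
  then show "bounded_borel (int1 f)" "bounded_borel (int2 f)" using b by (auto simp: bounded_borel_def)
qed

lemma int1_cong: "z \<in> unit_square \<Longrightarrow> (\<And>y. y \<in> unit_square \<Longrightarrow> f y = g y) \<Longrightarrow> int1 f z = int1 g z"
  unfolding int1_def by (rule set_lebesgue_integral_cong) (auto simp: mem_square pt_mem_square)

lemma int2_cong: "z \<in> unit_square \<Longrightarrow> (\<And>y. y \<in> unit_square \<Longrightarrow> f y = g y) \<Longrightarrow> int2 f z = int2 g z"
  unfolding int2_def by (rule set_lebesgue_integral_cong) (auto simp: mem_square pt_mem_square)

lemma int_add:
  assumes "bounded_borel f" "bounded_borel g" "z \<in> unit_square"
  shows "int1 (\<lambda>y. f y + g y) z = int1 f z + int1 g z" "int2 (\<lambda>y. f y + g y) z = int2 f z + int2 g z"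
proof -
  have *: "set_integrable lborel {0<..<z $ 1} (\<lambda>t. h (pt t (z $ 2)))" "set_integrable lborel {0<..<z $ 2} (\<lambda>t. h (pt (z $ 1) t))"
    if "bounded_borel h" for h
    by (rule set_integrable_subset[OF bounded_borel_line_integrable(1)[OF that]] set_integrable_subset[OF bounded_borel_line_integrable(2)[OF that]];
      use assms(3) in \<open>auto simp: mem_square\<close>)+
  show "int1 (\<lambda>y. f y + g y) z = int1 f z + int1 g z" "int2 (\<lambda>y. f y + g y) z = int2 f z + int2 g z"
    unfolding int1_def int2_def using * assms by (auto intro!: set_integral_add)
qed

lemma int_cmult:
  fixes f :: "real^2 \<Rightarrow> real"
  shows "int1 (\<lambda>y. c * f y) z = c * int1 f z" "int2 (\<lambda>y. c * f y) z = c * int2 f z"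
  unfolding int1_def int2_def by simp_all

text \<open>Fubini's theorem on the rectangle between the origin and \<open>z\<close>.\<close>

lemma int1_int2_commute:
  assumes "bounded_borel f" "z \<in> unit_square"
  shows "int1 (int2 f) z = int2 (int1 f) z"
proof -
  from bounded_borel_extend[OF assms(1)] obtain g where [measurable]: "g \<in> borel_measurable borel"
    and g: "\<And>z. z \<in> unit_square \<Longrightarrow> g z = f z" "\<And>z. z \<notin> unit_square \<Longrightarrow> g z = 0" by blast
  define h where "h w = indicator {w. 0 < w $ 1 \<and> w $ 1 < z $ 1 \<and> 0 < w $ 2 \<and> w $ 2 < z $ 2} w * g w" for w
  have "integrable lborel (\<lambda>w. indicator unit_square w *\<^sub>R f w)"
    using bounded_borel_integrable[OF assms(1)] by (simp add: set_integrable_def)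
  also have "(\<lambda>w. indicator unit_square w *\<^sub>R f w) = g" using g by (auto simp: indicator_def)
  finally have "integrable lborel h" unfolding h_def[abs_def]
    by (intro integrable_real_mult_indicator[of _ _ g, unfolded mult.commute[of _ "indicator _ _"]]) auto
  note fubini_real2(1,2)[OF this]
  moreover have "(\<integral>y. (\<integral>x. h (pt x y) \<partial>lborel) \<partial>lborel) = int2 (int1 f) z"
    unfolding int1_def int2_def set_lebesgue_integral_def
    by (intro Bochner_Integration.integral_cong refl)
       (use assms(2) in \<open>auto simp: h_def indicator_def mem_square pt_mem_square g intro!: Bochner_Integration.integral_cong\<close>)
  moreover have "(\<integral>x. (\<integral>y. h (pt x y) \<partial>lborel) \<partial>lborel) = int1 (int2 f) z"
    unfolding int1_def int2_def set_lebesgue_integral_def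
    by (intro Bochner_Integration.integral_cong refl)
       (use assms(2) in \<open>auto simp: h_def indicator_def mem_square pt_mem_square g intro!: Bochner_Integration.integral_cong\<close>)
  ultimately show ?thesis by simp
qed

lemma square_fubini:
  fixes f :: "real^2 \<Rightarrow> real"
  assumes "set_integrable lborel unit_square f"
  shows "(LINT z:unit_square|lborel. f z) = (LINT y:{0<..<1}|lborel. LINT x:{0<..<1}|lborel. f (pt x y))"
    and "(LINT z:unit_square|lborel. f z) = (LINT x:{0<..<1}|lborel. LINT y:{0<..<1}|lborel. f (pt x y))"
    and "AE y in lborel. y \<in> {0<..<1} \<longrightarrow> set_integrable lborel {0<..<1} (\<lambda>x. f (pt x y))"
    and "set_integrable lborel {0<..<1} (\<lambda>y. LINT x:{0<..<1}|lborel. f (pt x y))"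
    and "set_integrable lborel {0<..<1} (\<lambda>x. LINT y:{0<..<1}|lborel. f (pt x y))"
proof -
  define g where "g z = indicator unit_square z *\<^sub>R f z" for z
  have g: "integrable lborel g" using assms by (simp add: g_def[abs_def] set_integrable_def)
  have gp: "g (pt x y) = indicator {0<..<1} y *\<^sub>R (indicator {0<..<1} x *\<^sub>R f (pt x y))" 
    "g (pt x y) = indicator {0<..<1} x *\<^sub>R (indicator {0<..<1} y *\<^sub>R f (pt x y))" for x y
    by (auto simp: g_def indicator_def pt_mem_square)
  note F = fubini_real2[OF g]
  have i1: "(\<integral>x. g (pt x y) \<partial>lborel) = indicator {0<..<1} y *\<^sub>R (LINT x:{0<..<1}|lborel. f (pt x y))" for y
    unfolding gp(1) set_lebesgue_integral_def by simp
  have i2: "(\<integral>y. g (pt x y) \<partial>lborel) = indicator {0<..<1} x *\<^sub>R (LINT y:{0<..<1}|lborel. f (pt x y))" for x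
    unfolding gp(2) set_lebesgue_integral_def by simp
  show "(LINT z:unit_square|lborel. f z) = (LINT y:{0<..<1}|lborel. LINT x:{0<..<1}|lborel. f (pt x y))"
    using F(1) unfolding i1 by (simp add: set_lebesgue_integral_def g_def[abs_def])
  show "(LINT z:unit_square|lborel. f z) = (LINT x:{0<..<1}|lborel. LINT y:{0<..<1}|lborel. f (pt x y))"
    using F(2) unfolding i2 by (simp add: set_lebesgue_integral_def g_def[abs_def])
  show "set_integrable lborel {0<..<1} (\<lambda>y. LINT x:{0<..<1}|lborel. f (pt x y))"
    "set_integrable lborel {0<..<1} (\<lambda>x. LINT y:{0<..<1}|lborel. f (pt x y))"
    using F(4,5) unfolding i1 i2 by (auto simp: set_integrable_def)
  show "AE y in lborel. y \<in> {0<..<1} \<longrightarrow> set_integrable lborel {0<..<1} (\<lambda>x. f (pt x y))"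
    using F(3) unfolding gp(1) by eventually_elim (auto simp: set_integrable_def)
qed

section \<open>The product rule and integration by parts on lines\<close>

lemma lint_derivative:
  fixes j j' :: "real \<Rightarrow> real"
  assumes "\<And>s. s \<in> {a..b} \<Longrightarrow> (j has_real_derivative j' s) (at s)" "continuous_on {a..b} j'" "a \<le> b"
  shows "(LINT s:{a<..<b}|lborel. j' s) = j b - j a"
proof -
  have "set_integrable lborel {a..b} j'"
    using assms(2) by (intro borel_integrable_atLeastAtMost') auto
  then have "set_integrable lborel {a<..<b} j'"
    by (rule set_integrable_subset) auto
  then have "(LINT s:{a<..<b}|lborel. j' s) = integral {a<..<b} j'"
    by (rule set_borel_integral_eq_integral)
  also have "\<dots> = integral {a..b} j'" by (simp add: integral_open_interval_real)
  also have "\<dots> = j b - j a"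
    by (rule integral_unique, rule fundamental_theorem_of_calculus)
       (use assms in \<open>auto simp: has_real_derivative_iff_has_vector_derivative intro: has_vector_derivative_at_within\<close>)
  finally show ?thesis .
qed

text \<open>The derivative of \<open>j\<close> times the antiderivative of \<open>\<mu>\<close> need not exist anywhere when \<open>\<mu>\<close> is only
  integrable, so the product rule is stated in integrated form. The proof is Fubini's theorem on the
  triangle \<open>0 < t < s < x\<close>, where the integral of \<open>j'\<close> over \<open>s\<close> is \<open>j x - j t\<close>.\<close>

lemma product_rule_line:
  fixes j j' \<mu> :: "real \<Rightarrow> real"
  assumes \<mu>: "set_integrable lborel {0<..<1} \<mu>"
    and j: "\<And>s. s \<in> {0<..<1} \<Longrightarrow> (j has_real_derivative j' s) (at s)"
    and j': "continuous_on {0<..<1} j'" "\<And>s. s \<in> {0<..<1} \<Longrightarrow> \<bar>j' s\<bar> \<le> C"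
    and jb: "\<And>s. s \<in> {0<..<1} \<Longrightarrow> \<bar>j s\<bar> \<le> D"
    and x: "0 < x" "x < 1"
  shows "set_integrable lborel {0<..<x} (\<lambda>s. j s * \<mu> s)"
    and "set_integrable lborel {0<..<x} (\<lambda>s. j' s * (LINT t:{0<..<s}|lborel. \<mu> t))"
    and "(LINT s:{0<..<x}|lborel. j s * \<mu> s + j' s * (LINT t:{0<..<s}|lborel. \<mu> t)) = j x * (LINT t:{0<..<x}|lborel. \<mu> t)"
proof -
  define m where "m t = indicator {0<..<1} t * \<mu> t" for t
  define d where "d s = indicator {0<..<x} s * j' s" for s
  have m: "integrable lborel m" using \<mu> by (simp add: set_integrable_def m_def[abs_def])
  have [measurable]: "m \<in> borel_measurable borel" using m by auto
  have dB: "s \<in> {0<..<x} \<Longrightarrow> \<bar>d s\<bar> \<le> C" "s \<notin> {0<..<x} \<Longrightarrow> d s = 0" for s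
    using j'(2)[of s] x by (auto simp: d_def indicator_def)
  have "set_borel_measurable borel {0<..<x} j'"
    unfolding set_borel_measurable_def by (rule borel_measurable_continuous_on_indicator) (use j'(1) x in \<open>auto elim: continuous_on_subset\<close>)
  then have dm[measurable]: "d \<in> borel_measurable borel" by (simp add: d_def[abs_def] set_borel_measurable_def)
  have d: "integrable lborel d"
    by (rule integrableI_bounded_set[where A="{0<..<x}" and B=C])
       (use dB x in auto)
  define h where "h s t = (if t < s then d s * m t else 0)" for s t
  have "integrable (lborel \<Otimes>\<^sub>M lborel) (\<lambda>(s, t). d s * m t)"
  proof (rule lborel_pair.Fubini_integrable)
    have "integrable lborel (\<lambda>s. \<bar>d s\<bar> * (LINT t|lborel. \<bar>m t\<bar>))"
      using d by auto
    then show "integrable lborel (\<lambda>s. LINT t|lborel. norm (case (s, t) of (s, t) \<Rightarrow> d s * m t))"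
      by (simp add: abs_mult)
  qed (use m in auto)
  then have hI: "integrable (lborel \<Otimes>\<^sub>M lborel) (\<lambda>(s, t). h s t)"
    by (rule Bochner_Integration.integrable_bound) (auto simp: h_def split_beta')
  have "(LINT t|lborel. LINT s|lborel. h s t) = (LINT s|lborel. LINT t|lborel. h s t)"
    by (rule lborel_pair.Fubini_integral[OF hI])
  moreover have L: "(LINT t|lborel. h s t) = indicator {0<..<x} s * (j' s * (LINT t:{0<..<s}|lborel. \<mu> t))" for s
  proof (cases "s \<in> {0<..<x}")
    case True
    have "(LINT t|lborel. h s t) = (LINT t|lborel. d s * (indicator {0<..<s} t * \<mu> t))"
      by (rule Bochner_Integration.integral_cong) (use True x in \<open>auto simp: h_def m_def indicator_def\<close>)
    then show ?thesis using True by (simp add: set_lebesgue_integral_def d_def)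
  next
    case False
    then have "h s t = 0" for t by (simp add: h_def d_def)
    then show ?thesis using False by simp
  qed
  moreover have "(LINT s|lborel. h s t) = indicator {0<..<x} t * (\<mu> t * (j x - j t))" for t
  proof (cases "t \<in> {0<..<x}")
    case True
    have "(LINT s|lborel. h s t) = (LINT s|lborel. \<mu> t * (indicator {t<..<x} s * j' s))"
      by (rule Bochner_Integration.integral_cong) (use True x in \<open>auto simp: h_def m_def d_def indicator_def\<close>)
    also have "\<dots> = \<mu> t * (LINT s:{t<..<x}|lborel. j' s)" by (simp add: set_lebesgue_integral_def)
    also have "(LINT s:{t<..<x}|lborel. j' s) = j x - j t"
      by (rule lint_derivative) (use j j'(1) True x in \<open>auto elim!: continuous_on_subset\<close>)
    finally show ?thesis using True by simp
  next
    case False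
    then have "h s t = 0" for s using x by (auto simp: h_def d_def m_def indicator_def)
    then show ?thesis using False by simp
  qed
  ultimately have key: "(LINT t:{0<..<x}|lborel. \<mu> t * (j x - j t)) = (LINT s:{0<..<x}|lborel. j' s * (LINT t:{0<..<s}|lborel. \<mu> t))"
    by (simp add: set_lebesgue_integral_def)
  have \<mu>x: "set_integrable lborel {0<..<x} \<mu>"
    by (rule set_integrable_subset[OF \<mu>]) (use x in auto)
  have "continuous_on {0<..<1} j"
    using j by (intro DERIV_continuous_on) (auto intro: has_field_derivative_at_within)
  then have "set_borel_measurable borel {0<..<x} j"
    unfolding set_borel_measurable_def by (intro borel_measurable_continuous_on_indicator) (use x in \<open>auto elim!: continuous_on_subset\<close>)
  then have [measurable]: "(\<lambda>s. indicator {0<..<x} s * j s) \<in> borel_measurable borel"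
    by (simp add: set_borel_measurable_def)
  show jm: "set_integrable lborel {0<..<x} (\<lambda>s. j s * \<mu> s)"
  proof -
    have "integrable lborel (\<lambda>s. D * (indicator {0<..<x} s * \<mu> s))"
      using \<mu>x by (auto simp: set_integrable_def)
    then have "integrable lborel (\<lambda>s. (indicator {0<..<x} s * j s) * m s)"
    proof (rule Bochner_Integration.integrable_bound)
      show "AE s in lborel. norm ((indicator {0<..<x} s * j s) * m s) \<le> norm (D * (indicator {0<..<x} s * \<mu> s))"
      proof (rule AE_I2)
        fix s
        have "s \<in> {0<..<x} \<Longrightarrow> \<bar>j s\<bar> \<le> \<bar>D\<bar>" using jb[of s] x by auto
        then show "norm ((indicator {0<..<x} s * j s) * m s) \<le> norm (D * (indicator {0<..<x} s * \<mu> s))"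
          using x by (auto simp: indicator_def m_def abs_mult intro!: mult_right_mono)
      qed
    qed measurable
    moreover have "(\<lambda>s. (indicator {0<..<x} s * j s) * m s) = (\<lambda>s. indicator {0<..<x} s *\<^sub>R (j s * \<mu> s))"
      using x by (auto simp: m_def indicator_def)
    ultimately show ?thesis by (simp add: set_integrable_def)
  qed
  show jU: "set_integrable lborel {0<..<x} (\<lambda>s. j' s * (LINT t:{0<..<s}|lborel. \<mu> t))"
    using lborel_pair.integrable_fst[OF hI] unfolding L set_integrable_def by simp
  have "(LINT s:{0<..<x}|lborel. j s * \<mu> s + j' s * (LINT t:{0<..<s}|lborel. \<mu> t))
     = (LINT s:{0<..<x}|lborel. j s * \<mu> s) + (LINT t:{0<..<x}|lborel. \<mu> t * (j x - j t))"
    unfolding key by (rule set_integral_add[OF jm jU])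
  also have "(LINT t:{0<..<x}|lborel. \<mu> t * (j x - j t)) = (LINT t:{0<..<x}|lborel. j x * \<mu> t - j t * \<mu> t)"
    by (simp add: algebra_simps)
  also have "\<dots> = j x * (LINT t:{0<..<x}|lborel. \<mu> t) - (LINT s:{0<..<x}|lborel. j s * \<mu> s)"
    using \<mu>x jm by (subst set_integral_diff) auto
  finally show "(LINT s:{0<..<x}|lborel. j s * \<mu> s + j' s * (LINT t:{0<..<s}|lborel. \<mu> t)) = j x * (LINT t:{0<..<x}|lborel. \<mu> t)"
    by simp
qed

text \<open>The product rule up to an end point beyond the support of \<open>j\<close>; the constant \<open>c\<close> drops out because \<open>j'\<close>
  has integral zero.\<close>

lemma ibp_line:
  fixes j j' \<mu> :: "real \<Rightarrow> real"
  assumes \<mu>: "set_integrable lborel {0<..<1} \<mu>"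
    and j: "\<And>s. s \<in> {0<..<1} \<Longrightarrow> (j has_real_derivative j' s) (at s)"
    and j': "continuous_on {0<..<1} j'"
    and ab: "0 < a" "a < b" "b < 1" and supp: "\<And>s. s \<in> {0<..<1} \<Longrightarrow> s \<notin> {a<..<b} \<Longrightarrow> j s = 0 \<and> j' s = 0"
  shows "(LINT s:{0<..<1}|lborel. (c + (LINT t:{0<..<s}|lborel. \<mu> t)) * j' s) = - (LINT s:{0<..<1}|lborel. \<mu> s * j s)"
proof -
  have bdd: "\<exists>C. \<forall>s\<in>{0<..<1}. \<bar>f s\<bar> \<le> C" if "continuous_on {0<..<1} f" "\<And>s. s \<in> {0<..<1} \<Longrightarrow> s \<notin> {a<..<b} \<Longrightarrow> f s = 0" for f :: "real \<Rightarrow> real"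
  proof -
    have "compact (f ` {a..b})"
      by (rule compact_continuous_image) (use that(1) ab in \<open>auto elim!: continuous_on_subset\<close>)
    then obtain C where C: "\<forall>s\<in>{a..b}. \<bar>f s\<bar> \<le> C" using compact_imp_bounded by (force simp: bounded_iff)
    have "\<forall>s\<in>{0<..<1}. \<bar>f s\<bar> \<le> max C 0"
    proof
      fix s :: real assume s: "s \<in> {0<..<1}"
      show "\<bar>f s\<bar> \<le> max C 0"
        by (cases "s \<in> {a<..<b}") (use C that(2)[OF s] in \<open>auto simp: le_max_iff_disj\<close>)
    qed
    then show ?thesis ..
  qed
  have "continuous_on {0<..<1} j"
    using j by (intro DERIV_continuous_on) (auto intro: has_field_derivative_at_within)
  then obtain D where D: "\<And>s. s \<in> {0<..<1} \<Longrightarrow> \<bar>j s\<bar> \<le> D" using bdd supp by blast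
  obtain C where C: "\<And>s. s \<in> {0<..<1} \<Longrightarrow> \<bar>j' s\<bar> \<le> C" using bdd[OF j'] supp by blast
  have b0: "0 < b" using ab by simp
  note P = product_rule_line[OF \<mu> j j' C D b0 ab(3)]
  have to_b: "(LINT s:{0<..<1}|lborel. f s) = (LINT s:{0<..<b}|lborel. f s)" if "\<And>s. s \<in> {0<..<1} \<Longrightarrow> s \<notin> {a<..<b} \<Longrightarrow> f s = 0" for f :: "real \<Rightarrow> real"
    unfolding set_lebesgue_integral_def
    by (rule Bochner_Integration.integral_cong) (use that ab in \<open>auto simp: indicator_def\<close>)
  have J0: "(LINT s:{0<..<b}|lborel. j' s) = 0"
  proof -
    have "(LINT s:{0<..<b}|lborel. j' s) = (LINT s:{a<..<b}|lborel. j' s)"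
      unfolding set_lebesgue_integral_def
      by (rule Bochner_Integration.integral_cong) (use supp ab in \<open>auto simp: indicator_def\<close>)
    also have "\<dots> = j b - j a"
      by (rule lint_derivative) (use j j' ab in \<open>auto elim!: continuous_on_subset\<close>)
    finally show ?thesis using supp ab by simp
  qed
  have J'i: "set_integrable lborel {0<..<b} j'"
  proof -
    have "set_integrable lborel {a..b} j'"
      by (rule borel_integrable_atLeastAtMost') (use j' ab in \<open>auto elim!: continuous_on_subset\<close>)
    then have "set_integrable lborel {a<..<b} j'" by (rule set_integrable_subset) auto
    moreover have "(\<lambda>s. indicator {0<..<b} s *\<^sub>R j' s) = (\<lambda>s. indicator {a<..<b} s *\<^sub>R j' s)"
      using supp ab by (force simp: indicator_def)
    ultimately show ?thesis by (simp add: set_integrable_def)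
  qed
  have "(LINT s:{0<..<1}|lborel. (c + (LINT t:{0<..<s}|lborel. \<mu> t)) * j' s)
      = (LINT s:{0<..<b}|lborel. c * j' s + j' s * (LINT t:{0<..<s}|lborel. \<mu> t))"
    by (subst to_b) (use supp in \<open>auto simp: algebra_simps\<close>)
  also have "\<dots> = (LINT s:{0<..<b}|lborel. j' s * (LINT t:{0<..<s}|lborel. \<mu> t))"
    by (subst set_integral_add) (use J'i P(2) J0 in auto)
  also have "\<dots> = - (LINT s:{0<..<b}|lborel. j s * \<mu> s)"
  proof -
    have "j b = 0" using supp[of b] ab by simp
    then show ?thesis using P(3) set_integral_add(2)[OF P(1,2)] by simp
  qed
  also have "(LINT s:{0<..<b}|lborel. j s * \<mu> s) = (LINT s:{0<..<1}|lborel. \<mu> s * j s)"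
    by (subst to_b) (use supp in \<open>auto simp: mult.commute\<close>)
  finally show ?thesis .
qed

text \<open>Cauchy-Schwarz on an interval of length one: with \<open>m\<close> the mean of \<open>\<bar>u\<bar>\<close>, expand the
  nonnegative integral of \<open>(\<bar>u\<bar> - m)\<^sup>2\<close>.\<close>

lemma sq_lint_le:
  fixes u :: "real \<Rightarrow> real"
  assumes "set_integrable lborel {0<..<1} u" "set_integrable lborel {0<..<1} (\<lambda>t. (u t)\<^sup>2)" "0 < x" "x < 1"
  shows "(LINT t:{0<..<x}|lborel. u t)\<^sup>2 \<le> (LINT t:{0<..<1}|lborel. (u t)\<^sup>2)"
proof -
  define m where "m = (LINT t:{0<..<1}|lborel. \<bar>u t\<bar>)"
  have ua: "set_integrable lborel {0<..<1} (\<lambda>t. \<bar>u t\<bar>)" by (rule set_integrable_abs[OF assms(1)])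
  have one: "set_integrable lborel {0<..<1::real} (\<lambda>t. c::real)" for c
    by (auto simp: set_integrable_def intro!: integrable_mult_left integrable_real_indicator)
  have "\<bar>LINT t:{0<..<x}|lborel. u t\<bar> \<le> (LINT t:{0<..<x}|lborel. \<bar>u t\<bar>)"
  proof -
    have "set_integrable lborel {0<..<x} u"
      by (rule set_integrable_subset[OF assms(1)]) (use assms(4) in auto)
    then show ?thesis using set_integral_norm_bound by fastforce
  qed
  also have "\<dots> \<le> m" unfolding m_def
    unfolding set_lebesgue_integral_def
  proof (rule integral_mono)
    show "integrable lborel (\<lambda>t. indicator {0<..<x} t *\<^sub>R \<bar>u t\<bar>)"
      unfolding set_integrable_def[symmetric]
      by (rule set_integrable_subset[OF ua]) (use assms(4) in auto)
    show "integrable lborel (\<lambda>t. indicator {0<..<1} t *\<^sub>R \<bar>u t\<bar>)"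
      using ua by (simp add: set_integrable_def)
  qed (use assms(4) in \<open>auto simp: indicator_def\<close>)
  finally have "\<bar>LINT t:{0<..<x}|lborel. u t\<bar> \<le> \<bar>m\<bar>" by linarith
  then have A: "(LINT t:{0<..<x}|lborel. u t)\<^sup>2 \<le> m\<^sup>2" by (simp add: abs_le_square_iff)
  have "0 \<le> (LINT t:{0<..<1}|lborel. (\<bar>u t\<bar> - m)\<^sup>2)"
    by (simp add: set_lebesgue_integral_def)
  also have "(\<lambda>t. (\<bar>u t\<bar> - m)\<^sup>2) = (\<lambda>t. ((u t)\<^sup>2 - 2 * m * \<bar>u t\<bar>) + m\<^sup>2)"
    by (auto simp: power2_diff)
  also have "(LINT t:{0<..<1}|lborel. ((u t)\<^sup>2 - 2 * m * \<bar>u t\<bar>) + m\<^sup>2)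
     = (LINT t:{0<..<1}|lborel. (u t)\<^sup>2) - 2 * m * m + m\<^sup>2"
    unfolding m_def
    by (subst set_integral_add, (intro set_integral_diff assms(2) set_integrable_mult_right ua one)+)
       (subst set_integral_diff, use assms(2) ua in \<open>auto simp: set_integral_const\<close>)
  finally show ?thesis using A by (simp add: power2_eq_square)
qed

section \<open>Calculus with partial derivatives\<close>

lemma partial_eqI: "(f has_derivative D) (at x) \<Longrightarrow> partial i f x = D (axis i 1)"
  unfolding partial_def using frechet_derivative_at by metis

lemma has_derivative_partial:
  assumes "f differentiable (at x)"
  shows "(f has_derivative (\<lambda>h. partial 1 f x * h $ 1 + partial 2 f x * h $ 2)) (at x)"
proof -
  have D: "(f has_derivative frechet_derivative f (at x)) (at x)"
    using assms by (simp add: frechet_derivative_works)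
  interpret linear "frechet_derivative f (at x)" using D by (rule has_derivative_linear)
  have "frechet_derivative f (at x) = (\<lambda>h. partial 1 f x * h $ 1 + partial 2 f x * h $ 2)"
  proof
    fix h :: "real^2"
    have "h = (h $ 1) *\<^sub>R axis 1 1 + (h $ 2) *\<^sub>R axis 2 1"
      by (simp add: vec_eq_iff forall_2 axis_def)
    then have "frechet_derivative f (at x) h = frechet_derivative f (at x) ((h $ 1) *\<^sub>R axis 1 1 + (h $ 2) *\<^sub>R axis 2 1)"
      by simp
    then show "frechet_derivative f (at x) h = partial 1 f x * h $ 1 + partial 2 f x * h $ 2"
      by (simp add: add scale partial_def)
  qed
  then show ?thesis using D by simp
qed

lemma differentiable_transform_open:
  fixes f g :: "real^2 \<Rightarrow> real"
  assumes "open U" "x \<in> U" "\<And>y. y \<in> U \<Longrightarrow> f y = g y"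
  shows "f differentiable (at x) \<longleftrightarrow> g differentiable (at x)" "partial i f x = partial i g x"
proof -
  have *: "(f has_derivative D) (at x) \<longleftrightarrow> (g has_derivative D) (at x)" for D
    using has_derivative_transform_within_open[of f D x UNIV U g]
      has_derivative_transform_within_open[of g D x UNIV U f] assms by auto
  then show "f differentiable (at x) \<longleftrightarrow> g differentiable (at x)" by (simp add: differentiable_def)
  show "partial i f x = partial i g x"
    unfolding partial_def frechet_derivative_def * ..
qed

lemma partial_rules:
  assumes f: "f differentiable (at x)" and g: "g differentiable (at x)"
  shows "partial i (\<lambda>y. f y + g y) x = partial i f x + partial i g x"
    and "partial i (\<lambda>y. f y * g y) x = partial i f x * g x + f x * partial i g x"
    and "partial i (\<lambda>y. - f y) x = - partial i f x"
    and "f x \<noteq> 0 \<Longrightarrow> partial i (\<lambda>y. inverse (f y)) x = - (partial i f x * inverse (f x) * inverse (f x))"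
proof -
  have D: "(f has_derivative frechet_derivative f (at x)) (at x)" "(g has_derivative frechet_derivative g (at x)) (at x)"
    using f g by (simp_all add: frechet_derivative_works)
  show "partial i (\<lambda>y. f y + g y) x = partial i f x + partial i g x"
    using partial_eqI[OF has_derivative_add[OF D]] by (simp add: partial_def)
  show "partial i (\<lambda>y. f y * g y) x = partial i f x * g x + f x * partial i g x"
    using partial_eqI[OF has_derivative_mult[OF D]] by (simp add: partial_def)
  show "partial i (\<lambda>y. - f y) x = - partial i f x"
    using partial_eqI[OF has_derivative_minus[OF D(1)]] by (simp add: partial_def)
  show "partial i (\<lambda>y. inverse (f y)) x = - (partial i f x * inverse (f x) * inverse (f x))" if "f x \<noteq> 0"
    using partial_eqI[OF Deriv.has_derivative_inverse[OF that D(1)]] by (simp add: partial_def)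
qed

lemma partial_const [simp]: "partial i (\<lambda>y. c) x = 0"
  using partial_eqI[OF has_derivative_const] by simp

lemma line_derivative:
  assumes "f differentiable (at (pt s t))"
  shows "((\<lambda>s. f (pt s t)) has_real_derivative partial 1 f (pt s t)) (at s)"
    and "((\<lambda>t. f (pt s t)) has_real_derivative partial 2 f (pt s t)) (at t)"
proof -
  note D = has_derivative_partial[OF assms]
  have "((\<lambda>s. pt s t) has_derivative (\<lambda>h. h *\<^sub>R axis 1 1)) (at s)"
    unfolding pt_conv by (auto intro!: derivative_eq_intros)
  from diff_chain_at[OF this D]
  show "((\<lambda>s. f (pt s t)) has_real_derivative partial 1 f (pt s t)) (at s)"
    by (simp add: has_field_derivative_def comp_def axis_def mult_commute_abs)
  have "((\<lambda>t. pt s t) has_derivative (\<lambda>h. h *\<^sub>R axis 2 1)) (at t)"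
    unfolding pt_conv by (auto intro!: derivative_eq_intros)
  from diff_chain_at[OF this D]
  show "((\<lambda>t. f (pt s t)) has_real_derivative partial 2 f (pt s t)) (at t)"
    by (simp add: has_field_derivative_def comp_def axis_def mult_commute_abs)
qed

lemma has_derivative_components:
  fixes F :: "real^2 \<Rightarrow> real^2"
  assumes "\<And>i. (\<lambda>z. F z $ i) differentiable (at z)"
  shows "(F has_derivative (\<lambda>h. \<chi> i. partial 1 (\<lambda>z. F z $ i) z * h $ 1 + partial 2 (\<lambda>z. F z $ i) z * h $ 2)) (at z)"
  unfolding has_derivative_componentwise_within[of F]
  using has_derivative_partial[OF assms] by (auto simp: Basis_vec_def inner_axis)

lemma chain_rule:
  fixes F :: "real^2 \<Rightarrow> real^2"
  assumes F: "\<And>i. (\<lambda>z. F z $ i) differentiable (at z)" and f: "f differentiable (at (F z))"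
  shows "(\<lambda>z. f (F z)) differentiable (at z)"
    and "partial k (\<lambda>z. f (F z)) z = partial 1 f (F z) * partial k (\<lambda>z. F z $ 1) z + partial 2 f (F z) * partial k (\<lambda>z. F z $ 2) z"
proof -
  have D: "((\<lambda>z. f (F z)) has_derivative (\<lambda>h. partial 1 f (F z) * (partial 1 (\<lambda>z. F z $ 1) z * h $ 1 + partial 2 (\<lambda>z. F z $ 1) z * h $ 2)
     + partial 2 f (F z) * (partial 1 (\<lambda>z. F z $ 2) z * h $ 1 + partial 2 (\<lambda>z. F z $ 2) z * h $ 2))) (at z)"
    using diff_chain_at[OF has_derivative_components[OF F] has_derivative_partial[OF f]] by (simp add: comp_def)
  then show "(\<lambda>z. f (F z)) differentiable (at z)" by (auto simp: differentiable_def)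
  have "k = 1 \<or> k = 2" by (rule exhaust_2)
  then show "partial k (\<lambda>z. f (F z)) z = partial 1 f (F z) * partial k (\<lambda>z. F z $ 1) z + partial 2 f (F z) * partial k (\<lambda>z. F z $ 2) z"
    using partial_eqI[OF D, of k] by (auto simp: axis_def)
qed

definition C1_on :: "(real^2) set \<Rightarrow> (real^2 \<Rightarrow> real) \<Rightarrow> bool" where
  "C1_on U f \<longleftrightarrow> (\<forall>x\<in>U. f differentiable (at x)) \<and> (\<forall>i. continuous_on U (partial i f))"

lemma C1_on_continuous: "C1_on U f \<Longrightarrow> continuous_on U f"
  unfolding C1_on_def
  by (meson continuous_at_imp_continuous_on differentiable_imp_continuous_within)

lemma C1_on_differentiable: "C1_on U f \<Longrightarrow> x \<in> U \<Longrightarrow> f differentiable (at x)"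
  by (auto simp: C1_on_def)

lemma C1_on_cong:
  assumes "open U" "\<And>y. y \<in> U \<Longrightarrow> f y = g y"
  shows "C1_on U f \<longleftrightarrow> C1_on U g"
proof -
  have "f differentiable (at x) \<longleftrightarrow> g differentiable (at x)" "partial i f x = partial i g x" if "x \<in> U" for x i
    using differentiable_transform_open[OF assms(1) that, of f g] assms(2) by auto
  then show ?thesis unfolding C1_on_def by (metis (no_types, lifting) continuous_on_cong)
qed

lemma C1_on_mult [intro]:
  assumes f: "C1_on U f" and g: "C1_on U g"
  shows "C1_on U (\<lambda>y. f y * g y)"
proof -
  have "continuous_on U (\<lambda>x. partial i f x * g x + f x * partial i g x)" for i
    using f g C1_on_continuous[OF f] C1_on_continuous[OF g] by (auto simp: C1_on_def intro!: continuous_intros)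
  then have "continuous_on U (partial i (\<lambda>y. f y * g y))" for i
    using f g by (subst continuous_on_cong[OF refl partial_rules(2)]) (auto simp: C1_on_def)
  then show ?thesis using f g by (auto simp: C1_on_def intro!: differentiable_mult)
qed

lemma C1_on_add [intro]:
  assumes f: "C1_on U f" and g: "C1_on U g"
  shows "C1_on U (\<lambda>y. f y + g y)"
proof -
  have "continuous_on U (\<lambda>x. partial i f x + partial i g x)" for i
    using f g by (auto simp: C1_on_def intro!: continuous_intros)
  then have "continuous_on U (partial i (\<lambda>y. f y + g y))" for i
    using f g by (subst continuous_on_cong[OF refl partial_rules(1)]) (auto simp: C1_on_def)
  then show ?thesis using f g by (auto simp: C1_on_def intro!: differentiable_add)
qed

lemma C1_on_const [intro]: "C1_on U (\<lambda>y. c)"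
proof -
  have "partial i (\<lambda>y. c) = (\<lambda>y. 0)" for i by auto
  then show ?thesis by (simp add: C1_on_def)
qed

lemma C1_on_inverse:
  assumes f: "C1_on U f" and nz: "\<And>x. x \<in> U \<Longrightarrow> f x \<noteq> 0"
  shows "C1_on U (\<lambda>y. inverse (f y))"
proof -
  have "continuous_on U (\<lambda>x. - (partial i f x * inverse (f x) * inverse (f x)))" for i
    using f C1_on_continuous[OF f] nz by (auto simp: C1_on_def intro!: continuous_intros)
  then have "continuous_on U (partial i (\<lambda>y. inverse (f y)))" for i
    using f nz by (subst continuous_on_cong[OF refl partial_rules(4)]) (auto simp: C1_on_def)
  then show ?thesis using f nz by (auto simp: C1_on_def intro!: differentiable_inverse)
qed

lemma C1_on_compose:
  fixes F :: "real^2 \<Rightarrow> real^2"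
  assumes F: "\<And>i. C1_on U (\<lambda>z. F z $ i)" and f: "C1_on V f" and "F ` U \<subseteq> V"
  shows "C1_on U (\<lambda>z. f (F z))"
proof -
  have cF: "continuous_on U F"
    using C1_on_continuous[OF F] by (simp add: continuous_on_componentwise[of U F] Basis_vec_def inner_axis)
  have "continuous_on U (\<lambda>z. partial i f (F z))" for i
    by (rule continuous_on_compose2[OF _ cF assms(3)]) (use f in \<open>auto simp: C1_on_def\<close>)
  then have "continuous_on U (\<lambda>z. partial 1 f (F z) * partial k (\<lambda>z. F z $ 1) z + partial 2 f (F z) * partial k (\<lambda>z. F z $ 2) z)" for k
    using F by (auto simp: C1_on_def intro!: continuous_intros)
  then have "continuous_on U (partial k (\<lambda>z. f (F z)))" for k
    using F f assms(3) by (subst continuous_on_cong[OF refl chain_rule(2)]) (auto simp: C1_on_def)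
  moreover have "(\<lambda>z. f (F z)) differentiable (at z)" if "z \<in> U" for z
    by (rule chain_rule(1)) (use F f assms(3) that in \<open>auto simp: C1_on_def\<close>)
  ultimately show ?thesis by (auto simp: C1_on_def)
qed

text \<open>By the mean value theorem applied twice, in either order, the second difference of \<open>f\<close> over a small
  square of side \<open>h\<close> is \<open>h\<^sup>2\<close> times a value of each mixed derivative. If these differed at \<open>z\<close>,
  continuity would separate the two values for small \<open>h\<close>.\<close>

lemma partial_commute:
  assumes U: "open U" "z \<in> U" and f: "C1_on U f" "\<And>i. C1_on U (partial i f)"
  shows "partial 1 (partial 2 f) z = partial 2 (partial 1 f) z"
proof (rule ccontr)
  let ?P = "partial 2 (partial 1 f)" and ?Q = "partial 1 (partial 2 f)"
  assume ne: "?Q z \<noteq> ?P z"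
  define e where "e = \<bar>?P z - ?Q z\<bar> / 2"
  have e: "e > 0" using ne by (simp add: e_def)
  have "continuous (at z) ?P" "continuous (at z) ?Q"
    using f(2) U by (auto simp: C1_on_def continuous_on_eq_continuous_at)
  then obtain d1 d2 where d: "d1 > 0" "d2 > 0"
    "\<And>w. dist w z < d1 \<Longrightarrow> dist (?P w) (?P z) < e" "\<And>w. dist w z < d2 \<Longrightarrow> dist (?Q w) (?Q z) < e"
    using e unfolding continuous_at_eps_delta by (metis dist_commute)
  obtain d3 where d3: "d3 > 0" "ball z d3 \<subseteq> U" using U openE by blast
  define h where "h = Min {d1, d2, d3} / 3"
  have h: "h > 0" "2 * h < d1" "2 * h < d2" "2 * h < d3" using d d3 by (auto simp: h_def min_def)
  define a b where "a = z $ 1" and "b = z $ 2"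
  have near: "dist (pt s t) z \<le> 2 * h" if "a \<le> s" "s \<le> a + h" "b \<le> t" "t \<le> b + h" for s t
  proof -
    have "dist (pt s t) z \<le> \<bar>s - a\<bar> + \<bar>t - b\<bar>"
      using norm_le_l1_cart[of "pt s t - z"] by (simp add: dist_norm sum_2 a_def b_def)
    then show ?thesis using that by simp
  qed
  have inU: "pt s t \<in> U" if "a \<le> s" "s \<le> a + h" "b \<le> t" "t \<le> b + h" for s t
    using near[OF that] d3 h by (auto simp: dist_commute subset_eq)
  have D: "f differentiable (at (pt s t))" "partial i f differentiable (at (pt s t))"
    if "a \<le> s" "s \<le> a + h" "b \<le> t" "t \<le> b + h" for s t i
    using f inU[OF that] by (auto simp: C1_on_def)
  define \<Delta> where "\<Delta> = f (pt (a + h) (b + h)) - f (pt (a + h) b) - f (pt a (b + h)) + f (pt a b)"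
  have "\<exists>\<xi>>a. \<xi> < a + h \<and> (f (pt (a + h) (b + h)) - f (pt (a + h) b)) - (f (pt a (b + h)) - f (pt a b))
      = ((a + h) - a) * (partial 1 f (pt \<xi> (b + h)) - partial 1 f (pt \<xi> b))"
    by (rule MVT2) (use h in \<open>auto intro!: DERIV_diff line_derivative D\<close>)
  then obtain \<xi> where \<xi>: "a < \<xi>" "\<xi> < a + h" "\<Delta> = h * (partial 1 f (pt \<xi> (b + h)) - partial 1 f (pt \<xi> b))"
    by (auto simp: \<Delta>_def)
  have "\<exists>\<eta>>b. \<eta> < b + h \<and> partial 1 f (pt \<xi> (b + h)) - partial 1 f (pt \<xi> b) = ((b + h) - b) * ?P (pt \<xi> \<eta>)"
    by (rule MVT2) (use h \<xi> in \<open>auto intro!: line_derivative D\<close>)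
  then obtain \<eta> where \<eta>: "b < \<eta>" "\<eta> < b + h" "\<Delta> = h * (h * ?P (pt \<xi> \<eta>))" using \<xi>(3) by auto
  have "\<exists>\<xi>>b. \<xi> < b + h \<and> (f (pt (a + h) (b + h)) - f (pt a (b + h))) - (f (pt (a + h) b) - f (pt a b))
      = ((b + h) - b) * (partial 2 f (pt (a + h) \<xi>) - partial 2 f (pt a \<xi>))"
    by (rule MVT2) (use h in \<open>auto intro!: DERIV_diff line_derivative D\<close>)
  then obtain \<xi>' where \<xi>': "b < \<xi>'" "\<xi>' < b + h" "\<Delta> = h * (partial 2 f (pt (a + h) \<xi>') - partial 2 f (pt a \<xi>'))"
    by (auto simp: \<Delta>_def algebra_simps)
  have "\<exists>\<eta>>a. \<eta> < a + h \<and> partial 2 f (pt (a + h) \<xi>') - partial 2 f (pt a \<xi>') = ((a + h) - a) * ?Q (pt \<eta> \<xi>')"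
    by (rule MVT2) (use h \<xi>' in \<open>auto intro!: line_derivative D\<close>)
  then obtain \<eta>' where \<eta>': "a < \<eta>'" "\<eta>' < a + h" "\<Delta> = h * (h * ?Q (pt \<eta>' \<xi>'))" using \<xi>'(3) by auto
  have "?P (pt \<xi> \<eta>) = ?Q (pt \<eta>' \<xi>')" using \<eta>(3) \<eta>'(3) h by simp
  moreover have "dist (?P (pt \<xi> \<eta>)) (?P z) < e" using near[of \<xi> \<eta>] \<xi> \<eta> h by (intro d) auto
  moreover have "dist (?Q (pt \<eta>' \<xi>')) (?Q z) < e" using near[of \<eta>' \<xi>'] \<xi>' \<eta>' h by (intro d) auto
  ultimately show False by (auto simp: dist_real_def e_def abs_if split: if_splits)
qed

section \<open>Fields on the unit square\<close>

lemma open_square: "open unit_square" by (rule open_box)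

definition bounded_C1 :: "(real^2 \<Rightarrow> real) \<Rightarrow> bool" where
  "bounded_C1 f \<longleftrightarrow> C1_on unit_square f \<and> bounded_borel f \<and> (\<forall>i. bounded_borel (partial i f))"

lemma bounded_C1_D: assumes "bounded_C1 f" shows "bounded_borel f" "bounded_borel (partial i f)" "C1_on unit_square f"
    "z \<in> unit_square \<Longrightarrow> f differentiable (at z)"
  using assms by (auto simp: bounded_C1_def C1_on_def)

lemma continuous_borel_square: "continuous_on unit_square f \<Longrightarrow> set_borel_measurable lborel unit_square (f :: real^2 \<Rightarrow> real)"
  unfolding set_borel_measurable_def using borel_measurable_continuous_on_indicator[of unit_square f] by simp

lemma bounded_C1_I:
  assumes "C1_on unit_square f" "\<exists>C. \<forall>z\<in>unit_square. \<bar>f z\<bar> \<le> C" "\<And>i. \<exists>C. \<forall>z\<in>unit_square. \<bar>partial i f z\<bar> \<le> C"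
  shows "bounded_C1 f"
  unfolding bounded_C1_def bounded_borel_def using assms C1_on_continuous[OF assms(1)]
  by (auto intro!: continuous_borel_square simp: C1_on_def)

lemma bounded_C1_mult [intro]: assumes "bounded_C1 f" "bounded_C1 g" shows "bounded_C1 (\<lambda>z. f z * g z)"
proof -
  have "bounded_borel (\<lambda>z. partial i f z * g z + f z * partial i g z)" for i
    by (intro bounded_borel_add bounded_borel_mult bounded_C1_D assms)
  then have "bounded_borel (partial i (\<lambda>z. f z * g z))" for i
    by (rule bounded_borel_cong[THEN iffD1, rotated]) (use assms in \<open>auto simp: bounded_C1_def C1_on_def partial_rules\<close>)
  then show ?thesis using assms by (auto simp: bounded_C1_def)
qed

lemma bounded_C1_add [intro]: assumes "bounded_C1 f" "bounded_C1 g" shows "bounded_C1 (\<lambda>z. f z + g z)"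
proof -
  have "bounded_borel (\<lambda>z. partial i f z + partial i g z)" for i
    by (intro bounded_borel_add bounded_C1_D assms)
  then have "bounded_borel (partial i (\<lambda>z. f z + g z))" for i
    by (rule bounded_borel_cong[THEN iffD1, rotated]) (use assms in \<open>auto simp: bounded_C1_def C1_on_def partial_rules\<close>)
  then show ?thesis using assms by (auto simp: bounded_C1_def)
qed

lemma bounded_C1_const [intro]: "bounded_C1 (\<lambda>z. c)"
  by (rule bounded_C1_I) auto

lemma bounded_C1_uminus [intro]: "bounded_C1 f \<Longrightarrow> bounded_C1 (\<lambda>z. - f z)"
  using bounded_C1_mult[OF bounded_C1_const[of "-1"]] by simp

lemma bounded_C1_inverse:
  assumes f: "bounded_C1 f" and nz: "\<And>z. z \<in> unit_square \<Longrightarrow> f z \<noteq> 0" and b: "\<And>z. z \<in> unit_square \<Longrightarrow> \<bar>inverse (f z)\<bar> \<le> C"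
  shows "bounded_C1 (\<lambda>z. inverse (f z))"
proof -
  have c: "C1_on unit_square (\<lambda>z. inverse (f z))" using C1_on_inverse f nz by (auto simp: bounded_C1_def)
  have i: "bounded_borel (\<lambda>z. inverse (f z))"
    using continuous_borel_square[OF C1_on_continuous[OF c]] b by (auto simp: bounded_borel_def)
  have "bounded_borel (\<lambda>z. - (partial k f z * inverse (f z) * inverse (f z)))" for k
    by (intro bounded_borel_uminus bounded_borel_mult bounded_C1_D i f)
  then have "bounded_borel (partial k (\<lambda>z. inverse (f z)))" for k
    by (rule bounded_borel_cong[THEN iffD1, rotated]) (use f nz in \<open>auto simp: bounded_C1_def C1_on_def partial_rules\<close>)
  then show ?thesis using c i by (auto simp: bounded_C1_def)
qed

lemma bounded_C1_cong: assumes "\<And>z. z \<in> unit_square \<Longrightarrow> f z = g z" shows "bounded_C1 f \<longleftrightarrow> bounded_C1 g"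
proof -
  have "bounded_borel (partial i f) \<longleftrightarrow> bounded_borel (partial i g)" for i
    by (rule bounded_borel_cong) (rule differentiable_transform_open(2)[OF open_square _ assms])
  then show ?thesis using C1_on_cong[OF open_square assms] bounded_borel_cong[of f g, OF assms] by (auto simp: bounded_C1_def)
qed

text \<open>An integrable function on the square has integrable restrictions to almost every horizontal line.
  The identities for \<open>int1\<close> hold line by line, so they are stated for one such line.\<close>

definition line_integrable :: "real \<Rightarrow> (real^2 \<Rightarrow> real) \<Rightarrow> bool" where
  "line_integrable y \<mu> \<longleftrightarrow> set_integrable lborel {0<..<1} (\<lambda>t. \<mu> (pt t y))"

lemma bounded_borel_line_integrable1: "bounded_borel \<mu> \<Longrightarrow> z \<in> unit_square \<Longrightarrow> line_integrable (z $ 2) \<mu>"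
  unfolding line_integrable_def by (rule bounded_borel_line_integrable) (auto simp: mem_square)

lemma int1_product_rule:
  assumes j: "bounded_C1 j" and z: "z \<in> unit_square" and \<mu>: "line_integrable (z $ 2) \<mu>"
  shows "set_integrable lborel {0<..<z $ 1} (\<lambda>t. j (pt t (z $ 2)) * \<mu> (pt t (z $ 2)) + partial 1 j (pt t (z $ 2)) * int1 \<mu> (pt t (z $ 2)))"
    and "int1 (\<lambda>y. j y * \<mu> y + partial 1 j y * int1 \<mu> y) z = j z * int1 \<mu> z"
proof -
  define y where "y = z $ 2"
  have y: "0 < y" "y < 1" "0 < z $ 1" "z $ 1 < 1" using z by (auto simp: y_def mem_square)
  have sq: "pt t y \<in> unit_square" if "t \<in> {0<..<1}" for t using that y by (simp add: pt_mem_square)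
  obtain C D where C: "\<forall>z\<in>unit_square. \<bar>partial 1 j z\<bar> \<le> C" and D: "\<forall>z\<in>unit_square. \<bar>j z\<bar> \<le> D"
    using bounded_C1_D(1)[OF j] bounded_C1_D(2)[OF j, of 1] unfolding bounded_borel_def by blast
  have "continuous_on {0<..<1} (\<lambda>t. partial 1 j (pt t y))"
    by (rule continuous_on_compose2[of unit_square "partial 1 j"])
      (use j sq in \<open>auto simp: bounded_C1_def C1_on_def pt_conv intro!: continuous_intros\<close>)
  note P = product_rule_line[where j="\<lambda>t. j (pt t y)" and j'="\<lambda>t. partial 1 j (pt t y)" and C=C and D=D and x="z $ 1",
      OF \<mu>[unfolded line_integrable_def, folded y_def] _ this]
  have P': "set_integrable lborel {0<..<z $ 1} (\<lambda>s. j (pt s y) * \<mu> (pt s y))"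
    "set_integrable lborel {0<..<z $ 1} (\<lambda>s. partial 1 j (pt s y) * (LINT t:{0<..<s}|lborel. \<mu> (pt t y)))"
    "(LINT s:{0<..<z $ 1}|lborel. j (pt s y) * \<mu> (pt s y) + partial 1 j (pt s y) * (LINT t:{0<..<s}|lborel. \<mu> (pt t y))) = j (pt (z $ 1) y) * (LINT t:{0<..<z $ 1}|lborel. \<mu> (pt t y))"
    by (rule P; use sq j C D y in \<open>auto simp: bounded_C1_def C1_on_def intro: line_derivative\<close>)+
  show "set_integrable lborel {0<..<z $ 1} (\<lambda>t. j (pt t (z $ 2)) * \<mu> (pt t (z $ 2)) + partial 1 j (pt t (z $ 2)) * int1 \<mu> (pt t (z $ 2)))"
    using set_integral_add(1)[OF P'(1,2)] by (simp add: int1_def y_def)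
  show "int1 (\<lambda>y. j y * \<mu> y + partial 1 j y * int1 \<mu> y) z = j z * int1 \<mu> z"
    using P'(3) by (simp add: int1_def y_def)
qed

text \<open>The derivative in the first direction of \<open>j\<close> times the antiderivative of \<open>\<mu>\<close>, with the product rule
  carried out, so that \<open>\<mu>\<close> need not be continuous. Both transformations of the problem have this shape.\<close>

definition Pi_op :: "(2 \<Rightarrow> 2 \<Rightarrow> real^2 \<Rightarrow> real) \<Rightarrow> (2 \<Rightarrow> real^2 \<Rightarrow> real) \<Rightarrow> 2 \<Rightarrow> real^2 \<Rightarrow> real" where
  "Pi_op j \<mu> i z = (\<Sum>k\<in>UNIV. j i k z * \<mu> k z + partial 1 (j i k) z * int1 (\<mu> k) z)"

text \<open>The defining property of \<open>Pi_op\<close>: its antiderivative is \<open>j\<close> times the antiderivative of \<open>\<mu>\<close>.\<close>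

lemma int1_Pi_op:
  assumes j: "\<And>i k. bounded_C1 (j i k)" and z: "z \<in> unit_square" and \<mu>: "\<And>k. line_integrable (z $ 2) (\<mu> k)"
  shows "set_integrable lborel {0<..<z $ 1} (\<lambda>t. Pi_op j \<mu> i (pt t (z $ 2)))"
    and "int1 (Pi_op j \<mu> i) z = (\<Sum>k\<in>UNIV. j i k z * int1 (\<mu> k) z)"
proof -
  note P = int1_product_rule[OF j z \<mu>]
  show "set_integrable lborel {0<..<z $ 1} (\<lambda>t. Pi_op j \<mu> i (pt t (z $ 2)))"
    unfolding Pi_op_def sum_2 by (intro set_integral_add(1) P(1))
  have "int1 (Pi_op j \<mu> i) z = (LINT t:{0<..<z $ 1}|lborel. Pi_op j \<mu> i (pt t (z $ 2)))"
    by (simp add: int1_def)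
  also have "\<dots> = (\<Sum>k\<in>UNIV. int1 (\<lambda>y. j i k y * \<mu> k y + partial 1 (j i k) y * int1 (\<mu> k) y) z)"
    unfolding Pi_op_def sum_2 by (subst set_integral_add(2)[OF P(1) P(1)]) (simp add: int1_def)
  finally show "int1 (Pi_op j \<mu> i) z = (\<Sum>k\<in>UNIV. j i k z * int1 (\<mu> k) z)"
    by (simp only: P(2))
qed

lemma bounded_borel_Pi_op:
  assumes "\<And>i k. bounded_C1 (j i k)" "\<And>k. bounded_borel (\<mu> k)" shows "bounded_borel (Pi_op j \<mu> i)"
  unfolding Pi_op_def[abs_def] by (intro bounded_borel_sum bounded_borel_add bounded_borel_mult bounded_borel_int bounded_C1_D assms)

lemma partial_inverse_matrix:
  fixes j b :: "2 \<Rightarrow> 2 \<Rightarrow> real^2 \<Rightarrow> real"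
  assumes j: "\<And>i k. bounded_C1 (j i k)" and b: "\<And>i k. bounded_C1 (b i k)"
    and inv: "\<And>i l y. y \<in> unit_square \<Longrightarrow> (\<Sum>k\<in>UNIV. b i k y * j k l y) = (if i = l then 1 else 0)"
    and z: "z \<in> unit_square"
  shows "(\<Sum>k\<in>UNIV. partial m (b i k) z * j k l z + b i k z * partial m (j k l) z) = 0"
proof -
  have d: "b i k differentiable (at z)" "j i k differentiable (at z)" for i k
    using j b z by (auto simp: bounded_C1_def C1_on_def)
  have "partial m (\<lambda>y. \<Sum>k\<in>UNIV. b i k y * j k l y) z = (\<Sum>k\<in>UNIV. partial m (b i k) z * j k l z + b i k z * partial m (j k l) z)"
    unfolding sum_2 by (simp add: partial_rules d differentiable_mult)
  moreover have "partial m (\<lambda>y. \<Sum>k\<in>UNIV. b i k y * j k l y) z = partial m (\<lambda>y. if i = l then 1 else 0) z"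
    by (rule differentiable_transform_open(2)[OF open_square z inv])
  ultimately show ?thesis by simp
qed

text \<open>Expand both operators and replace the inner antiderivative by \<open>j\<close> times that of \<open>\<mu>\<close>. The terms with
  \<open>\<mu>\<close> combine to \<open>b j \<mu>\<close>, and the terms with its antiderivative to the derivative of \<open>b j\<close>, which
  is constant.\<close>

lemma Pi_op_inverse:
  assumes j: "\<And>i k. bounded_C1 (j i k)" and b: "\<And>i k. bounded_C1 (b i k)"
    and inv: "\<And>i l y. y \<in> unit_square \<Longrightarrow> (\<Sum>k\<in>UNIV. b i k y * j k l y) = (if i = l then 1 else 0)"
    and z: "z \<in> unit_square" and \<mu>: "\<And>k. line_integrable (z $ 2) (\<mu> k)"
  shows "Pi_op b (Pi_op j \<mu>) i z = \<mu> i z"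
proof -
  have "Pi_op b (Pi_op j \<mu>) i z = (\<Sum>k\<in>UNIV. b i k z * Pi_op j \<mu> k z + partial 1 (b i k) z * (\<Sum>l\<in>UNIV. j k l z * int1 (\<mu> l) z))"
    unfolding Pi_op_def[of b "Pi_op j \<mu>"] using int1_Pi_op(2)[OF j z \<mu>] by simp
  also have "\<dots> = (\<Sum>l\<in>UNIV. (\<Sum>k\<in>UNIV. b i k z * j k l z) * \<mu> l z
     + (\<Sum>k\<in>UNIV. partial 1 (b i k) z * j k l z + b i k z * partial 1 (j k l) z) * int1 (\<mu> l) z)"
    unfolding Pi_op_def sum_2 by (simp add: algebra_simps)
  also have "\<dots> = (\<Sum>l\<in>UNIV. (if i = l then 1 else 0) * \<mu> l z)"
    by (simp only: inv[OF z] partial_inverse_matrix[OF j b inv z]) simp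
  also have "\<dots> = \<mu> i z" using exhaust_2[of i] by (auto simp: sum_2)
  finally show ?thesis .
qed

lemma int1_AE_cong:
  assumes eq: "AE z in lborel. z \<in> unit_square \<longrightarrow> f z = g z" and f: "bounded_borel f"
    and g: "AE z in lborel. z \<in> unit_square \<longrightarrow> set_integrable lborel {0<..<z $ 1} (\<lambda>t. g (pt t (z $ 2)))"
  shows "AE z in lborel. z \<in> unit_square \<longrightarrow> int1 f z = int1 g z"
  using AE_second_coordinate[OF AE_lines[OF eq]] g
proof eventually_elim
  case (elim z)
  show ?case
  proof
    assume z: "z \<in> unit_square"
    have "set_integrable lborel {0<..<z $ 1} (\<lambda>t. f (pt t (z $ 2)))"
      by (rule set_integrable_subset[OF bounded_borel_line_integrable1[OF f z, unfolded line_integrable_def]])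
         (use z in \<open>auto simp: mem_square\<close>)
    then show "int1 f z = int1 g z" unfolding int1_def set_lebesgue_integral_def
    proof (intro integral_cong_AE)
      show "AE t in lborel. indicator {0<..<z $ 1} t *\<^sub>R f (pt t (z $ 2)) = indicator {0<..<z $ 1} t *\<^sub>R g (pt t (z $ 2))"
        using elim(1) z by (auto simp: indicator_def mem_square elim!: eventually_mono)
    qed (use elim(2) z in \<open>auto simp: set_integrable_def\<close>)
  qed
qed

lemma AE_line_integrable:
  assumes "set_integrable lborel unit_square \<mu>"
  shows "AE z in lborel. z \<in> unit_square \<longrightarrow> line_integrable (z $ 2) \<mu>"
  using AE_second_coordinate[OF square_fubini(3)[OF assms]] by (simp add: line_integrable_def)

text \<open>Uniqueness in \<open>Pi_op j \<mu> = R\<close>, for an arbitrary integrable \<open>\<mu>\<close> and an equation that holds almost everywhere.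
  Such a \<open>\<mu>\<close> comes from an unspecified representative of a preimage under one of the
  transformations; the conclusion shows that it agrees with the explicit one, and so does its antiderivative.\<close>

lemma Pi_op_AE_inverse:
  assumes j: "\<And>i k. bounded_C1 (j i k)" and b: "\<And>i k. bounded_C1 (b i k)"
    and inv: "\<And>i l y. y \<in> unit_square \<Longrightarrow> (\<Sum>k\<in>UNIV. b i k y * j k l y) = (if i = l then 1 else 0)"
    and \<mu>: "\<And>k. set_integrable lborel unit_square (\<mu> k)" and R: "\<And>k. bounded_borel (R k)"
    and eq: "\<And>k. AE z in lborel. z \<in> unit_square \<longrightarrow> Pi_op j \<mu> k z = R k z"
  shows "AE z in lborel. z \<in> unit_square \<longrightarrow> \<mu> i z = Pi_op b R i z \<and> (\<forall>k. (\<Sum>l\<in>UNIV. j k l z * int1 (\<mu> l) z) = int1 (R k) z)"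
proof -
  have li: "AE z in lborel. z \<in> unit_square \<longrightarrow> (\<forall>k. line_integrable (z $ 2) (\<mu> k))"
    using AE_line_integrable[OF \<mu>[of 1]] AE_line_integrable[OF \<mu>[of 2]]
    by eventually_elim (auto simp: forall_2)
  have I: "AE z in lborel. z \<in> unit_square \<longrightarrow> int1 (R k) z = int1 (Pi_op j \<mu> k) z" for k
  proof (rule int1_AE_cong[OF _ R])
    show "AE z in lborel. z \<in> unit_square \<longrightarrow> R k z = Pi_op j \<mu> k z" using eq[of k] by eventually_elim auto
    show "AE z in lborel. z \<in> unit_square \<longrightarrow> set_integrable lborel {0<..<z $ 1} (\<lambda>t. Pi_op j \<mu> k (pt t (z $ 2)))"
      using li by eventually_elim (use int1_Pi_op(1)[of j, OF j] in auto)
  qed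
  show ?thesis
    using li I[of 1] I[of 2] eq[of 1] eq[of 2]
  proof eventually_elim
    case (elim z)
    show ?case
    proof
      assume z: "z \<in> unit_square"
      then have R: "R k z = Pi_op j \<mu> k z" "int1 (R k) z = int1 (Pi_op j \<mu> k) z" for k
        using elim exhaust_2[of k] by auto
      have "Pi_op b R i z = Pi_op b (Pi_op j \<mu>) i z" unfolding Pi_op_def[of b] R ..
      then show "\<mu> i z = Pi_op b R i z \<and> (\<forall>k. (\<Sum>l\<in>UNIV. j k l z * int1 (\<mu> l) z) = int1 (R k) z)"
        using Pi_op_inverse[OF j b inv z, of \<mu>] elim(1) z int1_Pi_op(2)[OF j z, of \<mu>] R(2) by auto
    qed
  qed
qed

text \<open>The pull-back of a smooth test function is only as smooth as \<open>F\<close>, and it gets multiplied by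
  coefficients that are continuously differentiable. So test functions on the square are only
  asked to be \<open>C1\<close>. The set \<open>K\<close> contains the support and is compact in the open square.\<close>

definition ctest :: "(real^2) set \<Rightarrow> (real^2 \<Rightarrow> real) \<Rightarrow> bool" where
  "ctest K \<psi> \<longleftrightarrow> compact K \<and> K \<subseteq> unit_square \<and> C1_on unit_square \<psi> \<and> (\<forall>z\<in>unit_square - K. \<psi> z = 0)"

lemma ctest_mult: "C1_on unit_square g \<Longrightarrow> ctest K \<psi> \<Longrightarrow> ctest K (\<lambda>z. g z * \<psi> z)"
  by (auto simp: ctest_def)

lemma ctest_partial_0: "ctest K \<psi> \<Longrightarrow> z \<in> unit_square - K \<Longrightarrow> partial i \<psi> z = 0"
proof -
  assume a: "ctest K \<psi>" "z \<in> unit_square - K"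
  have "open (unit_square - K)" using a by (auto simp: ctest_def compact_imp_closed)
  from differentiable_transform_open(2)[OF this a(2), of \<psi> "\<lambda>_. 0"] a show ?thesis by (auto simp: ctest_def)
qed

lemma ctest_partial: "ctest K \<psi> \<Longrightarrow> C1_on unit_square (partial i \<psi>) \<Longrightarrow> ctest K (partial i \<psi>)"
  using ctest_partial_0 by (auto simp: ctest_def)

lemma ctest_bounded_borel: assumes "ctest K \<psi>" shows "bounded_borel \<psi>" "bounded_borel (partial i \<psi>)"
proof -
  have *: "bounded_borel f" if f: "continuous_on unit_square f" "\<And>z. z \<in> unit_square - K \<Longrightarrow> f z = 0" for f
  proof -
    have "compact (f ` K)" using assms f by (auto simp: ctest_def intro!: compact_continuous_image elim: continuous_on_subset)
    then obtain C where C: "\<forall>z\<in>K. \<bar>f z\<bar> \<le> C" using compact_imp_bounded by (force simp: bounded_iff)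
    have "\<bar>f z\<bar> \<le> max C 0" if "z \<in> unit_square" for z
      by (cases "z \<in> K") (use C f(2)[of z] that in \<open>auto simp: le_max_iff_disj\<close>)
    then show ?thesis using continuous_borel_square[OF f(1)] by (auto simp: bounded_borel_def)
  qed
  show "bounded_borel \<psi>" by (rule *) (use assms C1_on_continuous in \<open>auto simp: ctest_def\<close>)
  show "bounded_borel (partial i \<psi>)" by (rule *) (use assms ctest_partial_0 in \<open>auto simp: ctest_def C1_on_def\<close>)
qed

text \<open>A compact subset of the open square keeps a distance from the boundary, so that on each line the test function
  vanishes near both ends, as integration by parts requires.\<close>

lemma ctest_margin:
  assumes "ctest K \<psi>"
  obtains a b where "0 < a" "a < b" "b < 1"
    "\<And>z. z \<in> unit_square \<Longrightarrow> z $ 1 \<notin> {a<..<b} \<or> z $ 2 \<notin> {a<..<b} \<Longrightarrow> \<psi> z = 0 \<and> partial i \<psi> z = 0"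
proof -
  have K: "compact K" "K \<subseteq> unit_square" using assms by (auto simp: ctest_def)
  define S where "S = insert (1/2) ((\<lambda>z. z $ 1) ` K \<union> (\<lambda>z. z $ 2) ` K)"
  have S: "compact S" unfolding S_def using K(1)
    by (intro compact_insert compact_Un compact_continuous_image continuous_intros)
  have S1: "S \<subseteq> {0<..<1}" unfolding S_def using K(2) by (auto simp: mem_square)
  obtain l u where l: "l \<in> S" "\<And>s. s \<in> S \<Longrightarrow> l \<le> s" and u: "u \<in> S" "\<And>s. s \<in> S \<Longrightarrow> s \<le> u"
  proof -
    have "S \<noteq> {}" by (simp add: S_def)
    then show thesis using compact_attains_inf[OF S] compact_attains_sup[OF S] that by blast
  qed
  have lu: "0 < l" "u < 1" "l \<le> u" using l u S1 by auto
  show thesis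
  proof (rule that[of "l / 2" "(1 + u) / 2"])
    fix z assume z: "z \<in> unit_square" "z $ 1 \<notin> {l/2<..<(1+u)/2} \<or> z $ 2 \<notin> {l/2<..<(1+u)/2}"
    have "z \<notin> K"
    proof
      assume "z \<in> K"
      then have "z $ 1 \<in> S" "z $ 2 \<in> S" by (auto simp: S_def)
      then show False using z(2) l(2) u(2) lu by fastforce
    qed
    then show "\<psi> z = 0 \<and> partial i \<psi> z = 0" using assms z(1) ctest_partial_0[OF assms, of z i] by (auto simp: ctest_def)
  qed (use lu in auto)
qed

text \<open>The left factor is an antiderivative of \<open>u\<close> in the first direction with arbitrary initial values \<open>c\<close>
  on the edge. This is the form in which splines and transformed fields are
  given, and no derivative of them has to exist.\<close>

lemma ibp1:
  assumes \<psi>: "ctest K \<psi>" and u: "bounded_borel u" and c: "bounded_borel (\<lambda>z. c (z $ 2))"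
  shows "(LINT z:unit_square|lborel. (c (z $ 2) + int1 u z) * partial 1 \<psi> z) = - (LINT z:unit_square|lborel. u z * \<psi> z)"
proof -
  obtain a b where ab: "0 < a" "a < b" "b < 1"
    "\<And>z. z \<in> unit_square \<Longrightarrow> z $ 1 \<notin> {a<..<b} \<or> z $ 2 \<notin> {a<..<b} \<Longrightarrow> \<psi> z = 0 \<and> partial 1 \<psi> z = 0"
    using ctest_margin[OF \<psi>, of 1] by blast
  have "(LINT z:unit_square|lborel. (c (z $ 2) + int1 u z) * partial 1 \<psi> z)
      = (LINT y:{0<..<1}|lborel. LINT x:{0<..<1}|lborel. (c y + int1 u (pt x y)) * partial 1 \<psi> (pt x y))"
    by (subst square_fubini(1)[OF bounded_borel_integrable])
       (intro bounded_borel_mult bounded_borel_add bounded_borel_int ctest_bounded_borel[OF \<psi>] u c, simp)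
  also have "\<dots> = (LINT y:{0<..<1}|lborel. - (LINT x:{0<..<1}|lborel. u (pt x y) * \<psi> (pt x y)))"
  proof (rule set_lebesgue_integral_cong)
    show "\<forall>y. y \<in> {0<..<1} \<longrightarrow> (LINT x:{0<..<1}|lborel. (c y + int1 u (pt x y)) * partial 1 \<psi> (pt x y))
        = - (LINT x:{0<..<1}|lborel. u (pt x y) * \<psi> (pt x y))"
    proof (intro allI impI)
      fix y :: real assume y: "y \<in> {0<..<1}"
      then have sq: "pt t y \<in> unit_square" if "t \<in> {0<..<1}" for t using that by (simp add: pt_mem_square)
      have "continuous_on {0<..<1} (\<lambda>t. partial 1 \<psi> (pt t y))"
        by (rule continuous_on_compose2[of unit_square "partial 1 \<psi>"])
          (use \<psi> sq in \<open>auto simp: ctest_def C1_on_def pt_conv intro!: continuous_intros\<close>)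
      then show "(LINT x:{0<..<1}|lborel. (c y + int1 u (pt x y)) * partial 1 \<psi> (pt x y))
        = - (LINT x:{0<..<1}|lborel. u (pt x y) * \<psi> (pt x y))"
        unfolding int1_def vector_2
        by (intro ibp_line[where a=a and b=b] bounded_borel_line_integrable(1)[OF u y])
           (use sq \<psi> ab in \<open>auto simp: ctest_def C1_on_def intro!: line_derivative\<close>)
    qed
  qed simp
  also have "\<dots> = - (LINT z:unit_square|lborel. u z * \<psi> z)"
    by (subst square_fubini(1)[OF bounded_borel_integrable])
       (intro bounded_borel_mult ctest_bounded_borel[OF \<psi>] u, simp add: set_lebesgue_integral_def)
  finally show ?thesis .
qed

lemma ibp2:
  assumes \<psi>: "ctest K \<psi>" and u: "bounded_borel u" and c: "bounded_borel (\<lambda>z. c (z $ 1))"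
  shows "(LINT z:unit_square|lborel. (c (z $ 1) + int2 u z) * partial 2 \<psi> z) = - (LINT z:unit_square|lborel. u z * \<psi> z)"
proof -
  obtain a b where ab: "0 < a" "a < b" "b < 1"
    "\<And>z. z \<in> unit_square \<Longrightarrow> z $ 1 \<notin> {a<..<b} \<or> z $ 2 \<notin> {a<..<b} \<Longrightarrow> \<psi> z = 0 \<and> partial 2 \<psi> z = 0"
    using ctest_margin[OF \<psi>, of 2] by blast
  have "(LINT z:unit_square|lborel. (c (z $ 1) + int2 u z) * partial 2 \<psi> z)
      = (LINT x:{0<..<1}|lborel. LINT y:{0<..<1}|lborel. (c x + int2 u (pt x y)) * partial 2 \<psi> (pt x y))"
    by (subst square_fubini(2)[OF bounded_borel_integrable])
       (intro bounded_borel_mult bounded_borel_add bounded_borel_int ctest_bounded_borel[OF \<psi>] u c, simp)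
  also have "\<dots> = (LINT x:{0<..<1}|lborel. - (LINT y:{0<..<1}|lborel. u (pt x y) * \<psi> (pt x y)))"
  proof (rule set_lebesgue_integral_cong)
    show "\<forall>x. x \<in> {0<..<1} \<longrightarrow> (LINT y:{0<..<1}|lborel. (c x + int2 u (pt x y)) * partial 2 \<psi> (pt x y))
        = - (LINT y:{0<..<1}|lborel. u (pt x y) * \<psi> (pt x y))"
    proof (intro allI impI)
      fix x :: real assume x: "x \<in> {0<..<1}"
      then have sq: "pt x t \<in> unit_square" if "t \<in> {0<..<1}" for t using that by (simp add: pt_mem_square)
      have "continuous_on {0<..<1} (\<lambda>t. partial 2 \<psi> (pt x t))"
        by (rule continuous_on_compose2[of unit_square "partial 2 \<psi>"])
          (use \<psi> sq in \<open>auto simp: ctest_def C1_on_def pt_conv intro!: continuous_intros\<close>)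
      then show "(LINT y:{0<..<1}|lborel. (c x + int2 u (pt x y)) * partial 2 \<psi> (pt x y))
        = - (LINT y:{0<..<1}|lborel. u (pt x y) * \<psi> (pt x y))"
        unfolding int2_def vector_2
        by (intro ibp_line[where a=a and b=b] bounded_borel_line_integrable(2)[OF u x])
           (use sq \<psi> ab in \<open>auto simp: ctest_def C1_on_def intro!: line_derivative\<close>)
    qed
  qed simp
  also have "\<dots> = - (LINT z:unit_square|lborel. u z * \<psi> z)"
    by (subst square_fubini(2)[OF bounded_borel_integrable])
       (intro bounded_borel_mult ctest_bounded_borel[OF \<psi>] u, simp add: set_lebesgue_integral_def)
  finally show ?thesis .
qed

lemma int_L2_bound:
  assumes u: "bounded_borel u"
  shows "(LINT z:unit_square|lborel. (int1 u z)\<^sup>2) \<le> (LINT z:unit_square|lborel. (u z)\<^sup>2)"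
    and "(LINT z:unit_square|lborel. (int2 u z)\<^sup>2) \<le> (LINT z:unit_square|lborel. (u z)\<^sup>2)"
proof -
  have u2: "bounded_borel (\<lambda>z. (u z)\<^sup>2)" using bounded_borel_mult[OF u u] by (simp add: power2_eq_square)
  have i2: "bounded_borel (\<lambda>z. (int1 u z)\<^sup>2)" "bounded_borel (\<lambda>z. (int2 u z)\<^sup>2)"
    using bounded_borel_mult[OF bounded_borel_int(1)[OF u] bounded_borel_int(1)[OF u]] bounded_borel_mult[OF bounded_borel_int(2)[OF u] bounded_borel_int(2)[OF u]]
    by (simp_all add: power2_eq_square)
  have le: "(LINT x:{0<..<1}|lborel. f x) \<le> C" if "set_integrable lborel {0<..<1} f" "\<And>x. x \<in> {0<..<1} \<Longrightarrow> f x \<le> C" for f :: "real \<Rightarrow> real" and C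
  proof -
    have "(LINT x:{0<..<1}|lborel. f x) \<le> (LINT x:{0<..<1::real}|lborel. C)"
      by (rule set_integral_mono) (use that in \<open>auto simp: set_integrable_def intro!: integrable_mult_left integrable_real_indicator\<close>)
    then show ?thesis by (simp add: set_integral_const)
  qed
  show "(LINT z:unit_square|lborel. (int1 u z)\<^sup>2) \<le> (LINT z:unit_square|lborel. (u z)\<^sup>2)"
    unfolding square_fubini(1)[OF bounded_borel_integrable[OF u2]] square_fubini(1)[OF bounded_borel_integrable[OF i2(1)]]
  proof (rule set_integral_mono[OF square_fubini(4)[OF bounded_borel_integrable[OF i2(1)]] square_fubini(4)[OF bounded_borel_integrable[OF u2]]])
    fix y :: real assume y: "y \<in> {0<..<1}"
    show "(LINT x:{0<..<1}|lborel. (int1 u (pt x y))\<^sup>2) \<le> (LINT x:{0<..<1}|lborel. (u (pt x y))\<^sup>2)"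
      by (rule le[OF bounded_borel_line_integrable(1)[OF i2(1) y]], unfold int1_def vector_2,
          rule sq_lint_le[OF bounded_borel_line_integrable(1)[OF u y] bounded_borel_line_integrable(1)[OF u2 y]]) auto
  qed
  show "(LINT z:unit_square|lborel. (int2 u z)\<^sup>2) \<le> (LINT z:unit_square|lborel. (u z)\<^sup>2)"
    unfolding square_fubini(2)[OF bounded_borel_integrable[OF u2]] square_fubini(2)[OF bounded_borel_integrable[OF i2(2)]]
  proof (rule set_integral_mono[OF square_fubini(5)[OF bounded_borel_integrable[OF i2(2)]] square_fubini(5)[OF bounded_borel_integrable[OF u2]]])
    fix y :: real assume y: "y \<in> {0<..<1}"
    show "(LINT x:{0<..<1}|lborel. (int2 u (pt y x))\<^sup>2) \<le> (LINT x:{0<..<1}|lborel. (u (pt y x))\<^sup>2)"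
      by (rule le[OF bounded_borel_line_integrable(2)[OF i2(2) y]], unfold int2_def vector_2,
          rule sq_lint_le[OF bounded_borel_line_integrable(2)[OF u y] bounded_borel_line_integrable(2)[OF u2 y]]) auto
  qed
qed

section \<open>Smooth bump functions and uniqueness of the weak divergence\<close>

text \<open>\<open>flat 0\<close> is the smooth function \<open>exp (- 1 / t)\<close>, extended by zero; the powers of \<open>1 / t\<close> make
  the family closed under differentiation, up to linear combinations.\<close>

definition flat :: "nat \<Rightarrow> real \<Rightarrow> real" where
  "flat n t = (if t \<le> 0 then 0 else (1 / t) ^ n * exp (- (1 / t)))"

lemma flat_at_right_0: "(flat n \<longlongrightarrow> 0) (at_right 0)"
proof -
  have "((\<lambda>t::real. (inverse t) ^ n / exp (inverse t)) \<longlongrightarrow> 0) (at_right 0)"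
    by (rule filterlim_compose[OF tendsto_power_div_exp_0 filterlim_inverse_at_top_right])
  moreover have "\<forall>\<^sub>F t in at_right 0. (inverse t) ^ n / exp (inverse t) = flat n t"
    using eventually_at_right_less[of "0::real"]
    by eventually_elim (simp add: flat_def exp_minus divide_inverse)
  ultimately show ?thesis by (rule Lim_transform_eventually)
qed

lemma flat_has_derivative:
  "(flat n has_real_derivative flat (n + 2) t - real n * flat (n + 1) t) (at t)"
proof -
  consider "t < 0" | "t = 0" | "t > 0" by linarith
  then show ?thesis
  proof cases
    case 1
    have "((\<lambda>t. 0) has_real_derivative 0) (at t)" by simp
    then have "(flat n has_real_derivative 0) (at t)"
      by (rule has_field_derivative_transform_within_open[of _ _ _ "{..<0}"]) (use 1 in \<open>auto simp: flat_def\<close>)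
    then show ?thesis using 1 by (simp add: flat_def)
  next
    case 2
    have "((\<lambda>h. flat n h / h) \<longlongrightarrow> 0) (at 0)"
      unfolding filterlim_at_split
    proof
      have "\<forall>\<^sub>F h in at_left 0. 0 = flat n h / h"
        using eventually_at_left_real[of "-1" "0::real"] by (auto simp: flat_def elim!: eventually_mono)
      then show "((\<lambda>h. flat n h / h) \<longlongrightarrow> 0) (at_left 0)" by (rule Lim_transform_eventually[rotated]) simp
      have "\<forall>\<^sub>F h in at_right 0. flat (n + 1) h = flat n h / h"
        using eventually_at_right_less[of "0::real"] by eventually_elim (simp add: flat_def)
      then show "((\<lambda>h. flat n h / h) \<longlongrightarrow> 0) (at_right 0)"
        by (rule Lim_transform_eventually[OF flat_at_right_0])
    qed
    then show ?thesis using 2 by (simp add: DERIV_def flat_def)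
  next
    case 3
    have "((\<lambda>t. inverse t ^ n * exp (- inverse t)) has_real_derivative
        (real n * (- (inverse t * inverse t)) * inverse t ^ (n - 1)) * exp (- inverse t) + exp (- inverse t) * (inverse t * inverse t) * inverse t ^ n) (at t)"
      by (rule derivative_eq_intros refl | use 3 in \<open>simp; fail\<close>)+
    moreover have "(real n * (- (inverse t * inverse t)) * inverse t ^ (n - 1)) * exp (- inverse t) + exp (- inverse t) * (inverse t * inverse t) * inverse t ^ n
       = flat (n + 2) t - real n * flat (n + 1) t"
      using 3 by (cases n) (simp_all add: flat_def divide_inverse algebra_simps)
    ultimately have "((\<lambda>t. inverse t ^ n * exp (- inverse t)) has_real_derivative flat (n + 2) t - real n * flat (n + 1) t) (at t)"
      by simp
    then show ?thesis
      by (rule has_field_derivative_transform_within_open[of _ _ _ "{0<..}"]) (use 3 in \<open>auto simp: flat_def divide_inverse\<close>)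
  qed
qed

text \<open>The partial derivatives of a member are members again and all members are differentiable, so every member
  is smooth, by induction on the order.\<close>

inductive flat_algebra :: "(real^2 \<Rightarrow> real) \<Rightarrow> bool" where
  const: "flat_algebra (\<lambda>x. c)"
| flat: "flat_algebra (\<lambda>x. flat n (c * x $ i + e))"
| add: "flat_algebra f \<Longrightarrow> flat_algebra g \<Longrightarrow> flat_algebra (\<lambda>x. f x + g x)"
| mult: "flat_algebra f \<Longrightarrow> flat_algebra g \<Longrightarrow> flat_algebra (\<lambda>x. f x * g x)"

lemma flat_algebra_differentiable: "flat_algebra f \<Longrightarrow> f differentiable (at x)"
  and flat_algebra_partial: "flat_algebra f \<Longrightarrow> flat_algebra (partial k f)"
proof -
  have "(\<forall>x. f differentiable (at x)) \<and> flat_algebra (partial k f)" if "flat_algebra f"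
    using that
  proof induction
    case (const c)
    have "partial k (\<lambda>x. c) = (\<lambda>x. 0)" by auto
    then show ?case by (auto intro: flat_algebra.const)
  next
    case (flat n c i e)
    have D: "((\<lambda>x::real^2. flat n (c * x $ i + e)) has_derivative
        (\<lambda>h. (flat (n + 2) (c * x $ i + e) - real n * flat (n + 1) (c * x $ i + e)) * (c * h $ i))) (at x)" for x
    proof -
      have "((\<lambda>x::real^2. c * x $ i + e) has_derivative (\<lambda>h. c * h $ i)) (at x)"
        by (auto intro!: derivative_eq_intros bounded_linear.has_derivative[OF bounded_linear_vec_nth])
      from diff_chain_at[OF this flat_has_derivative[unfolded has_field_derivative_def]]
      show ?thesis by (simp add: comp_def)
    qed
    define a where "a = c * (axis k 1 :: real^2) $ i"
    have "partial k (\<lambda>x. flat n (c * x $ i + e)) = (\<lambda>x. a * flat (n + 2) (c * x $ i + e) + (- real n * a) * flat (n + 1) (c * x $ i + e))"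
      using partial_eqI[OF D] by (auto simp: fun_eq_iff a_def algebra_simps)
    moreover have "flat_algebra (\<lambda>x. a * flat (n + 2) (c * x $ i + e) + (- real n * a) * flat (n + 1) (c * x $ i + e))"
      by (intro flat_algebra.intros)
    ultimately have "flat_algebra (partial k (\<lambda>x. flat n (c * x $ i + e)))" by (simp only:)
    then show ?case using D unfolding differentiable_def by blast
  next
    case (add f g)
    then have "partial k (\<lambda>x. f x + g x) = (\<lambda>x. partial k f x + partial k g x)"
      by (auto simp: partial_rules)
    then show ?case using add by (auto intro!: flat_algebra.intros)
  next
    case (mult f g)
    then have "partial k (\<lambda>x. f x * g x) = (\<lambda>x. partial k f x * g x + f x * partial k g x)"
      by (auto simp: partial_rules)
    then show ?case using mult by (auto intro!: flat_algebra.intros)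
  qed
  then show "flat_algebra f \<Longrightarrow> f differentiable (at x)" "flat_algebra f \<Longrightarrow> flat_algebra (partial k f)" by auto
qed

lemma flat_algebra_continuous: "flat_algebra f \<Longrightarrow> continuous_on UNIV f"
  by (meson flat_algebra_differentiable continuous_at_imp_continuous_on differentiable_imp_continuous_within)

lemma flat_algebra_smooth: "flat_algebra f \<Longrightarrow> Ck_closure k UNIV f"
proof (induction k arbitrary: f)
  case 0
  then show ?case using flat_algebra_continuous by (auto simp: extends_continuously_def)
next
  case (Suc k)
  then show ?case using flat_algebra_continuous flat_algebra_differentiable flat_algebra_partial
    by (auto simp: extends_continuously_def)
qed

text \<open>Supported in the box shrunk by \<open>1 / n\<close> on each side, with values tending to \<open>1\<close> at every point of the box as
  \<open>n\<close> grows.\<close>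

definition bump :: "real^2 \<Rightarrow> real^2 \<Rightarrow> nat \<Rightarrow> real^2 \<Rightarrow> real" where
  "bump a b n x = (\<Prod>i\<in>UNIV. flat 0 (real n * x $ i + (- real n * a $ i - 1)) * flat 0 ((- real n) * x $ i + (real n * b $ i - 1)))"

lemma flat_0_range: "0 \<le> flat 0 t" "flat 0 t \<le> 1"
  by (auto simp: flat_def)

lemma bump_range: "0 \<le> bump a b n x" "bump a b n x \<le> 1"
  unfolding bump_def by (intro prod_nonneg prod_le_1 conjI ballI mult_nonneg_nonneg mult_le_one flat_0_range)+

lemma bump_algebra: "flat_algebra (bump a b n)"
proof -
  have "bump a b n = (\<lambda>x.
      (flat 0 (real n * x $ 1 + (- real n * a $ 1 - 1)) * flat 0 ((- real n) * x $ 1 + (real n * b $ 1 - 1)))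
    * (flat 0 (real n * x $ 2 + (- real n * a $ 2 - 1)) * flat 0 ((- real n) * x $ 2 + (real n * b $ 2 - 1))))"
    unfolding bump_def[abs_def] UNIV_2 by simp
  moreover have "flat_algebra (\<lambda>x.
      (flat 0 (real n * x $ 1 + (- real n * a $ 1 - 1)) * flat 0 ((- real n) * x $ 1 + (real n * b $ 1 - 1)))
    * (flat 0 (real n * x $ 2 + (- real n * a $ 2 - 1)) * flat 0 ((- real n) * x $ 2 + (real n * b $ 2 - 1))))"
    by (intro flat_algebra.mult flat_algebra.flat)
  ultimately show ?thesis by (simp only:)
qed

lemma bump_nonzero: "bump a b n x \<noteq> 0 \<Longrightarrow> n > 0 \<and> (\<forall>i. a $ i + 1 / n \<le> x $ i \<and> x $ i \<le> b $ i - 1 / n)"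
proof -
  assume nz: "bump a b n x \<noteq> 0"
  have *: "0 < real n * x $ i + (- real n * a $ i - 1) \<and> 0 < (- real n) * x $ i + (real n * b $ i - 1)" for i
  proof -
    have "flat 0 (real n * x $ i + (- real n * a $ i - 1)) * flat 0 ((- real n) * x $ i + (real n * b $ i - 1)) \<noteq> 0"
      using nz unfolding bump_def prod_zero_iff[OF finite_class.finite_UNIV] by blast
    then show ?thesis by (auto simp: flat_def split: if_splits)
  qed
  from *[of 1] have n: "n > 0" by (cases "n = 0") auto
  moreover have "a $ i + 1 / n \<le> x $ i \<and> x $ i \<le> b $ i - 1 / n" for i
    using *[of i] n by (simp add: field_simps)
  ultimately show ?thesis by auto
qed

lemma bump_test_function:
  assumes "box a b \<subseteq> U" shows "bump a b n \<in> test_functions U"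
proof -
  have c: "closure {x. bump a b n x \<noteq> 0} \<subseteq> cbox (\<chi> i. a $ i + 1 / n) (\<chi> i. b $ i - 1 / n)"
    by (rule closure_minimal) (use bump_nonzero[of a b n] in \<open>auto simp: mem_box_cart\<close>)
  have sub: "closure {x. bump a b n x \<noteq> 0} \<subseteq> box a b"
  proof (cases "n = 0")
    case True
    then have "{x. bump a b n x \<noteq> 0} = {}" using bump_nonzero[of a b n] by auto
    then show ?thesis by (metis closure_empty empty_subsetI)
  next
    case False
    then have "1 / real n > 0" by simp
    then have "cbox (\<chi> i. a $ i + 1 / real n) (\<chi> i. b $ i - 1 / real n) \<subseteq> box a b"
    proof (intro subsetI)
      fix x assume x: "x \<in> cbox (\<chi> i. a $ i + 1 / real n) (\<chi> i. b $ i - 1 / real n)"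
      have "a $ i < x $ i \<and> x $ i < b $ i" for i
      proof -
        have "a $ i + 1 / real n \<le> x $ i \<and> x $ i \<le> b $ i - 1 / real n"
          using x by (simp add: mem_box_cart)
        then show ?thesis using \<open>1 / real n > 0\<close> by linarith
      qed
      then show "x \<in> box a b" by (simp add: mem_box_cart)
    qed
    then show ?thesis using c by blast
  qed
  have "bounded {x. bump a b n x \<noteq> 0}" using sub bounded_box[of a b] closure_subset bounded_subset by metis
  then have "compact (closure {x. bump a b n x \<noteq> 0})" by (simp add: compact_closure)
  then show ?thesis using sub assms flat_algebra_smooth[OF bump_algebra] by (auto simp: test_functions_def)
qed

lemma bump_limit: "(\<lambda>n. bump a b n x) \<longlonglongrightarrow> indicator (box a b) x"
proof -
  have step: "(\<lambda>n. flat 0 (real n * t - 1)) \<longlonglongrightarrow> (if 0 < t then 1 else 0)" for t :: real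
  proof (cases "0 < t")
    case True
    have lim: "filterlim (\<lambda>n. real n * t - 1) at_top sequentially"
    proof -
      have "filterlim (\<lambda>n. t * real n) at_top sequentially"
        by (rule filterlim_tendsto_pos_mult_at_top[OF tendsto_const True filterlim_real_sequentially])
      then have "filterlim (\<lambda>n. -1 + t * real n) at_top sequentially"
        by (rule filterlim_tendsto_add_at_top[OF tendsto_const])
      then show ?thesis by (simp add: algebra_simps)
    qed
    have "(\<lambda>n. exp (- inverse (real n * t - 1))) \<longlonglongrightarrow> exp (- 0)"
      by (intro tendsto_intros filterlim_compose[OF tendsto_inverse_0_at_top lim] tendsto_inverse_0_at_top[OF lim])
    moreover have "\<forall>\<^sub>F n in sequentially. exp (- inverse (real n * t - 1)) = flat 0 (real n * t - 1)"
      using lim[unfolded filterlim_at_top_dense, rule_format, of 0]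
      by eventually_elim (simp add: flat_def divide_inverse)
    ultimately show ?thesis using True Lim_transform_eventually by (simp add: tendsto_cong)
  next
    case False
    have "flat 0 (real n * t - 1) = 0" for n
      using False mult_nonneg_nonpos[of "real n" t] by (auto simp: flat_def)
    then show ?thesis using False by simp
  qed
  have "(\<lambda>n. bump a b n x) \<longlonglongrightarrow> (\<Prod>i\<in>UNIV. (if 0 < x $ i - a $ i then 1 else 0) * (if 0 < b $ i - x $ i then 1 else 0))"
    unfolding bump_def
  proof (intro tendsto_prod tendsto_mult)
    fix i
    show "(\<lambda>n. flat 0 (real n * x $ i + (- real n * a $ i - 1))) \<longlonglongrightarrow> (if 0 < x $ i - a $ i then 1 else 0)"
      using step[of "x $ i - a $ i"] by (simp add: algebra_simps)
    show "(\<lambda>n. flat 0 ((- real n) * x $ i + (real n * b $ i - 1))) \<longlonglongrightarrow> (if 0 < b $ i - x $ i then 1 else 0)"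
      using step[of "b $ i - x $ i"] by (simp add: algebra_simps)
  qed
  also have "(\<Prod>i\<in>UNIV. (if 0 < x $ i - a $ i then 1 else 0) * (if 0 < b $ i - x $ i then 1 else 0)) = (indicator (box a b) x :: real)"
    by (auto simp: UNIV_2 indicator_def mem_box_cart forall_2)
  finally show ?thesis .
qed

text \<open>Boxes form an intersection stable generator of the Borel sets, so the integral vanishes over every Borel set.\<close>

lemma zero_on_boxes_AE:
  fixes d :: "real^2 \<Rightarrow> real"
  assumes d: "integrable lborel d" and z: "\<And>a b. (LINT x:box a b|lborel. d x) = 0" and 0: "(LINT x|lborel. d x) = 0"
  shows "AE x in lborel. d x = 0"
proof -
  have [measurable]: "d \<in> borel_measurable borel" using d by auto
  have si: "set_integrable lborel A d" if "A \<in> sets borel" for A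
    unfolding set_integrable_def using d that by (intro integrable_mult_indicator) auto
  have G: "sets (borel :: (real^2) measure) = sigma_sets UNIV (range (\<lambda>(a, b). box a b))"
    by (subst borel_eq_box) (simp add: sets_measure_of)
  have "(LINT x:A|lborel. d x) = 0" if "A \<in> sets borel" for A
  proof -
    have "Int_stable (range (\<lambda>(a, b). box a b :: (real^2) set))"
      by (auto simp: Int_stable_def box_Int_box)
    moreover have "range (\<lambda>(a, b). box a b :: (real^2) set) \<subseteq> Pow UNIV" by simp
    moreover have "A \<in> sigma_sets UNIV (range (\<lambda>(a, b). box a b))" using that G by simp
    ultimately show ?thesis
    proof (induction A rule: sigma_sets_induct_disjoint)
      case (basic A) then show ?case using z by auto
    next
      case empty then show ?case by (simp add: set_lebesgue_integral_def)
    next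
      case (compl A)
      then have [measurable]: "A \<in> sets borel" using G by simp
      have "(LINT x:A \<union> (UNIV - A)|lborel. d x) = (LINT x:A|lborel. d x) + (LINT x:UNIV - A|lborel. d x)"
        by (rule set_integral_Un) (auto intro!: si)
      then show ?case using compl 0 by (simp add: set_lebesgue_integral_def)
    next
      case (union A)
      have A: "A i \<in> sets borel" for i using union(2) G by auto
      then have UA: "(\<Union>i. A i) \<in> sets borel" by (intro sets.countable_UN) auto
      have "(LINT x:(\<Union>i. A i)|lborel. d x) = (\<Sum>i. (LINT x:(A i)|lborel. d x))"
        by (rule lebesgue_integral_countable_add)
           (use union(1) A UA in \<open>auto simp: disjoint_family_on_def intro!: si\<close>)
      then show ?case using union by simp
    qed
  qed
  then show ?thesis
    using density_unique_real[of lborel d "\<lambda>_. 0"] d by (auto simp: set_lebesgue_integral_def)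
qed

text \<open>Bumps converge boundedly to the indicator of a box, so \<open>d\<close> has integral zero over every box inside \<open>U\<close>.
  This determines \<open>d\<close> on each such box, and countably many of them cover \<open>U\<close>.\<close>

lemma orthogonal_to_bumps_AE:
  fixes d :: "real^2 \<Rightarrow> real"
  assumes U: "open U" and d: "set_integrable lborel U d"
    and z: "\<And>a b n. box a b \<subseteq> U \<Longrightarrow> (LINT x:U|lborel. d x * bump a b n x) = 0"
  shows "AE x in lborel. x \<in> U \<longrightarrow> d x = 0"
proof -
  have [measurable]: "U \<in> sets borel" using U by auto
  define e where "e x = indicator U x * d x" for x
  have e: "integrable lborel e" using d by (simp add: set_integrable_def e_def[abs_def])
  have [measurable]: "e \<in> borel_measurable borel" using e by auto
  have box0: "(LINT x:box a b|lborel. e x) = 0" if "box a b \<subseteq> U" for a b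
  proof -
    have bm[measurable]: "bump a b n \<in> borel_measurable borel" for n
      using flat_algebra_continuous[OF bump_algebra] by (rule borel_measurable_continuous_onI)
    have "(\<lambda>n. LINT x|lborel. e x * bump a b n x) \<longlonglongrightarrow> (LINT x|lborel. e x * indicator (box a b) x)"
    proof (rule integral_dominated_convergence[where w="\<lambda>x. \<bar>e x\<bar>"])
      show "AE x in lborel. (\<lambda>n. e x * bump a b n x) \<longlonglongrightarrow> e x * indicator (box a b) x"
        by (intro AE_I2 tendsto_mult tendsto_const bump_limit)
      show "AE x in lborel. norm (e x * bump a b n x) \<le> \<bar>e x\<bar>" for n
        using bump_range[of a b n] by (auto simp: abs_mult intro!: mult_left_le)
    qed (use e in \<open>simp_all add: integrable_abs\<close>)
    moreover have "(LINT x|lborel. e x * bump a b n x) = 0" for n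
      using z[OF that, of n] by (simp add: set_lebesgue_integral_def e_def mult.assoc)
    ultimately have "(\<lambda>n. 0) \<longlonglongrightarrow> (LINT x|lborel. e x * indicator (box a b) x)" by simp
    then have "(LINT x|lborel. e x * indicator (box a b) x) = 0" using LIMSEQ_unique[OF tendsto_const] by metis
    then show ?thesis by (simp add: set_lebesgue_integral_def mult.commute)
  qed
  have loc: "AE x in lborel. x \<in> box a b \<longrightarrow> d x = 0" if "box a b \<subseteq> U" for a b
  proof -
    define f where "f x = indicator (box a b) x * e x" for x
    have "AE x in lborel. f x = 0"
    proof (rule zero_on_boxes_AE)
      show "integrable lborel f" using integrable_mult_indicator[of "box a b" lborel e] e by (simp add: f_def[abs_def])
      show "(LINT x|lborel. f x) = 0" using box0[OF that] by (simp add: f_def[abs_def] set_lebesgue_integral_def)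
      fix l u :: "real^2"
      obtain a' b' where "box a b \<inter> box l u = box a' b'" using box_Int_box[of a b l u] by blast
      moreover have "(LINT x:box l u|lborel. f x) = (LINT x:box a b \<inter> box l u|lborel. e x)"
        unfolding set_lebesgue_integral_def f_def
        by (rule Bochner_Integration.integral_cong) (simp_all add: indicator_inter_arith mult.commute)
      moreover have "box a b \<inter> box l u \<subseteq> U" using that by blast
      ultimately show "(LINT x:box l u|lborel. f x) = 0" using box0[of a' b'] by simp
    qed
    then show ?thesis
    proof eventually_elim
      case (elim x)
      have "x \<in> box a b \<Longrightarrow> x \<in> U" using that by blast
      then show ?case using elim unfolding f_def e_def by (simp add: indicator_def split: if_splits)
    qed
  qed
  obtain \<D> where D: "countable \<D>" "\<D> \<subseteq> Pow U" "\<And>X. X \<in> \<D> \<Longrightarrow> \<exists>a b. X = box a b" "\<Union>\<D> = U"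
    by (rule open_countable_Union_open_box[OF U]) (rule that)
  have "AE x in lborel. \<forall>X\<in>\<D>. x \<in> X \<longrightarrow> d x = 0"
    unfolding AE_ball_countable[OF D(1)]
  proof
    fix X assume X: "X \<in> \<D>"
    then obtain a b where ab: "X = box a b" using D(3) by blast
    have "box a b \<subseteq> U" using X D(2) ab by blast
    then show "AE x in lborel. x \<in> X \<longrightarrow> d x = 0" unfolding ab by (rule loc)
  qed
  then show ?thesis
  proof eventually_elim
    case (elim x)
    then show ?case using D(4) by blast
  qed
qed

text \<open>On a bounded set, square integrability implies integrability, since \<open>\<bar>t\<bar> \<le> t\<^sup>2 + 1\<close>.\<close>

lemma L2_component_integrable:
  fixes d :: "real^2 \<Rightarrow> 'b::euclidean_space"
  assumes U: "U \<in> sets borel" "bounded U" and d: "d \<in> L2 U" and c: "c \<in> Basis"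
  shows "set_integrable lborel U (\<lambda>x. d x \<bullet> c)"
proof -
  have m: "(\<lambda>x. indicator U x *\<^sub>R d x) \<in> borel_measurable borel" and i: "integrable lborel (\<lambda>x. indicator U x *\<^sub>R (norm (d x))\<^sup>2)"
    using d by (auto simp: L2_def set_borel_measurable_def set_integrable_def)
  have fin: "integrable lborel (indicator U :: real^2 \<Rightarrow> real)"
    using U by (intro integrable_real_indicator) (use emeasure_bounded_finite[OF U(2)] in auto)
  have "integrable lborel (\<lambda>x. indicator U x *\<^sub>R (norm (d x))\<^sup>2 + indicator U x)"
    using i fin by (rule Bochner_Integration.integrable_add)
  then have "integrable lborel (\<lambda>x. (indicator U x *\<^sub>R d x) \<bullet> c)"
  proof (rule Bochner_Integration.integrable_bound)
    show "(\<lambda>x. (indicator U x *\<^sub>R d x) \<bullet> c) \<in> borel_measurable lborel" using m by measurable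
    have "\<bar>d x \<bullet> c\<bar> \<le> (norm (d x))\<^sup>2 + 1" for x
    proof -
      have "\<bar>d x \<bullet> c\<bar> \<le> norm (d x)" using c by (rule Basis_le_norm)
      moreover have "0 \<le> (norm (d x) - 1)\<^sup>2" by simp
      ultimately show ?thesis by (simp add: power2_eq_square algebra_simps)
    qed
    then show "AE x in lborel. norm ((indicator U x *\<^sub>R d x) \<bullet> c) \<le> norm (indicator U x *\<^sub>R (norm (d x))\<^sup>2 + indicator U x)"
      by (auto simp: indicator_def)
  qed
  then show ?thesis by (simp add: set_integrable_def)
qed

text \<open>This makes \<open>weak_div\<close>, which picks one weak divergence, computable: any explicitly given one represents it.\<close>

lemma weak_div_unique:
  assumes U: "open U" "bounded U" and d: "has_weak_div U \<tau> d" "has_weak_div U \<tau> d'"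
  shows "ae_eq U d d'"
proof -
  have Ub: "U \<in> sets borel" using U by auto
  have "AE x in lborel. x \<in> U \<longrightarrow> d x $ i - d' x $ i = 0" for i
  proof (rule orthogonal_to_bumps_AE[OF U(1)])
    have I: "set_integrable lborel U (\<lambda>x. d x $ i)" "set_integrable lborel U (\<lambda>x. d' x $ i)"
      using L2_component_integrable[OF Ub U(2), of d "axis i 1"] L2_component_integrable[OF Ub U(2), of d' "axis i 1"] d
      by (auto simp: has_weak_div_def inner_axis)
    then show "set_integrable lborel U (\<lambda>x. d x $ i - d' x $ i)" by (rule set_integral_diff)
    fix a b :: "real^2" and n assume ab: "box a b \<subseteq> U"
    have bm[measurable]: "bump a b n \<in> borel_measurable borel"
      using flat_algebra_continuous[OF bump_algebra] by (rule borel_measurable_continuous_onI)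
    have J: "set_integrable lborel U (\<lambda>x. f x * bump a b n x)" if "set_integrable lborel U f" for f :: "real^2 \<Rightarrow> real"
    proof -
      have fi: "integrable lborel (\<lambda>x. indicator U x * f x)" using that by (simp add: set_integrable_def)
      then have "integrable lborel (\<lambda>x. (indicator U x * f x) * bump a b n x)"
        by (rule Bochner_Integration.integrable_bound)
           (use fi bump_range[of a b n] in \<open>auto simp: abs_mult intro!: mult_left_le\<close>)
      then show ?thesis by (simp add: set_integrable_def mult.assoc)
    qed
    have "(LINT x:U|lborel. d x $ i * bump a b n x) = (LINT x:U|lborel. d' x $ i * bump a b n x)"
      using d bump_test_function[OF ab, of n] by (force simp: has_weak_div_def)
    then show "(LINT x:U|lborel. (d x $ i - d' x $ i) * bump a b n x) = 0"
      unfolding left_diff_distrib by (subst set_integral_diff(2)[OF J J]) (use I in auto)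
  qed
  from this[of 1] this[of 2] show ?thesis unfolding ae_eq_def
    by eventually_elim (auto simp: vec_eq_iff forall_2)
qed

section \<open>The geometry map\<close>

lemma extends_continuously_D:
  assumes "extends_continuously U f" "bounded U"
  shows "continuous_on U f" "\<exists>C. \<forall>z\<in>U. \<bar>f z\<bar> \<le> C"
proof -
  obtain g where g: "continuous_on (closure U) g" "\<And>x. x \<in> U \<Longrightarrow> g x = f x"
    using assms by (auto simp: extends_continuously_def)
  show "continuous_on U f"
    using continuous_on_subset[OF g(1) closure_subset] g(2) by (simp cong: continuous_on_cong)
  have "compact (g ` closure U)" using g(1) assms(2) by (intro compact_continuous_image) auto
  then obtain C where "\<forall>z\<in>closure U. \<bar>g z\<bar> \<le> C" using compact_imp_bounded by (force simp: bounded_iff)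
  then show "\<exists>C. \<forall>z\<in>U. \<bar>f z\<bar> \<le> C" using g(2) closure_subset by (metis subsetD)
qed

lemma Ck_closure_extends: "Ck_closure k U f \<Longrightarrow> extends_continuously U f"
  by (cases k) auto

lemma Ck_closure_C1:
  assumes "Ck_closure (Suc k) U f" "bounded U"
  shows "C1_on U f" "\<exists>C. \<forall>z\<in>U. \<bar>f z\<bar> \<le> C" "\<exists>C. \<forall>z\<in>U. \<bar>partial i f z\<bar> \<le> C"
proof -
  have e: "extends_continuously U f" "extends_continuously U (partial i f)" for i
    using assms(1) Ck_closure_extends[of k U "partial i f"] by auto
  show "C1_on U f" using assms(1) extends_continuously_D(1)[OF e(2) assms(2)] by (auto simp: C1_on_def)
  show "\<exists>C. \<forall>z\<in>U. \<bar>f z\<bar> \<le> C" "\<exists>C. \<forall>z\<in>U. \<bar>partial i f z\<bar> \<le> C"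
    by (rule extends_continuously_D(2)[OF e(1) assms(2)] extends_continuously_D(2)[OF e(2) assms(2)])+
qed

lemma Ck_closure_bounded_C1: "Ck_closure (Suc k) unit_square f \<Longrightarrow> bounded_C1 f"
  by (rule bounded_C1_I; rule Ck_closure_C1) auto

lemma mat22_nth [simp]:
  "mat22 a b c d $ 1 $ 1 = a" "mat22 a b c d $ 1 $ 2 = b" "mat22 a b c d $ 2 $ 1 = c" "mat22 a b c d $ 2 $ 2 = d"
  by (simp_all add: mat22_def)

lemma set_integrable_bounded_borel_mult:
  assumes g: "bounded_borel g" and f: "set_integrable lborel unit_square f"
  shows "set_integrable lborel unit_square (\<lambda>z. g z * f z)"
proof -
  obtain C where C: "\<And>z. z \<in> unit_square \<Longrightarrow> \<bar>g z\<bar> \<le> C" and gm: "(\<lambda>z. indicator unit_square z * g z) \<in> borel_measurable borel"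
    using g by (auto simp: bounded_borel_def set_borel_measurable_def)
  have fi: "integrable lborel (\<lambda>z. C * (indicator unit_square z * f z))"
    using f by (auto simp: set_integrable_def)
  have fm: "(\<lambda>z. indicator unit_square z * f z) \<in> borel_measurable borel"
    using f by (auto simp: set_integrable_def)
  have "integrable lborel (\<lambda>z. (indicator unit_square z * g z) * (indicator unit_square z * f z))"
  proof (rule Bochner_Integration.integrable_bound[OF fi])
    show "(\<lambda>z. (indicator unit_square z * g z) * (indicator unit_square z * f z)) \<in> borel_measurable lborel"
      using gm fm by measurable
    have "\<bar>g z * f z\<bar> \<le> \<bar>C * f z\<bar>" if "z \<in> unit_square" for z
      using C[OF that] by (auto simp: abs_mult intro!: mult_right_mono)
    then show "AE z in lborel. norm ((indicator unit_square z * g z) * (indicator unit_square z * f z)) \<le> norm (C * (indicator unit_square z * f z))"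
      by (auto simp: indicator_def)
  qed
  moreover have "(\<lambda>z. (indicator unit_square z * g z) * (indicator unit_square z * f z)) = (\<lambda>z. indicator unit_square z *\<^sub>R (g z * f z))"
    by (auto simp: indicator_def)
  ultimately show ?thesis by (simp add: set_integrable_def)
qed

text \<open>Intermediate values on the connected square. For the Jacobian determinant the constant sign \<open>s\<close> turns the factor
  \<open>\<bar>det J\<bar>\<close> of the change of variables into a smooth one.\<close>

lemma connected_sign:
  assumes "bounded_C1 f" "\<And>z. z \<in> unit_square \<Longrightarrow> f z \<noteq> 0"
  shows "\<exists>s. (s = 1 \<or> s = -1) \<and> (\<forall>z\<in>unit_square. \<bar>f z\<bar> = s * f z)"
proof (cases "\<forall>z\<in>unit_square. f z > 0")
  case True then show ?thesis by (intro exI[of _ 1]) auto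
next
  case False
  then obtain z0 where z0: "z0 \<in> unit_square" "f z0 < 0" using assms(2) by force
  have "connected (f ` unit_square)"
    using C1_on_continuous[OF bounded_C1_D(3)[OF assms(1)]] convex_connected[OF convex_box(2)] by (rule connected_continuous_image)
  then have "f z < 0" if "z \<in> unit_square" for z
  proof (rule_tac ccontr)
    assume con: "connected (f ` unit_square)" and "\<not> f z < 0"
    then have "0 \<in> f ` unit_square"
      using connectedD_interval[OF con, of "f z0" "f z" 0] z0 that by auto
    then show False using assms(2) by auto
  qed
  then have "\<bar>f z\<bar> = -1 * f z" if "z \<in> unit_square" for z using that by (simp add: abs_of_neg)
  then show ?thesis by (intro exI[of _ "-1"]) simp
qed

locale geometry =
  fixes F :: "real^2 \<Rightarrow> real^2"
  assumes adm: "admissible_geometry F"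
begin

abbreviation "\<Omega> \<equiv> F ` unit_square"
abbreviation "G \<equiv> Finv F"

text \<open>Entries as functions on the unit square: \<open>Jc\<close> of the Jacobian, \<open>jt\<close> of its adjugate, and \<open>jb\<close> of the
  inverse of the adjugate, which lives on the physical domain and is pulled back to the square.\<close>

definition dJ :: "real^2 \<Rightarrow> real" where "dJ z = det (jac F z)"
definition jt :: "2 \<Rightarrow> 2 \<Rightarrow> real^2 \<Rightarrow> real" where "jt i k z = adj_jac F z $ i $ k"
definition jb :: "2 \<Rightarrow> 2 \<Rightarrow> real^2 \<Rightarrow> real" where "jb k i z = adj_jac_inv F (F z) $ k $ i"
definition Jc :: "2 \<Rightarrow> 2 \<Rightarrow> real^2 \<Rightarrow> real" where "Jc i k = partial k (\<lambda>y. F y $ i)"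

lemma jac_nth: "jac F z $ i $ k = Jc i k z" by (simp add: jac_def Jc_def)

lemma injF: "inj_on F unit_square" and open_\<Omega>: "open \<Omega>" and bounded_\<Omega>: "bounded \<Omega>"
  using adm by (auto simp: admissible_geometry_def lipschitz_domain_def)

lemma \<Omega>_borel [measurable]: "\<Omega> \<in> sets borel" using open_\<Omega> by auto

lemma GF [simp]: "z \<in> unit_square \<Longrightarrow> G (F z) = z"
  using injF by simp

lemma FG [simp]: "x \<in> \<Omega> \<Longrightarrow> F (G x) = x" "x \<in> \<Omega> \<Longrightarrow> G x \<in> unit_square"
  by (auto intro: f_inv_into_f inv_into_into)

lemma F_Ck: "Ck_closure (Suc (Suc (Suc 0))) unit_square (\<lambda>z. F z $ i)"
  using adm by (simp add: admissible_geometry_def numeral_3_eq_3)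

lemma G_Ck: "Ck_closure (Suc (Suc (Suc 0))) \<Omega> (\<lambda>x. G x $ i)"
  using adm by (simp add: admissible_geometry_def numeral_3_eq_3)

lemma F_bounded_C1: "bounded_C1 (\<lambda>z. F z $ i)" by (rule Ck_closure_bounded_C1[OF F_Ck])

lemma Jc_bounded_C1: "bounded_C1 (Jc i k)" unfolding Jc_def
  by (rule Ck_closure_bounded_C1[of "Suc 0"]) (use F_Ck in auto)

lemma dJ_eq: "dJ z = Jc 1 1 z * Jc 2 2 z - Jc 1 2 z * Jc 2 1 z"
  by (simp add: dJ_def det_2 jac_nth)

lemma dJ_bounded_C1: "bounded_C1 dJ"
proof -
  have "dJ = (\<lambda>z. Jc 1 1 z * Jc 2 2 z + - (Jc 1 2 z * Jc 2 1 z))" by (auto simp: dJ_eq)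
  then show ?thesis by (simp only:) (intro bounded_C1_add bounded_C1_mult bounded_C1_uminus Jc_bounded_C1)
qed

lemma G_C1: "C1_on \<Omega> (\<lambda>x. G x $ i)" "\<exists>C. \<forall>x\<in>\<Omega>. \<bar>partial k (\<lambda>x. G x $ i) x\<bar> \<le> C"
  by (rule Ck_closure_C1[OF G_Ck bounded_\<Omega>])+

text \<open>The Jacobians of \<open>F\<close> and of its inverse are inverse matrices. As the derivatives of both maps are bounded, the
  determinant of the Jacobian is bounded away from zero, which is what the bounds on \<open>inverse dJ\<close> below need.\<close>

lemma chain_G:
  assumes z: "z \<in> unit_square"
  shows "partial 1 (\<lambda>x. G x $ i) (F z) * Jc 1 k z + partial 2 (\<lambda>x. G x $ i) (F z) * Jc 2 k z = (if i = k then 1 else 0)"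
proof -
  have "partial k (\<lambda>z. G (F z) $ i) z = partial 1 (\<lambda>x. G x $ i) (F z) * partial k (\<lambda>z. F z $ 1) z
     + partial 2 (\<lambda>x. G x $ i) (F z) * partial k (\<lambda>z. F z $ 2) z"
    by (rule chain_rule(2)) (use z G_C1(1) bounded_C1_D(4)[OF F_bounded_C1] in \<open>auto simp: C1_on_def\<close>)
  moreover have "partial k (\<lambda>z. G (F z) $ i) z = partial k (\<lambda>z. z $ i) z"
    by (rule differentiable_transform_open(2)[OF open_square z]) simp
  moreover have "partial k (\<lambda>z. z $ i) z = (if i = k then 1 else 0)"
    using partial_eqI[OF bounded_linear.has_derivative[OF bounded_linear_vec_nth has_derivative_ident]]
    by (auto simp: axis_def)
  ultimately show ?thesis by (simp add: Jc_def)
qed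

lemma dJ_inverse:
  assumes "z \<in> unit_square"
  shows "(partial 1 (\<lambda>x. G x $ 1) (F z) * partial 2 (\<lambda>x. G x $ 2) (F z) - partial 2 (\<lambda>x. G x $ 1) (F z) * partial 1 (\<lambda>x. G x $ 2) (F z)) * dJ z = 1"
proof -
  define a b c d where "a = partial 1 (\<lambda>x. G x $ 1) (F z)" and "b = partial 2 (\<lambda>x. G x $ 1) (F z)"
    and "c = partial 1 (\<lambda>x. G x $ 2) (F z)" and "d = partial 2 (\<lambda>x. G x $ 2) (F z)"
  have "a * Jc 1 1 z + b * Jc 2 1 z = 1" "a * Jc 1 2 z + b * Jc 2 2 z = 0"
    "c * Jc 1 1 z + d * Jc 2 1 z = 0" "c * Jc 1 2 z + d * Jc 2 2 z = 1"
    using chain_G[OF assms, of 1 1] chain_G[OF assms, of 1 2] chain_G[OF assms, of 2 1] chain_G[OF assms, of 2 2]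
    by (simp_all add: a_def b_def c_def d_def)
  then have "(a * d - b * c) * (Jc 1 1 z * Jc 2 2 z - Jc 1 2 z * Jc 2 1 z) = 1" by algebra
  then show ?thesis by (simp add: dJ_eq a_def b_def c_def d_def)
qed

lemma dJ_nz: "z \<in> unit_square \<Longrightarrow> dJ z \<noteq> 0" using dJ_inverse by force

lemma inverse_dJ_bounded_C1: "bounded_C1 (\<lambda>z. inverse (dJ z))"
proof -
  obtain C where C11: "\<forall>x\<in>\<Omega>. \<bar>partial 1 (\<lambda>x. G x $ 1) x\<bar> \<le> C" using G_C1(2)[of 1 1] by blast
  obtain D where D: "\<forall>x\<in>\<Omega>. \<bar>partial 2 (\<lambda>x. G x $ 2) x\<bar> \<le> D" using G_C1(2)[of 2 2] by blast
  obtain E where E: "\<forall>x\<in>\<Omega>. \<bar>partial 2 (\<lambda>x. G x $ 1) x\<bar> \<le> E" using G_C1(2)[of 2 1] by blast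
  obtain H where H: "\<forall>x\<in>\<Omega>. \<bar>partial 1 (\<lambda>x. G x $ 2) x\<bar> \<le> H" using G_C1(2)[of 1 2] by blast
  show ?thesis
  proof (rule bounded_C1_inverse[OF dJ_bounded_C1 dJ_nz])
    fix z assume z: "z \<in> unit_square"
    then have Fz: "F z \<in> \<Omega>" by auto
    have "inverse (dJ z) = partial 1 (\<lambda>x. G x $ 1) (F z) * partial 2 (\<lambda>x. G x $ 2) (F z) - partial 2 (\<lambda>x. G x $ 1) (F z) * partial 1 (\<lambda>x. G x $ 2) (F z)"
      by (rule inverse_unique) (use dJ_inverse[OF z] in \<open>simp only: mult.commute\<close>)
    also have "\<bar>\<dots>\<bar> \<le> C * D + E * H"
    proof -
      have "\<bar>p * q\<bar> \<le> P * Q" if "\<bar>p\<bar> \<le> P" "\<bar>q\<bar> \<le> Q" for p q P Q :: real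
        using that by (auto simp: abs_mult intro!: mult_mono)
      from this[OF C11[rule_format, OF Fz] D[rule_format, OF Fz]] this[OF E[rule_format, OF Fz] H[rule_format, OF Fz]]
      show ?thesis by linarith
    qed
    finally show "\<bar>inverse (dJ z)\<bar> \<le> C * D + E * H" .
  qed auto
qed

lemma jt_eq: "jt 1 1 = Jc 2 2" "jt 1 2 = (\<lambda>z. - Jc 1 2 z)" "jt 2 1 = (\<lambda>z. - Jc 2 1 z)" "jt 2 2 = Jc 1 1"
  by (auto simp: jt_def adj_jac_def jac_nth fun_eq_iff)

lemma jt_bounded_C1: "bounded_C1 (jt i k)"
  using exhaust_2[of i] exhaust_2[of k] by (auto simp: jt_eq intro!: bounded_C1_uminus Jc_bounded_C1)

text \<open>The inverse of the adjugate of a matrix is the matrix divided by its determinant.\<close>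

lemma jb_eq: assumes z: "z \<in> unit_square" shows "jb k i z = Jc k i z * inverse (dJ z)"
proof -
  let ?A = "adj_jac F z" and ?B = "\<chi> k i. Jc k i z * inverse (dJ z)"
  have inv: "(Jc 1 1 z * Jc 2 2 z - Jc 1 2 z * Jc 2 1 z) * inverse (dJ z) = 1" using dJ_nz[OF z] by (simp add: dJ_eq)
  have AB: "?A ** ?B = mat 1" "?B ** ?A = mat 1"
    by (simp_all add: vec_eq_iff forall_2 matrix_matrix_mult_def sum_2 mat_def adj_jac_def jac_nth) (use inv in algebra)+
  have "matrix_inv ?A = (SOME A'. ?A ** A' = mat 1 \<and> A' ** ?A = mat 1)" by (simp add: matrix_inv_def)
  also have "\<dots> = ?B"
  proof (rule some_equality)
    fix A' assume A': "?A ** A' = mat 1 \<and> A' ** ?A = mat 1"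
    have "A' = A' ** (?A ** ?B)" using AB by simp
    also have "\<dots> = ?B" using A' by (simp add: matrix_mul_assoc)
    finally show "A' = ?B" .
  qed (use AB in simp)
  finally show ?thesis using z by (simp add: jb_def adj_jac_inv_def)
qed

lemma jb_bounded_C1: "bounded_C1 (jb k i)"
  by (rule bounded_C1_cong[THEN iffD2, OF jb_eq]) (auto intro!: bounded_C1_mult Jc_bounded_C1 inverse_dJ_bounded_C1)

lemma jt_jb:
  assumes z: "z \<in> unit_square"
  shows "(\<Sum>k\<in>UNIV. jt i k z * jb k l z) = (if i = l then 1 else 0)"
    and "(\<Sum>k\<in>UNIV. jb i k z * jt k l z) = (if i = l then 1 else 0)"
proof -
  have inv: "(Jc 1 1 z * Jc 2 2 z - Jc 1 2 z * Jc 2 1 z) * inverse (dJ z) = 1" using dJ_nz[OF z] by (simp add: dJ_eq)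
  consider "i = 1" "l = 1" | "i = 1" "l = 2" | "i = 2" "l = 1" | "i = 2" "l = 2"
    using exhaust_2[of i] exhaust_2[of l] by auto
  then have "(\<Sum>k\<in>UNIV. jt i k z * jb k l z) = (if i = l then 1 else 0) \<and> (\<Sum>k\<in>UNIV. jb i k z * jt k l z) = (if i = l then 1 else 0)"
    by cases (use inv in \<open>auto simp: sum_2 jt_eq jb_eq[OF z] algebra_simps\<close>)
  then show "(\<Sum>k\<in>UNIV. jt i k z * jb k l z) = (if i = l then 1 else 0)" "(\<Sum>k\<in>UNIV. jb i k z * jt k l z) = (if i = l then 1 else 0)"
    by auto
qed

lemma G_continuous: "continuous_on \<Omega> G"
  using C1_on_continuous[OF G_C1(1)] by (simp add: continuous_on_componentwise[of \<Omega> G] Basis_vec_def inner_axis)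

lemma F_continuous: "continuous_on unit_square F"
  using C1_on_continuous[OF bounded_C1_D(3)[OF F_bounded_C1]] by (simp add: continuous_on_componentwise[of unit_square F] Basis_vec_def inner_axis)

lemma pull_borel:
  fixes f :: "real^2 \<Rightarrow> real"
  assumes "set_borel_measurable lborel \<Omega> f"
  shows "set_borel_measurable lborel unit_square (\<lambda>z. f (F z))"
proof -
  define g where "g x = indicator \<Omega> x *\<^sub>R f x" for x
  have [measurable]: "g \<in> borel_measurable borel" using assms by (simp add: set_borel_measurable_def g_def[abs_def])
  have [measurable]: "(\<lambda>z. indicator unit_square z *\<^sub>R F z) \<in> borel_measurable borel"
    by (rule borel_measurable_continuous_on_indicator) (auto intro: F_continuous)
  have "(\<lambda>z. indicator unit_square z *\<^sub>R f (F z)) = (\<lambda>z. indicator unit_square z *\<^sub>R g (indicator unit_square z *\<^sub>R F z))"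
    by (auto simp: indicator_def g_def)
  then show ?thesis by (simp add: set_borel_measurable_def)
qed

lemma push_borel:
  fixes f :: "real^2 \<Rightarrow> real"
  assumes "set_borel_measurable lborel unit_square f"
  shows "set_borel_measurable lborel \<Omega> (\<lambda>x. f (G x))"
proof -
  define g where "g x = indicator unit_square x *\<^sub>R f x" for x
  have [measurable]: "g \<in> borel_measurable borel" using assms by (simp add: set_borel_measurable_def g_def[abs_def])
  have [measurable]: "(\<lambda>z. indicator \<Omega> z *\<^sub>R G z) \<in> borel_measurable borel"
    by (rule borel_measurable_continuous_on_indicator) (auto intro: G_continuous)
  have "(\<lambda>z. indicator \<Omega> z *\<^sub>R f (G z)) = (\<lambda>z. indicator \<Omega> z *\<^sub>R g (indicator \<Omega> z *\<^sub>R G z))"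
    by (auto simp: indicator_def g_def fun_eq_iff dest: FG(2))
  then show ?thesis by (simp add: set_borel_measurable_def)
qed

lemma set_integral_lebesgue:
  fixes f :: "real^2 \<Rightarrow> real"
  assumes "set_borel_measurable lborel A f"
  shows "f absolutely_integrable_on A \<longleftrightarrow> set_integrable lborel A f"
    and "set_integrable lborel A f \<Longrightarrow> integral A f = (LINT x:A|lborel. f x)"
proof -
  show "f absolutely_integrable_on A \<longleftrightarrow> set_integrable lborel A f"
    using assms unfolding set_integrable_def set_borel_measurable_def by (subst integrable_completion) auto
  show "integral A f = (LINT x:A|lborel. f x)" if "set_integrable lborel A f"
    using that by (simp add: set_borel_integral_eq_integral)
qed

text \<open>Integrability is transferred as well as the value, since the fields on the physical domain are often given
  as unspecified members of an \<open>L2\<close> space.\<close>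

lemma change_of_variables:
  fixes f :: "real^2 \<Rightarrow> real"
  assumes f: "set_borel_measurable lborel \<Omega> f"
  shows "set_integrable lborel \<Omega> f \<longleftrightarrow> set_integrable lborel unit_square (\<lambda>z. \<bar>dJ z\<bar> * f (F z))"
    and "set_integrable lborel \<Omega> f \<Longrightarrow> (LINT x:\<Omega>|lborel. f x) = (LINT z:unit_square|lborel. \<bar>dJ z\<bar> * f (F z))"
proof -
  define D where "D z h = (\<chi> i. partial 1 (\<lambda>z. F z $ i) z * h $ 1 + partial 2 (\<lambda>z. F z $ i) z * h $ 2)" for z and h :: "real^2"
  have der: "(F has_derivative D z) (at z within unit_square)" if "z \<in> unit_square" for z
    unfolding D_def using has_derivative_components bounded_C1_D(4)[OF F_bounded_C1 that] has_derivative_at_withinI by blast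
  have mat: "matrix (D z) = jac F z" for z
    by (auto simp: matrix_def vec_eq_iff forall_2 D_def jac_def axis_def)
  have det: "det (matrix (D z)) = dJ z" for z by (simp add: mat dJ_def)
  let ?g = "\<lambda>z. \<bar>dJ z\<bar> * f (F z)"
  have gm: "set_borel_measurable lborel unit_square ?g"
  proof -
    have "(\<lambda>z. indicator unit_square z * dJ z) \<in> borel_measurable borel" "(\<lambda>z. indicator unit_square z * f (F z)) \<in> borel_measurable borel"
      using bounded_C1_D(1)[OF dJ_bounded_C1] pull_borel[OF f] by (auto simp: bounded_borel_def set_borel_measurable_def)
    then have "(\<lambda>z. \<bar>indicator unit_square z * dJ z\<bar> * (indicator unit_square z * f (F z))) \<in> borel_measurable borel"
      by measurable
    also have "(\<lambda>z. \<bar>indicator unit_square z * dJ z\<bar> * (indicator unit_square z * f (F z))) = (\<lambda>z. indicator unit_square z *\<^sub>R ?g z)"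
      by (auto simp: indicator_def)
    finally show ?thesis by (simp add: set_borel_measurable_def)
  qed
  have cv: "?g absolutely_integrable_on unit_square \<and> integral unit_square ?g = b \<longleftrightarrow> f absolutely_integrable_on \<Omega> \<and> integral \<Omega> f = b" for b
  proof -
    have "(vec b :: real^1) = vec c \<longleftrightarrow> b = c" for b c :: real by (simp add: vec_eq_iff)
    then show ?thesis
      using has_absolute_integral_change_of_variables[of unit_square F D "\<lambda>x. vec (f x) :: real^1" "vec b", OF _ der injF]
      unfolding det absolutely_integrable_on_1_iff integral_on_1_eq by simp
  qed
  show 1: "set_integrable lborel \<Omega> f \<longleftrightarrow> set_integrable lborel unit_square ?g"
    using cv set_integral_lebesgue(1)[OF f] set_integral_lebesgue(1)[OF gm] by blast
  assume fi: "set_integrable lborel \<Omega> f"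
  then have "integral unit_square ?g = integral \<Omega> f"
    using cv set_integral_lebesgue(1)[OF f] by blast
  then show "(LINT x:\<Omega>|lborel. f x) = (LINT z:unit_square|lborel. ?g z)"
    using set_integral_lebesgue(2)[OF f fi] set_integral_lebesgue(2)[OF gm] fi 1 by simp
qed

text \<open>Since \<open>Jc k 1 = dJ * jb k 1\<close>, contracting the gradient of the inverse adjugate with its first
  column is, by the chain rule, a derivative in the first parametric direction.\<close>

lemma T_corr_pull:
  assumes z: "z \<in> unit_square"
  shows "dJ z * T_corr F S' (F z) $ m = (\<Sum>i\<in>UNIV. partial 1 (jb m i) z * S' (pt 0 (z $ 2)) $ i $ 1)"
proof -
  define h where "h i x = adj_jac_inv F x $ m $ i" for i x
  have hd: "h i differentiable (at (F z))" for i
  proof -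
    have "(\<lambda>x. jb m i (G x)) differentiable (at (F z))"
      by (rule chain_rule(1)) (use z G_C1(1) bounded_C1_D(4)[OF jb_bounded_C1] in \<open>auto simp: C1_on_def\<close>)
    moreover have "h i x = jb m i (G x)" if "x \<in> \<Omega>" for x using that by (simp add: h_def jb_def)
    ultimately show ?thesis
      using differentiable_transform_open(1)[OF open_\<Omega>, of "F z" "h i" "\<lambda>x. jb m i (G x)"] z by blast
  qed
  have p: "partial 1 (jb m i) z = partial 1 (h i) (F z) * Jc 1 1 z + partial 2 (h i) (F z) * Jc 2 1 z" for i
  proof -
    have "jb m i = (\<lambda>z. h i (F z))" by (auto simp: jb_def h_def)
    then show ?thesis using chain_rule(2)[OF bounded_C1_D(4)[OF F_bounded_C1 z] hd, of 1 i] by (simp add: Jc_def)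
  qed
  have t: "T_corr F S' (F z) $ m = (\<Sum>k\<in>UNIV. \<Sum>i\<in>UNIV. partial k (h i) (F z) * jb k 1 z * S' (pt 0 (z $ 2)) $ i $ 1)"
    using z by (simp add: T_corr_def h_def[abs_def] jb_def)
  have "dJ z * jb k 1 z = Jc k 1 z" for k using dJ_nz[OF z] by (simp add: jb_eq[OF z])
  then have e: "Jc k 1 z = dJ z * jb k 1 z" for k by simp
  show ?thesis unfolding t p e sum_2 by (simp add: algebra_simps)
qed

end

section \<open>Explicit inverses of the two transformations\<close>

lemma matrix_cancel:
  fixes a b :: "2 \<Rightarrow> 2 \<Rightarrow> real" and x :: "2 \<Rightarrow> real"
  assumes "\<And>i l. (\<Sum>k\<in>UNIV. a i k * b k l) = (if i = l then 1 else 0)"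
  shows "(\<Sum>k\<in>UNIV. a i k * (\<Sum>l\<in>UNIV. b k l * x l)) = x i"
proof -
  have "(\<Sum>k\<in>UNIV. a i k * (\<Sum>l\<in>UNIV. b k l * x l)) = (\<Sum>l\<in>UNIV. (\<Sum>k\<in>UNIV. a i k * b k l) * x l)"
    unfolding sum_2 by (simp add: algebra_simps)
  also have "\<dots> = x i" unfolding assms using exhaust_2[of i] by (auto simp: sum_2)
  finally show ?thesis .
qed

lemma lint_vec_nth:
  fixes g :: "real \<Rightarrow> real^2"
  assumes "\<And>k. set_integrable lborel A (\<lambda>t. g t $ k)"
  shows "(LINT t:A|lborel. g t) $ k = (LINT t:A|lborel. g t $ k)"
proof -
  have "(\<lambda>t. indicator A t *\<^sub>R g t) = (\<lambda>t. (indicator A t *\<^sub>R g t $ 1) *\<^sub>R axis 1 1 + (indicator A t *\<^sub>R g t $ 2) *\<^sub>R axis 2 1)"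
    by (auto simp: vec_eq_iff forall_2 axis_def fun_eq_iff)
  moreover have "integrable lborel (\<lambda>t. (indicator A t *\<^sub>R g t $ 1) *\<^sub>R axis 1 (1::real) + (indicator A t *\<^sub>R g t $ 2) *\<^sub>R axis (2::2) (1::real))"
    using assms by (intro Bochner_Integration.integrable_add integrable_scaleR_left) (auto simp: set_integrable_def)
  ultimately have "integrable lborel (\<lambda>t. indicator A t *\<^sub>R g t)" by (simp only:)
  from integral_bounded_linear[OF bounded_linear_vec_nth this, of k]
  show ?thesis by (simp add: set_lebesgue_integral_def)
qed

lemma Pi_op_cong:
  assumes "z \<in> unit_square" "\<And>k y. y \<in> unit_square \<Longrightarrow> \<mu> k y = \<nu> k y"
  shows "Pi_op j \<mu> i z = Pi_op j \<nu> i z"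
  unfolding Pi_op_def using assms int1_cong[OF assms(1), of "\<mu> _" "\<nu> _"] by (auto intro!: sum.cong)

context geometry
begin

text \<open>Bounded fields on the square give square integrable fields on the physical domain, which has
  finite measure.\<close>

lemma push_L2:
  fixes f :: "real^2 \<Rightarrow> 'b::euclidean_space"
  assumes f: "\<And>c. c \<in> Basis \<Longrightarrow> bounded_borel (\<lambda>z. f z \<bullet> c)"
  shows "(\<lambda>x. f (G x)) \<in> L2 \<Omega>"
proof -
  have "(\<lambda>x. (indicator \<Omega> x *\<^sub>R f (G x)) \<bullet> c) \<in> borel_measurable borel" if "c \<in> Basis" for c
    using push_borel[of "\<lambda>z. f z \<bullet> c"] f[OF that] by (auto simp: bounded_borel_def set_borel_measurable_def)
  then have m: "(\<lambda>x. indicator \<Omega> x *\<^sub>R f (G x)) \<in> borel_measurable borel"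
    by (subst borel_measurable_euclidean_space) auto
  have "\<exists>C. \<forall>c\<in>Basis. \<forall>z\<in>unit_square. \<bar>f z \<bullet> c\<bar> \<le> C c"
    using f unfolding bounded_borel_def by (intro bchoice) blast
  then obtain C where C: "\<And>c z. c \<in> Basis \<Longrightarrow> z \<in> unit_square \<Longrightarrow> \<bar>f z \<bullet> c\<bar> \<le> C c" by blast
  define D where "D = (\<Sum>c\<in>Basis. C c)"
  have D: "norm (f z) \<le> D" if "z \<in> unit_square" for z
    using norm_le_l1[of "f z"] sum_mono[of Basis "\<lambda>c. \<bar>f z \<bullet> c\<bar>" C] C that by (fastforce simp: D_def)
  have "integrable lborel (\<lambda>x. (norm (indicator \<Omega> x *\<^sub>R f (G x)))\<^sup>2)"
  proof (rule integrableI_bounded_set[where A=\<Omega> and B="D\<^sup>2"])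
    show "(\<lambda>x. (norm (indicator \<Omega> x *\<^sub>R f (G x)))\<^sup>2) \<in> borel_measurable lborel" using m by measurable
    show "AE x\<in>\<Omega> in lborel. norm ((norm (indicator \<Omega> x *\<^sub>R f (G x)))\<^sup>2) \<le> D\<^sup>2"
      using D by (auto intro!: AE_I2 power_mono simp: indicator_def)
  qed (use emeasure_bounded_finite[OF bounded_\<Omega>] in auto)
  also have "(\<lambda>x. (norm (indicator \<Omega> x *\<^sub>R f (G x)))\<^sup>2) = (\<lambda>x. indicator \<Omega> x *\<^sub>R (norm (f (G x)))\<^sup>2)"
    by (auto simp: indicator_def)
  finally show ?thesis using m by (simp add: L2_def set_integrable_def set_borel_measurable_def)
qed

lemma pull_integrable:
  assumes f: "set_integrable lborel \<Omega> f"
  shows "set_integrable lborel unit_square (\<lambda>z. (f (F z) :: real))"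
proof -
  obtain s where s: "s = 1 \<or> s = -1" "\<forall>z\<in>unit_square. \<bar>dJ z\<bar> = s * dJ z"
    using connected_sign[OF dJ_bounded_C1 dJ_nz] by blast
  have fm: "set_borel_measurable lborel \<Omega> f" using f by (simp add: set_integrable_def set_borel_measurable_def)
  have "set_integrable lborel unit_square (\<lambda>z. (s * inverse (dJ z)) * (\<bar>dJ z\<bar> * f (F z)))"
    by (rule set_integrable_bounded_borel_mult) (use f change_of_variables(1)[OF fm] bounded_C1_D(1)[OF inverse_dJ_bounded_C1] in \<open>auto intro!: bounded_borel_mult\<close>)
  moreover have "(s * inverse (dJ z)) * (\<bar>dJ z\<bar> * f (F z)) = f (F z)" if "z \<in> unit_square" for z
    using s dJ_nz[OF that] that by auto
  ultimately show ?thesis by (subst (asm) set_integrable_cong[OF refl refl]) auto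
qed

lemma Y3_nth:
  assumes z: "z \<in> unit_square" and li: "\<And>k. line_integrable (z $ 2) (\<lambda>y. dJ y * v (F y) $ k)"
  shows "Y3 F v z $ i = Pi_op jt (\<lambda>k y. dJ y * v (F y) $ k) i z"
proof -
  have "int1 (\<lambda>y. det (jac F y) *\<^sub>R v (F y)) z $ k = int1 (\<lambda>y. dJ y * v (F y) $ k) z" for k
    unfolding int1_def
  proof (subst lint_vec_nth)
    show "set_integrable lborel {0<..<z $ 1} (\<lambda>t. (det (jac F (pt t (z $ 2))) *\<^sub>R v (F (pt t (z $ 2)))) $ k)" for k
    proof -
      have "{0<..<z $ 1} \<subseteq> {0<..<1}" using z by (auto simp: mem_square)
      then show ?thesis
        using set_integrable_subset[OF li[of k, unfolded line_integrable_def], of "{0<..<z $ 1}"] by (simp add: dJ_def)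
    qed
  qed (simp add: dJ_def)
  then show ?thesis
    by (simp add: Y3_def Pi_op_def matrix_vector_mult_def sum_2 jt_def[abs_def] dJ_def[symmetric] algebra_simps)
qed

text \<open>The field with Piola pull-back \<open>Pi_op jb w\<close> is a preimage of \<open>w\<close>, by \<open>Pi_op_inverse\<close> for the pair \<open>jt\<close>, \<open>jb\<close>.
  Hence the chosen representative is some square integrable preimage, and \<open>Pi_op_AE_inverse\<close>, for
  the same pair in the opposite order, shows that it has the same pull-back almost everywhere.\<close>

lemma Y3_inv_spec:
  assumes w: "\<And>k. bounded_borel (\<lambda>z. w z $ k)"
  shows "Y3_inv F w \<in> L2 \<Omega>"
    and "AE z in lborel. z \<in> unit_square \<longrightarrow> (\<forall>k. dJ z * Y3_inv F w (F z) $ k = Pi_op jb (\<lambda>k z. w z $ k) k z)"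
proof -
  let ?w = "\<lambda>k z. w z $ k"
  define u :: "real^2 \<Rightarrow> real^2" where "u z = (\<chi> k. inverse (dJ z) * Pi_op jb ?w k z)" for z
  have uB: "bounded_borel (\<lambda>z. u z $ k)" for k
    unfolding u_def using w by (auto intro!: bounded_borel_mult bounded_C1_D(1)[OF inverse_dJ_bounded_C1] bounded_borel_Pi_op jb_bounded_C1)
  have uL: "(\<lambda>x. u (G x)) \<in> L2 \<Omega>"
    by (rule push_L2) (use uB in \<open>auto simp: Basis_vec_def inner_axis\<close>)
  have du: "dJ z * u (G (F z)) $ k = Pi_op jb ?w k z" if "z \<in> unit_square" for z k
    using that dJ_nz[OF that] by (simp add: u_def)
  have "Y3 F (\<lambda>x. u (G x)) z = w z" if z: "z \<in> unit_square" for z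
  proof -
    have "bounded_borel (\<lambda>y. dJ y * u (G (F y)) $ k)" for k
      by (rule bounded_borel_cong[THEN iffD2, OF du bounded_borel_Pi_op]) (use jb_bounded_C1 w in auto)
    then have "Y3 F (\<lambda>x. u (G x)) z $ i = Pi_op jt (\<lambda>k y. dJ y * u (G (F y)) $ k) i z" for i
      by (intro Y3_nth z bounded_borel_line_integrable1)
    also have "\<dots> i = Pi_op jt (Pi_op jb ?w) i z" for i
      by (rule Pi_op_cong[OF z du])
    also have "\<dots> i = w z $ i" for i
      by (rule Pi_op_inverse[OF jb_bounded_C1 jt_bounded_C1 jt_jb(1) z]) (use bounded_borel_line_integrable1[OF w z] in auto)
    finally show ?thesis by (simp add: vec_eq_iff)
  qed
  then have ex: "(\<lambda>x. u (G x)) \<in> L2 \<Omega> \<and> ae_eq unit_square (Y3 F (\<lambda>x. u (G x))) w"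
    using uL by (auto simp: ae_eq_def)
  define v where "v = Y3_inv F w"
  have v: "v \<in> L2 \<Omega>" "ae_eq unit_square (Y3 F v) w"
    using someI[of "\<lambda>v. v \<in> L2 \<Omega> \<and> ae_eq unit_square (Y3 F v) w", OF ex] by (auto simp: v_def Y3_inv_def)
  show "Y3_inv F w \<in> L2 \<Omega>" using v(1) by (simp add: v_def)
  let ?m = "\<lambda>k y. dJ y * v (F y) $ k"
  have vi: "set_integrable lborel \<Omega> (\<lambda>x. v x $ k)" for k
    using L2_component_integrable[OF \<Omega>_borel bounded_\<Omega> v(1), of "axis k 1"] by (simp add: inner_axis)
  have mi: "set_integrable lborel unit_square (?m k)" for k
    by (rule set_integrable_bounded_borel_mult[OF bounded_C1_D(1)[OF dJ_bounded_C1] pull_integrable[OF vi]])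
  have "AE z in lborel. z \<in> unit_square \<longrightarrow> Pi_op jt ?m k z = w z $ k" for k
    using AE_line_integrable[OF mi[of 1]] AE_line_integrable[OF mi[of 2]] v(2)[unfolded ae_eq_def]
  proof eventually_elim
    case (elim z)
    show ?case
    proof
      assume z: "z \<in> unit_square"
      have "line_integrable (z $ 2) (?m l)" for l using elim(1,2) z exhaust_2[of l] by auto
      from Y3_nth[OF z this] show "Pi_op jt ?m k z = w z $ k" using elim(3) z by simp
    qed
  qed
  then have A: "AE z in lborel. z \<in> unit_square \<longrightarrow> ?m i z = Pi_op jb ?w i z \<and> (\<forall>k. (\<Sum>l\<in>UNIV. jt k l z * int1 (?m l) z) = int1 (?w k) z)" for i
    by (intro Pi_op_AE_inverse jt_bounded_C1 jb_bounded_C1 mi w jt_jb(2))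
  show "AE z in lborel. z \<in> unit_square \<longrightarrow> (\<forall>k. dJ z * Y3_inv F w (F z) $ k = Pi_op jb ?w k z)"
    using A[of 1] A[of 2] unfolding v_def[symmetric] by eventually_elim (simp add: forall_2)
qed

text \<open>The solution of \<open>Y2 F S = R\<close> in terms of \<open>M = (S \<circ> F) Jt\<^sup>T\<close>, where \<open>Jt\<close> is the adjugate Jacobian. The
  second column of the equation says that \<open>Jt\<close> times the antiderivative of the second column of \<open>M\<close> is
  the antiderivative of that of \<open>R\<close>, which gives \<open>Pf\<close> for the former. The remaining terms of
  the equation are \<open>Jt M\<close> and derivatives of \<open>Jt\<close> times \<open>Pf\<close>, so \<open>Nf\<close> is \<open>Jt M\<close>, and \<open>Mf\<close> and \<open>Sf\<close> are
  \<open>M\<close> and \<open>S \<circ> F\<close> by inversion of matrices.\<close>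

definition Pf :: "(2 \<Rightarrow> 2 \<Rightarrow> real^2 \<Rightarrow> real) \<Rightarrow> 2 \<Rightarrow> real^2 \<Rightarrow> real" where
  "Pf R l z = (\<Sum>m\<in>UNIV. jb l m z * int1 (R m 2) z)"

definition Nf :: "(2 \<Rightarrow> 2 \<Rightarrow> real^2 \<Rightarrow> real) \<Rightarrow> 2 \<Rightarrow> 2 \<Rightarrow> real^2 \<Rightarrow> real" where
  "Nf R i j z = (if j = 1 then R i 1 z + (\<Sum>l\<in>UNIV. partial 2 (jt i l) z * Pf R l z)
     else R i 2 z - (\<Sum>l\<in>UNIV. partial 1 (jt i l) z * Pf R l z))"

definition Mf :: "(2 \<Rightarrow> 2 \<Rightarrow> real^2 \<Rightarrow> real) \<Rightarrow> 2 \<Rightarrow> 2 \<Rightarrow> real^2 \<Rightarrow> real" where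
  "Mf R k j z = (\<Sum>i\<in>UNIV. jb k i z * Nf R i j z)"

definition Sf :: "(2 \<Rightarrow> 2 \<Rightarrow> real^2 \<Rightarrow> real) \<Rightarrow> 2 \<Rightarrow> 2 \<Rightarrow> real^2 \<Rightarrow> real" where
  "Sf R k l z = (\<Sum>j\<in>UNIV. jb l j z * Mf R k j z)"

lemma bounded_borel_Pf: "(\<And>i j. bounded_borel (R i j)) \<Longrightarrow> bounded_borel (Pf R l)"
  unfolding Pf_def[abs_def] by (intro bounded_borel_sum bounded_borel_mult bounded_borel_int bounded_C1_D(1)[OF jb_bounded_C1])

lemma bounded_borel_Nf: assumes "\<And>i j. bounded_borel (R i j)" shows "bounded_borel (Nf R i j)"
proof (cases "j = 1")
  case True then show ?thesis unfolding Nf_def[abs_def] by (auto intro!: bounded_borel_add bounded_borel_sum bounded_borel_mult bounded_borel_Pf assms bounded_C1_D(2)[OF jt_bounded_C1])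
next
  case False then show ?thesis unfolding Nf_def[abs_def] by (auto intro!: bounded_borel_diff bounded_borel_sum bounded_borel_mult bounded_borel_Pf assms bounded_C1_D(2)[OF jt_bounded_C1])
qed

lemma bounded_borel_Mf: "(\<And>i j. bounded_borel (R i j)) \<Longrightarrow> bounded_borel (Mf R k j)"
  unfolding Mf_def[abs_def] by (intro bounded_borel_sum bounded_borel_mult bounded_borel_Nf bounded_C1_D(1)[OF jb_bounded_C1])

lemma bounded_borel_Sf: "(\<And>i j. bounded_borel (R i j)) \<Longrightarrow> bounded_borel (Sf R k j)"
  unfolding Sf_def[abs_def] by (intro bounded_borel_sum bounded_borel_mult bounded_borel_Mf bounded_C1_D(1)[OF jb_bounded_C1])

text \<open>The derivative of an inverse matrix, from the derivative of the constant product.\<close>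

lemma partial_jb:
  assumes z: "z \<in> unit_square"
  shows "partial n (jb k m) z = - (\<Sum>i\<in>UNIV. jb k i z * (\<Sum>l\<in>UNIV. partial n (jt i l) z * jb l m z))"
proof -
  have 0: "(\<Sum>i\<in>UNIV. partial n (jb k i) z * jt i l z + jb k i z * partial n (jt i l) z) = 0" for l
    by (rule partial_inverse_matrix[OF jt_bounded_C1 jb_bounded_C1 jt_jb(2) z])
  have "(\<Sum>l\<in>UNIV. (\<Sum>i\<in>UNIV. partial n (jb k i) z * jt i l z + jb k i z * partial n (jt i l) z) * jb l m z) = 0"
    unfolding 0 by simp
  then have "(\<Sum>i\<in>UNIV. partial n (jb k i) z * (\<Sum>l\<in>UNIV. jt i l z * jb l m z))
     + (\<Sum>i\<in>UNIV. jb k i z * (\<Sum>l\<in>UNIV. partial n (jt i l) z * jb l m z)) = 0"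
    unfolding sum_2 by (simp add: algebra_simps)
  moreover have "(\<Sum>i\<in>UNIV. partial n (jb k i) z * (\<Sum>l\<in>UNIV. jt i l z * jb l m z)) = partial n (jb k m) z"
    unfolding jt_jb(1)[OF z] using exhaust_2[of m] by (auto simp: sum_2)
  ultimately show ?thesis by linarith
qed

text \<open>Both sides contain the antiderivative of the second column of \<open>R\<close>: on the right with the derivative of \<open>jb\<close>, on the
  left with that of \<open>jt\<close>, and \<open>partial_jb\<close> converts one into the other.\<close>

lemma Mf_2: assumes z: "z \<in> unit_square" shows "Mf R k 2 z = Pi_op jb (\<lambda>m. R m 2) k z"
  unfolding Pi_op_def Mf_def partial_jb[OF z] Nf_def Pf_def sum_2 by (simp add: algebra_simps)

text \<open>The rows of the Jacobian are gradients, so mixed derivatives commute. Hence the terms that \<open>Nf\<close> adds to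
  the two off-diagonal entries of \<open>R\<close> are equal.\<close>

lemma Nf_sym:
  assumes z: "z \<in> unit_square" and R: "R 1 2 z = R 2 1 z"
  shows "Nf R i j z = Nf R j i z"
proof -
  have c: "partial 2 (jt 2 l) z = - partial 1 (jt 1 l) z" for l
  proof -
    have d: "Jc i k differentiable (at z)" for i k by (rule bounded_C1_D(4)[OF Jc_bounded_C1 z])
    have com: "partial 2 (Jc i 1) z = partial 1 (Jc i 2) z" for i
      using partial_commute[OF open_square z bounded_C1_D(3)[OF F_bounded_C1[of i]]] bounded_C1_D(3)[OF Jc_bounded_C1] by (simp add: Jc_def)
    show ?thesis using exhaust_2[of l] by (auto simp: jt_eq partial_rules(3)[OF d d] com)
  qed
  have "Nf R 1 2 z = Nf R 2 1 z"
    by (simp add: Nf_def R c sum_negf)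
  then show ?thesis using exhaust_2[of i] exhaust_2[of j] by auto
qed

lemma Sf_sym:
  assumes "z \<in> unit_square" "R 1 2 z = R 2 1 z"
  shows "Sf R k l z = Sf R l k z"
proof -
  note N = Nf_sym[of z R 1 2, OF assms]
  show ?thesis unfolding Sf_def Mf_def sum_2 N by (simp add: algebra_simps)
qed

text \<open>The matrix \<open>M\<close> of an arbitrary field \<open>S\<close>; it equals \<open>Mf R\<close> if \<open>Y2 F S = R\<close>.\<close>

definition Mo :: "(real^2 \<Rightarrow> real^2^2) \<Rightarrow> 2 \<Rightarrow> 2 \<Rightarrow> real^2 \<Rightarrow> real" where
  "Mo S k j y = (\<Sum>l\<in>UNIV. jt j l y * S (F y) $ k $ l)"

text \<open>The Airy matrix of \<open>F_n\<close> consists of second derivatives of \<open>F\<close>, that is of derivatives of \<open>jt\<close> in the second direction in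
  its first column, and in the first direction in its second column.\<close>

lemma Y2_nth:
  assumes z: "z \<in> unit_square"
  shows "Y2 F S z $ i $ 2 = Pi_op jt (\<lambda>k. Mo S k 2) i z"
    and "Y2 F S z $ i $ 1 = (\<Sum>k\<in>UNIV. jt i k z * Mo S k 1 z - partial 2 (jt i k) z * int1 (Mo S k 2) z)"
proof -
  have d: "Jc i k differentiable (at z)" for i k by (rule bounded_C1_D(4)[OF Jc_bounded_C1 z])
  have I: "int1 (\<lambda>y. alt_sign n * (\<Sum>l\<in>UNIV. adj_jac F y $ 2 $ l * S (F y) $ other_index n $ l)) z = alt_sign n * int1 (Mo S (other_index n) 2) z" for n
    unfolding int_cmult Mo_def[abs_def] jt_def ..
  have airy: "airy (\<lambda>y. F y $ n) z = mat22 (partial 2 (Jc n 2) z) (- partial 1 (Jc n 2) z) (- partial 2 (Jc n 1) z) (partial 1 (Jc n 1) z)" for n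
    by (simp add: airy_def Jc_def)
  have A: "(adj_jac F z ** S (F z) ** transpose (adj_jac F z)) $ i $ j = (\<Sum>k\<in>UNIV. jt i k z * Mo S k j z)" for i j
    by (simp add: matrix_matrix_mult_def transpose_def sum_2 Mo_def jt_def algebra_simps)
  show "Y2 F S z $ i $ 2 = Pi_op jt (\<lambda>k. Mo S k 2) i z"
    unfolding Y2_def I airy Pi_op_def using exhaust_2[of i]
    by (auto simp: A sum_2 alt_sign_def other_index_def jt_eq partial_rules(3)[OF d d])
  show "Y2 F S z $ i $ 1 = (\<Sum>k\<in>UNIV. jt i k z * Mo S k 1 z - partial 2 (jt i k) z * int1 (Mo S k 2) z)"
    unfolding Y2_def I airy using exhaust_2[of i]
    by (auto simp: A sum_2 alt_sign_def other_index_def jt_eq partial_rules(3)[OF d d])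
qed

text \<open>As for \<open>Y3\<close>: the explicit field is a symmetric preimage, so the chosen representative is some square
  integrable preimage. Its second column in \<open>M\<close> and the antiderivative of this column are then determined by
  \<open>Pi_op_AE_inverse\<close>, and the rest follows by algebra at almost every point.\<close>

lemma Y2_inv_spec:
  fixes R :: "real^2 \<Rightarrow> real^2^2"
  assumes R: "\<And>i j. bounded_borel (\<lambda>z. R z $ i $ j)" and sym: "\<And>z. z \<in> unit_square \<Longrightarrow> R z $ 1 $ 2 = R z $ 2 $ 1"
  shows "Y2_inv F R \<in> L2_sym \<Omega>"
    and "AE z in lborel. z \<in> unit_square \<longrightarrow> (\<forall>k l. Y2_inv F R (F z) $ k $ l = Sf (\<lambda>i j z. R z $ i $ j) k l z)"
proof -
  let ?R = "\<lambda>i j z. R z $ i $ j"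
  define u :: "real^2 \<Rightarrow> real^2^2" where "u z = (\<chi> k l. Sf ?R k l z)" for z
  have uB: "bounded_borel (\<lambda>z. u z $ k $ l)" for k l
    unfolding u_def using bounded_borel_Sf[of ?R, OF R] by simp
  have uL: "(\<lambda>x. u (G x)) \<in> L2 \<Omega>"
    by (rule push_L2) (use uB in \<open>auto simp: Basis_vec_def inner_axis\<close>)
  have uS: "(\<lambda>x. u (G x)) \<in> L2_sym \<Omega>"
  proof -
    have "u (G x) $ k $ l = u (G x) $ l $ k" if "x \<in> \<Omega>" for x k l
      using Sf_sym[of "G x" ?R k l, OF FG(2)[OF that] sym[OF FG(2)[OF that]]] by (simp add: u_def)
    then have "transpose (u (G x)) = u (G x)" if "x \<in> \<Omega>" for x
      using that by (simp add: transpose_def vec_eq_iff)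
    then show ?thesis using uL unfolding L2_sym_def sym_matrices_def by blast
  qed
  have Mu: "Mo (\<lambda>x. u (G x)) k j z = Mf ?R k j z" if z: "z \<in> unit_square" for k j z
    using matrix_cancel[of "\<lambda>j l. jt j l z" "\<lambda>j l. jb j l z" j "\<lambda>j. Mf ?R k j z", OF jt_jb(1)[OF z]] z
    by (simp add: Mo_def u_def Sf_def)
  have "Y2 F (\<lambda>x. u (G x)) z = R z" if z: "z \<in> unit_square" for z
  proof -
    have li: "line_integrable (z $ 2) (\<lambda>z. R z $ i $ j)" for i j by (rule bounded_borel_line_integrable1[OF R z])
    have M2: "Mo (\<lambda>x. u (G x)) k 2 y = Pi_op jb (\<lambda>m. ?R m 2) k y" if "y \<in> unit_square" for k y
      using Mu[OF that] Mf_2[OF that] by simp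
    have "Y2 F (\<lambda>x. u (G x)) z $ i $ 2 = Pi_op jt (Pi_op jb (\<lambda>m. ?R m 2)) i z" for i
      unfolding Y2_nth(1)[OF z] by (rule Pi_op_cong[OF z M2])
    also have "\<dots> i = R z $ i $ 2" for i
      by (rule Pi_op_inverse[OF jb_bounded_C1 jt_bounded_C1 jt_jb(1) z li])
    finally have 2: "Y2 F (\<lambda>x. u (G x)) z $ i $ 2 = R z $ i $ 2" for i .
    have I: "int1 (Mo (\<lambda>x. u (G x)) k 2) z = Pf ?R k z" for k
      using int1_cong[OF z M2] int1_Pi_op(2)[of jb z "\<lambda>m. ?R m 2", OF jb_bounded_C1 z li] by (simp add: Pf_def)
    have "Y2 F (\<lambda>x. u (G x)) z $ i $ 1 = (\<Sum>k\<in>UNIV. jt i k z * Mf ?R k 1 z) - (\<Sum>k\<in>UNIV. partial 2 (jt i k) z * Pf ?R k z)" for i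
      unfolding Y2_nth(2)[OF z] I Mu[OF z] by (simp add: sum_subtractf)
    moreover have "(\<Sum>k\<in>UNIV. jt i k z * Mf ?R k 1 z) = Nf ?R i 1 z" for i
      unfolding Mf_def by (rule matrix_cancel[OF jt_jb(1)[OF z]])
    ultimately have "Y2 F (\<lambda>x. u (G x)) z $ i $ 1 = R z $ i $ 1" for i by (simp add: Nf_def)
    then show ?thesis using 2 by (simp add: vec_eq_iff forall_2)
  qed
  then have ex: "(\<lambda>x. u (G x)) \<in> L2_sym \<Omega> \<and> ae_eq unit_square (Y2 F (\<lambda>x. u (G x))) R"
    using uS by (auto simp: ae_eq_def)
  define S where "S = Y2_inv F R"
  have S: "S \<in> L2_sym \<Omega>" "ae_eq unit_square (Y2 F S) R"
    using someI[of "\<lambda>S. S \<in> L2_sym \<Omega> \<and> ae_eq unit_square (Y2 F S) R", OF ex] by (auto simp: S_def Y2_inv_def)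
  show "Y2_inv F R \<in> L2_sym \<Omega>" using S(1) by (simp add: S_def)
  have Si: "set_integrable lborel \<Omega> (\<lambda>x. S x $ k $ l)" for k l
  proof -
    have "S \<in> L2 \<Omega>" using S(1) by (simp add: L2_sym_def)
    moreover have "axis k (axis l 1) \<in> (Basis :: (real^2^2) set)" by (auto simp: Basis_vec_def)
    ultimately show ?thesis
      using L2_component_integrable[OF \<Omega>_borel bounded_\<Omega>, of S "axis k (axis l 1)"] by (simp add: inner_axis)
  qed
  have Mi: "set_integrable lborel unit_square (Mo S k j)" for k j
    unfolding Mo_def[abs_def] sum_2
    by (intro set_integral_add(1) set_integrable_bounded_borel_mult[OF bounded_C1_D(1)[OF jt_bounded_C1]] pull_integrable Si)
  have "AE z in lborel. z \<in> unit_square \<longrightarrow> Pi_op jt (\<lambda>k. Mo S k 2) i z = R z $ i $ 2" for i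
    using S(2)[unfolded ae_eq_def] by eventually_elim (simp add: Y2_nth(1)[symmetric])
  then have A: "AE z in lborel. z \<in> unit_square \<longrightarrow> Mo S i 2 z = Pi_op jb (\<lambda>i. ?R i 2) i z \<and> (\<forall>k. (\<Sum>l\<in>UNIV. jt k l z * int1 (Mo S l 2) z) = int1 (?R k 2) z)" for i
    by (intro Pi_op_AE_inverse jt_bounded_C1 jb_bounded_C1 Mi R jt_jb(2))
  show "AE z in lborel. z \<in> unit_square \<longrightarrow> (\<forall>k l. Y2_inv F R (F z) $ k $ l = Sf ?R k l z)"
    using A[of 1] A[of 2] S(2)[unfolded ae_eq_def] unfolding S_def[symmetric]
  proof eventually_elim
    case (elim z)
    show ?case
    proof (intro impI allI)
      fix k l assume z: "z \<in> unit_square"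
      have M2: "Mo S k 2 z = Mf ?R k 2 z" for k
        using elim(1,2) z exhaust_2[of k] by (auto simp: Mf_2[OF z])
      have I: "int1 (Mo S k 2) z = Pf ?R k z" for k
      proof -
        have "(\<Sum>l\<in>UNIV. jt m l z * int1 (Mo S l 2) z) = int1 (?R m 2) z" for m
          using elim(1) z by simp
        then show ?thesis
          using matrix_cancel[of "\<lambda>i k. jb i k z" "\<lambda>i k. jt i k z" k "\<lambda>l. int1 (Mo S l 2) z", OF jt_jb(2)[OF z]]
          by (simp add: Pf_def)
      qed
      have "R z $ i $ 1 = (\<Sum>k\<in>UNIV. jt i k z * Mo S k 1 z) - (\<Sum>k\<in>UNIV. partial 2 (jt i k) z * Pf ?R k z)" for i
        using elim(3) z Y2_nth(2)[OF z, of S i] by (simp add: I sum_subtractf)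
      then have "(\<Sum>k\<in>UNIV. jt i k z * Mo S k 1 z) = Nf ?R i 1 z" for i by (simp add: Nf_def)
      then have M1: "Mo S k 1 z = Mf ?R k 1 z" for k
        using matrix_cancel[of "\<lambda>i k. jb i k z" "\<lambda>i k. jt i k z" k "\<lambda>l. Mo S l 1 z", OF jt_jb(2)[OF z]]
        by (simp add: Mf_def)
      have "Mo S k j z = Mf ?R k j z" for j using M1 M2 exhaust_2[of j] by auto
      then show "S (F z) $ k $ l = Sf ?R k l z"
        using matrix_cancel[of "\<lambda>i k. jb i k z" "\<lambda>i k. jt i k z" l "\<lambda>l. S (F z) $ k $ l", OF jt_jb(2)[OF z]]
        by (simp add: Sf_def Mo_def)
    qed
  qed
qed

end

section \<open>The divergence of the transformed stress\<close>

abbreviation square_integral :: "(real^2 \<Rightarrow> real) \<Rightarrow> real" where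
  "square_integral f \<equiv> LINT z:unit_square|lborel. f z"

lemma square_integral_add: "bounded_borel f \<Longrightarrow> bounded_borel g \<Longrightarrow> square_integral (\<lambda>z. f z + g z) = square_integral f + square_integral g"
  by (intro set_integral_add bounded_borel_integrable)

lemma square_integral_diff: "bounded_borel f \<Longrightarrow> bounded_borel g \<Longrightarrow> square_integral (\<lambda>z. f z - g z) = square_integral f - square_integral g"
  by (intro set_integral_diff bounded_borel_integrable)

lemma square_integral_cmult: "square_integral (\<lambda>z. c * f z) = c * square_integral f"
  by simp

lemma square_integral_sum2: "bounded_borel (f 1) \<Longrightarrow> bounded_borel (f 2) \<Longrightarrow> square_integral (\<lambda>z. \<Sum>i\<in>UNIV. f (i::2) z) = (\<Sum>i\<in>UNIV. square_integral (f i))"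
  unfolding sum_2 by (rule square_integral_add)

lemma square_integral_cong: "(\<And>z. z \<in> unit_square \<Longrightarrow> f z = g z) \<Longrightarrow> square_integral f = square_integral g"
  by (rule set_lebesgue_integral_cong) auto

text \<open>The rows of \<open>S\<close> have divergence \<open>d + e\<close>, with \<open>d\<close> the derivative of the first column in the first
  direction and \<open>e\<close> that of the second column in the second direction. It is expressed by
  antiderivatives, because splines of low smoothness do not have these derivatives at every point. In
  the first direction the initial values are those of \<open>S\<close> on the edge, as the trace correction
  refers to them.\<close>

definition regular_field :: "(real^2 \<Rightarrow> real^2^2) \<Rightarrow> (2 \<Rightarrow> real^2 \<Rightarrow> real) \<Rightarrow> (2 \<Rightarrow> real^2 \<Rightarrow> real) \<Rightarrow> bool" where
  "regular_field S d e \<longleftrightarrow> (\<forall>i j. bounded_borel (\<lambda>z. S z $ i $ j)) \<and> (\<forall>z\<in>unit_square. S z $ 1 $ 2 = S z $ 2 $ 1) \<and>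
    (\<forall>i. bounded_borel (d i) \<and> bounded_borel (e i) \<and> bounded_borel (\<lambda>z. S (pt 0 (z $ 2)) $ i $ 1) \<and>
       (\<forall>z\<in>unit_square. S z $ i $ 1 = S (pt 0 (z $ 2)) $ i $ 1 + int1 (d i) z) \<and>
       (\<exists>c. bounded_borel (\<lambda>z. c (z $ 1)) \<and> (\<forall>z\<in>unit_square. S z $ i $ 2 = c (z $ 1) + int2 (e i) z)))"

context geometry
begin

lemma Mf_1:
  assumes z: "z \<in> unit_square"
  shows "Mf R k 1 z = (\<Sum>i\<in>UNIV. jb k i z * R i 1 z - partial 2 (jb k i) z * int1 (R i 2) z)"
  unfolding Mf_def partial_jb[OF z] Nf_def Pf_def sum_2 by (simp add: algebra_simps)

lemma Sf_diff:
  assumes R: "\<And>i j. bounded_borel (R i j)" and R': "\<And>i j. bounded_borel (R' i j)" and z: "z \<in> unit_square"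
  shows "Sf (\<lambda>i j z. R i j z - R' i j z) k l z = Sf R k l z - Sf R' k l z"
proof -
  have "int1 (\<lambda>y. R i j y - R' i j y) z = int1 (R i j) z - int1 (R' i j) z" for i j
    using int_add(1)[OF R[of i j] bounded_borel_uminus[OF R'[of i j]] z] int_cmult(1)[of "-1" "R' i j" z] by simp
  note E = this
  have "Pf (\<lambda>i j z. R i j z - R' i j z) l z = Pf R l z - Pf R' l z" for l
    unfolding Pf_def E sum_2 by (simp add: algebra_simps)
  note E2 = this
  have "Nf (\<lambda>i j z. R i j z - R' i j z) i j z = Nf R i j z - Nf R' i j z" for i j
    unfolding Nf_def E2 sum_2 by (simp add: algebra_simps)
  note E3 = this
  show ?thesis unfolding Sf_def Mf_def E3 sum_2 by (simp add: algebra_simps)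
qed

lemma Sf_cong:
  assumes z: "z \<in> unit_square" and "\<And>i j y. y \<in> unit_square \<Longrightarrow> R i j y = R' i j y"
  shows "Sf R k l z = Sf R' k l z"
proof -
  have "Pf R l z = Pf R' l z" for l
    unfolding Pf_def using int1_cong[OF z assms(2)] by simp
  then have "Nf R i j z = Nf R' i j z" for i j by (simp add: Nf_def assms(2)[OF z])
  then show ?thesis by (simp add: Sf_def Mf_def)
qed

text \<open>The Piola pull-back of the trace correction, see \<open>T_corr_pull\<close>; the diagonal matrix \<open>Dc S\<close> is what
  \<open>Y2_tilde\<close> subtracts from \<open>S\<close> before the inverse of \<open>Y2\<close> is applied.\<close>

definition tc :: "(real^2 \<Rightarrow> real^2^2) \<Rightarrow> 2 \<Rightarrow> real^2 \<Rightarrow> real" where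
  "tc S m z = (\<Sum>i\<in>UNIV. partial 1 (jb m i) z * S (pt 0 (z $ 2)) $ i $ 1)"

definition Dc :: "(real^2 \<Rightarrow> real^2^2) \<Rightarrow> real^2 \<Rightarrow> real^2^2" where
  "Dc S = (\<lambda>z. mat22 (int1 (\<lambda>y. Y3 F (T_corr F S) y $ 1) z) 0 0 (int2 (\<lambda>y. Y3 F (T_corr F S) y $ 2) z))"

lemma tc_bounded_borel: "regular_field S d e \<Longrightarrow> bounded_borel (tc S m)"
  unfolding tc_def[abs_def] regular_field_def by (intro bounded_borel_sum bounded_borel_mult bounded_C1_D(2)[OF jb_bounded_C1]) auto

lemma Y3_T_corr:
  assumes S: "regular_field S d e" and z: "z \<in> unit_square"
  shows "Y3 F (T_corr F S) z $ i = Pi_op jt (tc S) i z"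
proof -
  have t: "dJ y * T_corr F S (F y) $ k = tc S k y" if "y \<in> unit_square" for k y
    unfolding tc_def by (rule T_corr_pull[OF that])
  have "bounded_borel (\<lambda>y. dJ y * T_corr F S (F y) $ k)" for k
    by (rule bounded_borel_cong[THEN iffD2, OF t tc_bounded_borel[OF S]])
  then have "Y3 F (T_corr F S) z $ i = Pi_op jt (\<lambda>k y. dJ y * T_corr F S (F y) $ k) i z"
    by (intro Y3_nth z bounded_borel_line_integrable1)
  also have "\<dots> = Pi_op jt (tc S) i z" by (rule Pi_op_cong[OF z t])
  finally show ?thesis .
qed

lemma Dc_nth:
  assumes S: "regular_field S d e" and z: "z \<in> unit_square"
  shows "Dc S z $ 1 $ 1 = (\<Sum>k\<in>UNIV. jt 1 k z * int1 (tc S k) z)"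
    and "Dc S z $ 1 $ 2 = 0" "Dc S z $ 2 $ 1 = 0" "Dc S z $ 2 $ 2 = int2 (Pi_op jt (tc S) 2) z"
proof -
  have "int1 (\<lambda>y. Y3 F (T_corr F S) y $ 1) z = int1 (Pi_op jt (tc S) 1) z"
    by (rule int1_cong[OF z Y3_T_corr[OF S]])
  also have "\<dots> = (\<Sum>k\<in>UNIV. jt 1 k z * int1 (tc S k) z)"
    by (rule int1_Pi_op(2)[OF jt_bounded_C1 z bounded_borel_line_integrable1[OF tc_bounded_borel[OF S] z]])
  finally show "Dc S z $ 1 $ 1 = (\<Sum>k\<in>UNIV. jt 1 k z * int1 (tc S k) z)" by (simp add: Dc_def)
  show "Dc S z $ 1 $ 2 = 0" "Dc S z $ 2 $ 1 = 0" by (simp_all add: Dc_def)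
  show "Dc S z $ 2 $ 2 = int2 (Pi_op jt (tc S) 2) z"
    using int2_cong[OF z Y3_T_corr[OF S]] by (simp add: Dc_def)
qed

lemma Dc_bounded_borel: assumes S: "regular_field S d e" shows "bounded_borel (\<lambda>z. Dc S z $ i $ j)"
proof -
  have "bounded_borel (\<lambda>z. \<Sum>k\<in>UNIV. jt 1 k z * int1 (tc S k) z)"
    by (intro bounded_borel_sum bounded_borel_mult bounded_borel_int tc_bounded_borel[OF S] bounded_C1_D(1)[OF jt_bounded_C1])
  then have 1: "bounded_borel (\<lambda>z. Dc S z $ 1 $ 1)"
    using bounded_borel_cong[of "\<lambda>z. Dc S z $ 1 $ 1" "\<lambda>z. \<Sum>k\<in>UNIV. jt 1 k z * int1 (tc S k) z", OF Dc_nth(1)[OF S]] by blast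
  have "bounded_borel (int2 (Pi_op jt (tc S) 2))"
    by (intro bounded_borel_int bounded_borel_Pi_op jt_bounded_C1 tc_bounded_borel[OF S])
  then have 2: "bounded_borel (\<lambda>z. Dc S z $ 2 $ 2)"
    using bounded_borel_cong[of "\<lambda>z. Dc S z $ 2 $ 2" "int2 (Pi_op jt (tc S) 2)", OF Dc_nth(4)[OF S]] by blast
  have 3: "bounded_borel (\<lambda>z. Dc S z $ 1 $ 2)" "bounded_borel (\<lambda>z. Dc S z $ 2 $ 1)"
    by (auto simp: Dc_def)
  show ?thesis using 1 2 3 exhaust_2[of i] exhaust_2[of j] by auto
qed

abbreviation Rc :: "(real^2 \<Rightarrow> real^2^2) \<Rightarrow> 2 \<Rightarrow> 2 \<Rightarrow> real^2 \<Rightarrow> real" where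
  "Rc S i j z \<equiv> S z $ i $ j - Dc S z $ i $ j"

text \<open>The explicit inverse of \<open>Y2\<close> is linear, so the two terms of \<open>Y2_tilde\<close> combine to the inverse applied to the
  corrected field \<open>Rc S\<close>.\<close>

lemma Y2_tilde_spec:
  assumes S: "regular_field S d e"
  shows "Y2_tilde F S \<in> L2_sym \<Omega>"
    and "AE z in lborel. z \<in> unit_square \<longrightarrow> (\<forall>k l. Y2_tilde F S (F z) $ k $ l = Sf (Rc S) k l z)"
proof -
  have SB: "bounded_borel (\<lambda>z. S z $ i $ j)" for i j using S by (simp add: regular_field_def)
  have Ss: "S z $ 1 $ 2 = S z $ 2 $ 1" if "z \<in> unit_square" for z using S that by (simp add: regular_field_def)
  have Ds: "Dc S z $ 1 $ 2 = Dc S z $ 2 $ 1" if "z \<in> unit_square" for z using Dc_nth(2,3)[OF S that] by simp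
  have A: "Y2_inv F S \<in> L2_sym \<Omega>"
    "AE z in lborel. z \<in> unit_square \<longrightarrow> (\<forall>k l. Y2_inv F S (F z) $ k $ l = Sf (\<lambda>i j z. S z $ i $ j) k l z)"
    by (rule Y2_inv_spec[OF SB]; rule Ss; assumption)+
  have B: "Y2_inv F (Dc S) \<in> L2_sym \<Omega>"
    "AE z in lborel. z \<in> unit_square \<longrightarrow> (\<forall>k l. Y2_inv F (Dc S) (F z) $ k $ l = Sf (\<lambda>i j z. Dc S z $ i $ j) k l z)"
    by (rule Y2_inv_spec[OF Dc_bounded_borel[OF S]]; rule Ds; assumption)+
  have eq: "Y2_tilde F S = (\<lambda>x. Y2_inv F S x - Y2_inv F (Dc S) x)"
    by (auto simp: Y2_tilde_def Dc_def fun_eq_iff)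
  have AL: "Y2_inv F S \<in> L2 \<Omega>" and BL: "Y2_inv F (Dc S) \<in> L2 \<Omega>" using A(1) B(1) by (simp_all add: L2_sym_def)
  have "(\<lambda>x. Y2_inv F S x - Y2_inv F (Dc S) x) \<in> L2 \<Omega>"
  proof -
    have m: "(\<lambda>x. indicator \<Omega> x *\<^sub>R Y2_inv F S x) \<in> borel_measurable borel" "(\<lambda>x. indicator \<Omega> x *\<^sub>R Y2_inv F (Dc S) x) \<in> borel_measurable borel"
      and i: "integrable lborel (\<lambda>x. indicator \<Omega> x *\<^sub>R (norm (Y2_inv F S x))\<^sup>2)" "integrable lborel (\<lambda>x. indicator \<Omega> x *\<^sub>R (norm (Y2_inv F (Dc S) x))\<^sup>2)"
      using AL BL by (auto simp: L2_def set_borel_measurable_def set_integrable_def)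
    have m3: "(\<lambda>x. indicator \<Omega> x *\<^sub>R Y2_inv F S x - indicator \<Omega> x *\<^sub>R Y2_inv F (Dc S) x) \<in> borel_measurable borel"
      using m by measurable
    have "integrable lborel (\<lambda>x. 2 * (indicator \<Omega> x *\<^sub>R (norm (Y2_inv F S x))\<^sup>2) + 2 * (indicator \<Omega> x *\<^sub>R (norm (Y2_inv F (Dc S) x))\<^sup>2))"
      using i by simp
    then have "integrable lborel (\<lambda>x. (norm (indicator \<Omega> x *\<^sub>R Y2_inv F S x - indicator \<Omega> x *\<^sub>R Y2_inv F (Dc S) x))\<^sup>2)"
    proof (rule Bochner_Integration.integrable_bound)
      show "(\<lambda>x. (norm (indicator \<Omega> x *\<^sub>R Y2_inv F S x - indicator \<Omega> x *\<^sub>R Y2_inv F (Dc S) x))\<^sup>2) \<in> borel_measurable lborel"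
        using m3 by measurable
      have "(norm (a - b))\<^sup>2 \<le> 2 * (norm a)\<^sup>2 + 2 * (norm b)\<^sup>2" for a b :: "real^2^2"
      proof -
        have "(norm (a - b))\<^sup>2 \<le> (norm a + norm b)\<^sup>2" by (intro power_mono norm_triangle_ineq4) simp
        moreover have "0 \<le> (norm a - norm b)\<^sup>2" by simp
        ultimately show ?thesis by (simp add: power2_sum power2_diff)
      qed
      then show "AE x in lborel. norm ((norm (indicator \<Omega> x *\<^sub>R Y2_inv F S x - indicator \<Omega> x *\<^sub>R Y2_inv F (Dc S) x))\<^sup>2)
         \<le> norm (2 * (indicator \<Omega> x *\<^sub>R (norm (Y2_inv F S x))\<^sup>2) + 2 * (indicator \<Omega> x *\<^sub>R (norm (Y2_inv F (Dc S) x))\<^sup>2))"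
        by (intro AE_I2) (simp add: indicator_def)
    qed
    moreover have "(\<lambda>x. (norm (indicator \<Omega> x *\<^sub>R Y2_inv F S x - indicator \<Omega> x *\<^sub>R Y2_inv F (Dc S) x))\<^sup>2)
        = (\<lambda>x. indicator \<Omega> x *\<^sub>R (norm (Y2_inv F S x - Y2_inv F (Dc S) x))\<^sup>2)"
      by (auto simp: indicator_def)
    ultimately show ?thesis using m3 by (simp add: L2_def set_borel_measurable_def set_integrable_def scaleR_diff_right)
  qed
  moreover have "transpose (Y2_inv F S x - Y2_inv F (Dc S) x) = Y2_inv F S x - Y2_inv F (Dc S) x" if "x \<in> \<Omega>" for x
  proof -
    have "transpose (Y2_inv F S x) = Y2_inv F S x" "transpose (Y2_inv F (Dc S) x) = Y2_inv F (Dc S) x"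
      using A(1) B(1) that unfolding L2_sym_def sym_matrices_def by blast+
    then show ?thesis by (simp add: transpose_def vec_eq_iff)
  qed
  ultimately show "Y2_tilde F S \<in> L2_sym \<Omega>" unfolding eq L2_sym_def sym_matrices_def by blast
  show "AE z in lborel. z \<in> unit_square \<longrightarrow> (\<forall>k l. Y2_tilde F S (F z) $ k $ l = Sf (Rc S) k l z)"
    using A(2) B(2)
  proof eventually_elim
    case (elim z)
    then show ?case
      using Sf_diff[of "\<lambda>i j z. S z $ i $ j" "\<lambda>i j z. Dc S z $ i $ j", OF SB Dc_bounded_borel[OF S]] by (simp add: eq)
  qed
qed

text \<open>After a change of variables this says that the divergence of \<open>Y2_tilde F S\<close> is the field with Piola
  pull-back \<open>Pi_op jb (d + e)\<close>, that is \<open>Y3_inv F\<close> of the divergence of \<open>S\<close>. The columns of \<open>Mf\<close> are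
  \<open>jb R\<^sub>1 - (partial 2 jb) Q\<close> and \<open>jb R\<^sub>2 + (partial 1 jb) Q\<close>, where \<open>R\<^sub>1\<close> and \<open>R\<^sub>2\<close> are those of
  \<open>Rc S\<close> and \<open>Q\<close> is the antiderivative of \<open>R\<^sub>2\<close>. So formally \<open>M\<close> is the rotated gradient of \<open>jb Q\<close>, which is
  divergence free, plus \<open>jb (R\<^sub>1 + partial 2 Q)\<close> in the first column. In \<open>R\<^sub>1 + partial 2 Q\<close> the
  antiderivatives of \<open>d\<close> and of \<open>e\<close> add up to that of \<open>d + e\<close>, which yields \<open>Pi_op jb (d + e)\<close>
  after multiplication by \<open>jb\<close> and differentiation. What is left is the
  contribution \<open>(partial 1 jb) S(0,\<cdot>)\<close> of the edge values of \<open>S\<close>; it is \<open>tc S\<close>, and the correction cancels it.\<close>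

lemma weak_divergence_square:
  assumes S: "regular_field S d e"
    and \<psi>: "ctest K \<psi>" "\<And>j. C1_on unit_square (partial j \<psi>)"
  shows "square_integral (\<lambda>z. \<Sum>j\<in>UNIV. Mf (Rc S) k j z * partial j \<psi> z) = - square_integral (\<lambda>z. Pi_op jb (\<lambda>i z. d i z + e i z) k z * \<psi> z)"
proof -
  let ?R = "Rc S"
  define N where "N m = int1 (tc S m)" for m
  define a where "a i z = S (pt 0 (z $ 2)) $ i $ 1" for i and z :: "real^2"
  define f where "f i z = d i z + e i z" for i z
  define W where "W i z = a i z + int1 (f i) z" for i z
  define q where "q i z = int1 (e i) z - (if i = 2 then (\<Sum>k\<in>UNIV. jt 2 k z * N k z) else 0)" for i z
  define Q where "Q i = int1 (?R i 2)" for i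
  have SB: "bounded_borel (\<lambda>z. S z $ i $ j)" "bounded_borel (d i)" "bounded_borel (e i)" "bounded_borel (a i)" for i j
    using S by (auto simp: regular_field_def a_def[abs_def])
  have fB: "bounded_borel (f i)" for i unfolding f_def[abs_def] by (intro bounded_borel_add SB)
  have RB: "bounded_borel (?R i j)" for i j by (intro bounded_borel_diff SB Dc_bounded_borel[OF S])
  have QB: "bounded_borel (Q i)" for i unfolding Q_def by (intro bounded_borel_int RB)
  have NB: "bounded_borel (N m)" for m unfolding N_def by (intro bounded_borel_int tc_bounded_borel[OF S])
  have WB: "bounded_borel (W i)" for i unfolding W_def[abs_def] by (intro bounded_borel_add SB bounded_borel_int fB)
  have sB: "bounded_borel (\<lambda>z. \<Sum>k\<in>UNIV. jt i k z * N k z)" for i by (intro bounded_borel_sum bounded_borel_mult NB bounded_C1_D(1)[OF jt_bounded_C1])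
  have qB: "bounded_borel (q i)" for i
    using bounded_borel_diff[OF bounded_borel_int(1)[OF SB(3)[of i]] sB[of 2]] bounded_borel_int(1)[OF SB(3)[of i]] unfolding q_def[abs_def]
    by (cases "i = 2") simp_all
  have bb: "bounded_borel (jb k i)" "bounded_borel (partial j (jb k i))" "C1_on unit_square (jb k i)" for i j by (rule bounded_C1_D[OF jb_bounded_C1])+
  note pB = ctest_bounded_borel[OF \<psi>(1)] ctest_bounded_borel(2)[OF ctest_partial[OF \<psi>]]
  have dif: "jb k i differentiable (at z)" "\<psi> differentiable (at z)" "partial j \<psi> differentiable (at z)"
    if "z \<in> unit_square" for z i j
    using bounded_C1_D(4)[OF jb_bounded_C1 that] \<psi> that by (auto simp: ctest_def C1_on_def)
  \<comment> \<open>\<open>Q\<close> as an antiderivative in the second direction\<close>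
  have Q2: "\<exists>C. bounded_borel (\<lambda>z. C (z $ 1)) \<and> (\<forall>z\<in>unit_square. Q i z = C (z $ 1) + int2 (q i) z)" for i
  proof -
    obtain c where c: "bounded_borel (\<lambda>z. c (z $ 1))" "\<And>z. z \<in> unit_square \<Longrightarrow> S z $ i $ 2 = c (z $ 1) + int2 (e i) z"
      using S unfolding regular_field_def by blast
    define C where "C x = (LINT t:{0<..<x}|lborel. c t)" for x
    have C: "int1 (\<lambda>z. c (z $ 1)) = (\<lambda>z. C (z $ 1))" by (simp add: int1_def[abs_def] C_def)
    define D where "D z = (if i = 2 then int2 (Pi_op jt (tc S) 2) z else 0)" for z
    have DB: "bounded_borel D" unfolding D_def[abs_def]
      using bounded_borel_int(2)[OF bounded_borel_Pi_op[of jt "tc S" 2, OF jt_bounded_C1 tc_bounded_borel[OF S]]] by (cases "i = 2") auto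
    have Dz: "Dc S z $ i $ 2 = D z" if "z \<in> unit_square" for z
      using exhaust_2[of i] Dc_nth[OF S that] by (auto simp: D_def)
    have "Q i z = C (z $ 1) + int2 (q i) z" if z: "z \<in> unit_square" for z
    proof -
      have "Q i z = int1 (\<lambda>z. (c (z $ 1) + int2 (e i) z) + - 1 * D z) z"
        unfolding Q_def by (rule int1_cong[OF z]) (simp add: c(2) Dz)
      also have "\<dots> = C (z $ 1) + int1 (int2 (e i)) z - int1 D z"
        using int_add(1)[OF bounded_borel_add[OF c(1) bounded_borel_int(2)[OF SB(3)]] bounded_borel_mult[OF bounded_borel_const DB] z, of i "-1"]
          int_add(1)[OF c(1) bounded_borel_int(2)[OF SB(3)] z, of i] C int_cmult(1)[of "-1" D z] by simp
      also have "int1 (int2 (e i)) z = int2 (int1 (e i)) z" by (rule int1_int2_commute[OF SB(3) z])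
      also have "int1 D z = int2 (\<lambda>z. if i = 2 then (\<Sum>k\<in>UNIV. jt 2 k z * N k z) else 0) z"
      proof (cases "i = 2")
        case True
        then have "int1 D z = int1 (int2 (Pi_op jt (tc S) 2)) z" by (simp add: D_def[abs_def])
        also have "\<dots> = int2 (int1 (Pi_op jt (tc S) 2)) z"
          by (rule int1_int2_commute[OF bounded_borel_Pi_op z]) (intro jt_bounded_C1 tc_bounded_borel[OF S])+
        also have "\<dots> = int2 (\<lambda>z. \<Sum>k\<in>UNIV. jt 2 k z * N k z) z"
          unfolding N_def
          by (rule int2_cong[OF z]) (rule int1_Pi_op(2)[OF jt_bounded_C1 _ bounded_borel_line_integrable1[OF tc_bounded_borel[OF S]]])
        finally show ?thesis using True by simp
      next
        case False
        then show ?thesis by (simp add: D_def[abs_def] int1_def int2_def set_lebesgue_integral_def)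
      qed
      finally have "Q i z = C (z $ 1) + int2 (int1 (e i)) z - int2 (\<lambda>z. if i = 2 then (\<Sum>k\<in>UNIV. jt 2 k z * N k z) else 0) z" .
      moreover have "int2 (int1 (e i)) z - int2 (\<lambda>z. if i = 2 then (\<Sum>k\<in>UNIV. jt 2 k z * N k z) else 0) z = int2 (q i) z"
      proof -
        have X: "bounded_borel (\<lambda>z. if i = 2 then (\<Sum>k\<in>UNIV. jt 2 k z * N k z) else 0)" using sB[of 2] by (cases "i = 2") auto
        show ?thesis
          using int_add(2)[OF bounded_borel_int(1)[OF SB(3)] bounded_borel_mult[OF bounded_borel_const X] z, of i "-1"]
            int_cmult(2)[of "-1" "\<lambda>z. if i = 2 then (\<Sum>k\<in>UNIV. jt 2 k z * N k z) else 0" z]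
          by (simp add: q_def[abs_def])
      qed
      ultimately show ?thesis by simp
    qed
    moreover have "bounded_borel (\<lambda>z. C (z $ 1))" using bounded_borel_int(1)[OF c(1)] unfolding C .
    ultimately show ?thesis by blast
  qed
  \<comment> \<open>In the first row the correction enters through the first column, in the second row through
    q, the derivative of Q in the second direction; in total it is minus jt N in both.\<close>
  have R1q: "?R i 1 z + q i z = W i z - (\<Sum>k\<in>UNIV. jt i k z * N k z)" if z: "z \<in> unit_square" for i z
  proof -
    have "S z $ i $ 1 = a i z + int1 (d i) z" using S z by (auto simp: regular_field_def a_def)
    moreover have "int1 (f i) z = int1 (d i) z + int1 (e i) z"
      unfolding f_def[abs_def] by (rule int_add(1)[OF SB(2,3) z])
    ultimately show ?thesis
      using exhaust_2[of i] Dc_nth(1,3)[OF S z] by (auto simp: W_def q_def N_def)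
  qed
  \<comment> \<open>Four integrands with integral zero, by integration by parts: A and B move the two derivatives
    of the rotated gradient of jb Q to the test function, C treats the antiderivative W of d + e with
    the edge values, D the correction N. Their combination is the claim, point by point.\<close>
  define A where "A i z = Q i z * partial 1 (\<lambda>y. jb k i y * partial 2 \<psi> y) z + ?R i 2 z * (jb k i z * partial 2 \<psi> z)" for i z
  define B where "B i z = Q i z * partial 2 (\<lambda>y. jb k i y * partial 1 \<psi> y) z + q i z * (jb k i z * partial 1 \<psi> z)" for i z
  define C where "C i z = W i z * partial 1 (\<lambda>y. jb k i y * \<psi> y) z + f i z * (jb k i z * \<psi> z)" for i z
  define D where "D z = N k z * partial 1 \<psi> z + tc S k z * \<psi> z" for z
  note ct = ctest_mult[OF bb(3) \<psi>(1)] ctest_mult[OF bb(3) ctest_partial[OF \<psi>]]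
  have AB: "bounded_borel (A i)" for i unfolding A_def[abs_def] by (intro bounded_borel_add bounded_borel_mult QB RB ctest_bounded_borel[OF ct(2)])
  have BB: "bounded_borel (B i)" for i unfolding B_def[abs_def] by (intro bounded_borel_add bounded_borel_mult QB qB ctest_bounded_borel[OF ct(2)])
  have CB: "bounded_borel (C i)" for i unfolding C_def[abs_def] by (intro bounded_borel_add bounded_borel_mult WB fB ctest_bounded_borel[OF ct(1)])
  have DB: "bounded_borel D" unfolding D_def[abs_def] by (intro bounded_borel_add bounded_borel_mult NB tc_bounded_borel[OF S] pB)
  have A0: "square_integral (A i) = 0" for i
  proof -
    have "square_integral (\<lambda>z. Q i z * partial 1 (\<lambda>y. jb k i y * partial 2 \<psi> y) z) = - square_integral (\<lambda>z. ?R i 2 z * (jb k i z * partial 2 \<psi> z))"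
      using ibp1[OF ct(2)[of i 2] RB[of i 2] bounded_borel_const[of 0]] by (simp add: Q_def)
    then show ?thesis unfolding A_def
      by (simp add: square_integral_add[OF bounded_borel_mult[OF QB ctest_bounded_borel(2)[OF ct(2)]] bounded_borel_mult[OF RB ctest_bounded_borel(1)[OF ct(2)]]])
  qed
  have B0: "square_integral (B i) = 0" for i
  proof -
    obtain c where c: "bounded_borel (\<lambda>z. c (z $ 1))" "\<And>z. z \<in> unit_square \<Longrightarrow> Q i z = c (z $ 1) + int2 (q i) z"
      using Q2[of i] by blast
    have "square_integral (\<lambda>z. Q i z * partial 2 (\<lambda>y. jb k i y * partial 1 \<psi> y) z) = square_integral (\<lambda>z. (c (z $ 1) + int2 (q i) z) * partial 2 (\<lambda>y. jb k i y * partial 1 \<psi> y) z)"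
      by (rule square_integral_cong) (simp add: c(2))
    also have "\<dots> = - square_integral (\<lambda>z. q i z * (jb k i z * partial 1 \<psi> z))"
      by (rule ibp2[OF ct(2)[of i 1] qB[of i] c(1)])
    finally show ?thesis unfolding B_def
      by (simp add: square_integral_add[OF bounded_borel_mult[OF QB ctest_bounded_borel(2)[OF ct(2)]] bounded_borel_mult[OF qB ctest_bounded_borel(1)[OF ct(2)]]])
  qed
  have C0: "square_integral (C i) = 0" for i
  proof -
    have "square_integral (\<lambda>z. W i z * partial 1 (\<lambda>y. jb k i y * \<psi> y) z) = - square_integral (\<lambda>z. f i z * (jb k i z * \<psi> z))"
      using ibp1[OF ct(1)[of i] fB[of i], of "\<lambda>y. S (pt 0 y) $ i $ 1"] SB(4)[of i] by (simp add: W_def a_def[abs_def])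
    then show ?thesis unfolding C_def
      by (simp add: square_integral_add[OF bounded_borel_mult[OF WB ctest_bounded_borel(2)[OF ct(1)]] bounded_borel_mult[OF fB ctest_bounded_borel(1)[OF ct(1)]]])
  qed
  have D0: "square_integral D = 0"
  proof -
    have "square_integral (\<lambda>z. N k z * partial 1 \<psi> z) = - square_integral (\<lambda>z. tc S k z * \<psi> z)"
      using ibp1[OF \<psi>(1) tc_bounded_borel[OF S, of k] bounded_borel_const[of 0]] by (simp add: N_def)
    then show ?thesis unfolding D_def
      by (simp add: square_integral_add[OF bounded_borel_mult[OF NB pB(2)] bounded_borel_mult[OF tc_bounded_borel[OF S] pB(1)]])
  qed
  have LB: "bounded_borel (\<lambda>z. \<Sum>j\<in>UNIV. Mf ?R k j z * partial j \<psi> z)"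
    by (intro bounded_borel_sum bounded_borel_mult bounded_borel_Mf RB pB)
  have PB: "bounded_borel (\<lambda>z. Pi_op jb f k z * \<psi> z)"
    by (intro bounded_borel_mult bounded_borel_Pi_op jb_bounded_C1 fB pB)
  have point: "(\<Sum>j\<in>UNIV. Mf ?R k j z * partial j \<psi> z) + Pi_op jb f k z * \<psi> z = (\<Sum>i\<in>UNIV. (A i z - B i z) + C i z) - D z"
    if z: "z \<in> unit_square" for z
  proof -
    have com: "partial 1 (partial 2 \<psi>) z = partial 2 (partial 1 \<psi>) z"
      using partial_commute[OF open_square z _ \<psi>(2)] \<psi>(1) by (auto simp: ctest_def)
    have Nk: "(\<Sum>i\<in>UNIV. jb k i z * (\<Sum>l\<in>UNIV. jt i l z * N l z)) = N k z"
      by (rule matrix_cancel[OF jt_jb(2)[OF z]])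
    have "(\<Sum>j\<in>UNIV. Mf ?R k j z * partial j \<psi> z)
       = (\<Sum>i\<in>UNIV. (A i z - B i z) + jb k i z * (?R i 1 z + q i z) * partial 1 \<psi> z)"
      unfolding sum_2[of "\<lambda>j. Mf ?R k j z * partial j \<psi> z"] Mf_1[OF z] Mf_2[OF z] Pi_op_def A_def B_def Q_def[symmetric]
        partial_rules(2)[OF dif(1)[OF z] dif(3)[OF z]] com sum_2
      by (simp add: algebra_simps)
    also have "\<dots> = (\<Sum>i\<in>UNIV. (A i z - B i z) + jb k i z * W i z * partial 1 \<psi> z) - N k z * partial 1 \<psi> z"
      unfolding R1q[OF z] Nk[symmetric] sum_2 by (simp add: algebra_simps)
    also have "\<dots> = (\<Sum>i\<in>UNIV. (A i z - B i z) + C i z) - D z - Pi_op jb f k z * \<psi> z"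
      unfolding C_def D_def Pi_op_def W_def tc_def a_def partial_rules(2)[OF dif(1)[OF z] dif(2)[OF z]] sum_2
      by (simp add: algebra_simps)
    finally show ?thesis by simp
  qed
  have "square_integral (\<lambda>z. \<Sum>j\<in>UNIV. Mf ?R k j z * partial j \<psi> z) + square_integral (\<lambda>z. Pi_op jb f k z * \<psi> z)
      = square_integral (\<lambda>z. (\<Sum>i\<in>UNIV. (A i z - B i z) + C i z) - D z)"
    unfolding square_integral_add[OF LB PB, symmetric] by (rule square_integral_cong[OF point])
  also have "\<dots> = (\<Sum>i\<in>UNIV. (square_integral (A i) - square_integral (B i)) + square_integral (C i)) - square_integral D"
  proof -
    have X: "bounded_borel (\<lambda>z. (A i z - B i z) + C i z)" for i by (intro bounded_borel_add bounded_borel_diff AB BB CB)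
    have "square_integral (\<lambda>z. (\<Sum>i\<in>UNIV. (A i z - B i z) + C i z) - D z) = (\<Sum>i\<in>UNIV. square_integral (\<lambda>z. (A i z - B i z) + C i z)) - square_integral D"
      by (subst square_integral_diff[OF bounded_borel_sum DB], rule X, subst square_integral_sum2[OF X X]) simp
    moreover have "square_integral (\<lambda>z. (A i z - B i z) + C i z) = (square_integral (A i) - square_integral (B i)) + square_integral (C i)" for i
      by (simp only: square_integral_add[OF bounded_borel_diff[OF AB BB] CB] square_integral_diff[OF AB BB])
    ultimately show ?thesis by (simp only:)
  qed
  also have "\<dots> = 0" using A0 B0 C0 D0 by simp
  finally show ?thesis unfolding f_def[abs_def] by simp
qed

end

section \<open>Tensor product splines\<close>

lemma bounded_borel_interval_comp: 
  assumes "bounded_borel_interval f" shows "bounded_borel (\<lambda>z. f (z $ 1))" "bounded_borel (\<lambda>z. f (z $ 2))"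
proof -
  obtain C where C: "\<forall>x\<in>{0..1}. \<bar>f x\<bar> \<le> C" and [measurable]: "f \<in> borel_measurable borel"
    using assms by (auto simp: bounded_borel_interval_def)
  have "set_borel_measurable lborel unit_square (\<lambda>z. f (z $ 1))" "set_borel_measurable lborel unit_square (\<lambda>z. f (z $ 2))"
    unfolding set_borel_measurable_def by measurable
  moreover have "\<forall>z\<in>unit_square. \<bar>f (z $ 1)\<bar> \<le> C" "\<forall>z\<in>unit_square. \<bar>f (z $ 2)\<bar> \<le> C"
    using C by (auto simp: mem_square)
  ultimately show "bounded_borel (\<lambda>z. f (z $ 1))" "bounded_borel (\<lambda>z. f (z $ 2))" by (auto simp: bounded_borel_def)
qed

lemma tensor_add:
  assumes "f \<in> tensor_space X Y" "g \<in> tensor_space X Y"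
  shows "(\<lambda>z. f z + g z) \<in> tensor_space X Y"
proof -
  obtain n a b where f: "f = (\<lambda>z. \<Sum>k<(n::nat). a k (z $ 1) * b k (z $ 2))" "\<forall>k<n. a k \<in> X" "\<forall>k<n. b k \<in> Y"
    using assms(1) by (auto simp: tensor_space_def)
  obtain m c d where g: "g = (\<lambda>z. \<Sum>k<(m::nat). c k (z $ 1) * d k (z $ 2))" "\<forall>k<m. c k \<in> X" "\<forall>k<m. d k \<in> Y"
    using assms(2) by (auto simp: tensor_space_def)
  define a' where "a' k = (if k < n then a k else c (k - n))" for k
  define b' where "b' k = (if k < n then b k else d (k - n))" for k
  have "(\<Sum>k<n + m. a' k x * b' k y) = (\<Sum>k<n. a k x * b k y) + (\<Sum>k<m. c k x * d k y)" for x y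
  proof -
    have "(\<Sum>k<n + m. a' k x * b' k y) = (\<Sum>k<n. a' k x * b' k y) + (\<Sum>k<m. a' (n + k) x * b' (n + k) y)"
      by (induction m) (simp_all add: add.assoc)
    then show ?thesis by (simp add: a'_def b'_def)
  qed
  then have "(\<lambda>z. f z + g z) = (\<lambda>z. \<Sum>k<n + m. a' k (z $ 1) * b' k (z $ 2))" by (simp add: f(1) g(1))
  moreover have "\<forall>k<n + m. a' k \<in> X" "\<forall>k<n + m. b' k \<in> Y" using f g by (auto simp: a'_def b'_def)
  ultimately show ?thesis unfolding tensor_space_def by blast
qed

lemma tensor_zero: "(\<lambda>z. 0) \<in> tensor_space X Y"
  unfolding tensor_space_def by (rule CollectI, rule exI[of _ 0]) simp

lemma lint_sum:
  fixes f :: "nat \<Rightarrow> real \<Rightarrow> real"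
  assumes "\<And>k. k < n \<Longrightarrow> set_integrable lborel A (f k)"
  shows "(LINT t:A|lborel. \<Sum>k<n. f k t) = (\<Sum>k<n. LINT t:A|lborel. f k t)"
proof -
  have "(LINT t:A|lborel. \<Sum>k<n. f k t) = (LINT t|lborel. (\<Sum>k<n. indicator A t *\<^sub>R f k t))"
    unfolding set_lebesgue_integral_def scaleR_sum_right ..
  also have "\<dots> = (\<Sum>k<n. LINT t:A|lborel. f k t)"
    unfolding set_lebesgue_integral_def
    by (rule Bochner_Integration.integral_sum) (use assms in \<open>simp add: set_integrable_def\<close>)
  finally show ?thesis .
qed

lemma bounded_borel_interval_integrable: "bounded_borel_interval f \<Longrightarrow> 0 \<le> x \<Longrightarrow> x \<le> 1 \<Longrightarrow> set_integrable lborel {0<..<x} f"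
proof -
  assume "bounded_borel_interval f" "0 \<le> x" "x \<le> 1"
  then obtain C where C: "\<forall>x\<in>{0..1}. \<bar>f x\<bar> \<le> C" and [measurable]: "f \<in> borel_measurable borel"
    by (auto simp: bounded_borel_interval_def)
  show ?thesis unfolding set_integrable_def
    by (rule integrableI_bounded_set[where A="{0<..<x}" and B=C])
       (use C \<open>x \<le> 1\<close> \<open>0 \<le> x\<close> in \<open>auto simp: indicator_def\<close>)
qed

lemma tensor_bounded_borel:
  assumes "f \<in> tensor_space X Y" "\<And>g. g \<in> X \<Longrightarrow> bounded_borel_interval g" "\<And>g. g \<in> Y \<Longrightarrow> bounded_borel_interval g"
  shows "bounded_borel f" "bounded_borel (\<lambda>z. f (pt 0 (z $ 2)))" "bounded_borel (\<lambda>z. f (pt (z $ 1) 0))"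
proof -
  obtain n a b where f: "f = (\<lambda>z. \<Sum>k<(n::nat). a k (z $ 1) * b k (z $ 2))" "\<forall>k<n. a k \<in> X" "\<forall>k<n. b k \<in> Y"
    using assms(1) by (auto simp: tensor_space_def)
  show "bounded_borel f" "bounded_borel (\<lambda>z. f (pt 0 (z $ 2)))" "bounded_borel (\<lambda>z. f (pt (z $ 1) 0))"
    unfolding f(1) vector_2
    by (intro bounded_borel_sum bounded_borel_mult bounded_borel_const bounded_borel_interval_comp assms(2,3); use f in simp)+
qed

lemma spline2_bounded_borel:
  assumes "f \<in> spline_space2 \<psi>1 \<psi>2 q1 q2 s1 s2"
  shows "bounded_borel f" "bounded_borel (\<lambda>z. f (pt 0 (z $ 2)))" "bounded_borel (\<lambda>z. f (pt (z $ 1) 0))"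
  by (rule tensor_bounded_borel[OF assms[unfolded spline_space2_def]]; rule spline_bounded_borel_interval; assumption)+

lemma tensor_int:
  fixes n :: nat
  assumes "\<And>g. g \<in> X \<Longrightarrow> bounded_borel_interval g" "\<And>g. g \<in> Y \<Longrightarrow> bounded_borel_interval g" "\<And>k. k < n \<Longrightarrow> a k \<in> X" "\<And>k. k < n \<Longrightarrow> b k \<in> Y"
    and z: "z \<in> unit_square"
  shows "int1 (\<lambda>z. \<Sum>k<n. a k (z $ 1) * b k (z $ 2)) z = (\<Sum>k<n. (LINT t:{0<..<z $ 1}|lborel. a k t) * b k (z $ 2))"
    and "int2 (\<lambda>z. \<Sum>k<n. a k (z $ 1) * b k (z $ 2)) z = (\<Sum>k<n. a k (z $ 1) * (LINT t:{0<..<z $ 2}|lborel. b k t))"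
proof -
  have z': "0 \<le> z $ 1" "z $ 1 \<le> 1" "0 \<le> z $ 2" "z $ 2 \<le> 1" using z by (auto simp: mem_square)
  have "(LINT t:{0<..<z $ 1}|lborel. \<Sum>k<n. a k t * b k (z $ 2)) = (\<Sum>k<n. LINT t:{0<..<z $ 1}|lborel. a k t * b k (z $ 2))"
    by (rule lint_sum, intro set_integrable_mult_left impI bounded_borel_interval_integrable assms z')
  then show "int1 (\<lambda>z. \<Sum>k<n. a k (z $ 1) * b k (z $ 2)) z = (\<Sum>k<n. (LINT t:{0<..<z $ 1}|lborel. a k t) * b k (z $ 2))"
    by (simp add: int1_def)
  have "(LINT t:{0<..<z $ 2}|lborel. \<Sum>k<n. a k (z $ 1) * b k t) = (\<Sum>k<n. LINT t:{0<..<z $ 2}|lborel. a k (z $ 1) * b k t)"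
    by (rule lint_sum, intro set_integrable_mult_right impI bounded_borel_interval_integrable assms z')
  then show "int2 (\<lambda>z. \<Sum>k<n. a k (z $ 1) * b k (z $ 2)) z = (\<Sum>k<n. a k (z $ 1) * (LINT t:{0<..<z $ 2}|lborel. b k t))"
    by (simp add: int2_def)
qed

text \<open>In each tensor product only the first factor is replaced by its derivative.\<close>

lemma spline2_derivative_1:
  assumes bp: "breakpoints \<psi>1" and s: "-1 \<le> s1" and f: "f \<in> spline_space2 \<psi>1 \<psi>2 (Suc q1) q2 (s1 + 1) s2"
  shows "\<exists>g\<in>spline_space2 \<psi>1 \<psi>2 q1 q2 s1 s2. \<forall>z\<in>unit_square. f z = f (pt 0 (z $ 2)) + int1 g z"
proof -
  obtain n a b where ab: "f = (\<lambda>z. \<Sum>k<(n::nat). a k (z $ 1) * b k (z $ 2))"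
    "\<forall>k<n. a k \<in> spline_space \<psi>1 (Suc q1) (s1 + 1)" "\<forall>k<n. b k \<in> spline_space \<psi>2 q2 s2"
    using f by (auto simp: tensor_space_def spline_space2_def)
  have "\<forall>k. \<exists>g. k < n \<longrightarrow> g \<in> spline_space \<psi>1 q1 s1 \<and> (\<forall>x. 0 \<le> x \<longrightarrow> x \<le> 1 \<longrightarrow> a k x = a k 0 + (LINT t:{0<..<x}|lborel. g t))" (is "\<forall>k. \<exists>g. k < n \<longrightarrow> ?P g k")
  proof
    fix k show "\<exists>g. k < n \<longrightarrow> ?P g k"
    proof (cases "k < n")
      case True
      from spline_derivative[OF bp s ab(2)[rule_format, OF True]] obtain h where "?P h k" by (elim bexE conjE) (rule that, intro conjI; assumption)
      then show ?thesis by blast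
    qed simp
  qed
  from choice[OF this] obtain g where g0: "\<forall>k. k < n \<longrightarrow> ?P (g k) k" by blast
  have g: "\<And>k. k < n \<Longrightarrow> g k \<in> spline_space \<psi>1 q1 s1"
    "\<And>k x. k < n \<Longrightarrow> 0 \<le> x \<Longrightarrow> x \<le> 1 \<Longrightarrow> a k x = a k 0 + (LINT t:{0<..<x}|lborel. g k t)" using g0 by meson+
  let ?h = "\<lambda>z::real^2. \<Sum>k<n. g k (z $ 1) * b k (z $ 2)"
  have "?h \<in> spline_space2 \<psi>1 \<psi>2 q1 q2 s1 s2"
    unfolding spline_space2_def tensor_space_def using g(1) ab(3) by blast
  moreover have "f z = f (pt 0 (z $ 2)) + int1 ?h z" if z: "z \<in> unit_square" for z
  proof -
    have "int1 ?h z = (\<Sum>k<n. (LINT t:{0<..<z $ 1}|lborel. g k t) * b k (z $ 2))"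
      by (rule tensor_int(1)[OF spline_bounded_borel_interval spline_bounded_borel_interval _ _ z]) (use g(1) ab(3) in auto)
    then have "f (pt 0 (z $ 2)) + int1 ?h z = (\<Sum>k<n. (a k 0 + (LINT t:{0<..<z $ 1}|lborel. g k t)) * b k (z $ 2))"
      by (simp add: ab(1) algebra_simps sum.distrib)
    also have "\<dots> = f z" unfolding ab(1)
      by (rule sum.cong) (use z g(2)[of _ "z $ 1"] in \<open>auto simp: mem_square\<close>)
    finally show ?thesis by simp
  qed
  ultimately show ?thesis by blast
qed

lemma spline2_derivative_2:
  assumes bp: "breakpoints \<psi>2" and s: "-1 \<le> s2" and f: "f \<in> spline_space2 \<psi>1 \<psi>2 q1 (Suc q2) s1 (s2 + 1)"
  shows "\<exists>g\<in>spline_space2 \<psi>1 \<psi>2 q1 q2 s1 s2. \<forall>z\<in>unit_square. f z = f (pt (z $ 1) 0) + int2 g z"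
proof -
  obtain n a b where ab: "f = (\<lambda>z. \<Sum>k<(n::nat). a k (z $ 1) * b k (z $ 2))"
    "\<forall>k<n. a k \<in> spline_space \<psi>1 q1 s1" "\<forall>k<n. b k \<in> spline_space \<psi>2 (Suc q2) (s2 + 1)"
    using f by (auto simp: tensor_space_def spline_space2_def)
  have "\<forall>k. \<exists>g. k < n \<longrightarrow> g \<in> spline_space \<psi>2 q2 s2 \<and> (\<forall>x. 0 \<le> x \<longrightarrow> x \<le> 1 \<longrightarrow> b k x = b k 0 + (LINT t:{0<..<x}|lborel. g t))" (is "\<forall>k. \<exists>g. k < n \<longrightarrow> ?P g k")
  proof
    fix k show "\<exists>g. k < n \<longrightarrow> ?P g k"
    proof (cases "k < n")
      case True
      from spline_derivative[OF bp s ab(3)[rule_format, OF True]] obtain h where "?P h k" by (elim bexE conjE) (rule that, intro conjI; assumption)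
      then show ?thesis by blast
    qed simp
  qed
  from choice[OF this] obtain g where g0: "\<forall>k. k < n \<longrightarrow> ?P (g k) k" by blast
  then have g: "\<And>k. k < n \<Longrightarrow> g k \<in> spline_space \<psi>2 q2 s2"
    "\<And>k x. k < n \<Longrightarrow> 0 \<le> x \<Longrightarrow> x \<le> 1 \<Longrightarrow> b k x = b k 0 + (LINT t:{0<..<x}|lborel. g k t)" by blast+
  let ?h = "\<lambda>z::real^2. \<Sum>k<n. a k (z $ 1) * g k (z $ 2)"
  have "?h \<in> spline_space2 \<psi>1 \<psi>2 q1 q2 s1 s2"
    unfolding spline_space2_def tensor_space_def using g(1) ab(2) by blast
  moreover have "f z = f (pt (z $ 1) 0) + int2 ?h z" if z: "z \<in> unit_square" for z
  proof -
    have "int2 ?h z = (\<Sum>k<n. a k (z $ 1) * (LINT t:{0<..<z $ 2}|lborel. g k t))"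
      by (rule tensor_int(2)[OF spline_bounded_borel_interval spline_bounded_borel_interval _ _ z]) (use g(1) ab(2) in auto)
    then have "f (pt (z $ 1) 0) + int2 ?h z = (\<Sum>k<n. a k (z $ 1) * (b k 0 + (LINT t:{0<..<z $ 2}|lborel. g k t)))"
      by (simp add: ab(1) algebra_simps sum.distrib)
    also have "\<dots> = f z" unfolding ab(1)
      by (rule sum.cong) (use z g(2)[of _ "z $ 2"] in \<open>auto simp: mem_square\<close>)
    finally show ?thesis by simp
  qed
  ultimately show ?thesis by blast
qed

text \<open>The vanishing initial values on the edge are recorded because they make the trace correction vanish.\<close>

lemma spline2_antiderivative_1:
  assumes bp: "breakpoints \<psi>1" and s: "-1 \<le> s1" and g: "g \<in> spline_space2 \<psi>1 \<psi>2 q1 q2 s1 s2"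
  shows "\<exists>f\<in>spline_space2 \<psi>1 \<psi>2 (Suc q1) q2 (s1 + 1) s2. (\<forall>y. f (pt 0 y) = 0) \<and> (\<forall>z\<in>unit_square. f z = int1 g z)"
proof -
  obtain n a b where ab: "g = (\<lambda>z. \<Sum>k<(n::nat). a k (z $ 1) * b k (z $ 2))"
    "\<forall>k<n. a k \<in> spline_space \<psi>1 q1 s1" "\<forall>k<n. b k \<in> spline_space \<psi>2 q2 s2"
    using g by (auto simp: tensor_space_def spline_space2_def)
  have "\<forall>k. \<exists>f. k < n \<longrightarrow> f \<in> spline_space \<psi>1 (Suc q1) (s1 + 1) \<and> f 0 = 0 \<and> (\<forall>x. 0 \<le> x \<longrightarrow> x \<le> 1 \<longrightarrow> f x = (LINT t:{0<..<x}|lborel. a k t))" (is "\<forall>k. \<exists>f. k < n \<longrightarrow> ?P f k")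
  proof
    fix k show "\<exists>f. k < n \<longrightarrow> ?P f k"
    proof (cases "k < n")
      case True
      from spline_antiderivative[OF bp s ab(2)[rule_format, OF True]] obtain h where "?P h k" by (elim bexE conjE) (rule that, intro conjI; assumption)
      then show ?thesis by blast
    qed simp
  qed
  from choice[OF this] obtain f where f0: "\<forall>k. k < n \<longrightarrow> ?P (f k) k" by blast
  then have f: "\<And>k. k < n \<Longrightarrow> f k \<in> spline_space \<psi>1 (Suc q1) (s1 + 1)" "\<And>k. k < n \<Longrightarrow> f k 0 = 0"
    "\<And>k x. k < n \<Longrightarrow> 0 \<le> x \<Longrightarrow> x \<le> 1 \<Longrightarrow> f k x = (LINT t:{0<..<x}|lborel. a k t)" by blast+
  let ?h = "\<lambda>z::real^2. \<Sum>k<n. f k (z $ 1) * b k (z $ 2)"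
  have "?h \<in> spline_space2 \<psi>1 \<psi>2 (Suc q1) q2 (s1 + 1) s2"
    unfolding spline_space2_def tensor_space_def using f(1) ab(3) by blast
  moreover have "?h z = int1 g z" if z: "z \<in> unit_square" for z
  proof -
    have "int1 g z = (\<Sum>k<n. (LINT t:{0<..<z $ 1}|lborel. a k t) * b k (z $ 2))"
      unfolding ab(1) by (rule tensor_int(1)[OF spline_bounded_borel_interval spline_bounded_borel_interval _ _ z]) (use ab(2,3) in auto)
    also have "\<dots> = ?h z"
      by (rule sum.cong) (use z f(3)[of _ "z $ 1"] in \<open>auto simp: mem_square\<close>)
    finally show ?thesis by simp
  qed
  moreover have "?h (pt 0 y) = 0" for y unfolding vector_2 by (rule sum.neutral) (simp add: f(2))
  ultimately show ?thesis by (intro bexI[of _ ?h] conjI allI ballI)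
qed

lemma spline2_antiderivative_2:
  assumes bp: "breakpoints \<psi>2" and s: "-1 \<le> s2" and g: "g \<in> spline_space2 \<psi>1 \<psi>2 q1 q2 s1 s2"
  shows "\<exists>f\<in>spline_space2 \<psi>1 \<psi>2 q1 (Suc q2) s1 (s2 + 1). \<forall>z\<in>unit_square. f z = int2 g z"
proof -
  obtain n a b where ab: "g = (\<lambda>z. \<Sum>k<(n::nat). a k (z $ 1) * b k (z $ 2))"
    "\<forall>k<n. a k \<in> spline_space \<psi>1 q1 s1" "\<forall>k<n. b k \<in> spline_space \<psi>2 q2 s2"
    using g by (auto simp: tensor_space_def spline_space2_def)
  have "\<forall>k. \<exists>f. k < n \<longrightarrow> f \<in> spline_space \<psi>2 (Suc q2) (s2 + 1) \<and> (\<forall>x. 0 \<le> x \<longrightarrow> x \<le> 1 \<longrightarrow> f x = (LINT t:{0<..<x}|lborel. b k t))" (is "\<forall>k. \<exists>f. k < n \<longrightarrow> ?P f k")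
  proof
    fix k show "\<exists>f. k < n \<longrightarrow> ?P f k"
    proof (cases "k < n")
      case True
      from spline_antiderivative[OF bp s ab(3)[rule_format, OF True]] obtain h where "?P h k" by (elim bexE conjE) (rule that, intro conjI; assumption)
      then show ?thesis by blast
    qed simp
  qed
  from choice[OF this] obtain f where f0: "\<forall>k. k < n \<longrightarrow> ?P (f k) k" by blast
  then have f: "\<And>k. k < n \<Longrightarrow> f k \<in> spline_space \<psi>2 (Suc q2) (s2 + 1)"
    "\<And>k x. k < n \<Longrightarrow> 0 \<le> x \<Longrightarrow> x \<le> 1 \<Longrightarrow> f k x = (LINT t:{0<..<x}|lborel. b k t)" by blast+
  let ?h = "\<lambda>z::real^2. \<Sum>k<n. a k (z $ 1) * f k (z $ 2)"
  have "?h \<in> spline_space2 \<psi>1 \<psi>2 q1 (Suc q2) s1 (s2 + 1)"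
    unfolding spline_space2_def tensor_space_def using f(1) ab(2) by blast
  moreover have "?h z = int2 g z" if z: "z \<in> unit_square" for z
  proof -
    have "int2 g z = (\<Sum>k<n. a k (z $ 1) * (LINT t:{0<..<z $ 2}|lborel. b k t))"
      unfolding ab(1) by (rule tensor_int(2)[OF spline_bounded_borel_interval spline_bounded_borel_interval _ _ z]) (use ab(2,3) in auto)
    also have "\<dots> = ?h z"
      by (rule sum.cong) (use z f(2)[of _ "z $ 2"] in \<open>auto simp: mem_square\<close>)
    finally show ?thesis by simp
  qed
  ultimately show ?thesis by (intro bexI[of _ ?h] ballI)
qed

section \<open>Square integrable fields\<close>

lemma set_borel_inner:
  fixes f :: "real^2 \<Rightarrow> 'b::euclidean_space"
  assumes "set_borel_measurable lborel A f" "set_borel_measurable lborel A g"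
  shows "set_borel_measurable lborel A (\<lambda>x. f x \<bullet> g x)"
proof -
  have [measurable]: "(\<lambda>x. indicator A x *\<^sub>R f x) \<in> borel_measurable borel" "(\<lambda>x. indicator A x *\<^sub>R g x) \<in> borel_measurable borel"
    using assms by (simp_all add: set_borel_measurable_def)
  have "(\<lambda>x. (indicator A x *\<^sub>R f x) \<bullet> (indicator A x *\<^sub>R g x)) \<in> borel_measurable borel" by measurable
  also have "(\<lambda>x. (indicator A x *\<^sub>R f x) \<bullet> (indicator A x *\<^sub>R g x)) = (\<lambda>x. indicator A x *\<^sub>R (f x \<bullet> g x))"
    by (auto simp: indicator_def)
  finally show ?thesis by (simp add: set_borel_measurable_def)
qed

lemma set_borel_mult:
  fixes f g :: "real^2 \<Rightarrow> real"
  assumes "set_borel_measurable lborel A f" "set_borel_measurable lborel A g"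
  shows "set_borel_measurable lborel A (\<lambda>x. f x * g x)"
  using set_borel_inner[OF assms] by simp

lemma set_borel_add:
  fixes f g :: "real^2 \<Rightarrow> real"
  assumes "set_borel_measurable lborel A f" "set_borel_measurable lborel A g"
  shows "set_borel_measurable lborel A (\<lambda>x. f x + g x)"
  using assms unfolding set_borel_measurable_def by (simp add: distrib_left)

lemma L2_set_borel: "f \<in> L2 U \<Longrightarrow> set_borel_measurable lborel U f"
  by (simp add: L2_def)

lemma set_borel_nth:
  fixes f :: "real^2 \<Rightarrow> 'b::euclidean_space^2"
  assumes "set_borel_measurable lborel A f"
  shows "set_borel_measurable lborel A (\<lambda>x. f x $ i)"
proof -
  have "(\<lambda>v::'b^2. v $ i) \<in> borel_measurable borel"
    by (rule borel_measurable_continuous_onI) (intro continuous_intros)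
  from measurable_compose[OF assms[unfolded set_borel_measurable_def] this]
  show ?thesis by (simp add: set_borel_measurable_def)
qed

lemma lint_ae_eq:
  fixes f g :: "real^2 \<Rightarrow> real"
  assumes "set_borel_measurable lborel U f" "set_borel_measurable lborel U g" "AE x in lborel. x \<in> U \<longrightarrow> f x = g x"
  shows "(LINT x:U|lborel. f x) = (LINT x:U|lborel. g x)"
  unfolding set_lebesgue_integral_def
proof (rule integral_cong_AE)
  show "AE x in lborel. indicator U x *\<^sub>R f x = indicator U x *\<^sub>R g x"
    using assms(3) by eventually_elim (auto simp: indicator_def)
qed (use assms in \<open>auto simp: set_borel_measurable_def\<close>)

lemma L2_inner_ae:
  fixes f :: "real^2 \<Rightarrow> 'b::euclidean_space"
  assumes "f \<in> L2 U" "f' \<in> L2 U" "g \<in> L2 U" "g' \<in> L2 U" "ae_eq U f f'" "ae_eq U g g'"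
  shows "L2_inner U f g = L2_inner U f' g'"
  unfolding L2_inner_def
proof (rule lint_ae_eq)
  show "AE x in lborel. x \<in> U \<longrightarrow> f x \<bullet> g x = f' x \<bullet> g' x"
    using assms(5,6) unfolding ae_eq_def by eventually_elim auto
qed (intro set_borel_inner L2_set_borel assms)+

lemma L2_norm_sq: "(L2_norm U f)\<^sup>2 = L2_inner U f f"
proof -
  have "0 \<le> L2_inner U f f" unfolding L2_inner_def set_lebesgue_integral_def
    by (rule integral_nonneg_AE) (auto simp: indicator_def)
  then show ?thesis by (simp add: L2_norm_def)
qed

lemma L2_norm_ae:
  fixes f :: "real^2 \<Rightarrow> 'b::euclidean_space"
  shows "f \<in> L2 U \<Longrightarrow> f' \<in> L2 U \<Longrightarrow> ae_eq U f f' \<Longrightarrow> L2_norm U f = L2_norm U f'"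
  unfolding L2_norm_def using L2_inner_ae[of f U f' f f'] by simp

lemma ae_eq_refl: "ae_eq U f f" by (simp add: ae_eq_def)

lemma ae_eq_sym: assumes "ae_eq U f g" shows "ae_eq U g f"
  using assms unfolding ae_eq_def by eventually_elim auto

lemma ae_eq_trans: assumes "ae_eq U f g" "ae_eq U g h" shows "ae_eq U f h"
  using assms unfolding ae_eq_def by eventually_elim auto

text \<open>On the whole plane an extension to the closure is the function itself, so smoothness in the sense of
  continuous extensions is ordinary smoothness.\<close>

lemma smooth_C1:
  assumes "\<And>k. Ck_closure k UNIV \<phi>"
  shows "C1_on UNIV \<phi>" "C1_on UNIV (partial i \<phi>)"
proof -
  have c: "continuous_on UNIV f" if "Ck_closure k UNIV f" for k f
    using Ck_closure_extends[OF that] by (auto simp: extends_continuously_def cong: continuous_on_cong)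
  have "C1_on UNIV f" if "Ck_closure (Suc k) UNIV f" for k f
    using that c by (auto simp: C1_on_def)
  note this[of 0] this[of 0 "partial i \<phi>"]
  then show "C1_on UNIV \<phi>" "C1_on UNIV (partial i \<phi>)"
    using assms[of "Suc 0"] assms[of "Suc (Suc 0)"] by auto
qed

lemma test_function_set_borel:
  assumes "\<phi> \<in> test_functions U" "U \<in> sets borel"
  shows "set_borel_measurable lborel U \<phi>" "set_borel_measurable lborel U (partial j \<phi>)"
proof -
  have C: "C1_on UNIV \<phi>" "C1_on UNIV (partial j \<phi>)" using smooth_C1 assms(1) by (auto simp: test_functions_def)
  have [measurable]: "\<phi> \<in> borel_measurable borel" "partial j \<phi> \<in> borel_measurable borel"
    using C1_on_continuous[OF C(1)] C1_on_continuous[OF C(2)] by (auto intro: borel_measurable_continuous_onI)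
  note [measurable] = assms(2)
  show "set_borel_measurable lborel U \<phi>" "set_borel_measurable lborel U (partial j \<phi>)"
    unfolding set_borel_measurable_def by measurable
qed

lemma has_weak_div_ae:
  assumes U: "U \<in> sets borel" and T: "has_weak_div U T d" "T \<in> L2 U" "\<tau> \<in> L2 U" "ae_eq U \<tau> T"
  shows "has_weak_div U \<tau> d"
  unfolding has_weak_div_def
proof (intro conjI ballI allI)
  show "d \<in> L2 U" using T(1) by (simp add: has_weak_div_def)
  fix \<phi> i assume \<phi>: "\<phi> \<in> test_functions U"
  have m: "set_borel_measurable lborel U (\<lambda>x. \<Sum>j\<in>UNIV. t x $ i $ j * partial j \<phi> x)" if "t \<in> L2 U" for t :: "real^2 \<Rightarrow> real^2^2"
    unfolding sum_2 by (intro set_borel_add set_borel_mult set_borel_nth[OF set_borel_nth[OF L2_set_borel[OF that]]] test_function_set_borel[OF \<phi> U])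
  have "(LINT x:U|lborel. \<Sum>j\<in>UNIV. \<tau> x $ i $ j * partial j \<phi> x) = (LINT x:U|lborel. \<Sum>j\<in>UNIV. T x $ i $ j * partial j \<phi> x)"
  proof (rule lint_ae_eq[OF m m])
    show "AE x in lborel. x \<in> U \<longrightarrow> (\<Sum>j\<in>UNIV. \<tau> x $ i $ j * partial j \<phi> x) = (\<Sum>j\<in>UNIV. T x $ i $ j * partial j \<phi> x)"
      using T(4) unfolding ae_eq_def by eventually_elim auto
  qed (rule T)+
  then show "(LINT x:U|lborel. \<Sum>j\<in>UNIV. \<tau> x $ i $ j * partial j \<phi> x) = - (LINT x:U|lborel. d x $ i * \<phi> x)"
    using T(1) \<phi> by (simp add: has_weak_div_def)
qed

lemma weak_div_ae:
  assumes "open U" "bounded U" "has_weak_div U \<tau> d"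
  shows "weak_div U \<tau> \<in> L2 U" "ae_eq U (weak_div U \<tau>) d"
proof -
  have "has_weak_div U \<tau> (weak_div U \<tau>)" unfolding weak_div_def by (rule someI[of "has_weak_div U \<tau>", OF assms(3)])
  then show "weak_div U \<tau> \<in> L2 U" "ae_eq U (weak_div U \<tau>) d"
    using weak_div_unique[OF assms(1,2) _ assms(3)] by (auto simp: has_weak_div_def)
qed

section \<open>Bounded operators on the unit square\<close>

abbreviation square_norm :: "(real^2 \<Rightarrow> real) \<Rightarrow> real" where
  "square_norm f \<equiv> square_integral (\<lambda>z. (f z)\<^sup>2)"

lemma square_norm_bounded_borel: "bounded_borel f \<Longrightarrow> bounded_borel (\<lambda>z. (f z)\<^sup>2)"
  using bounded_borel_mult[of f f] by (simp add: power2_eq_square)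

lemma square_integral_mono: "bounded_borel f \<Longrightarrow> bounded_borel g \<Longrightarrow> (\<And>z. z \<in> unit_square \<Longrightarrow> f z \<le> g z) \<Longrightarrow> square_integral f \<le> square_integral g"
  by (rule set_integral_mono[OF bounded_borel_integrable bounded_borel_integrable])

lemma square_norm_nonneg: "0 \<le> square_norm f"
  unfolding set_lebesgue_integral_def by (rule integral_nonneg_AE) (auto simp: indicator_def)

text \<open>Bounds in the square norm for the explicit formulas. The constant \<open>C\<close> is chosen before the argument \<open>w\<close>, so it
  only depends on the geometry; this is the reason why the stability constants do not depend on the mesh.\<close>

definition bounded_op :: "((2 \<Rightarrow> real^2 \<Rightarrow> real) \<Rightarrow> real^2 \<Rightarrow> real) \<Rightarrow> bool" where
  "bounded_op X \<longleftrightarrow> (\<exists>C\<ge>0. \<forall>w. (\<forall>k. bounded_borel (w k)) \<longrightarrow> bounded_borel (X w) \<and> square_norm (X w) \<le> C * (square_norm (w 1) + square_norm (w 2)))"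

lemma bounded_op_proj: "bounded_op (\<lambda>w. w k)"
proof -
  have "square_norm (w k) \<le> 1 * (square_norm (w 1) + square_norm (w 2))" for w :: "2 \<Rightarrow> real^2 \<Rightarrow> real"
    using exhaust_2[of k] square_norm_nonneg[of "w 1"] square_norm_nonneg[of "w 2"] by auto
  then show ?thesis unfolding bounded_op_def by (intro exI[of _ 1]) auto
qed

lemma bounded_op_zero: "bounded_op (\<lambda>w z. 0)"
  unfolding bounded_op_def by (intro exI[of _ 0]) (auto simp: set_lebesgue_integral_def)

lemma bounded_op_int: assumes "bounded_op X" shows "bounded_op (\<lambda>w. int1 (X w))" "bounded_op (\<lambda>w. int2 (X w))"
proof -
  obtain C where C: "C \<ge> 0" "\<And>w. (\<forall>k. bounded_borel (w k)) \<Longrightarrow> bounded_borel (X w) \<and> square_norm (X w) \<le> C * (square_norm (w 1) + square_norm (w 2))"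
    using assms by (auto simp: bounded_op_def)
  have "bounded_borel (int1 (X w)) \<and> square_norm (int1 (X w)) \<le> C * (square_norm (w 1) + square_norm (w 2))"
    "bounded_borel (int2 (X w)) \<and> square_norm (int2 (X w)) \<le> C * (square_norm (w 1) + square_norm (w 2))" if "\<forall>k. bounded_borel (w k)" for w
    using C(2)[OF that] bounded_borel_int[of "X w"] int_L2_bound[of "X w"] by linarith+
  then show "bounded_op (\<lambda>w. int1 (X w))" "bounded_op (\<lambda>w. int2 (X w))"
    unfolding bounded_op_def using C(1) by (intro exI[of _ C] conjI allI impI; simp)+
qed

lemma bounded_op_add: assumes "bounded_op X" "bounded_op Y" shows "bounded_op (\<lambda>w z. X w z + Y w z)"
proof -
  obtain C where C: "C \<ge> 0" "\<And>w. (\<forall>k. bounded_borel (w k)) \<Longrightarrow> bounded_borel (X w) \<and> square_norm (X w) \<le> C * (square_norm (w 1) + square_norm (w 2))"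
    using assms(1) by (auto simp: bounded_op_def)
  obtain D where D: "D \<ge> 0" "\<And>w. (\<forall>k. bounded_borel (w k)) \<Longrightarrow> bounded_borel (Y w) \<and> square_norm (Y w) \<le> D * (square_norm (w 1) + square_norm (w 2))"
    using assms(2) by (auto simp: bounded_op_def)
  have "bounded_borel (\<lambda>z. X w z + Y w z) \<and> square_norm (\<lambda>z. X w z + Y w z) \<le> (2 * C + 2 * D) * (square_norm (w 1) + square_norm (w 2))"
    if w: "\<forall>k. bounded_borel (w k)" for w
  proof
    have X: "bounded_borel (X w)" "square_norm (X w) \<le> C * (square_norm (w 1) + square_norm (w 2))" and Y: "bounded_borel (Y w)" "square_norm (Y w) \<le> D * (square_norm (w 1) + square_norm (w 2))"
      using C(2)[OF w] D(2)[OF w] by auto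
    show b: "bounded_borel (\<lambda>z. X w z + Y w z)" by (intro bounded_borel_add X Y)
    have "square_norm (\<lambda>z. X w z + Y w z) \<le> square_integral (\<lambda>z. 2 * (X w z)\<^sup>2 + 2 * (Y w z)\<^sup>2)"
    proof (rule square_integral_mono[OF square_norm_bounded_borel[OF b]])
      show "bounded_borel (\<lambda>z. 2 * (X w z)\<^sup>2 + 2 * (Y w z)\<^sup>2)" by (intro bounded_borel_add bounded_borel_mult bounded_borel_const square_norm_bounded_borel X Y)
      fix z
      have "0 \<le> (X w z - Y w z)\<^sup>2" by simp
      then show "(X w z + Y w z)\<^sup>2 \<le> 2 * (X w z)\<^sup>2 + 2 * (Y w z)\<^sup>2"
        by (simp add: power2_sum power2_diff)
    qed
    also have "\<dots> = 2 * square_norm (X w) + 2 * square_norm (Y w)"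
      by (simp add: square_integral_add[OF bounded_borel_mult[OF bounded_borel_const square_norm_bounded_borel[OF X(1)]] bounded_borel_mult[OF bounded_borel_const square_norm_bounded_borel[OF Y(1)]]])
    also have "\<dots> \<le> (2 * C + 2 * D) * (square_norm (w 1) + square_norm (w 2))"
      using X(2) Y(2) by (simp add: algebra_simps)
    finally show "square_norm (\<lambda>z. X w z + Y w z) \<le> (2 * C + 2 * D) * (square_norm (w 1) + square_norm (w 2))" .
  qed
  then show ?thesis unfolding bounded_op_def using C(1) D(1) by (intro exI[of _ "2 * C + 2 * D"]) auto
qed

lemma bounded_op_mult: assumes "bounded_borel g" "bounded_op X" shows "bounded_op (\<lambda>w z. g z * X w z)"
proof -
  obtain C where C: "C \<ge> 0" "\<And>w. (\<forall>k. bounded_borel (w k)) \<Longrightarrow> bounded_borel (X w) \<and> square_norm (X w) \<le> C * (square_norm (w 1) + square_norm (w 2))"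
    using assms(2) by (auto simp: bounded_op_def)
  obtain D where D: "\<And>z. z \<in> unit_square \<Longrightarrow> \<bar>g z\<bar> \<le> D" using assms(1) by (auto simp: bounded_borel_def)
  have "bounded_borel (\<lambda>z. g z * X w z) \<and> square_norm (\<lambda>z. g z * X w z) \<le> (D\<^sup>2 * C) * (square_norm (w 1) + square_norm (w 2))"
    if w: "\<forall>k. bounded_borel (w k)" for w
  proof
    have X: "bounded_borel (X w)" "square_norm (X w) \<le> C * (square_norm (w 1) + square_norm (w 2))" using C(2)[OF w] by auto
    show b: "bounded_borel (\<lambda>z. g z * X w z)" by (intro bounded_borel_mult X assms)
    have "square_norm (\<lambda>z. g z * X w z) \<le> square_integral (\<lambda>z. D\<^sup>2 * (X w z)\<^sup>2)"
    proof (rule square_integral_mono[OF square_norm_bounded_borel[OF b]])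
      show "bounded_borel (\<lambda>z. D\<^sup>2 * (X w z)\<^sup>2)" by (intro bounded_borel_mult bounded_borel_const square_norm_bounded_borel X)
      fix z :: "real^2" assume "z \<in> unit_square"
      then have "(g z)\<^sup>2 \<le> D\<^sup>2" using D power_mono[of "\<bar>g z\<bar>" D 2] by simp
      then show "(g z * X w z)\<^sup>2 \<le> D\<^sup>2 * (X w z)\<^sup>2" by (simp add: power_mult_distrib mult_right_mono)
    qed
    also have "\<dots> = D\<^sup>2 * square_norm (X w)" by simp
    also have "\<dots> \<le> D\<^sup>2 * (C * (square_norm (w 1) + square_norm (w 2)))" using X(2) by (intro mult_left_mono) auto
    finally show "square_norm (\<lambda>z. g z * X w z) \<le> (D\<^sup>2 * C) * (square_norm (w 1) + square_norm (w 2))" by (simp add: mult.assoc)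
  qed
  then show ?thesis unfolding bounded_op_def using C(1) by (intro exI[of _ "D\<^sup>2 * C"]) auto
qed

lemma bounded_op_diff: "bounded_op X \<Longrightarrow> bounded_op Y \<Longrightarrow> bounded_op (\<lambda>w z. X w z - Y w z)"
  using bounded_op_add[of X "\<lambda>w z. -1 * Y w z"] bounded_op_mult[OF bounded_borel_const[of "-1"], of Y] by simp

context geometry
begin

text \<open>The constant sign of the determinant of the Jacobian.\<close>

definition sJ :: real where "sJ = (SOME s. (s = 1 \<or> s = -1) \<and> (\<forall>z\<in>unit_square. \<bar>dJ z\<bar> = s * dJ z))"

lemma sJ: "sJ = 1 \<or> sJ = -1" "z \<in> unit_square \<Longrightarrow> \<bar>dJ z\<bar> = sJ * dJ z"
proof -
  have "(sJ = 1 \<or> sJ = -1) \<and> (\<forall>z\<in>unit_square. \<bar>dJ z\<bar> = sJ * dJ z)"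
    unfolding sJ_def by (rule someI_ex[OF connected_sign[OF dJ_bounded_C1 dJ_nz]])
  then show "sJ = 1 \<or> sJ = -1" "z \<in> unit_square \<Longrightarrow> \<bar>dJ z\<bar> = sJ * dJ z" by blast+
qed

text \<open>Fields are pulled back with the factor \<open>dJ\<close> instead of its absolute value, which keeps the formulas
  smooth; of the absolute value only the constant sign \<open>sJ\<close> is left.\<close>

lemma pull_lint:
  assumes f: "set_borel_measurable lborel \<Omega> f" and g: "bounded_borel g"
    and eq: "AE z in lborel. z \<in> unit_square \<longrightarrow> dJ z * f (F z) = g z"
  shows "(LINT x:\<Omega>|lborel. f x) = sJ * square_integral g"
proof -
  let ?h = "\<lambda>z. sJ * dJ z * f (F z)"
  have dm: "set_borel_measurable lborel unit_square (\<lambda>z. sJ * dJ z)"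
    using bounded_borel_mult[OF bounded_borel_const[of sJ] bounded_C1_D(1)[OF dJ_bounded_C1]] by (simp add: bounded_borel_def)
  have hm: "set_borel_measurable lborel unit_square ?h"
    by (rule set_borel_mult[OF dm pull_borel[OF f]])
  have gB: "bounded_borel (\<lambda>z. sJ * g z)" by (intro bounded_borel_mult bounded_borel_const g)
  have ae: "AE z in lborel. z \<in> unit_square \<longrightarrow> ?h z = sJ * g z"
    using eq by eventually_elim auto
  have hi: "set_integrable lborel unit_square ?h"
    unfolding set_integrable_def
  proof (rule integrable_cong_AE_imp)
    show "integrable lborel (\<lambda>z. indicator unit_square z *\<^sub>R (sJ * g z))"
      using bounded_borel_integrable[OF gB] by (simp add: set_integrable_def)
    show "AE z in lborel. indicator unit_square z *\<^sub>R (sJ * g z) = indicator unit_square z *\<^sub>R ?h z"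
      using ae by eventually_elim (auto simp: indicator_def)
  qed (use hm in \<open>simp add: set_borel_measurable_def\<close>)
  have eq2: "\<bar>dJ z\<bar> * f (F z) = ?h z" if "z \<in> unit_square" for z using sJ(2)[OF that] by simp
  have "set_integrable lborel unit_square (\<lambda>z. \<bar>dJ z\<bar> * f (F z))"
  proof -
    have "(\<lambda>z. indicator unit_square z *\<^sub>R (\<bar>dJ z\<bar> * f (F z))) = (\<lambda>z. indicator unit_square z *\<^sub>R ?h z)"
      using eq2 by (auto simp: indicator_def fun_eq_iff)
    then show ?thesis using hi by (simp only: set_integrable_def)
  qed
  then have "set_integrable lborel \<Omega> f" using change_of_variables(1)[OF f] by simp
  then have "(LINT x:\<Omega>|lborel. f x) = square_integral (\<lambda>z. \<bar>dJ z\<bar> * f (F z))" by (rule change_of_variables(2)[OF f])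
  also have "\<dots> = square_integral ?h" by (rule square_integral_cong[OF eq2])
  also have "\<dots> = square_integral (\<lambda>z. sJ * g z)"
    by (rule lint_ae_eq[OF hm _ ae]) (use gB in \<open>simp add: bounded_borel_def\<close>)
  finally show ?thesis by simp
qed

text \<open>The gradient of a test function transforms with \<open>jt\<^sup>T\<close> after multiplication by \<open>dJ\<close>, so the factor
  \<open>jt\<close> in \<open>M = (S \<circ> F) Jt\<^sup>T\<close> is the one that the change of variables produces.\<close>

lemma test_pull:
  assumes \<phi>: "\<phi> \<in> test_functions \<Omega>"
  shows "\<exists>K. ctest K (\<lambda>z. \<phi> (F z))" "C1_on unit_square (partial j (\<lambda>z. \<phi> (F z)))"
    "z \<in> unit_square \<Longrightarrow> dJ z * partial l \<phi> (F z) = (\<Sum>j\<in>UNIV. jt j l z * partial j (\<lambda>z. \<phi> (F z)) z)"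
proof -
  have "Ck_closure k UNIV \<phi>" for k using \<phi> by (simp add: test_functions_def)
  note C = smooth_C1[OF this]
  have F1: "C1_on unit_square (\<lambda>z. F z $ i)" for i by (rule bounded_C1_D(3)[OF F_bounded_C1])
  have psi: "C1_on unit_square (\<lambda>z. \<phi> (F z))" by (rule C1_on_compose[OF F1 C(1)]) simp
  have part: "partial j (\<lambda>z. \<phi> (F z)) z = partial 1 \<phi> (F z) * Jc 1 j z + partial 2 \<phi> (F z) * Jc 2 j z" if "z \<in> unit_square" for j z
    unfolding Jc_def by (rule chain_rule(2)[OF C1_on_differentiable[OF F1 that] C1_on_differentiable[OF C(1) UNIV_I]])
  have dC: "C1_on unit_square (\<lambda>z. partial l \<phi> (F z))" for l by (rule C1_on_compose[OF F1 C(2)]) simp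
  show "C1_on unit_square (partial j (\<lambda>z. \<phi> (F z)))"
  proof (rule iffD2[OF C1_on_cong])
    have "C1_on unit_square (\<lambda>z. partial 1 \<phi> (F z) * Jc 1 j z)" "C1_on unit_square (\<lambda>z. partial 2 \<phi> (F z) * Jc 2 j z)"
      by (rule C1_on_mult[OF dC bounded_C1_D(3)[OF Jc_bounded_C1]])+
    then show "C1_on unit_square (\<lambda>z. partial 1 \<phi> (F z) * Jc 1 j z + partial 2 \<phi> (F z) * Jc 2 j z)"
      by (rule C1_on_add)
    show "partial j (\<lambda>z. \<phi> (F z)) y = partial 1 \<phi> (F y) * Jc 1 j y + partial 2 \<phi> (F y) * Jc 2 j y" if "y \<in> unit_square" for y
      by (rule part[OF that])
  qed (rule open_square)
  show "dJ z * partial l \<phi> (F z) = (\<Sum>j\<in>UNIV. jt j l z * partial j (\<lambda>z. \<phi> (F z)) z)" if "z \<in> unit_square"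
  proof -
    have "l = 1 \<or> l = 2" by (rule exhaust_2)
    then show ?thesis
      by (elim disjE) (simp_all add: part[OF that] sum_2 jt_eq dJ_eq, simp_all add: algebra_simps)
  qed
  let ?S = "closure {x. \<phi> x \<noteq> 0}"
  have S: "compact ?S" "?S \<subseteq> \<Omega>" using \<phi> by (auto simp: test_functions_def)
  have "ctest (G ` ?S) (\<lambda>z. \<phi> (F z))"
    unfolding ctest_def
  proof (intro conjI ballI)
    show "compact (G ` ?S)" by (rule compact_continuous_image[OF continuous_on_subset[OF G_continuous S(2)] S(1)])
    show "G ` ?S \<subseteq> unit_square"
    proof (rule image_subsetI)
      fix x assume "x \<in> ?S"
      then show "G x \<in> unit_square" by (rule FG(2)[OF subsetD[OF S(2)]])
    qed
    show "C1_on unit_square (\<lambda>z. \<phi> (F z))" by (rule psi)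
    fix z assume z: "z \<in> unit_square - G ` ?S"
    show "\<phi> (F z) = 0"
    proof (rule ccontr)
      assume "\<phi> (F z) \<noteq> 0"
      then have "F z \<in> {x. \<phi> x \<noteq> 0}" by simp
      then have "F z \<in> ?S" by (rule subsetD[OF closure_subset])
      then have "G (F z) \<in> G ` ?S" by (rule imageI)
      then have "z \<in> G ` ?S" unfolding GF[OF DiffD1[OF z]] .
      then show False by (rule notE[OF conjunct2[OF z[unfolded Diff_iff]]])
    qed
  qed
  then show "\<exists>K. ctest K (\<lambda>z. \<phi> (F z))" ..
qed

text \<open>The transformed divergence is the divergence of the transform. Both sides of the defining identity of
  the weak divergence are pulled back to the square, where they are those of \<open>weak_divergence_square\<close>.\<close>

lemma has_weak_div_Y2_tilde:
  assumes S: "regular_field S d e" and v: "v \<in> L2 \<Omega>"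
    and eq: "AE z in lborel. z \<in> unit_square \<longrightarrow> (\<forall>k. dJ z * v (F z) $ k = Pi_op jb (\<lambda>i z. d i z + e i z) k z)"
  shows "has_weak_div \<Omega> (Y2_tilde F S) v"
  unfolding has_weak_div_def
proof (intro conjI ballI allI)
  show "v \<in> L2 \<Omega>" by (rule v)
  fix \<phi> i assume \<phi>: "\<phi> \<in> test_functions \<Omega>"
  let ?T = "Y2_tilde F S" and ?\<psi> = "\<lambda>z. \<phi> (F z)"
  have T: "?T \<in> L2 \<Omega>" using Y2_tilde_spec(1)[OF S] by (simp add: L2_sym_def)
  obtain K where K: "ctest K ?\<psi>" using test_pull(1)[OF \<phi>] by blast
  have SB: "bounded_borel (\<lambda>z. S z $ i $ j)" "bounded_borel (d i)" "bounded_borel (e i)" for i j using S by (auto simp: regular_field_def)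
  have RB: "bounded_borel (Rc S i j)" for i j by (intro bounded_borel_diff SB Dc_bounded_borel[OF S])
  have "(LINT x:\<Omega>|lborel. \<Sum>j\<in>UNIV. ?T x $ i $ j * partial j \<phi> x) = sJ * square_integral (\<lambda>z. \<Sum>j\<in>UNIV. Mf (Rc S) i j z * partial j ?\<psi> z)"
  proof (rule pull_lint)
    show "set_borel_measurable lborel \<Omega> (\<lambda>x. \<Sum>j\<in>UNIV. ?T x $ i $ j * partial j \<phi> x)"
      unfolding sum_2 by (intro set_borel_add set_borel_mult set_borel_nth[OF set_borel_nth[OF L2_set_borel[OF T]]] test_function_set_borel[OF \<phi> \<Omega>_borel])
    show "bounded_borel (\<lambda>z. \<Sum>j\<in>UNIV. Mf (Rc S) i j z * partial j ?\<psi> z)"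
      by (intro bounded_borel_sum bounded_borel_mult bounded_borel_Mf RB ctest_bounded_borel[OF K])
    show "AE z in lborel. z \<in> unit_square \<longrightarrow> dJ z * (\<Sum>j\<in>UNIV. ?T (F z) $ i $ j * partial j \<phi> (F z)) = (\<Sum>j\<in>UNIV. Mf (Rc S) i j z * partial j ?\<psi> z)"
      using Y2_tilde_spec(2)[OF S]
    proof eventually_elim
      case (elim z)
      show ?case
      proof
        assume z: "z \<in> unit_square"
        have c: "(\<Sum>l\<in>UNIV. jt m l z * Sf (Rc S) i l z) = Mf (Rc S) i m z" for m
          unfolding Sf_def by (rule matrix_cancel[OF jt_jb(1)[OF z]])
        have "dJ z * (\<Sum>j\<in>UNIV. ?T (F z) $ i $ j * partial j \<phi> (F z)) = (\<Sum>j\<in>UNIV. Sf (Rc S) i j z * (dJ z * partial j \<phi> (F z)))"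
          using elim z by (simp add: sum_2 algebra_simps)
        also have "\<dots> = (\<Sum>m\<in>UNIV. (\<Sum>l\<in>UNIV. jt m l z * Sf (Rc S) i l z) * partial m ?\<psi> z)"
          unfolding test_pull(3)[OF \<phi> z] by (simp add: sum_2 algebra_simps)
        finally show "dJ z * (\<Sum>j\<in>UNIV. ?T (F z) $ i $ j * partial j \<phi> (F z)) = (\<Sum>j\<in>UNIV. Mf (Rc S) i j z * partial j ?\<psi> z)"
          unfolding c .
      qed
    qed
  qed
  also have "\<dots> = - (sJ * square_integral (\<lambda>z. Pi_op jb (\<lambda>i z. d i z + e i z) i z * ?\<psi> z))"
    using weak_divergence_square[OF S K test_pull(2)[OF \<phi>]] by simp
  also have "sJ * square_integral (\<lambda>z. Pi_op jb (\<lambda>i z. d i z + e i z) i z * ?\<psi> z) = (LINT x:\<Omega>|lborel. v x $ i * \<phi> x)"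
  proof (rule pull_lint[symmetric])
    show "set_borel_measurable lborel \<Omega> (\<lambda>x. v x $ i * \<phi> x)"
      by (intro set_borel_mult set_borel_nth[OF L2_set_borel[OF v]] test_function_set_borel[OF \<phi> \<Omega>_borel])
    show "bounded_borel (\<lambda>z. Pi_op jb (\<lambda>i z. d i z + e i z) i z * ?\<psi> z)"
      by (intro bounded_borel_mult bounded_borel_Pi_op jb_bounded_C1 bounded_borel_add SB ctest_bounded_borel[OF K])
    show "AE z in lborel. z \<in> unit_square \<longrightarrow> dJ z * (v (F z) $ i * \<phi> (F z)) = Pi_op jb (\<lambda>i z. d i z + e i z) i z * ?\<psi> z"
      using eq by eventually_elim (simp flip: mult.assoc)
  qed
  finally show "(LINT x:\<Omega>|lborel. \<Sum>j\<in>UNIV. ?T x $ i $ j * partial j \<phi> x) = - (LINT x:\<Omega>|lborel. v x $ i * \<phi> x)" .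
qed

text \<open>The diagonal field with divergence \<open>w\<close>: each row has a single nonzero entry, an antiderivative of a component of \<open>w\<close>
  in the direction in which the divergence differentiates it.\<close>

definition diagf :: "(2 \<Rightarrow> real^2 \<Rightarrow> real) \<Rightarrow> 2 \<Rightarrow> 2 \<Rightarrow> real^2 \<Rightarrow> real" where
  "diagf w i j = (if i = 1 \<and> j = 1 then int1 (w 1) else if i = 2 \<and> j = 2 then int2 (w 2) else (\<lambda>z. 0))"

lemma bounded_op_diagf: "bounded_op (\<lambda>w. diagf w i j)"
proof -
  have "(\<lambda>w. diagf w i j) = (\<lambda>w. int1 (w 1)) \<or> (\<lambda>w. diagf w i j) = (\<lambda>w. int2 (w 2)) \<or> (\<lambda>w. diagf w i j) = (\<lambda>w z. 0)"
    by (auto simp: diagf_def fun_eq_iff)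
  then show ?thesis
    by (elim disjE; simp only: bounded_op_int(1)[OF bounded_op_proj] bounded_op_int(2)[OF bounded_op_proj] bounded_op_zero)
qed

lemma bounded_op_Sf: "bounded_op (\<lambda>w. Sf (diagf w) k l)"
proof -
  have P: "bounded_op (\<lambda>w. Pf (diagf w) l)" for l
    unfolding Pf_def[abs_def] sum_2 by (intro bounded_op_add bounded_op_mult bounded_C1_D(1)[OF jb_bounded_C1] bounded_op_int bounded_op_diagf)
  have N: "bounded_op (\<lambda>w. Nf (diagf w) i j)" for i j
  proof (cases "j = 1")
    case True
    have "bounded_op (\<lambda>w z. diagf w i 1 z + (partial 2 (jt i 1) z * Pf (diagf w) 1 z + partial 2 (jt i 2) z * Pf (diagf w) 2 z))"
      by (intro bounded_op_add bounded_op_mult bounded_C1_D(2)[OF jt_bounded_C1] bounded_op_diagf P)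
    then show ?thesis using True by (simp add: Nf_def[abs_def] sum_2)
  next
    case False
    have "bounded_op (\<lambda>w z. diagf w i 2 z - (partial 1 (jt i 1) z * Pf (diagf w) 1 z + partial 1 (jt i 2) z * Pf (diagf w) 2 z))"
      by (intro bounded_op_diff bounded_op_add bounded_op_mult bounded_C1_D(2)[OF jt_bounded_C1] bounded_op_diagf P)
    then show ?thesis using False by (simp add: Nf_def[abs_def] sum_2)
  qed
  have M: "bounded_op (\<lambda>w. Mf (diagf w) k j)" for k j
    unfolding Mf_def[abs_def] sum_2 by (intro bounded_op_add bounded_op_mult bounded_C1_D(1)[OF jb_bounded_C1] N)
  show ?thesis unfolding Sf_def[abs_def] sum_2 by (intro bounded_op_add bounded_op_mult bounded_C1_D(1)[OF jb_bounded_C1] M)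
qed

lemma bounded_op_Pi_jt: "bounded_op (\<lambda>m. Pi_op jt m k)"
  unfolding Pi_op_def[abs_def] sum_2
  by (intro bounded_op_add bounded_op_mult bounded_C1_D(1)[OF jt_bounded_C1] bounded_C1_D(2)[OF jt_bounded_C1] bounded_op_int bounded_op_proj)

lemma L2_inner_pull_vec:
  fixes m :: "2 \<Rightarrow> real^2 \<Rightarrow> real"
  assumes v: "v \<in> L2 \<Omega>" and m: "\<And>k. bounded_borel (m k)"
    and eq: "AE z in lborel. z \<in> unit_square \<longrightarrow> (\<forall>k. dJ z * v (F z) $ k = m k z)"
  shows "L2_inner \<Omega> v v = sJ * square_integral (\<lambda>z. inverse (dJ z) * ((m 1 z)\<^sup>2 + (m 2 z)\<^sup>2))"
  unfolding L2_inner_def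
proof (rule pull_lint)
  show "set_borel_measurable lborel \<Omega> (\<lambda>x. v x \<bullet> v x)" by (intro set_borel_inner L2_set_borel v)
  show "bounded_borel (\<lambda>z. inverse (dJ z) * ((m 1 z)\<^sup>2 + (m 2 z)\<^sup>2))"
    by (intro bounded_borel_mult bounded_borel_add square_norm_bounded_borel m bounded_C1_D(1)[OF inverse_dJ_bounded_C1])
  show "AE z in lborel. z \<in> unit_square \<longrightarrow> dJ z * (v (F z) \<bullet> v (F z)) = inverse (dJ z) * ((m 1 z)\<^sup>2 + (m 2 z)\<^sup>2)"
    using eq
  proof eventually_elim
    case (elim z)
    show ?case
    proof
      assume z: "z \<in> unit_square"
      then have "m k z = dJ z * v (F z) $ k" for k using elim by simp
      then show "dJ z * (v (F z) \<bullet> v (F z)) = inverse (dJ z) * ((m 1 z)\<^sup>2 + (m 2 z)\<^sup>2)"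
        using dJ_nz[OF z] by (simp add: inner_vec_def sum_2 power2_eq_square field_simps)
    qed
  qed
qed

lemma L2_inner_pull_mat:
  fixes s :: "2 \<Rightarrow> 2 \<Rightarrow> real^2 \<Rightarrow> real"
  assumes T: "T \<in> L2 \<Omega>" and s: "\<And>k l. bounded_borel (s k l)"
    and eq: "AE z in lborel. z \<in> unit_square \<longrightarrow> (\<forall>k l. T (F z) $ k $ l = s k l z)"
  shows "L2_inner \<Omega> T T = sJ * square_integral (\<lambda>z. dJ z * (((s 1 1 z)\<^sup>2 + (s 1 2 z)\<^sup>2) + ((s 2 1 z)\<^sup>2 + (s 2 2 z)\<^sup>2)))"
  unfolding L2_inner_def
proof (rule pull_lint)
  show "set_borel_measurable lborel \<Omega> (\<lambda>x. T x \<bullet> T x)" by (intro set_borel_inner L2_set_borel T)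
  show "bounded_borel (\<lambda>z. dJ z * (((s 1 1 z)\<^sup>2 + (s 1 2 z)\<^sup>2) + ((s 2 1 z)\<^sup>2 + (s 2 2 z)\<^sup>2)))"
    by (intro bounded_borel_mult bounded_borel_add square_norm_bounded_borel s bounded_C1_D(1)[OF dJ_bounded_C1])
  show "AE z in lborel. z \<in> unit_square \<longrightarrow> dJ z * (T (F z) \<bullet> T (F z)) = dJ z * (((s 1 1 z)\<^sup>2 + (s 1 2 z)\<^sup>2) + ((s 2 1 z)\<^sup>2 + (s 2 2 z)\<^sup>2))"
    using eq by eventually_elim (simp add: inner_vec_def sum_2 power2_eq_square)
qed

text \<open>The chain of estimates goes through the parametric field \<open>w\<close>: the stress \<open>T\<close> is bounded by
  \<open>w\<close>, since \<open>Sf \<circ> diagf\<close> is a bounded operator, and \<open>w\<close> by the displacement \<open>v\<close>, since \<open>Pi_op jt\<close> is one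
  and recovers \<open>w\<close> from the pull-back of \<open>v\<close>. Changes of variables cost the bound \<open>D\<close> of \<open>dJ\<close> each.\<close>

lemma energy_bound:
  "\<exists>C>0. \<forall>w T v. (\<forall>k. bounded_borel (w k)) \<longrightarrow> T \<in> L2 \<Omega> \<longrightarrow> v \<in> L2 \<Omega> \<longrightarrow>
     (AE z in lborel. z \<in> unit_square \<longrightarrow> (\<forall>k l. T (F z) $ k $ l = Sf (diagf w) k l z)) \<longrightarrow>
     (AE z in lborel. z \<in> unit_square \<longrightarrow> (\<forall>k. dJ z * v (F z) $ k = Pi_op jb w k z)) \<longrightarrow>
     L2_inner \<Omega> T T \<le> C * L2_inner \<Omega> v v"
proof -
  define A where "A k l = (SOME C. C \<ge> 0 \<and> (\<forall>w. (\<forall>k. bounded_borel (w k)) \<longrightarrow> bounded_borel (Sf (diagf w) k l) \<and> square_norm (Sf (diagf w) k l) \<le> C * (square_norm (w 1) + square_norm (w 2))))" for k l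
  have A': "A k l \<ge> 0 \<and> (\<forall>w. (\<forall>k. bounded_borel (w k)) \<longrightarrow> bounded_borel (Sf (diagf w) k l) \<and> square_norm (Sf (diagf w) k l) \<le> A k l * (square_norm (w 1) + square_norm (w 2)))" for k l
    unfolding A_def by (rule someI_ex) (rule bounded_op_Sf[unfolded bounded_op_def])
  have A: "\<And>k l. A k l \<ge> 0"
    "\<And>k l w. (\<forall>k. bounded_borel (w k)) \<Longrightarrow> square_norm (Sf (diagf w) k l) \<le> A k l * (square_norm (w 1) + square_norm (w 2))"
    "\<And>k l w. (\<forall>k. bounded_borel (w k)) \<Longrightarrow> bounded_borel (Sf (diagf w) k l)" using A' by blast+
  define B where "B k = (SOME C. C \<ge> 0 \<and> (\<forall>m. (\<forall>k. bounded_borel (m k)) \<longrightarrow> bounded_borel (Pi_op jt m k) \<and> square_norm (Pi_op jt m k) \<le> C * (square_norm (m 1) + square_norm (m 2))))" for k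
  have B': "B k \<ge> 0 \<and> (\<forall>m. (\<forall>k. bounded_borel (m k)) \<longrightarrow> bounded_borel (Pi_op jt m k) \<and> square_norm (Pi_op jt m k) \<le> B k * (square_norm (m 1) + square_norm (m 2)))" for k
    unfolding B_def by (rule someI_ex) (rule bounded_op_Pi_jt[unfolded bounded_op_def])
  have B: "\<And>k. B k \<ge> 0"
    "\<And>k m. (\<forall>k. bounded_borel (m k)) \<Longrightarrow> square_norm (Pi_op jt m k) \<le> B k * (square_norm (m 1) + square_norm (m 2))" using B' by blast+
  obtain D where D: "\<And>z. z \<in> unit_square \<Longrightarrow> \<bar>dJ z\<bar> \<le> D" using bounded_C1_D(1)[OF dJ_bounded_C1] unfolding bounded_borel_def by blast
  have D0: "0 \<le> D" using D[of "pt (1/2) (1/2)"] by (simp add: pt_mem_square)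
  define a where "a = (A 1 1 + A 1 2) + (A 2 1 + A 2 2)"
  define b where "b = B 1 + B 2"
  have a0: "0 \<le> a" and b0: "0 \<le> b" unfolding a_def b_def by (intro add_nonneg_nonneg A(1) B(1))+
  have main: "L2_inner \<Omega> T T \<le> (D * a * b * D) * L2_inner \<Omega> v v"
    if w: "\<forall>k. bounded_borel (w k)" and T: "T \<in> L2 \<Omega>" and v: "v \<in> L2 \<Omega>"
    and eT: "AE z in lborel. z \<in> unit_square \<longrightarrow> (\<forall>k l. T (F z) $ k $ l = Sf (diagf w) k l z)"
    and ev: "AE z in lborel. z \<in> unit_square \<longrightarrow> (\<forall>k. dJ z * v (F z) $ k = Pi_op jb w k z)" for w T v
  proof -
    let ?s = "Sf (diagf w)" and ?m = "Pi_op jb w"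
    have sB: "bounded_borel (?s k l)" for k l by (rule A(3)[OF w])
    have mB: "bounded_borel (?m k)" for k using w by (intro bounded_borel_Pi_op jb_bounded_C1) auto
    have "L2_inner \<Omega> T T = square_integral (\<lambda>z. (sJ * dJ z) * (((?s 1 1 z)\<^sup>2 + (?s 1 2 z)\<^sup>2) + ((?s 2 1 z)\<^sup>2 + (?s 2 2 z)\<^sup>2)))"
      unfolding L2_inner_pull_mat[OF T sB eT] square_integral_cmult[symmetric] by (simp add: mult.assoc)
    also have "\<dots> \<le> square_integral (\<lambda>z. D * (((?s 1 1 z)\<^sup>2 + (?s 1 2 z)\<^sup>2) + ((?s 2 1 z)\<^sup>2 + (?s 2 2 z)\<^sup>2)))"
    proof (rule square_integral_mono)
      fix z :: "real^2" assume z: "z \<in> unit_square"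
      have "sJ * dJ z \<le> D" using sJ(2)[OF z] D[OF z] by simp
      then show "(sJ * dJ z) * (((?s 1 1 z)\<^sup>2 + (?s 1 2 z)\<^sup>2) + ((?s 2 1 z)\<^sup>2 + (?s 2 2 z)\<^sup>2)) \<le> D * (((?s 1 1 z)\<^sup>2 + (?s 1 2 z)\<^sup>2) + ((?s 2 1 z)\<^sup>2 + (?s 2 2 z)\<^sup>2))"
        by (rule mult_right_mono) (intro add_nonneg_nonneg zero_le_power2)
    qed (intro bounded_borel_mult bounded_borel_add bounded_borel_const square_norm_bounded_borel sB bounded_C1_D(1)[OF dJ_bounded_C1])+
    also have "\<dots> = D * ((square_norm (?s 1 1) + square_norm (?s 1 2)) + (square_norm (?s 2 1) + square_norm (?s 2 2)))"
      by (simp only: square_integral_cmult square_integral_add[OF bounded_borel_add[OF square_norm_bounded_borel[OF sB] square_norm_bounded_borel[OF sB]] bounded_borel_add[OF square_norm_bounded_borel[OF sB] square_norm_bounded_borel[OF sB]]] square_integral_add[OF square_norm_bounded_borel[OF sB] square_norm_bounded_borel[OF sB]])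
    also have "\<dots> \<le> D * (a * (square_norm (w 1) + square_norm (w 2)))"
      using A(2)[OF w, of 1 1] A(2)[OF w, of 1 2] A(2)[OF w, of 2 1] A(2)[OF w, of 2 2]
      by (intro mult_left_mono D0) (simp add: a_def distrib_right)
    also have "square_norm (w 1) + square_norm (w 2) \<le> b * (square_norm (?m 1) + square_norm (?m 2))"
    proof -
      have "square_norm (w k) = square_norm (Pi_op jt ?m k)" for k
        by (rule square_integral_cong) (use Pi_op_inverse[OF jb_bounded_C1 jt_bounded_C1 jt_jb(1), of _ w k] bounded_borel_line_integrable1 w in auto)
      then show ?thesis using B(2)[of ?m 1] B(2)[of ?m 2] mB by (simp add: b_def distrib_right)
    qed
    also have "square_norm (?m 1) + square_norm (?m 2) \<le> D * L2_inner \<Omega> v v"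
    proof -
      have "square_norm (?m 1) + square_norm (?m 2) = square_integral (\<lambda>z. (?m 1 z)\<^sup>2 + (?m 2 z)\<^sup>2)"
        by (rule square_integral_add[symmetric]) (intro square_norm_bounded_borel mB)+
      also have "\<dots> \<le> square_integral (\<lambda>z. D * (sJ * (inverse (dJ z) * ((?m 1 z)\<^sup>2 + (?m 2 z)\<^sup>2))))"
      proof (rule square_integral_mono)
        fix z :: "real^2" assume z: "z \<in> unit_square"
        have s2: "sJ * sJ = 1" using sJ(1) by auto
        have pos: "0 \<le> sJ * inverse (dJ z)"
        proof -
          have "sJ * inverse (dJ z) = inverse (sJ * dJ z)" using sJ(1) by (auto simp: inverse_minus_eq)
          then show ?thesis using sJ(2)[OF z] by (metis abs_ge_zero inverse_nonnegative_iff_nonnegative)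
        qed
        have "1 = (sJ * dJ z) * (sJ * inverse (dJ z))" using s2 dJ_nz[OF z] by (simp add: field_simps)
        also have "\<dots> \<le> D * (sJ * inverse (dJ z))"
          using sJ(2)[OF z] D[OF z] by (intro mult_right_mono pos) simp
        finally have "1 * ((?m 1 z)\<^sup>2 + (?m 2 z)\<^sup>2) \<le> D * (sJ * inverse (dJ z)) * ((?m 1 z)\<^sup>2 + (?m 2 z)\<^sup>2)"
          by (rule mult_right_mono) (intro add_nonneg_nonneg zero_le_power2)
        then show "(?m 1 z)\<^sup>2 + (?m 2 z)\<^sup>2 \<le> D * (sJ * (inverse (dJ z) * ((?m 1 z)\<^sup>2 + (?m 2 z)\<^sup>2)))"
          by (simp add: mult.assoc)
      qed (intro bounded_borel_mult bounded_borel_add bounded_borel_const square_norm_bounded_borel mB bounded_C1_D(1)[OF inverse_dJ_bounded_C1])+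
      also have "\<dots> = D * L2_inner \<Omega> v v"
        unfolding L2_inner_pull_vec[OF v mB ev] by simp
      finally show ?thesis .
    qed
    finally show ?thesis using D0 a0 b0 by (simp add: mult.assoc mult_left_mono)
  qed
  have "L2_inner \<Omega> T T \<le> (D * a * b * D + 1) * L2_inner \<Omega> v v"
    if "L2_inner \<Omega> T T \<le> (D * a * b * D) * L2_inner \<Omega> v v" for T :: "real^2 \<Rightarrow> real^2^2" and v :: "real^2 \<Rightarrow> real^2"
    using that L2_norm_sq[of \<Omega> v] zero_le_power2[of "L2_norm \<Omega> v"] by (simp add: distrib_right)
  then show ?thesis using main D0 a0 b0
    by (intro exI[of _ "D * a * b * D + 1"]) (auto intro!: add_nonneg_pos mult_nonneg_nonneg)
qed

end

section \<open>Stability\<close>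

text \<open>The degrees in \<open>V2_hat\<close> are chosen such that both derivatives in a row of the divergence lie in the same
  spline space, namely the component of \<open>V3_hat\<close> for that row.\<close>

lemma V2_hat_regular:
  assumes bp: "breakpoints \<psi>1" "breakpoints \<psi>2" and r: "1 \<le> r" "r < int p" and S: "S \<in> V2_hat \<psi>1 \<psi>2 p r"
  shows "\<exists>d e. regular_field S d e \<and> (\<lambda>z. vector [d 1 z + e 1 z, d 2 z + e 2 z]) \<in> V3_hat \<psi>1 \<psi>2 p r"
proof -
  obtain s1 s2 s3 where S_eq: "S = (\<lambda>z. mat22 (s1 z) (s2 z) (s2 z) (s3 z))"
    and s1: "s1 \<in> spline_space2 \<psi>1 \<psi>2 (p + 1) (p - 1) (r + 1) (r - 1)"
    and s2: "s2 \<in> spline_space2 \<psi>1 \<psi>2 p p r r"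
    and s3: "s3 \<in> spline_space2 \<psi>1 \<psi>2 (p - 1) (p + 1) (r - 1) (r + 1)"
    using S unfolding V2_hat_def by blast
  have p: "Suc (p - 1) = p" "p + 1 = Suc p" "r - 1 + 1 = r" using r by auto
  have rr: "-1 \<le> r" "-1 \<le> r - 1" using r by auto
  have "s1 \<in> spline_space2 \<psi>1 \<psi>2 (Suc p) (p - 1) (r + 1) (r - 1)" using s1 by (simp only: p)
  from spline2_derivative_1[OF bp(1) rr(1) this]
  obtain d1 where d1: "d1 \<in> spline_space2 \<psi>1 \<psi>2 p (p - 1) r (r - 1)"
    "\<forall>z\<in>unit_square. s1 z = s1 (pt 0 (z $ 2)) + int1 d1 z" by (elim bexE) (rule that)
  have "s2 \<in> spline_space2 \<psi>1 \<psi>2 (Suc (p - 1)) p (r - 1 + 1) r" using s2 by (simp only: p)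
  from spline2_derivative_1[OF bp(1) rr(2) this]
  obtain d2 where d2: "d2 \<in> spline_space2 \<psi>1 \<psi>2 (p - 1) p (r - 1) r"
    "\<forall>z\<in>unit_square. s2 z = s2 (pt 0 (z $ 2)) + int1 d2 z" by (elim bexE) (rule that)
  have "s2 \<in> spline_space2 \<psi>1 \<psi>2 p (Suc (p - 1)) r (r - 1 + 1)" using s2 by (simp only: p)
  from spline2_derivative_2[OF bp(2) rr(2) this]
  obtain e1 where e1: "e1 \<in> spline_space2 \<psi>1 \<psi>2 p (p - 1) r (r - 1)"
    "\<forall>z\<in>unit_square. s2 z = s2 (pt (z $ 1) 0) + int2 e1 z" by (elim bexE) (rule that)
  have "s3 \<in> spline_space2 \<psi>1 \<psi>2 (p - 1) (Suc p) (r - 1) (r + 1)" using s3 by (simp only: p)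
  from spline2_derivative_2[OF bp(2) rr(1) this]
  obtain e2 where e2: "e2 \<in> spline_space2 \<psi>1 \<psi>2 (p - 1) p (r - 1) r"
    "\<forall>z\<in>unit_square. s3 z = s3 (pt (z $ 1) 0) + int2 e2 z" by (elim bexE) (rule that)
  define d where "d k = (if k = (1::2) then d1 else d2)" for k
  define e where "e k = (if k = (1::2) then e1 else e2)" for k
  have "regular_field S d e"
    unfolding regular_field_def
  proof (intro conjI allI ballI)
    fix i j :: 2
    show "bounded_borel (\<lambda>z. S z $ i $ j)"
      using exhaust_2[of i] exhaust_2[of j] spline2_bounded_borel(1)[OF s1] spline2_bounded_borel(1)[OF s2] spline2_bounded_borel(1)[OF s3]
      by (auto simp: S_eq)
    show "bounded_borel (d i)" "bounded_borel (e i)"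
      using spline2_bounded_borel(1)[OF d1(1)] spline2_bounded_borel(1)[OF d2(1)] spline2_bounded_borel(1)[OF e1(1)] spline2_bounded_borel(1)[OF e2(1)]
      by (simp_all add: d_def e_def)
    show "bounded_borel (\<lambda>z. S (pt 0 (z $ 2)) $ i $ 1)"
      using exhaust_2[of i] spline2_bounded_borel(2)[OF s1] spline2_bounded_borel(2)[OF s2] by (auto simp: S_eq)
    show "S z $ i $ 1 = S (pt 0 (z $ 2)) $ i $ 1 + int1 (d i) z" if "z \<in> unit_square" for z
      using exhaust_2[of i] bspec[OF d1(2) that] bspec[OF d2(2) that] by (elim disjE) (simp_all add: S_eq d_def)
    have "S z $ i $ 2 = S (pt (z $ 1) 0) $ i $ 2 + int2 (e i) z" if "z \<in> unit_square" for z
      using exhaust_2[of i] bspec[OF e1(2) that] bspec[OF e2(2) that] by (elim disjE) (simp_all add: S_eq e_def)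
    moreover have "bounded_borel (\<lambda>z. S (pt (z $ 1) 0) $ i $ 2)"
      using exhaust_2[of i] spline2_bounded_borel(3)[OF s2] spline2_bounded_borel(3)[OF s3] by (auto simp: S_eq)
    ultimately show "\<exists>c. bounded_borel (\<lambda>z. c (z $ 1)) \<and> (\<forall>z\<in>unit_square. S z $ i $ 2 = c (z $ 1) + int2 (e i) z)"
      by (intro exI[of _ "\<lambda>x. S (pt x 0) $ i $ 2"] conjI ballI)
  qed (simp add: S_eq)
  moreover have "(\<lambda>z. d 1 z + e 1 z) \<in> spline_space2 \<psi>1 \<psi>2 p (p - 1) r (r - 1)"
    "(\<lambda>z. d 2 z + e 2 z) \<in> spline_space2 \<psi>1 \<psi>2 (p - 1) p (r - 1) r"
    using tensor_add d1(1) d2(1) e1(1) e2(1) by (simp_all add: d_def e_def spline_space2_def)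
  then have "(\<lambda>z. vector [d 1 z + e 1 z, d 2 z + e 2 z]) \<in> V3_hat \<psi>1 \<psi>2 p r"
    unfolding V3_hat_def
    by (intro CollectI exI[of _ "\<lambda>z. d 1 z + e 1 z"] exI[of _ "\<lambda>z. d 2 z + e 2 z"] conjI refl)
  ultimately show ?thesis by (intro exI conjI)
qed

lemma V3_hat_bounded_borel: "w \<in> V3_hat \<psi>1 \<psi>2 p r \<Longrightarrow> bounded_borel (\<lambda>z. w z $ k)"
  using exhaust_2[of k] by (auto simp: V3_hat_def dest: spline2_bounded_borel(1))

context geometry
begin

text \<open>This inclusion makes the discrete kernel divergence free: the divergence itself may be used as test function.\<close>

lemma divergence_V2_h:
  assumes bp: "breakpoints \<psi>1" "breakpoints \<psi>2" and r: "1 \<le> r" "r < int p" and \<tau>: "\<tau> \<in> V2_h F \<psi>1 \<psi>2 p r"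
  shows "\<exists>v\<in>V3_h F \<psi>1 \<psi>2 p r. has_weak_div \<Omega> \<tau> v"
proof -
  obtain S where \<tau>L: "\<tau> \<in> L2_sym \<Omega>" and S: "S \<in> V2_hat \<psi>1 \<psi>2 p r" and ae: "ae_eq \<Omega> \<tau> (Y2_tilde F S)"
    using \<tau> unfolding V2_h_def by (elim CollectE conjE bexE) (rule that)
  from V2_hat_regular[OF bp r S] obtain d e where de: "regular_field S d e" and w: "(\<lambda>z. vector [d 1 z + e 1 z, d 2 z + e 2 z]) \<in> V3_hat \<psi>1 \<psi>2 p r"
    by (elim exE conjE) (rule that)
  define w where "w = (\<lambda>z. vector [d 1 z + e 1 z, d 2 z + e 2 z] :: real^2)"
  have wk: "(\<lambda>k z. w z $ k) = (\<lambda>k z. d k z + e k z)"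
  proof (intro ext)
    fix k z show "w z $ k = d k z + e k z" using exhaust_2[of k] by (elim disjE) (simp_all add: w_def)
  qed
  have wV: "w \<in> V3_hat \<psi>1 \<psi>2 p r" using w by (simp add: w_def)
  have Pi_wk: "Pi_op jb (\<lambda>k z. w z $ k) = Pi_op jb (\<lambda>k z. d k z + e k z)" by (rule arg_cong[OF wk])
  note Y = Y3_inv_spec[OF V3_hat_bounded_borel[OF wV], unfolded Pi_wk]
  have "Y3_inv F w \<in> V3_h F \<psi>1 \<psi>2 p r" unfolding V3_h_def
    by (intro CollectI conjI bexI[OF _ wV] Y(1) ae_eq_refl)
  moreover have div: "has_weak_div \<Omega> (Y2_tilde F S) (Y3_inv F w)"
    by (rule has_weak_div_Y2_tilde[OF de Y])
  have "Y2_tilde F S \<in> L2 \<Omega>" "\<tau> \<in> L2 \<Omega>" using Y2_tilde_spec(1)[OF de] \<tau>L by (simp_all add: L2_sym_def)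
  then have "has_weak_div \<Omega> \<tau> (Y3_inv F w)" by (rule has_weak_div_ae[OF \<Omega>_borel div _ _ ae])
  ultimately show ?thesis by (intro bexI)
qed

text \<open>The stress is \<open>Y2_tilde\<close> of the diagonal field of antiderivatives of \<open>w\<close>. It belongs to \<open>V2_hat\<close>
  by the choice of degrees there, and as its first column vanishes on the edge, the trace
  correction disappears and the stress is given by \<open>Sf\<close> alone, which \<open>energy_bound\<close> controls.\<close>

lemma V2_h_right_inverse:
  assumes bp: "breakpoints \<psi>1" "breakpoints \<psi>2" and r: "1 \<le> r" "r < int p" and w: "w \<in> V3_hat \<psi>1 \<psi>2 p r"
  shows "\<exists>T\<in>V2_h F \<psi>1 \<psi>2 p r. has_weak_div \<Omega> T (Y3_inv F w) \<and>
    (AE z in lborel. z \<in> unit_square \<longrightarrow> (\<forall>k l. T (F z) $ k $ l = Sf (diagf (\<lambda>k z. w z $ k)) k l z))"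
proof -
  obtain w1 w2 where w_eq: "w = (\<lambda>z. vector [w1 z, w2 z])"
    and w1: "w1 \<in> spline_space2 \<psi>1 \<psi>2 p (p - 1) r (r - 1)" and w2: "w2 \<in> spline_space2 \<psi>1 \<psi>2 (p - 1) p (r - 1) r"
    using w unfolding V3_hat_def by (elim CollectE exE conjE) (rule that)
  have rr: "-1 \<le> r" using r by auto
  from spline2_antiderivative_1[OF bp(1) rr w1]
  obtain s1 where s1: "s1 \<in> spline_space2 \<psi>1 \<psi>2 (Suc p) (p - 1) (r + 1) (r - 1)" "\<forall>y. s1 (pt 0 y) = 0"
    "\<forall>z\<in>unit_square. s1 z = int1 w1 z" by (elim bexE conjE) (rule that)
  from spline2_antiderivative_2[OF bp(2) rr w2]
  obtain s3 where s3: "s3 \<in> spline_space2 \<psi>1 \<psi>2 (p - 1) (Suc p) (r - 1) (r + 1)"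
    "\<forall>z\<in>unit_square. s3 z = int2 w2 z" by (elim bexE) (rule that)
  define S where "S = (\<lambda>z. mat22 (s1 z) 0 0 (s3 z))"
  have S0: "S (pt 0 y) $ i $ 1 = 0" for i y using exhaust_2[of i] s1(2) by (elim disjE) (simp_all add: S_def)
  have SV: "S \<in> V2_hat \<psi>1 \<psi>2 p r"
  proof -
    have "(\<lambda>z. 0) \<in> spline_space2 \<psi>1 \<psi>2 p p r r" unfolding spline_space2_def by (rule tensor_zero)
    then show ?thesis unfolding V2_hat_def S_def
      using s1(1) s3(1) unfolding Suc_eq_plus1
      by (intro CollectI exI[of _ s1] exI[of _ "\<lambda>z. 0"] exI[of _ s3] conjI refl)
  qed
  have i0: "int1 (\<lambda>z. 0::real) z = 0" "int2 (\<lambda>z. 0::real) z = 0" for z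
    by (simp_all add: int1_def int2_def set_lebesgue_integral_def)
  define d where "d k = (if k = (1::2) then w1 else (\<lambda>z. 0))" for k
  define e where "e k = (if k = (1::2) then (\<lambda>z. 0) else w2)" for k
  have reg: "regular_field S d e"
    unfolding regular_field_def
  proof (intro conjI allI ballI)
    fix i j :: 2
    show "bounded_borel (\<lambda>z. S z $ i $ j)"
      using exhaust_2[of i] exhaust_2[of j] spline2_bounded_borel(1)[OF s1(1)] spline2_bounded_borel(1)[OF s3(1)]
      by (auto simp: S_def)
    show "bounded_borel (d i)" "bounded_borel (e i)"
      using spline2_bounded_borel(1)[OF w1] spline2_bounded_borel(1)[OF w2] bounded_borel_const[of 0] by (simp_all add: d_def e_def)
    show "bounded_borel (\<lambda>z. S (pt 0 (z $ 2)) $ i $ 1)" using bounded_borel_const[of 0] by (simp add: S0)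
    show "S z $ i $ 1 = S (pt 0 (z $ 2)) $ i $ 1 + int1 (d i) z" if "z \<in> unit_square" for z
      using exhaust_2[of i] bspec[OF s1(3) that] unfolding S0 by (elim disjE) (simp_all add: S_def d_def i0)
    have "S z $ i $ 2 = 0 + int2 (e i) z" if "z \<in> unit_square" for z
      using exhaust_2[of i] bspec[OF s3(2) that] by (elim disjE) (simp_all add: S_def e_def i0)
    then show "\<exists>c. bounded_borel (\<lambda>z. c (z $ 1)) \<and> (\<forall>z\<in>unit_square. S z $ i $ 2 = c (z $ 1) + int2 (e i) z)"
      by (intro exI[of _ "\<lambda>x. 0"] conjI bounded_borel_const ballI)
  qed (simp add: S_def)
  have wk: "(\<lambda>k z. w z $ k) = (\<lambda>k z. d k z + e k z)"
  proof (intro ext)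
    fix k z show "w z $ k = d k z + e k z" using exhaust_2[of k] by (elim disjE) (simp_all add: w_eq d_def e_def)
  qed
  have Pi_wk: "Pi_op jb (\<lambda>k z. w z $ k) = Pi_op jb (\<lambda>k z. d k z + e k z)" by (rule arg_cong[OF wk])
  note Y = Y3_inv_spec[OF V3_hat_bounded_borel[OF w], unfolded Pi_wk]
  have div: "has_weak_div \<Omega> (Y2_tilde F S) (Y3_inv F w)"
    by (rule has_weak_div_Y2_tilde[OF reg Y])
  have tc0: "tc S = (\<lambda>m z. 0)" by (simp add: tc_def fun_eq_iff S0)
  have Pi0: "Pi_op jt (tc S) 2 = (\<lambda>z. 0)" by (simp add: tc0 Pi_op_def fun_eq_iff i0)
  have R: "Rc S i j z = diagf (\<lambda>k z. w z $ k) i j z" if z: "z \<in> unit_square" for i j z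
  proof -
    have D: "Dc S z $ 1 $ 1 = 0" "Dc S z $ 2 $ 2 = 0"
      using Dc_nth(1,4)[OF reg z] Pi0 by (simp_all add: tc0 i0)
    show ?thesis
      using exhaust_2[of i] exhaust_2[of j] D Dc_nth(2,3)[OF reg z] bspec[OF s1(3) z] bspec[OF s3(2) z]
      by (elim disjE) (simp_all add: S_def diagf_def w_eq)
  qed
  have "Y2_tilde F S \<in> V2_h F \<psi>1 \<psi>2 p r"
    unfolding V2_h_def by (intro CollectI conjI bexI[OF _ SV] Y2_tilde_spec(1)[OF reg] ae_eq_refl)
  moreover have "AE z in lborel. z \<in> unit_square \<longrightarrow> (\<forall>k l. Y2_tilde F S (F z) $ k $ l = Sf (diagf (\<lambda>k z. w z $ k)) k l z)"
    using Y2_tilde_spec(2)[OF reg]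
  proof eventually_elim
    case (elim z)
    show ?case
    proof (intro impI allI)
      fix k l assume z: "z \<in> unit_square"
      have "Y2_tilde F S (F z) $ k $ l = Sf (Rc S) k l z" using elim z by blast
      also have "\<dots> = Sf (diagf (\<lambda>k z. w z $ k)) k l z" by (rule Sf_cong[OF z R])
      finally show "Y2_tilde F S (F z) $ k $ l = Sf (diagf (\<lambda>k z. w z $ k)) k l z" .
    qed
  qed
  ultimately show ?thesis by (intro bexI[of _ "Y2_tilde F S"] conjI div)
qed

text \<open>Both constants are fixed before the breakpoints: \<open>\<gamma>1\<close> comes from \<open>energy_bound\<close>, and \<open>\<gamma>2\<close> is the
  lower bound of \<open>A\<close>. For given \<open>v\<close>, a stress \<open>T\<close> with divergence \<open>v\<close> has quotient
  \<open>n / N\<close>, where \<open>n\<close> is the norm of \<open>v\<close> and the square of the norm \<open>N\<close> of \<open>T\<close> is at most \<open>(C + 1) n\<^sup>2\<close>.\<close>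

lemma stability:
  assumes A: "admissible_tensor \<Omega> A" and r: "1 \<le> r" "r < int p"
  shows "\<exists>\<gamma>1>0. \<exists>\<gamma>2>0. \<forall>\<psi>1 \<psi>2. breakpoints \<psi>1 \<longrightarrow> breakpoints \<psi>2 \<longrightarrow>
     (\<forall>f uD. inf_sup_stable \<gamma>1 \<gamma>2 (strong_symmetry_problem F A f uD \<psi>1 \<psi>2 p r))"
proof -
  obtain \<alpha> where \<alpha>: "\<alpha> > 0" "\<forall>\<tau>\<in>L2_sym \<Omega>. L2_inner \<Omega> (\<lambda>x. A x (\<tau> x)) \<tau> \<ge> \<alpha> * (L2_norm \<Omega> \<tau>)\<^sup>2"
    using A unfolding admissible_tensor_def by (elim conjE exE) (rule that)
  obtain C where C: "C > 0" "\<forall>w T v. (\<forall>k. bounded_borel (w k)) \<longrightarrow> T \<in> L2 \<Omega> \<longrightarrow> v \<in> L2 \<Omega> \<longrightarrow>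
     (AE z in lborel. z \<in> unit_square \<longrightarrow> (\<forall>k l. T (F z) $ k $ l = Sf (diagf w) k l z)) \<longrightarrow>
     (AE z in lborel. z \<in> unit_square \<longrightarrow> (\<forall>k. dJ z * v (F z) $ k = Pi_op jb w k z)) \<longrightarrow>
     L2_inner \<Omega> T T \<le> C * L2_inner \<Omega> v v"
    using energy_bound by (elim exE conjE) (rule that)
  define \<gamma> where "\<gamma> = 1 / sqrt (C + 1)"
  have \<gamma>: "\<gamma> > 0" using C(1) by (simp add: \<gamma>_def)
  have "inf_sup_stable \<gamma> \<alpha> (strong_symmetry_problem F A f uD \<psi>1 \<psi>2 p r)"
    if bp: "breakpoints \<psi>1" "breakpoints \<psi>2" for \<psi>1 \<psi>2 f uD
    unfolding inf_sup_stable_def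
  proof
    let ?P = "strong_symmetry_problem F A f uD \<psi>1 \<psi>2 p r"
    have P: "space_V ?P = V2_h F \<psi>1 \<psi>2 p r" "space_Q ?P = V3_h F \<psi>1 \<psi>2 p r" "norm_V ?P = Hdiv_norm \<Omega>" "norm_Q ?P = L2_norm \<Omega>"
      "form_b ?P \<tau> v = L2_inner \<Omega> (weak_div \<Omega> \<tau>) v" "form_a ?P \<sigma> \<tau> = L2_inner \<Omega> (\<lambda>x. A x (\<sigma> x)) \<tau>" for \<sigma> \<tau> v
      by (simp_all add: strong_symmetry_problem_def Let_def)
    show "(INF v\<in>{v \<in> space_Q ?P. norm_Q ?P v \<noteq> 0}. SUP \<tau>\<in>{\<tau> \<in> space_V ?P. norm_V ?P \<tau> \<noteq> 0}.
        ereal (form_b ?P \<tau> v / (norm_V ?P \<tau> * norm_Q ?P v))) \<ge> ereal \<gamma>"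
      unfolding P
    proof (rule INF_greatest)
      fix v assume "v \<in> {v \<in> V3_h F \<psi>1 \<psi>2 p r. L2_norm \<Omega> v \<noteq> 0}"
      then have v: "v \<in> V3_h F \<psi>1 \<psi>2 p r" and nz: "L2_norm \<Omega> v \<noteq> 0" by auto
      obtain w where vL: "v \<in> L2 \<Omega>" and w: "w \<in> V3_hat \<psi>1 \<psi>2 p r" and vw: "ae_eq \<Omega> v (Y3_inv F w)"
        using v unfolding V3_h_def by (elim CollectE conjE bexE) (rule that)
      define u where "u = Y3_inv F w"
      have uL: "u \<in> L2 \<Omega>" and uAE: "AE z in lborel. z \<in> unit_square \<longrightarrow> (\<forall>k. dJ z * u (F z) $ k = Pi_op jb (\<lambda>k z. w z $ k) k z)"
        unfolding u_def by (rule Y3_inv_spec[OF V3_hat_bounded_borel[OF w]])+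
      have uv: "ae_eq \<Omega> u v" unfolding u_def by (rule ae_eq_sym[OF vw])
      obtain T where T: "T \<in> V2_h F \<psi>1 \<psi>2 p r" "has_weak_div \<Omega> T u"
        and TAE: "AE z in lborel. z \<in> unit_square \<longrightarrow> (\<forall>k l. T (F z) $ k $ l = Sf (diagf (\<lambda>k z. w z $ k)) k l z)"
        using V2_h_right_inverse[OF bp r w] unfolding u_def[symmetric] by (elim bexE conjE) (rule that)
      have TL: "T \<in> L2 \<Omega>" using T(1) by (simp add: V2_h_def L2_sym_def)
      note wd = weak_div_ae[OF open_\<Omega> bounded_\<Omega> T(2)]
      have wdv: "ae_eq \<Omega> (weak_div \<Omega> T) v" by (rule ae_eq_trans[OF wd(2) uv])
      define n where "n = L2_norm \<Omega> v"
      have "0 \<le> L2_inner \<Omega> v v" unfolding L2_norm_sq[symmetric] by (rule zero_le_power2)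
      then have n: "n > 0" using nz by (simp add: n_def L2_norm_def)
      have b: "L2_inner \<Omega> (weak_div \<Omega> T) v = n\<^sup>2"
        unfolding n_def L2_norm_sq by (rule L2_inner_ae[OF wd(1) vL vL vL wdv ae_eq_refl])
      have "L2_inner \<Omega> T T \<le> C * L2_inner \<Omega> u u"
        by (rule C(2)[THEN spec, THEN spec, THEN spec, THEN mp, THEN mp, THEN mp, THEN mp, THEN mp, OF _ TL uL TAE uAE])
           (rule allI, rule V3_hat_bounded_borel[OF w])
      also have "L2_inner \<Omega> u u = n\<^sup>2"
        unfolding n_def L2_norm_sq by (rule L2_inner_ae[OF uL vL uL vL uv uv])
      finally have t: "(L2_norm \<Omega> T)\<^sup>2 \<le> C * n\<^sup>2" unfolding L2_norm_sq .
      define N where "N = Hdiv_norm \<Omega> T"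
      have "L2_norm \<Omega> (weak_div \<Omega> T) = n" unfolding n_def by (rule L2_norm_ae[OF wd(1) vL wdv])
      then have N: "N = sqrt ((L2_norm \<Omega> T)\<^sup>2 + n\<^sup>2)" by (simp add: N_def Hdiv_norm_def)
      have Npos: "N > 0" unfolding N using n by (intro real_sqrt_gt_zero add_nonneg_pos) auto
      have "N \<le> sqrt ((C + 1) * n\<^sup>2)" unfolding N using t by (simp add: distrib_right)
      also have "\<dots> = sqrt (C + 1) * n" using n by (simp add: real_sqrt_mult)
      finally have Nle: "N \<le> sqrt (C + 1) * n" .
      have "\<gamma> \<le> n\<^sup>2 / (N * n)"
      proof -
        have "\<gamma> * N \<le> n" using Nle C(1) by (simp add: \<gamma>_def field_simps)
        then have "\<gamma> * (N * n) \<le> n\<^sup>2" using n by (simp add: power2_eq_square mult_right_mono flip: mult.assoc)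
        then show ?thesis using Npos n by (simp add: pos_le_divide_eq)
      qed
      then have "ereal \<gamma> \<le> ereal (L2_inner \<Omega> (weak_div \<Omega> T) v / (Hdiv_norm \<Omega> T * L2_norm \<Omega> v))"
        unfolding b N_def[symmetric] n_def[symmetric] by simp
      moreover have "T \<in> {\<tau> \<in> V2_h F \<psi>1 \<psi>2 p r. Hdiv_norm \<Omega> \<tau> \<noteq> 0}" using T(1) Npos by (simp add: N_def)
      ultimately show "ereal \<gamma> \<le> (SUP \<tau>\<in>{\<tau> \<in> V2_h F \<psi>1 \<psi>2 p r. Hdiv_norm \<Omega> \<tau> \<noteq> 0}.
          ereal (L2_inner \<Omega> (weak_div \<Omega> \<tau>) v / (Hdiv_norm \<Omega> \<tau> * L2_norm \<Omega> v)))"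
        by (rule SUP_upper2[rotated])
    qed
    show "\<forall>\<tau>\<in>kernel_b ?P. form_a ?P \<tau> \<tau> \<ge> \<alpha> * (norm_V ?P \<tau>)\<^sup>2"
    proof
      fix \<tau> assume "\<tau> \<in> kernel_b ?P"
      then have \<tau>: "\<tau> \<in> V2_h F \<psi>1 \<psi>2 p r" and k: "\<And>v. v \<in> V3_h F \<psi>1 \<psi>2 p r \<Longrightarrow> L2_inner \<Omega> (weak_div \<Omega> \<tau>) v = 0"
        unfolding kernel_b_def P by auto
      obtain v where v: "v \<in> V3_h F \<psi>1 \<psi>2 p r" "has_weak_div \<Omega> \<tau> v" using divergence_V2_h[OF bp r \<tau>] by blast
      note wd = weak_div_ae[OF open_\<Omega> bounded_\<Omega> v(2)]
      have vL: "v \<in> L2 \<Omega>" using v(1) by (simp add: V3_h_def)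
      have "L2_inner \<Omega> (weak_div \<Omega> \<tau>) (weak_div \<Omega> \<tau>) = L2_inner \<Omega> (weak_div \<Omega> \<tau>) v"
        by (rule L2_inner_ae[OF wd(1) wd(1) wd(1) vL ae_eq_refl wd(2)])
      then have "(L2_norm \<Omega> (weak_div \<Omega> \<tau>))\<^sup>2 = 0" unfolding L2_norm_sq using k[OF v(1)] by simp
      then have "(Hdiv_norm \<Omega> \<tau>)\<^sup>2 = (L2_norm \<Omega> \<tau>)\<^sup>2" by (simp add: Hdiv_norm_def)
      moreover have "\<tau> \<in> L2_sym \<Omega>" using \<tau> by (simp add: V2_h_def)
      ultimately show "form_a ?P \<tau> \<tau> \<ge> \<alpha> * (norm_V ?P \<tau>)\<^sup>2" unfolding P using bspec[OF \<alpha>(2)] by simp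
    qed
  qed
  then show ?thesis using \<gamma> \<alpha>(1) by (intro exI[of _ \<gamma>] exI[of _ \<alpha>] conjI allI impI)
qed

end

theorem theorem5:
  fixes F :: "real^2 \<Rightarrow> real^2"
    and A :: "real^2 \<Rightarrow> real^2^2 \<Rightarrow> real^2^2"
    and cu :: real and p :: nat and r :: int
  assumes "admissible_geometry F"
    and "admissible_tensor (F ` unit_square) A"
    and "1 \<le> r" and "r < int p"
  shows "\<exists>\<gamma>1>0. \<exists>\<gamma>2>0. \<forall>\<psi>1 \<psi>2. admissible_mesh cu F \<psi>1 \<psi>2 \<longrightarrow>
           V2_h F \<psi>1 \<psi>2 p r \<subseteq> Hdiv_sym (F ` unit_square) \<and>
           (\<forall>f \<in> L2 (F ` unit_square). \<forall>uD \<in> H1 (F ` unit_square).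
              inf_sup_stable \<gamma>1 \<gamma>2 (strong_symmetry_problem F A f uD \<psi>1 \<psi>2 p r))"
proof -
  interpret geometry F using assms(1) by unfold_locales
  obtain \<gamma>1 \<gamma>2 where \<gamma>: "\<gamma>1 > 0" "\<gamma>2 > 0"
    "\<And>\<psi>1 \<psi>2 f uD. breakpoints \<psi>1 \<Longrightarrow> breakpoints \<psi>2 \<Longrightarrow> inf_sup_stable \<gamma>1 \<gamma>2 (strong_symmetry_problem F A f uD \<psi>1 \<psi>2 p r)"
    using stability[OF assms(2,3,4)] by blast
  have "V2_h F \<psi>1 \<psi>2 p r \<subseteq> Hdiv_sym (F ` unit_square)" if "breakpoints \<psi>1" "breakpoints \<psi>2" for \<psi>1 \<psi>2
  proof
    fix \<tau> assume \<tau>: "\<tau> \<in> V2_h F \<psi>1 \<psi>2 p r"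
    then show "\<tau> \<in> Hdiv_sym (F ` unit_square)"
      using divergence_V2_h[OF that assms(3,4) \<tau>] unfolding Hdiv_sym_def V2_h_def by blast
  qed
  then show ?thesis
    using \<gamma> by (intro exI[of _ \<gamma>1] exI[of _ \<gamma>2] conjI allI impI ballI) (simp_all add: admissible_mesh_def)
qed

end
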